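(* Let $L>0$, $\nu\in(0,1)$, $\lambda_1,\lambda_2>0$, and let $\mathcal{O}$ be the class of admissible domains. Let $\mathbf{g}_1\in L^2(\Omega^{\mathrm M};\mathbb{R}^2)$, $g_2\in L^2(\Omega^{\mathrm M})$, and $T_d\in H^1(\Omega^{\mathrm M})\cap C_c(\Omega^{\mathrm M})$. Suppose that $$\mathrm{Re}\in(0,\varepsilon_1),\qquad \mathrm{Pr}\in\left(0,\frac{\varepsilon_2}{\mathrm{Re}}\right),\qquad \mathrm{Gr}\in(0,\varepsilon_3\,\mathrm{Re}),$$ and that $\mathbf{g}_1,g_2,T_d$ satisfy the smallness condition $K_1^{\mathrm M}<1$, $K_2^{\mathrm M}\le\tau$ (with the constants specified in the context). Then there exists $\Omega_{\gamma^*}\in\mathcal{O}$ such that $$J(T^*,\gamma^* )=\inf_{\Omega_\gamma\in\mathcal{O}}J(T,\gamma),$$ where, for each $\Omega_\gamma\in\mathcal{O}$, $T$ is the temperature component of the weak solution $(\mathbf{v},T)$ of the Boussinesq system in $\Omega_\gamma$, and $T^*$ is the one for $\Omega_{\gamma^*}$.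
   Context: Admissible domains: $\mathcal{O}$ is the class of all $\Omega_\gamma=\{(x_1,x_2)\in\mathbb{R}^2: 0<x_1<1,\ \gamma(x_1)<x_2<1\}$ with $\gamma\in H_0^1(0,1)$, $\gamma\le 1-\nu$ a.e. and $|\gamma'|\le L$ a.e. in $(0,1)$. $\Gamma_\gamma=\{(x_1,x_2)\in\partial\Omega_\gamma: x_2=\gamma(x_1)\}$. $\mathrm M>0$ is fixed so that $\Omega_\gamma\subset\Omega^{\mathrm M}:=(0,1)\times(-\mathrm M,1)$ for every $\Omega_\gamma\in\mathcal{O}$. The data $\mathbf{g}_1,g_2,T_d$ are given on $\Omega^{\mathrm M}$ and restricted to $\Omega_\gamma$. For a domain $\Omega$: $V(\Omega)=\{\boldsymbol\varphi\in H^1(\Omega;\mathbb{R}^2): \operatorname{div}\boldsymbol\varphi=0\text{ a.e.},\ \boldsymbol\varphi=0\text{ on }\partial\Omega\}$ and $H_0^1(\Omega)$, both normed by the $L^2$ norm of the gradient, with duals $V(\Omega)'$, $H^{-1}(\Omega)$ ($L^2$ functions act by integration). $\mathbf{e}=(0,1)$; $\mathrm{Re},\mathrm{Pr},\mathrm{Gr}>0$. Weak solution of the Boussinesq system in $\Omega_\gamma$: a pair $(\mathbf{v},T)\in V(\Omega_\gamma)\times H^1(\Omega_\gamma)$ with $T-T_d\in H_0^1(\Omega_\gamma)$ such that $$\int_{\Omega_\gamma}(\mathbf{v}\cdot\nabla\mathbf{v})\cdot\boldsymbol\varphi+\frac1{\mathrm{Re}}\int_{\Omega_\gamma}\nabla\mathbf{v}:\nabla\boldsymbol\varphi-\frac{\mathrm{Gr}}{\mathrm{Re}^2}\int_{\Omega_\gamma}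 T\mathbf{e}\cdot\boldsymbol\varphi=\int_{\Omega_\gamma}\mathbf{g}_1\cdot\boldsymbol\varphi\quad\forall\boldsymbol\varphi\in V(\Omega_\gamma),$$ $$\int_{\Omega_\gamma}(\mathbf{v}\cdot\nabla T)\varphi+\frac1{\mathrm{Re}\,\mathrm{Pr}}\int_{\Omega_\gamma}\nabla T\cdot\nabla\varphi=\int_{\Omega_\gamma}g_2\varphi\quad\forall\varphi\in H_0^1(\Omega_\gamma).$$ Cost functional: $$J(T,\gamma)=\|T-I(T,\gamma)\|_{L^2(\Omega_\gamma)}^2+\frac{\lambda_1}{2}\|\gamma'\|_{L^2(0,1)}^2+\frac{\lambda_2}{2}\left(\int_0^1\gamma(\xi)\,d\xi\right)^2,\qquad I(T,\gamma)=\frac1{|\Omega_\gamma|}\int_{\Omega_\gamma}T(x)\,dx.$$ Smallness quantities: for constants $C,\tau>0$, $$K_1^{\mathrm M}=C\left(\tau(\mathrm{Re}+\mathrm{Re}\,\mathrm{Pr})+\mathrm{Re}\,\mathrm{Pr}\|T_d\|_{H^1(\Omega^{\mathrm M})}+\frac{\mathrm{Gr}}{\mathrm{Re}}\right),$$ $$K_2^{\mathrm M}=C\Big(\tau^2(\mathrm{Re}+\mathrm{Re}\,\mathrm{Pr})+\tau\big(\mathrm{Re}\,\mathrm{Pr}\|T_d\|_{H^1(\Omega^{\mathrm M})}+\tfrac{\mathrm{Gr}}{\mathrm{Re}}\big)+\mathrm{Re}\|\mathbf{g}_1\|_{V(\Omega^{\mathrm M})'}+\mathrm{Re}\,\mathrm{Pr}\|g_2\|_{H^{-1}(\Omega^{\mathrm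 M})}+\|T_d\|_{H^1(\Omega^{\mathrm M})}+\tfrac{\mathrm{Gr}}{\mathrm{Re}}\|T_d\|_{H^1(\Omega^{\mathrm M})}\Big).$$ The constants $C,\tau,\varepsilon_1,\varepsilon_2,\varepsilon_3>0$, depending only on $L,\nu,\mathrm M$, are fixed such that, whenever the parameters lie in the ranges above and $K_1^{\mathrm M}<1$, $K_2^{\mathrm M}\le\tau$, for every $\Omega_\gamma\in\mathcal{O}$ the Boussinesq system in $\Omega_\gamma$ has a unique weak solution, and it satisfies $\|\mathbf{v}\|_{V(\Omega_\gamma)}+\|T-T_d\|_{H_0^1(\Omega_\gamma)}\le\tau$. Such constants exist. *)

theory Defs
  imports "HOL-Analysis.Analysis"
begin

text \<open>
  Elements of \<open>L\<^sup>2\<close>, \<open>H\<^sup>1\<close>, etc. are represented by functions on the whole type; only their values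
  on \<open>\<Omega>\<close>, up to null sets, matter. Scalar fields are the case \<open>'b = real\<close>.
\<close>

primrec Ck :: "nat \<Rightarrow> ('a::euclidean_space \<Rightarrow> 'b::real_normed_vector) \<Rightarrow> bool" where
  "Ck 0 f \<longleftrightarrow> continuous_on UNIV f"
| "Ck (Suc k) f \<longleftrightarrow> f differentiable_on UNIV \<and>
     (\<forall>b\<in>Basis. Ck k (\<lambda>x. frechet_derivative f (at x) b))"

definition test_functions :: "'a::euclidean_space set \<Rightarrow> ('a \<Rightarrow> 'b::real_normed_vector) set" where
  "test_functions \<Omega> = {\<phi>. (\<forall>k. Ck k \<phi>) \<and>
     compact (closure {x. \<phi> x \<noteq> 0}) \<and> closure {x. \<phi> x \<noteq> 0} \<subseteq> \<Omega>}"

definition L2 :: "'a::euclidean_space set \<Rightarrow> ('a \<Rightarrow> 'b::euclidean_space) set" where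
  "L2 \<Omega> = {u \<in> borel_measurable (lebesgue_on \<Omega>).
     integrable (lebesgue_on \<Omega>) (\<lambda>x. (norm (u x))\<^sup>2)}"

definition L2_norm :: "'a::euclidean_space set \<Rightarrow> ('a \<Rightarrow> 'b::euclidean_space) \<Rightarrow> real" where
  "L2_norm \<Omega> u = sqrt (LINT x|lebesgue_on \<Omega>. (norm (u x))\<^sup>2)"

definition is_weak_deriv ::
  "'a::euclidean_space set \<Rightarrow> 'a \<Rightarrow> ('a \<Rightarrow> 'b::euclidean_space) \<Rightarrow> ('a \<Rightarrow> 'b) \<Rightarrow> bool" where
  "is_weak_deriv \<Omega> b u w \<longleftrightarrow> (\<forall>\<phi>::'a \<Rightarrow> real. \<phi> \<in> test_functions \<Omega> \<longrightarrow>
     (LINT x|lebesgue_on \<Omega>. frechet_derivative \<phi> (at x) b *\<^sub>R u x)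
       = - (LINT x|lebesgue_on \<Omega>. \<phi> x *\<^sub>R w x))"

definition H1 :: "'a::euclidean_space set \<Rightarrow> ('a \<Rightarrow> 'b::euclidean_space) set" where
  "H1 \<Omega> = {u \<in> L2 \<Omega>. \<forall>b\<in>Basis. \<exists>w\<in>L2 \<Omega>. is_weak_deriv \<Omega> b u w}"

text \<open>For \<open>u \<in> H1 \<Omega>\<close> and \<open>b \<in> Basis\<close> the weak derivative is unique up to null sets, so the choice of
  the representative is immaterial below.\<close>

definition weak_deriv ::
  "'a::euclidean_space set \<Rightarrow> 'a \<Rightarrow> ('a \<Rightarrow> 'b::euclidean_space) \<Rightarrow> 'a \<Rightarrow> 'b" where
  "weak_deriv \<Omega> b u = (SOME w. w \<in> L2 \<Omega> \<and> is_weak_deriv \<Omega> b u w)"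

definition grad_inner ::
  "'a::euclidean_space set \<Rightarrow> ('a \<Rightarrow> 'b::euclidean_space) \<Rightarrow> ('a \<Rightarrow> 'b) \<Rightarrow> 'a \<Rightarrow> real" where
  "grad_inner \<Omega> u w x = (\<Sum>b\<in>Basis. weak_deriv \<Omega> b u x \<bullet> weak_deriv \<Omega> b w x)"

definition convect ::
  "'a::euclidean_space set \<Rightarrow> ('a \<Rightarrow> 'a) \<Rightarrow> ('a \<Rightarrow> 'b::euclidean_space) \<Rightarrow> 'a \<Rightarrow> 'b" where
  "convect \<Omega> v u x = (\<Sum>b\<in>Basis. (v x \<bullet> b) *\<^sub>R weak_deriv \<Omega> b u x)"

definition divergence :: "'a::euclidean_space set \<Rightarrow> ('a \<Rightarrow> 'a) \<Rightarrow> 'a \<Rightarrow> real" where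
  "divergence \<Omega> v x = (\<Sum>b\<in>Basis. weak_deriv \<Omega> b v x \<bullet> b)"

definition grad_norm :: "'a::euclidean_space set \<Rightarrow> ('a \<Rightarrow> 'b::euclidean_space) \<Rightarrow> real" where
  "grad_norm \<Omega> u = sqrt (LINT x|lebesgue_on \<Omega>. grad_inner \<Omega> u u x)"

definition H1_norm :: "'a::euclidean_space set \<Rightarrow> ('a \<Rightarrow> 'b::euclidean_space) \<Rightarrow> real" where
  "H1_norm \<Omega> u = sqrt ((L2_norm \<Omega> u)\<^sup>2 + (grad_norm \<Omega> u)\<^sup>2)"

definition H10 :: "'a::euclidean_space set \<Rightarrow> ('a \<Rightarrow> 'b::euclidean_space) set" where
  "H10 \<Omega> = {u \<in> H1 \<Omega>. \<exists>\<phi>::nat \<Rightarrow> 'a \<Rightarrow> 'b. (\<forall>n. \<phi> n \<in> test_functions \<Omega>) \<and>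
     (\<lambda>n. H1_norm \<Omega> (\<lambda>x. u x - \<phi> n x)) \<longlonglongrightarrow> 0}"

text \<open>The boundary condition is understood as membership in \<open>H10 \<Omega>\<close>, which for Lipschitz domains
  (all domains below) is the space of fields with vanishing trace.\<close>

definition V :: "'a::euclidean_space set \<Rightarrow> ('a \<Rightarrow> 'a) set" where
  "V \<Omega> = {\<phi> \<in> H1 \<Omega>. (AE x in lebesgue_on \<Omega>. divergence \<Omega> \<phi> x = 0) \<and> \<phi> \<in> H10 \<Omega>}"

text \<open>Norm of \<open>\<phi> \<mapsto> \<integral> g \<cdot> \<phi>\<close> in the dual of \<open>X\<close>, where \<open>X\<close> carries the norm \<open>grad_norm \<Omega>\<close>. For bounded
  \<open>\<Omega>\<close>, \<open>g \<in> L2 \<Omega>\<close> and \<open>X \<subseteq> H10 \<Omega>\<close> the supremum is over a bounded set, by Poincare's inequality.\<close>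

definition dual_norm ::
  "'a::euclidean_space set \<Rightarrow> ('a \<Rightarrow> 'b::euclidean_space) set \<Rightarrow> ('a \<Rightarrow> 'b) \<Rightarrow> real" where
  "dual_norm \<Omega> X g =
     Sup {\<bar>LINT x|lebesgue_on \<Omega>. g x \<bullet> \<phi> x\<bar> | \<phi>. \<phi> \<in> X \<and> grad_norm \<Omega> \<phi> \<le> 1}"

definition Cc :: "'a::euclidean_space set \<Rightarrow> ('a \<Rightarrow> real) set" where
  "Cc \<Omega> = {f. continuous_on \<Omega> f \<and> (\<exists>K. compact K \<and> K \<subseteq> \<Omega> \<and> (\<forall>x\<in>\<Omega> - K. f x = 0))}"

definition Dom :: "(real \<Rightarrow> real) \<Rightarrow> (real^2) set" where
  "Dom \<gamma> = {x. 0 < x$1 \<and> x$1 < 1 \<and> \<gamma> (x$1) < x$2 \<and> x$2 < 1}"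

definition Dom_max :: "real \<Rightarrow> (real^2) set" where
  "Dom_max M = {x. 0 < x$1 \<and> x$1 < 1 \<and> - M < x$2 \<and> x$2 < 1}"

text \<open>\<open>Dom \<gamma>\<close> depends on the values of \<open>\<gamma>\<close> at every point, so the class \<open>\<gamma> \<in> H\<^sub>0\<^sup>1(0,1)\<close> is represented by
  its continuous representative on \<open>[0,1]\<close>.\<close>

definition admissible :: "real \<Rightarrow> real \<Rightarrow> (real \<Rightarrow> real) set" where
  "admissible L \<nu> = {\<gamma>. \<gamma> \<in> H10 {0<..<1} \<and> continuous_on {0..1} \<gamma> \<and>
     (AE s in lebesgue_on {0<..<1}. \<gamma> s \<le> 1 - \<nu>) \<and>
     (AE s in lebesgue_on {0<..<1}. \<bar>weak_deriv {0<..<1} 1 \<gamma> s\<bar> \<le> L)}"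

definition weak_solution ::
  "real \<Rightarrow> real \<Rightarrow> real \<Rightarrow> (real^2 \<Rightarrow> real^2) \<Rightarrow> (real^2 \<Rightarrow> real) \<Rightarrow> (real^2 \<Rightarrow> real) \<Rightarrow>
   (real^2) set \<Rightarrow> (real^2 \<Rightarrow> real^2) \<Rightarrow> (real^2 \<Rightarrow> real) \<Rightarrow> bool" where
  "weak_solution Rey Pra Gra g1 g2 Td \<Omega> v T \<longleftrightarrow>
     v \<in> V \<Omega> \<and> T \<in> H1 \<Omega> \<and> (\<lambda>x. T x - Td x) \<in> H10 \<Omega> \<and>
     (\<forall>\<phi>\<in>V \<Omega>.
        (LINT x|lebesgue_on \<Omega>. convect \<Omega> v v x \<bullet> \<phi> x)
        + 1 / Rey * (LINT x|lebesgue_on \<Omega>. grad_inner \<Omega> v \<phi> x)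
        - Gra / Rey\<^sup>2 * (LINT x|lebesgue_on \<Omega>. (T x *\<^sub>R axis 2 1) \<bullet> \<phi> x)
        = (LINT x|lebesgue_on \<Omega>. g1 x \<bullet> \<phi> x)) \<and>
     (\<forall>\<phi>\<in>H10 \<Omega>.
        (LINT x|lebesgue_on \<Omega>. convect \<Omega> v T x * \<phi> x)
        + 1 / (Rey * Pra) * (LINT x|lebesgue_on \<Omega>. grad_inner \<Omega> T \<phi> x)
        = (LINT x|lebesgue_on \<Omega>. g2 x * \<phi> x))"

definition K1 :: "real \<Rightarrow> real \<Rightarrow> real \<Rightarrow> real \<Rightarrow> real \<Rightarrow> real \<Rightarrow> (real^2 \<Rightarrow> real) \<Rightarrow> real" where
  "K1 M C \<tau> Rey Pra Gra Td =
     C * (\<tau> * (Rey + Rey * Pra) + Rey * Pra * H1_norm (Dom_max M) Td + Gra / Rey)"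

definition K2 :: "real \<Rightarrow> real \<Rightarrow> real \<Rightarrow> real \<Rightarrow> real \<Rightarrow> real \<Rightarrow>
   (real^2 \<Rightarrow> real^2) \<Rightarrow> (real^2 \<Rightarrow> real) \<Rightarrow> (real^2 \<Rightarrow> real) \<Rightarrow> real" where
  "K2 M C \<tau> Rey Pra Gra g1 g2 Td =
     C * (\<tau>\<^sup>2 * (Rey + Rey * Pra)
        + \<tau> * (Rey * Pra * H1_norm (Dom_max M) Td + Gra / Rey)
        + Rey * dual_norm (Dom_max M) (V (Dom_max M)) g1
        + Rey * Pra * dual_norm (Dom_max M) (H10 (Dom_max M)) g2
        + H1_norm (Dom_max M) Td
        + Gra / Rey * H1_norm (Dom_max M) Td)"

definition smallness_regime ::
  "real \<Rightarrow> real \<Rightarrow> real \<Rightarrow> real \<Rightarrow> real \<Rightarrow> real \<Rightarrow> real \<Rightarrow> real \<Rightarrow> real \<Rightarrow>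
   (real^2 \<Rightarrow> real^2) \<Rightarrow> (real^2 \<Rightarrow> real) \<Rightarrow> (real^2 \<Rightarrow> real) \<Rightarrow> bool" where
  "smallness_regime M C \<tau> \<epsilon>1 \<epsilon>2 \<epsilon>3 Rey Pra Gra g1 g2 Td \<longleftrightarrow>
     Rey \<in> {0<..<\<epsilon>1} \<and> Pra \<in> {0<..<\<epsilon>2 / Rey} \<and> Gra \<in> {0<..<\<epsilon>3 * Rey} \<and>
     K1 M C \<tau> Rey Pra Gra Td < 1 \<and> K2 M C \<tau> Rey Pra Gra g1 g2 Td \<le> \<tau>"

text \<open>The property by which the constants are fixed. The same constants serve all physical parameters,
  data and all domains; uniqueness is that of the a.e. equivalence classes.\<close>

definition wellposedness_constants ::
  "real \<Rightarrow> real \<Rightarrow> real \<Rightarrow> real \<Rightarrow> real \<Rightarrow> real \<Rightarrow> real \<Rightarrow> real \<Rightarrow> bool" where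
  "wellposedness_constants L \<nu> M C \<tau> \<epsilon>1 \<epsilon>2 \<epsilon>3 \<longleftrightarrow>
     C > 0 \<and> \<tau> > 0 \<and> \<epsilon>1 > 0 \<and> \<epsilon>2 > 0 \<and> \<epsilon>3 > 0 \<and>
     (\<forall>Rey Pra Gra g1 g2 Td.
        g1 \<in> L2 (Dom_max M) \<longrightarrow> g2 \<in> L2 (Dom_max M) \<longrightarrow> Td \<in> H1 (Dom_max M) \<inter> Cc (Dom_max M) \<longrightarrow>
        smallness_regime M C \<tau> \<epsilon>1 \<epsilon>2 \<epsilon>3 Rey Pra Gra g1 g2 Td \<longrightarrow>
        (\<forall>\<gamma>\<in>admissible L \<nu>. \<exists>v T.
           weak_solution Rey Pra Gra g1 g2 Td (Dom \<gamma>) v T \<and>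
           grad_norm (Dom \<gamma>) v + grad_norm (Dom \<gamma>) (\<lambda>x. T x - Td x) \<le> \<tau> \<and>
           (\<forall>v' T'. weak_solution Rey Pra Gra g1 g2 Td (Dom \<gamma>) v' T' \<longrightarrow>
              (AE x in lebesgue_on (Dom \<gamma>). v' x = v x \<and> T' x = T x))))"

definition mean :: "(real^2) set \<Rightarrow> (real^2 \<Rightarrow> real) \<Rightarrow> real" where
  "mean \<Omega> T = 1 / measure lebesgue \<Omega> * (LINT x|lebesgue_on \<Omega>. T x)"

definition J :: "real \<Rightarrow> real \<Rightarrow> (real^2 \<Rightarrow> real) \<Rightarrow> (real \<Rightarrow> real) \<Rightarrow> real" where
  "J lam1 lam2 T \<gamma> =
     (L2_norm (Dom \<gamma>) (\<lambda>x. T x - mean (Dom \<gamma>) T))\<^sup>2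
     + lam1 / 2 * (L2_norm {0<..<1} (weak_deriv {0<..<1} 1 \<gamma>))\<^sup>2
     + lam2 / 2 * (LINT s|lebesgue_on {0<..<1}. \<gamma> s)\<^sup>2"

end

theory Submission
  imports Defs "HOL-Complex_Analysis.Great_Picard"
begin

text \<open>
  Direct method. Along a minimizing sequence the boundaries \<open>\<gamma>\<^sub>n\<close> are equi-Lipschitz, so a subsequence
  converges uniformly to an admissible \<open>\<gamma>\<close>, and \<open>\<gamma>\<^sub>n'\<close> converges weakly in \<open>L\<^sup>2\<close>. The solutions, extended by
  zero, are bounded by \<open>\<tau>\<close> and hence converge weakly in \<open>H\<^sup>1\<close>, and strongly in \<open>L\<^sup>2\<close> by Rellich's theorem.

  The limit solves the system on \<open>Dom \<gamma>\<close> because the solution spaces converge in the sense of Mosco. For the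
  affine map that stretches the plane about a point near the top of the domain, horizontally so much
  less than vertically that the Lipschitz graphs are still pushed downwards, functions on \<open>Dom \<gamma>\<close> composed with
  the map live on \<open>Dom \<gamma>\<^sub>n\<close> for large \<open>n\<close>, and vice versa; a matching linear transformation of the values
  preserves the divergence constraint. This yields the recovery sequences for test functions, and, after
  passing to convex combinations, the membership of the weak limit in the space over \<open>Dom \<gamma>\<close>.

  Ladyzhenskaya's inequality makes the products of test functions and velocities converge in \<open>L\<^sup>2\<close>, which is enough
  for the convective terms. Finally the first and the last term of the cost converge, and \<open>\<parallel>\<gamma>'\<parallel>\<^sup>2\<close> is
  weakly lower semicontinuous. By uniqueness the value of the cost depends on \<open>\<gamma>\<close> only, so that the bounded
  solutions may be used throughout.
\<close>

section \<open>Weak convergence in Hilbert spaces\<close>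

text \<open>The domains and the spaces of test functions both vary with n, and solenoidal fields
  cannot be cut off. Hence test functions are not adapted to each domain: for a fixed s = 1/(k+1)
  the stretched copy of a test function is one and the same function for all large n. The limit in n
  is taken first, with this function fixed and only the solution moving; strong convergence of the
  stretched copies then serves for the limit in k. A weak limit clearly vanishes a.e. outside the
  limit domain, but this leaves open whether test functions supported there approximate it; the
  stretching answers this without traces. The centre (1/2, 1 - \<nu>/2) lies at least \<nu>/2 above
  every admissible graph, so a stretching by s lowers graphs by at least s\<nu>/2, while horizontal
  displacement and uniform distance of the graphs together cost at most s\<nu>/4. The temperature
  need not vanish on the boundary, so its difference to \<open>Td\<close> is extended by zero
  instead.\<close>

definition weakly_to :: "(nat \<Rightarrow> 'a::real_inner) \<Rightarrow> 'a \<Rightarrow> bool" where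
  "weakly_to x l \<longleftrightarrow> (\<forall>g. (\<lambda>n. inner (x n) g) \<longlonglongrightarrow> inner l g)"

text \<open>Near-minimizers of the norm over the hulls of the tails are Cauchy: the minimal values
  increase and are bounded, and the parallelogram law turns a small excess over the minimum into a
  small distance. The strong limit found here later serves as the weak limit of a
  subsequence.\<close>

lemma mazur_bounded:
  fixes x :: "nat \<Rightarrow> 'a::{real_inner,complete_space}"
  assumes B: "\<And>n. norm (x n) \<le> B"
  obtains W w where "\<And>n. W n \<in> convex hull (x ` {n..})" "W \<longlonglongrightarrow> w"
proof -
  let ?C = "\<lambda>n. convex hull (x ` {n..})"
  define d where "d n = Inf ((\<lambda>y. (norm y)\<^sup>2) ` ?C n)" for n
  have ne: "?C n \<noteq> {}" for n by auto
  have Cmono: "?C m \<subseteq> ?C n" if "n \<le> m" for n m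
    using that by (intro hull_mono image_mono) auto
  have bdd: "bdd_below ((\<lambda>y. (norm y)\<^sup>2) ` ?C n)" for n
    by (rule bdd_belowI[of _ 0]) auto
  have dle: "d n \<le> (norm y)\<^sup>2" if "y \<in> ?C n" for n y
    unfolding d_def using that by (intro cInf_lower bdd) auto
  have dB: "d n \<le> B\<^sup>2" for n
    using dle[of "x n" n] power_mono[OF B[of n] norm_ge_zero, of 2]
    by (meson atLeast_iff hull_inc image_eqI order_refl order_trans)
  have dmono: "incseq d"
    unfolding d_def
    by (intro incseq_SucI cInf_superset_mono bdd image_mono Cmono) (use ne in auto)
  then obtain D where D: "d \<longlonglongrightarrow> D" using incseq_convergent[OF dmono] dB by blast
  have "\<exists>y\<in>?C n. (norm y)\<^sup>2 < d n + 1 / Suc n" for n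
  proof -
    have "Inf ((\<lambda>y. (norm y)\<^sup>2) ` ?C n) < d n + 1 / Suc n" unfolding d_def by simp
    then show ?thesis using cInf_less_iff[OF _ bdd[of n]] ne by blast
  qed
  then obtain W where WC: "\<And>n. W n \<in> ?C n" and Wd: "\<And>n. (norm (W n))\<^sup>2 < d n + 1 / Suc n" by metis
  \<comment> \<open>The midpoint of \<open>W n\<close> and \<open>W m\<close> lies in the hull of
    the tail from \<open>N\<close>, so its squared norm is at least \<open>d N\<close>, while both
    squared norms are at most \<open>D + 1 / Suc N\<close>. The parallelogram law bounds what is
    left.\<close>
  have par: "(norm (W n - W m))\<^sup>2 \<le> 2 * (D - d N) * 2 + 4 / Suc N" if "N \<le> n" "N \<le> m" for n m N
  proof -
    have "W n \<in> ?C N" "W m \<in> ?C N" using WC Cmono that by blast+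
    then have "(1/2) *\<^sub>R W n + (1/2) *\<^sub>R W m \<in> ?C N"
      by (intro convexD[OF convex_convex_hull]) auto
    then have "d N \<le> (norm ((1/2) *\<^sub>R W n + (1/2) *\<^sub>R W m))\<^sup>2" by (rule dle)
    also have "\<dots> = (norm (W n + W m))\<^sup>2 / 4"
      by (simp add: scaleR_right_distrib[symmetric] power_divide)
    finally have 1: "4 * d N \<le> (norm (W n + W m))\<^sup>2" by simp
    have 2: "(norm (W n + W m))\<^sup>2 + (norm (W n - W m))\<^sup>2 = 2 * (norm (W n))\<^sup>2 + 2 * (norm (W m))\<^sup>2"
      by (simp add: power2_norm_eq_inner inner_add inner_diff inner_commute)
    have "d n \<le> D" "d m \<le> D" using incseq_le[OF dmono D] by auto
    moreover have "1 / Suc n \<le> 1 / Suc N" "1 / Suc m \<le> 1 / Suc N" using that by (auto simp: field_simps)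
    ultimately show ?thesis using 1 2 Wd[of n] Wd[of m] by simp
  qed
  have "Cauchy W"
  proof (rule metric_CauchyI)
    fix e :: real assume "e > 0"
    have "(\<lambda>N. 2 * (D - d N) * 2 + 4 / Suc N) \<longlonglongrightarrow> 2 * (D - D) * 2 + 0"
      by (intro tendsto_intros D LIMSEQ_Suc[OF lim_const_over_n])
    then have "eventually (\<lambda>N. 2 * (D - d N) * 2 + 4 / Suc N < e\<^sup>2) sequentially"
      by (rule order_tendstoD) (use \<open>e > 0\<close> in auto)
    then obtain N where N: "2 * (D - d N) * 2 + 4 / Suc N < e\<^sup>2"
      by (auto simp: eventually_sequentially)
    show "\<exists>M. \<forall>m\<ge>M. \<forall>n\<ge>M. dist (W m) (W n) < e"
    proof (intro exI allI impI)
      fix m n assume "N \<le> m" "N \<le> n"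
      then have "(norm (W m - W n))\<^sup>2 < e\<^sup>2" using par[of N m n] N by linarith
      then show "dist (W m) (W n) < e" using \<open>e > 0\<close> by (simp add: dist_norm power_less_imp_less_base)
    qed
  qed
  then obtain w where "W \<longlonglongrightarrow> w" using Cauchy_convergent convergent_def by blast
  then show ?thesis using that WC by blast
qed

text \<open>A slab of half-width e/2 around the level l is convex, so it contains the hull of a tail
  as soon as it contains the tail.\<close>

lemma convex_hull_tail_inner:
  assumes "\<And>n. W n \<in> convex hull (x ` {n..})" and "(\<lambda>n. inner (x n) g) \<longlonglongrightarrow> l"
  shows "(\<lambda>n. inner (W n) g) \<longlonglongrightarrow> l"
proof (rule metric_LIMSEQ_I)
  fix e :: real assume "e > 0"
  then obtain N where N: "\<And>n. n \<ge> N \<Longrightarrow> dist (inner (x n) g) l < e/2"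
    using metric_LIMSEQ_D[OF assms(2), of "e/2"] by auto
  have "dist (inner (W n) g) l < e" if "n \<ge> N" for n
  proof -
    let ?S = "{y. inner g y \<le> l + e/2} \<inter> {y. inner g y \<ge> l - e/2}"
    have "convex hull (x ` {n..}) \<subseteq> ?S"
    proof (rule hull_minimal)
      show "convex ?S" by (intro convex_Int convex_halfspace_le convex_halfspace_ge)
      show "x ` {n..} \<subseteq> ?S"
      proof
        fix y assume "y \<in> x ` {n..}"
        then obtain k where "k \<ge> n" "y = x k" by auto
        then have "\<bar>inner g y - l\<bar> < e/2" using N[of k] that by (simp add: dist_real_def inner_commute)
        then have "inner g y \<le> l + e/2" "inner g y \<ge> l - e/2" by linarith+
        then show "y \<in> ?S" by simp
      qed
    qed
    then have "inner g (W n) \<le> l + e/2" "inner g (W n) \<ge> l - e/2" using assms(1)[of n] by auto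
    then have "\<bar>inner g (W n) - l\<bar> < e" using \<open>e > 0\<close> by linarith
    then show ?thesis by (simp add: dist_real_def inner_commute)
  qed
  then show "\<exists>no. \<forall>n\<ge>no. dist (inner (W n) g) l < e" by blast
qed

lemma weakly_to_mazur:
  fixes x :: "nat \<Rightarrow> 'a::{real_inner,complete_space}"
  assumes "weakly_to x l" "\<And>n. norm (x n) \<le> B"
  obtains W where "\<And>n. W n \<in> convex hull (x ` {n..})" "W \<longlonglongrightarrow> l"
proof -
  obtain W w where W: "\<And>n. W n \<in> convex hull (x ` {n..})" "W \<longlonglongrightarrow> w"
    using mazur_bounded[of x B] assms(2) by blast
  have "inner w g = inner l g" for g
  proof (rule LIMSEQ_unique)
    show "(\<lambda>n. inner (W n) g) \<longlonglongrightarrow> inner w g" by (intro tendsto_intros W)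
    show "(\<lambda>n. inner (W n) g) \<longlonglongrightarrow> inner l g"
      using convex_hull_tail_inner[OF W(1)] assms(1) unfolding weakly_to_def by blast
  qed
  then have "inner (w - l) (w - l) = 0" by (simp add: inner_diff_left)
  then have "w = l" by simp
  then show ?thesis using that W by blast
qed

lemma weakly_closed:
  fixes x :: "nat \<Rightarrow> 'a::{real_inner,complete_space}"
  assumes "weakly_to x l" "\<And>n. norm (x n) \<le> B" "closed S" "convex S" "\<And>n. x n \<in> S"
  shows "l \<in> S"
proof -
  obtain W where W: "\<And>n. W n \<in> convex hull (x ` {n..})" "W \<longlonglongrightarrow> l"
    using weakly_to_mazur[OF assms(1,2)] by blast
  have "convex hull (x ` {n..}) \<subseteq> S" for n using assms(4,5) by (intro hull_minimal) auto
  then have "W n \<in> S" for n using W(1) by blast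
  then show ?thesis using closed_sequentially[OF assms(3) _ W(2)] by blast
qed

lemma weakly_to_subseq: "weakly_to x l \<Longrightarrow> strict_mono r \<Longrightarrow> weakly_to (x \<circ> r) l"
  unfolding weakly_to_def using LIMSEQ_subseq_LIMSEQ by (fastforce simp: o_def)

lemma LIMSEQ_if_subseq:
  fixes X :: "nat \<Rightarrow> 'a::metric_space"
  assumes "\<And>s. strict_mono (s::nat \<Rightarrow> nat) \<Longrightarrow> \<exists>t::nat \<Rightarrow> nat. strict_mono t \<and> (\<lambda>n. X (s (t n))) \<longlonglongrightarrow> L"
  shows "X \<longlonglongrightarrow> L"
proof (rule ccontr)
  assume "\<not> X \<longlonglongrightarrow> L"
  then obtain e where e: "e > 0" "\<And>N. \<exists>n\<ge>N. dist (X n) L \<ge> e"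
    by (auto simp: lim_sequentially not_less)
  then have "infinite {n. dist (X n) L \<ge> e}" by (simp add: infinite_nat_iff_unbounded_le)
  then obtain s where s: "strict_mono (s::nat \<Rightarrow> nat)" "\<And>n. s n \<in> {n. dist (X n) L \<ge> e}"
    using infinite_enumerate by blast
  obtain t :: "nat \<Rightarrow> nat" where t: "(\<lambda>n. X (s (t n))) \<longlonglongrightarrow> L" using assms[OF s(1)] by blast
  then obtain n where "dist (X (s (t n))) L < e" using metric_LIMSEQ_D[OF t e(1)] by blast
  then show False using s(2)[of "t n"] by simp
qed

text \<open>Bolzano-Weierstrass gives every subsequence a convergent one inside it, and the second
  assumption identifies its limit; the subsequence principle does the rest.\<close>

lemma LIMSEQ_if_subseq_limits:
  fixes X :: "nat \<Rightarrow> real"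
  assumes B: "\<And>n. norm (X n) \<le> B"
    and key: "\<And>s l. strict_mono (s::nat \<Rightarrow> nat) \<Longrightarrow> (\<lambda>n. X (s n)) \<longlonglongrightarrow> l \<Longrightarrow> l = L"
  shows "X \<longlonglongrightarrow> L"
proof (rule LIMSEQ_if_subseq)
  fix s :: "nat \<Rightarrow> nat" assume s: "strict_mono s"
  have "bounded (range (X \<circ> s))" using B by (auto simp: bounded_iff)
  then obtain l t where t: "strict_mono (t::nat \<Rightarrow> nat)" "((X \<circ> s) \<circ> t) \<longlonglongrightarrow> l"
    using bounded_imp_convergent_subsequence by blast
  have "strict_mono (s \<circ> t)" "(\<lambda>n. X ((s \<circ> t) n)) \<longlonglongrightarrow> l" using s t strict_mono_o by (auto simp: o_def)
  then have "l = L" by (rule key)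
  then show "\<exists>t::nat \<Rightarrow> nat. strict_mono t \<and> (\<lambda>n. X (s (t n))) \<longlonglongrightarrow> L" using t by (auto simp: o_def)
qed

text \<open>A diagonal selection makes the inner products with all members \<open>x m\<close>
  converge. The candidate for the weak limit is the strong limit \<open>w\<close> of convex
  combinations of this subsequence, which avoids representing a limit functional. For arbitrary
  \<open>g\<close> it remains to see that the inner products have no other cluster point than
  \<open>inner w g\<close>.\<close>

lemma bounded_weak_subseq:
  fixes x :: "nat \<Rightarrow> 'a::{real_inner,complete_space}"
  assumes B: "\<And>n. norm (x n) \<le> B"
  obtains r l where "strict_mono (r::nat \<Rightarrow> nat)" "weakly_to (x \<circ> r) l"
proof -
  have "norm (inner (x n) (x m)) \<le> B * B" for n m
    using Cauchy_Schwarz_ineq2[of "x n" "x m"] B[of n] B[of m]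
    by (smt (verit) mult_mono norm_ge_zero real_norm_def)
  then obtain r where r: "strict_mono (r::nat \<Rightarrow> nat)"
    and lim: "\<And>m. m \<in> (UNIV::nat set) \<Longrightarrow> \<exists>l. (\<lambda>n. inner (x (r n)) (x m)) \<longlonglongrightarrow> l"
    using function_convergent_subsequence[of "UNIV::nat set" "\<lambda>n m. inner (x n) (x m)" "B*B"] by (metis countableI_type)
  define y where "y = x \<circ> r"
  have yB: "norm (y n) \<le> B" for n using B by (simp add: y_def)
  obtain W w where W: "\<And>n. W n \<in> convex hull (y ` {n..})" "W \<longlonglongrightarrow> w"
    using mazur_bounded[of y B] yB by blast
  have key: "l = inner w g" if "strict_mono s" "(\<lambda>n. inner (y (s n)) g) \<longlonglongrightarrow> l" for s :: "nat \<Rightarrow> nat" and g l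
  proof -
    obtain W' w' where W': "\<And>n. W' n \<in> convex hull ((y \<circ> s) ` {n..})" "W' \<longlonglongrightarrow> w'"
      using mazur_bounded[of "y \<circ> s" B] yB by (auto simp: o_def)
    have eq: "inner w (x m) = inner w' (x m)" for m
    proof -
      obtain k where k: "(\<lambda>n. inner (y n) (x m)) \<longlonglongrightarrow> k" using lim[of m] by (auto simp: y_def)
      have "(\<lambda>n. inner ((y \<circ> s) n) (x m)) \<longlonglongrightarrow> k" using LIMSEQ_subseq_LIMSEQ[OF k that(1)] by (simp add: o_def)
      then have "(\<lambda>n. inner (W' n) (x m)) \<longlonglongrightarrow> k" by (rule convex_hull_tail_inner[OF W'(1)])
      moreover have "(\<lambda>n. inner (W n) (x m)) \<longlonglongrightarrow> k" by (rule convex_hull_tail_inner[OF W(1) k])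
      moreover have "(\<lambda>n. inner (W' n) (x m)) \<longlonglongrightarrow> inner w' (x m)" "(\<lambda>n. inner (W n) (x m)) \<longlonglongrightarrow> inner w (x m)"
        by (intro tendsto_intros W W')+
      ultimately show ?thesis using LIMSEQ_unique by metis
    qed
    \<comment> \<open>The hyperplane orthogonal to \<open>w - w'\<close> contains all
      \<open>x m\<close>, hence both limits of convex combinations, so \<open>w - w'\<close> is
      orthogonal to itself.\<close>
    define S where "S = {z. inner (w - w') z = 0}"
    have "closed S" unfolding S_def by (rule closed_hyperplane)
    have "convex S" unfolding S_def by (rule convex_hyperplane)
    have xS: "x m \<in> S" for m using eq by (simp add: S_def inner_diff_left)
    have "convex hull (y ` {n..}) \<subseteq> S" for n
      using \<open>convex S\<close> xS by (intro hull_minimal) (auto simp: y_def)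
    then have "w \<in> S" using closed_sequentially[OF \<open>closed S\<close> _ W(2)] W(1) by blast
    have "convex hull ((y \<circ> s) ` {n..}) \<subseteq> S" for n
      using \<open>convex S\<close> xS by (intro hull_minimal) (auto simp: y_def)
    then have "w' \<in> S" using closed_sequentially[OF \<open>closed S\<close> _ W'(2)] W'(1) by blast
    have "inner (w - w') (w - w') = 0" using \<open>w \<in> S\<close> \<open>w' \<in> S\<close> by (simp add: S_def inner_diff_right)
    then have "w = w'" by simp
    have "(\<lambda>n. inner ((y \<circ> s) n) g) \<longlonglongrightarrow> l" using that(2) by (simp add: o_def)
    then have "(\<lambda>n. inner (W' n) g) \<longlonglongrightarrow> l" by (rule convex_hull_tail_inner[OF W'(1)])
    moreover have "(\<lambda>n. inner (W' n) g) \<longlonglongrightarrow> inner w' g" by (intro tendsto_intros W')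
    ultimately show ?thesis using \<open>w = w'\<close> LIMSEQ_unique by metis
  qed
  have "weakly_to y w"
    unfolding weakly_to_def
  proof
    fix g
    show "(\<lambda>n. inner (y n) g) \<longlonglongrightarrow> inner w g"
    proof (rule LIMSEQ_if_subseq_limits)
      show "norm (inner (y n) g) \<le> B * norm g" for n
        using Cauchy_Schwarz_ineq2[of "y n" g] mult_right_mono[OF yB[of n] norm_ge_zero[of g]] by simp
    qed (use key in blast)
  qed
  then show ?thesis using that r y_def by blast
qed

lemma weakly_to_strong_inner:
  assumes "weakly_to x l" "\<And>n. norm (x n) \<le> B" "y \<longlonglongrightarrow> m"
  shows "(\<lambda>n. inner (x n) (y n)) \<longlonglongrightarrow> inner l m"
proof -
  have "(\<lambda>n. inner (x n) (y n - m)) \<longlonglongrightarrow> 0"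
  proof (rule Lim_null_comparison)
    show "eventually (\<lambda>n. norm (inner (x n) (y n - m)) \<le> B * norm (y n - m)) sequentially"
    proof (intro always_eventually allI)
      fix n
      have "norm (inner (x n) (y n - m)) \<le> norm (x n) * norm (y n - m)"
        using Cauchy_Schwarz_ineq2 by simp
      also have "\<dots> \<le> B * norm (y n - m)" by (intro mult_right_mono assms) auto
      finally show "norm (inner (x n) (y n - m)) \<le> B * norm (y n - m)" .
    qed
    show "(\<lambda>n. B * norm (y n - m)) \<longlonglongrightarrow> 0"
      using assms(3) by (intro tendsto_mult_right_zero tendsto_norm_zero) (simp add: LIM_zero)
  qed
  moreover have "(\<lambda>n. inner (x n) m) \<longlonglongrightarrow> inner l m" using assms(1) by (simp add: weakly_to_def)
  ultimately have "(\<lambda>n. inner (x n) (y n - m) + inner (x n) m) \<longlonglongrightarrow> 0 + inner l m" by (rule tendsto_add)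
  then show ?thesis by (simp add: inner_diff_right)
qed

text \<open>Lower semicontinuity of the norm, obtained by testing with the limit itself. The norms
  are assumed to converge because the cost argument provides exactly that.\<close>

lemma weakly_to_norm_le:
  assumes "weakly_to x l" "(\<lambda>n. norm (x n)) \<longlonglongrightarrow> c"
  shows "norm l \<le> c"
proof -
  have "inner l l \<le> c * norm l"
  proof (rule tendsto_le[OF sequentially_bot])
    show "(\<lambda>n. norm (x n) * norm l) \<longlonglongrightarrow> c * norm l" by (intro tendsto_intros assms)
    show "(\<lambda>n. inner (x n) l) \<longlonglongrightarrow> inner l l" using assms(1) by (simp add: weakly_to_def)
    show "eventually (\<lambda>n. inner (x n) l \<le> norm (x n) * norm l) sequentially"
      using norm_cauchy_schwarz by (intro always_eventually allI)
  qed
  then have "norm l * norm l \<le> c * norm l" by (simp add: power2_norm_eq_inner[symmetric] power2_eq_square)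
  moreover have "c \<ge> 0" using assms(2) by (rule LIMSEQ_le_const) auto
  ultimately show ?thesis by (cases "norm l = 0") auto
qed

section \<open>The Hilbert space of square integrable functions\<close>

text \<open>Always on the whole space: a domain enters only through extension by zero, so that
  functions on different domains become elements of one space.\<close>

definition square_int :: "('a::euclidean_space \<Rightarrow> 'b::euclidean_space) \<Rightarrow> bool" where
  "square_int f \<longleftrightarrow> f \<in> borel_measurable lebesgue \<and> integrable lebesgue (\<lambda>x. (norm (f x))\<^sup>2)"

lemma square_int_measurable[measurable_dest, dest]: "square_int f \<Longrightarrow> f \<in> borel_measurable lebesgue"
  by (simp add: square_int_def)

lemma square_int_bound:
  assumes "f \<in> borel_measurable lebesgue" "integrable lebesgue g" "AE x in lebesgue. (norm (f x))\<^sup>2 \<le> g x"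
  shows "square_int f"
proof -
  have "integrable lebesgue (\<lambda>x. (norm (f x))\<^sup>2)"
    by (rule Bochner_Integration.integrable_bound[OF assms(2)]) (use assms in auto)
  then show ?thesis using assms(1) by (simp add: square_int_def)
qed

lemma square_int_0[simp]: "square_int (\<lambda>x. 0)"
  by (simp add: square_int_def)

lemma square_int_add:
  assumes "square_int f" "square_int g" shows "square_int (\<lambda>x. f x + g x)"
proof (rule square_int_bound[where g = "\<lambda>x. 2 * (norm (f x))\<^sup>2 + 2 * (norm (g x))\<^sup>2"])
  show "AE x in lebesgue. (norm (f x + g x))\<^sup>2 \<le> 2 * (norm (f x))\<^sup>2 + 2 * (norm (g x))\<^sup>2"
  proof (rule AE_I2)
    fix x
    have "(norm (f x + g x))\<^sup>2 + (norm (f x - g x))\<^sup>2 = 2 * (norm (f x))\<^sup>2 + 2 * (norm (g x))\<^sup>2"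
      by (simp add: power2_norm_eq_inner inner_add inner_diff inner_commute)
    then show "(norm (f x + g x))\<^sup>2 \<le> 2 * (norm (f x))\<^sup>2 + 2 * (norm (g x))\<^sup>2"
      using zero_le_power2[of "norm (f x - g x)"] by linarith
  qed
qed (use assms in \<open>auto simp: square_int_def\<close>)

lemma square_int_scaleR: "square_int f \<Longrightarrow> square_int (\<lambda>x. c *\<^sub>R f x)"
  by (auto simp: square_int_def power_mult_distrib)

lemma square_int_minus: "square_int f \<Longrightarrow> square_int (\<lambda>x. - f x)"
  using square_int_scaleR[of f "-1"] by simp

lemma square_int_diff: "square_int f \<Longrightarrow> square_int g \<Longrightarrow> square_int (\<lambda>x. f x - g x)"
  using square_int_add[of f "\<lambda>x. - g x"] square_int_minus[of g] by simp

lemma square_int_inner: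
  assumes "square_int f" "square_int g" shows "integrable lebesgue (\<lambda>x. f x \<bullet> g x)"
proof (rule Bochner_Integration.integrable_bound[where f = "\<lambda>x. (norm (f x))\<^sup>2 + (norm (g x))\<^sup>2"])
  show "AE x in lebesgue. norm (f x \<bullet> g x) \<le> norm ((norm (f x))\<^sup>2 + (norm (g x))\<^sup>2)"
  proof (rule AE_I2)
    fix x
    have "\<bar>f x \<bullet> g x\<bar> \<le> norm (f x) * norm (g x)" by (rule Cauchy_Schwarz_ineq2)
    also have "\<dots> \<le> (norm (f x))\<^sup>2 + (norm (g x))\<^sup>2"
      using sum_squares_bound[of "norm (f x)" "norm (g x)"] mult_nonneg_nonneg[of "norm (f x)" "norm (g x)"]
      by (simp add: power2_eq_square del: mult_nonneg_nonneg)
    finally show "norm (f x \<bullet> g x) \<le> norm ((norm (f x))\<^sup>2 + (norm (g x))\<^sup>2)" by simp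
  qed
qed (use assms in \<open>auto simp: square_int_def\<close>)

lemma square_int_cong_AE:
  assumes "square_int f" "AE x in lebesgue. f x = g x" shows "square_int g"
proof -
  have "g \<in> borel_measurable lebesgue"
    using assms by (intro borel_measurable_AE[of f g]) auto
  then show ?thesis
    by (rule square_int_bound[where g = "\<lambda>x. (norm (f x))\<^sup>2"]) (use assms in \<open>auto simp: square_int_def\<close>)
qed

definition l2_rel :: "('a::euclidean_space \<Rightarrow> 'b::euclidean_space) \<Rightarrow> ('a \<Rightarrow> 'b) \<Rightarrow> bool" where
  "l2_rel f g \<longleftrightarrow> square_int f \<and> square_int g \<and> (AE x in lebesgue. f x = g x)"

text \<open>\<open>fn\<close> picks a representative, so it is determined up to null sets only.\<close>

quotient_type (overloaded) ('a, 'b) l2 = "'a::euclidean_space \<Rightarrow> 'b::euclidean_space" / partial: l2_rel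
  morphisms fn el
proof (rule part_equivpI)
  show "\<exists>x. l2_rel x x" by (rule exI[of _ "\<lambda>x. 0"]) (simp add: l2_rel_def)
  show "symp l2_rel" by (auto intro!: sympI simp: l2_rel_def elim: AE_mp)
  show "transp l2_rel" by (auto intro!: transpI simp: l2_rel_def elim: AE_mp)
qed

instantiation l2 :: (euclidean_space, euclidean_space) real_vector
begin
lift_definition zero_l2 :: "('a, 'b) l2" is "\<lambda>x. 0" by (simp add: l2_rel_def)
lift_definition plus_l2 :: "('a, 'b) l2 \<Rightarrow> ('a, 'b) l2 \<Rightarrow> ('a, 'b) l2" is "\<lambda>f g x. f x + g x"
  by (auto simp: l2_rel_def square_int_add elim: AE_mp)
lift_definition minus_l2 :: "('a, 'b) l2 \<Rightarrow> ('a, 'b) l2 \<Rightarrow> ('a, 'b) l2" is "\<lambda>f g x. f x - g x"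
  by (auto simp: l2_rel_def square_int_diff elim: AE_mp)
lift_definition uminus_l2 :: "('a, 'b) l2 \<Rightarrow> ('a, 'b) l2" is "\<lambda>f x. - f x"
  by (auto simp: l2_rel_def square_int_minus elim: AE_mp)
lift_definition scaleR_l2 :: "real \<Rightarrow> ('a, 'b) l2 \<Rightarrow> ('a, 'b) l2" is "\<lambda>c f x. c *\<^sub>R f x"
  by (auto simp: l2_rel_def square_int_scaleR elim: AE_mp)
instance
proof
  fix f g h :: "('a,'b) l2" and a b :: real
  show "f + g + h = f + (g + h)" by transfer (auto simp: l2_rel_def square_int_add add.assoc)
  show "f + g = g + f" by transfer (auto simp: l2_rel_def square_int_add add.commute)
  show "0 + f = f" by transfer (auto simp: l2_rel_def)
  show "- f + f = 0" by transfer (auto simp: l2_rel_def)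
  show "f - g = f + - g"
    by transfer (auto simp: l2_rel_def square_int_diff square_int_add square_int_minus)
  show "a *\<^sub>R (f + g) = a *\<^sub>R f + a *\<^sub>R g"
    by transfer (auto simp: l2_rel_def square_int_add square_int_scaleR scaleR_right_distrib)
  show "(a + b) *\<^sub>R f = a *\<^sub>R f + b *\<^sub>R f"
    by transfer (auto simp: l2_rel_def square_int_add square_int_scaleR scaleR_left_distrib)
  show "a *\<^sub>R b *\<^sub>R f = (a * b) *\<^sub>R f"
    by transfer (auto simp: l2_rel_def square_int_scaleR)
  show "1 *\<^sub>R f = f" by transfer (auto simp: l2_rel_def)
qed
end

instantiation l2 :: (euclidean_space, euclidean_space) real_inner
begin
lift_definition inner_l2 :: "('a, 'b) l2 \<Rightarrow> ('a, 'b) l2 \<Rightarrow> real" is "\<lambda>f g. LINT x|lebesgue. f x \<bullet> g x"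
proof -
  fix f f' g g' :: "'a \<Rightarrow> 'b" assume *: "l2_rel f f'" "l2_rel g g'"
  show "(LINT x|lebesgue. f x \<bullet> g x) = (LINT x|lebesgue. f' x \<bullet> g' x)"
  proof (rule integral_cong_AE)
    show "AE x in lebesgue. f x \<bullet> g x = f' x \<bullet> g' x"
      using * unfolding l2_rel_def by (auto elim: AE_mp)
  qed (use * in \<open>auto simp: l2_rel_def\<close>)
qed
definition norm_l2 :: "('a, 'b) l2 \<Rightarrow> real" where "norm_l2 f = sqrt (inner f f)"
definition dist_l2 :: "('a, 'b) l2 \<Rightarrow> ('a, 'b) l2 \<Rightarrow> real" where "dist_l2 f g = norm (f - g)"
definition sgn_l2 :: "('a, 'b) l2 \<Rightarrow> ('a, 'b) l2" where "sgn_l2 f = f /\<^sub>R norm f"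
definition uniformity_l2 :: "(('a, 'b) l2 \<times> ('a, 'b) l2) filter" where
  "uniformity_l2 = (INF e\<in>{0<..}. principal {(x, y). dist x y < e})"
definition open_l2 :: "('a, 'b) l2 set \<Rightarrow> bool" where
  "open_l2 U = (\<forall>x\<in>U. eventually (\<lambda>(x', y). x' = x \<longrightarrow> y \<in> U) uniformity)"
instance
proof
  fix f g h :: "('a,'b) l2" and r :: real
  show "dist f g = norm (f - g)" by (rule dist_l2_def)
  show "sgn f = f /\<^sub>R norm f" by (rule sgn_l2_def)
  show "(uniformity :: (('a, 'b) l2 \<times> ('a, 'b) l2) filter) = (INF e\<in>{0<..}. principal {(x, y). dist x y < e})"
    by (rule uniformity_l2_def)
  show "open U = (\<forall>x\<in>U. eventually (\<lambda>(x', y). x' = x \<longrightarrow> y \<in> U) uniformity)" for U :: "('a,'b) l2 set"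
    by (rule open_l2_def)
  show "inner f g = inner g f" by transfer (simp add: inner_commute)
  show "inner (f + g) h = inner f h + inner g h"
    by transfer (simp add: l2_rel_def inner_add_left square_int_inner)
  show "inner (r *\<^sub>R f) g = r * inner f g" by transfer simp
  show "0 \<le> inner f f" by transfer simp
  show "inner f f = 0 \<longleftrightarrow> f = 0"
  proof transfer
    fix f :: "'a \<Rightarrow> 'b" assume "l2_rel f f"
    then have f: "square_int f" by (simp add: l2_rel_def)
    have "(LINT x|lebesgue. f x \<bullet> f x) = 0 \<longleftrightarrow> (AE x in lebesgue. f x \<bullet> f x = 0)"
      by (rule integral_nonneg_eq_0_iff_AE) (use f in \<open>auto intro: square_int_inner\<close>)
    then show "(LINT x|lebesgue. f x \<bullet> f x) = 0 \<longleftrightarrow> l2_rel f (\<lambda>x. 0)"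
      using f by (simp add: l2_rel_def)
  qed
  show "norm f = sqrt (inner f f)" by (rule norm_l2_def)
qed
end

section \<open>Passing between functions and their classes\<close>

lemma square_int_fn[simp, intro]: "square_int (fn u)"
  using Quotient3_rep_reflp[OF Quotient3_l2, of u] by (simp add: l2_rel_def)

lemma fn_measurable[measurable]: "fn u \<in> borel_measurable lebesgue"
  by (rule square_int_measurable[OF square_int_fn])

lemma el_eq_iff: "square_int f \<Longrightarrow> square_int g \<Longrightarrow> el f = el g \<longleftrightarrow> (AE x in lebesgue. f x = g x)"
  using Quotient3_rel[OF Quotient3_l2, of f g] by (simp add: l2_rel_def)

lemma el_eqI: "square_int f \<Longrightarrow> AE x in lebesgue. f x = g x \<Longrightarrow> el f = el g"
  using el_eq_iff square_int_cong_AE by blast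

lemma el_fn[simp]: "el (fn u) = u"
  using Quotient3_abs_rep[OF Quotient3_l2] .

lemma fn_el: "square_int f \<Longrightarrow> AE x in lebesgue. fn (el f) x = f x"
  using el_eq_iff[of "fn (el f)" f] by simp

lemma el_add: "square_int f \<Longrightarrow> square_int g \<Longrightarrow> el (\<lambda>x. f x + g x) = el f + el g"
  by (subst plus_l2.abs_eq) (auto simp: l2_rel_def)
lemma el_diff: "square_int f \<Longrightarrow> square_int g \<Longrightarrow> el (\<lambda>x. f x - g x) = el f - el g"
  by (subst minus_l2.abs_eq) (auto simp: l2_rel_def)
lemma el_scaleR: "square_int f \<Longrightarrow> el (\<lambda>x. c *\<^sub>R f x) = c *\<^sub>R el f"
  by (subst scaleR_l2.abs_eq) (auto simp: l2_rel_def)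
lemma el_0: "el (\<lambda>x. 0) = 0"
  by (simp add: zero_l2_def)

lemma inner_el: "square_int f \<Longrightarrow> square_int g \<Longrightarrow> inner (el f) (el g) = (LINT x|lebesgue. f x \<bullet> g x)"
  by (subst inner_l2.abs_eq) (auto simp: l2_rel_def)

lemma norm_el: "square_int f \<Longrightarrow> (norm (el f))\<^sup>2 = (LINT x|lebesgue. (norm (f x))\<^sup>2)"
  by (simp add: power2_norm_eq_inner inner_el)

lemma nn_integral_norm_el:
  assumes "square_int f" shows "(\<integral>\<^sup>+x. ennreal ((norm (f x))\<^sup>2) \<partial>lebesgue) = ennreal ((norm (el f))\<^sup>2)"
  unfolding norm_el[OF assms] by (rule nn_integral_eq_integral) (use assms in \<open>auto simp: square_int_def\<close>)

lemma norm_fn: "(norm u)\<^sup>2 = (LINT x|lebesgue. (norm (fn u x))\<^sup>2)"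
  using norm_el[of "fn u"] by simp

lemma fn_add: "AE x in lebesgue. fn (u + v) x = fn u x + fn v x"
  using fn_el[of "\<lambda>x. fn u x + fn v x"] by (simp add: el_add square_int_add)
lemma fn_diff: "AE x in lebesgue. fn (u - v) x = fn u x - fn v x"
  using fn_el[of "\<lambda>x. fn u x - fn v x"] by (simp add: el_diff square_int_diff)
lemma fn_scaleR: "AE x in lebesgue. fn (c *\<^sub>R u) x = c *\<^sub>R fn u x"
  using fn_el[of "\<lambda>x. c *\<^sub>R fn u x"] by (simp add: el_scaleR square_int_scaleR)

text \<open>Riesz-Fischer along a fast sequence: the increments are summable pointwise, which gives
  an a.e. limit, and Fatou's lemma shows that it is the limit in norm as well. Having both limits at
  once yields completeness and also a.e. convergent subsequences.\<close>

lemma l2_fast_Cauchy: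
  fixes X :: "nat \<Rightarrow> ('a::euclidean_space, 'b::euclidean_space) l2"
  assumes "\<And>k. norm (X (Suc k) - X k) \<le> (1/4) ^ k"
  shows "\<exists>l. X \<longlonglongrightarrow> l \<and> (AE x in lebesgue. (\<lambda>k. fn (X k) x) \<longlonglongrightarrow> fn l x)"
proof -
  \<comment> \<open>The weight 4^k serves two needs: the integrals, at most 4^k * 16^-k, remain
    summable, and a pointwise bound c on \<open>d k x\<close> makes the increments at most sqrt c *
    2^-k, which is summable too.\<close>
  define d where "d k x = 4 ^ k * (norm (fn (X (Suc k)) x - fn (X k) x))\<^sup>2" for k x
  have dm[measurable]: "d k \<in> borel_measurable lebesgue" for k unfolding d_def by measurable
  have "(\<integral>\<^sup>+x. d k x \<partial>lebesgue) \<le> ennreal ((1/4) ^ k)" for k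
  proof -
    have s: "square_int (\<lambda>x. fn (X (Suc k)) x - fn (X k) x)" by (simp add: square_int_diff)
    have "(\<integral>\<^sup>+x. d k x \<partial>lebesgue) = ennreal (LINT x|lebesgue. d k x)"
      by (rule nn_integral_eq_integral) (use s in \<open>auto simp: d_def square_int_def\<close>)
    also have "(LINT x|lebesgue. d k x) = 4 ^ k * (norm (X (Suc k) - X k))\<^sup>2"
      using norm_el[OF s] by (simp add: d_def el_diff)
    also have "\<dots> \<le> 4 ^ k * ((1/4) ^ k)\<^sup>2"
      using assms by (intro mult_left_mono power_mono) auto
    also have "\<dots> = (1/4) ^ k" by (simp add: power2_eq_square power_divide)
    finally show ?thesis by (simp add: ennreal_leI)
  qed
  then have "(\<Sum>k. \<integral>\<^sup>+x. d k x \<partial>lebesgue) \<le> (\<Sum>k. ennreal ((1/4) ^ k))"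
    by (intro suminf_le) auto
  also have "\<dots> < \<infinity>"
    by (subst suminf_ennreal2) (auto intro!: summable_geometric)
  finally have "(\<integral>\<^sup>+x. (\<Sum>k. ennreal (d k x)) \<partial>lebesgue) < \<infinity>"
    by (subst nn_integral_suminf) auto
  then have "AE x in lebesgue. (\<Sum>k. ennreal (d k x)) \<noteq> \<infinity>"
    by (intro nn_integral_PInf_AE) auto
  then have conv: "AE x in lebesgue. convergent (\<lambda>k. fn (X k) x)"
  proof (rule AE_mp, intro AE_I2 impI)
    fix x assume *: "(\<Sum>k. ennreal (d k x)) \<noteq> \<infinity>"
    obtain c where c: "(\<Sum>k. ennreal (d k x)) = ennreal c" "c \<ge> 0"
      using * by (cases "\<Sum>k. ennreal (d k x)") auto
    have "ennreal (d k x) \<le> ennreal c" for k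
      using sum_le_suminf[of "\<lambda>k. ennreal (d k x)" "{k}"] c by auto
    then have dc: "d k x \<le> c" for k using c by simp
    have le: "norm (fn (X (Suc k)) x - fn (X k) x) \<le> sqrt c * (1/2) ^ k" for k
    proof (rule power2_le_imp_le)
      have "4 ^ k * (norm (fn (X (Suc k)) x - fn (X k) x))\<^sup>2 \<le> c" using dc[of k] by (simp add: d_def)
      then have "(norm (fn (X (Suc k)) x - fn (X k) x))\<^sup>2 \<le> c / 4 ^ k" by (simp add: field_simps)
      also have "\<dots> = (sqrt c * (1/2) ^ k)\<^sup>2"
        using c by (simp add: power_mult_distrib power_divide power2_eq_square power_mult_distrib[symmetric])
      finally show "(norm (fn (X (Suc k)) x - fn (X k) x))\<^sup>2 \<le> (sqrt c * (1/2) ^ k)\<^sup>2" .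
    qed (use c in simp)
    have "summable (\<lambda>k. fn (X (Suc k)) x - fn (X k) x)"
      by (rule summable_comparison_test'[where g = "\<lambda>k. sqrt c * (1/2)^k" and N = 0])
         (use le in \<open>auto intro!: summable_mult summable_geometric\<close>)
    then have "convergent (\<lambda>n. \<Sum>k<n. fn (X (Suc k)) x - fn (X k) x)"
      by (simp add: summable_iff_convergent)
    then have "convergent (\<lambda>n. fn (X n) x - fn (X 0) x)" by (simp add: sum_lessThan_telescope[where f = "\<lambda>k. fn (X k) x"])
    then show "convergent (\<lambda>k. fn (X k) x)"
      using convergent_add[OF _ convergent_const[of "fn (X 0) x"], of "\<lambda>n. fn (X n) x - fn (X 0) x"] by simp
  qed
  define f where "f x = lim (\<lambda>k. fn (X k) x)" for x
  have fm[measurable]: "f \<in> borel_measurable lebesgue"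
    unfolding f_def by (rule borel_measurable_lim_metric) simp
  have lim: "AE x in lebesgue. (\<lambda>k. fn (X k) x) \<longlonglongrightarrow> f x"
    using conv by (auto simp: f_def convergent_LIMSEQ_iff elim: AE_mp)
  have tail: "norm (X (k + j) - X k) \<le> 2 * (1/4) ^ k" for k j
  proof -
    have "norm (X (k + j) - X k) \<le> (\<Sum>i<j. (1/4) ^ (k + i))"
    proof (induction j)
      case (Suc j)
      have "norm (X (k + Suc j) - X k) \<le> norm (X (Suc (k + j)) - X (k + j)) + norm (X (k + j) - X k)"
        using norm_triangle_ineq[of "X (Suc (k + j)) - X (k + j)" "X (k + j) - X k"] by simp
      then show ?case using Suc assms[of "k + j"] by simp
    qed simp
    also have "\<dots> = (1/4) ^ k * (\<Sum>i<j. (1/4) ^ i)" by (simp add: power_add sum_distrib_left)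
    also have "(\<Sum>i<j. (1/4::real) ^ i) = 4 / 3 * (1 - (1/4) ^ j)"
      by (simp add: sum_gp_strict)
    also have "(1/4) ^ k * (4 / 3 * (1 - (1/4) ^ j)) \<le> (1/4) ^ k * (2::real)"
    proof (rule mult_left_mono)
      have "4 / 3 * (1 - (1/4) ^ j) \<le> 4 / 3 * (1::real)" by (intro mult_left_mono) simp_all
      also have "\<dots> \<le> 2" by simp
      finally show "4 / 3 * (1 - (1/4) ^ j) \<le> (2::real)" .
    qed simp
    finally show ?thesis by simp
  qed
  \<comment> \<open>Fatou's lemma for j to infinity puts the limit in place of
    \<open>X (k + j)\<close> in the tail estimate.\<close>
  have fatou: "(\<integral>\<^sup>+x. ennreal ((norm (f x - fn (X k) x))\<^sup>2) \<partial>lebesgue) \<le> ennreal ((2 * (1/4) ^ k)\<^sup>2)" for k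
  proof -
    have "(\<integral>\<^sup>+x. ennreal ((norm (f x - fn (X k) x))\<^sup>2) \<partial>lebesgue) 
        = (\<integral>\<^sup>+x. liminf (\<lambda>j. ennreal ((norm (fn (X (k + j)) x - fn (X k) x))\<^sup>2)) \<partial>lebesgue)"
    proof (rule nn_integral_cong_AE, rule AE_mp[OF lim], intro AE_I2 impI)
      fix x assume "(\<lambda>j. fn (X j) x) \<longlonglongrightarrow> f x"
      then have "(\<lambda>j. fn (X (k + j)) x) \<longlonglongrightarrow> f x" by (subst add.commute) (rule LIMSEQ_ignore_initial_segment)
      then have "(\<lambda>j. ennreal ((norm (fn (X (k + j)) x - fn (X k) x))\<^sup>2)) \<longlonglongrightarrow> ennreal ((norm (f x - fn (X k) x))\<^sup>2)"
        by (intro tendsto_intros)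
      then show "ennreal ((norm (f x - fn (X k) x))\<^sup>2) = liminf (\<lambda>j. ennreal ((norm (fn (X (k + j)) x - fn (X k) x))\<^sup>2))"
        using lim_imp_Liminf[OF sequentially_bot] by metis
    qed
    also have "\<dots> \<le> liminf (\<lambda>j. \<integral>\<^sup>+x. ennreal ((norm (fn (X (k + j)) x - fn (X k) x))\<^sup>2) \<partial>lebesgue)"
      by (rule nn_integral_liminf) measurable
    also have "\<dots> \<le> ennreal ((2 * (1/4) ^ k)\<^sup>2)"
    proof -
      have "(\<integral>\<^sup>+x. ennreal ((norm (fn (X (k + j)) x - fn (X k) x))\<^sup>2) \<partial>lebesgue) \<le> ennreal ((2 * (1/4) ^ k)\<^sup>2)" for j
      proof -
        have s: "square_int (\<lambda>x. fn (X (k + j)) x - fn (X k) x)" by (simp add: square_int_diff)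
        have "(\<integral>\<^sup>+x. ennreal ((norm (fn (X (k + j)) x - fn (X k) x))\<^sup>2) \<partial>lebesgue) = ennreal ((norm (X (k + j) - X k))\<^sup>2)"
          using nn_integral_norm_el[OF s] by (simp add: el_diff[OF square_int_fn square_int_fn])
        then show ?thesis using power_mono[OF tail[of k j] norm_ge_zero, of 2] by (simp add: ennreal_leI)
      qed
      then show ?thesis by (intro Liminf_le) auto
    qed
    finally show ?thesis .
  qed
  have s0: "square_int (\<lambda>x. f x - fn (X k) x)" for k
    using fatou[of k] unfolding square_int_def
    by (intro conjI integrableI_bounded) (auto simp: less_top[symmetric] top_unique)
  have sf: "square_int f" using square_int_add[OF s0[of 0] square_int_fn[of "X 0"]] by simp
  have le: "norm (X k - el f) \<le> 2 * (1/4) ^ k" for k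
  proof (rule power2_le_imp_le)
    have "ennreal ((norm (el f - X k))\<^sup>2) = (\<integral>\<^sup>+x. ennreal ((norm (f x - fn (X k) x))\<^sup>2) \<partial>lebesgue)"
      using nn_integral_norm_el[OF s0[of k]] by (simp add: el_diff[OF sf square_int_fn])
    then have "ennreal ((norm (X k - el f))\<^sup>2) \<le> ennreal ((2 * (1/4) ^ k)\<^sup>2)"
      using fatou[of k] by (simp add: norm_minus_commute)
    then show "(norm (X k - el f))\<^sup>2 \<le> (2 * (1/4) ^ k)\<^sup>2" by simp
  qed simp
  have "X \<longlonglongrightarrow> el f"
  proof (rule LIM_zero_cancel, rule Lim_null_comparison)
    show "eventually (\<lambda>k. norm (X k - el f) \<le> 2 * (1/4) ^ k) sequentially" using le by simp
    show "(\<lambda>k. 2 * (1/4::real) ^ k) \<longlonglongrightarrow> 0" by (intro tendsto_mult_right_zero LIMSEQ_power_zero) simp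
  qed
  moreover have "AE x in lebesgue. (\<lambda>k. fn (X k) x) \<longlonglongrightarrow> fn (el f) x"
    using lim fn_el[OF sf] by (auto elim: AE_mp)
  ultimately show ?thesis by blast
qed

lemma Cauchy_fast_subseq:
  fixes X :: "nat \<Rightarrow> 'a::real_normed_vector"
  assumes "Cauchy X"
  obtains r where "strict_mono (r::nat \<Rightarrow> nat)" "\<And>k. norm (X (r (Suc k)) - X (r k)) \<le> (1/4) ^ k"
proof -
  have "\<exists>N. \<forall>m\<ge>N. \<forall>n\<ge>N. norm (X m - X n) < (1/4)^k" for k :: nat
    using CauchyD[OF assms, of "(1/4)^k"] by simp
  then obtain N where N: "\<And>k m n. m \<ge> N k \<Longrightarrow> n \<ge> N k \<Longrightarrow> norm (X m - X n) < (1/4)^k" by metis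
  obtain r where r: "strict_mono (r::nat \<Rightarrow> nat)" "\<And>k. N k \<le> r k"
  proof
    \<comment> \<open>The summand k makes the indices strictly increasing, and the sum makes them
      large enough even when \<open>N\<close> is not monotone.\<close>
    let ?r = "\<lambda>k. k + (\<Sum>i\<le>k. N i)"
    show "strict_mono ?r" by (rule strict_monoI_Suc) simp
    show "N k \<le> ?r k" for k
      using member_le_sum[of k "{..k}" N] by simp
  qed
  have "norm (X (r (Suc k)) - X (r k)) \<le> (1/4)^k" for k
    using N[of k "r (Suc k)" "r k"] r strict_mono_less_eq[OF r(1), of k "Suc k"] order_trans less_imp_le
    by (metis le_SucI order_refl)
  then show ?thesis using that r by blast
qed

instance l2 :: (euclidean_space, euclidean_space) complete_space
proof
  fix X :: "nat \<Rightarrow> ('a, 'b) l2" assume X: "Cauchy X"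
  obtain r where r: "strict_mono (r::nat \<Rightarrow> nat)" "\<And>k. norm (X (r (Suc k)) - X (r k)) \<le> (1/4) ^ k"
    using Cauchy_fast_subseq[OF X] by blast
  obtain l where "(X \<circ> r) \<longlonglongrightarrow> l" using l2_fast_Cauchy[of "X \<circ> r"] r by (auto simp: o_def)
  then show "convergent X"
    using Cauchy_converges_subseq[OF X r(1), of l] by (auto simp: convergent_def)
qed

lemma l2_AE_subseq:
  assumes "X \<longlonglongrightarrow> l"
  obtains r where "strict_mono (r::nat \<Rightarrow> nat)" "AE x in lebesgue. (\<lambda>k. fn (X (r k)) x) \<longlonglongrightarrow> fn l x"
proof -
  obtain r where r: "strict_mono (r::nat \<Rightarrow> nat)" "\<And>k. norm (X (r (Suc k)) - X (r k)) \<le> (1/4) ^ k"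
    using Cauchy_fast_subseq[OF LIMSEQ_imp_Cauchy[OF assms]] by blast
  obtain l' where l': "(X \<circ> r) \<longlonglongrightarrow> l'" "AE x in lebesgue. (\<lambda>k. fn (X (r k)) x) \<longlonglongrightarrow> fn l' x"
    using l2_fast_Cauchy[of "X \<circ> r"] r by (auto simp: o_def)
  have "l' = l" using LIMSEQ_subseq_LIMSEQ[OF assms r(1)] l'(1) LIMSEQ_unique by blast
  then show ?thesis using that r l' by blast
qed

text \<open>Dominated convergence for the squared differences, which are at most 4 |g|^2.
  Measurability of the limit is concluded rather than assumed: it agrees a.e. with
  \<open>lim\<close>, and the measure is complete.\<close>

lemma el_dominated:
  fixes f :: "nat \<Rightarrow> 'a::euclidean_space \<Rightarrow> 'b::euclidean_space"
  assumes f: "\<And>n. f n \<in> borel_measurable lebesgue" and g: "square_int g"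
    and b: "\<And>n. AE x in lebesgue. norm (f n x) \<le> norm (g x)"
    and lim: "AE x in lebesgue. (\<lambda>n. f n x) \<longlonglongrightarrow> h x"
  shows "(\<lambda>n. el (f n)) \<longlonglongrightarrow> el h" "square_int h" "\<And>n. square_int (f n)"
proof -
  have hm[measurable]: "h \<in> borel_measurable lebesgue"
  proof -
    have "AE x in lebesgue. lim (\<lambda>n. f n x) = h x" using lim by (auto elim!: AE_mp simp: limI)
    moreover have "(\<lambda>x. lim (\<lambda>n. f n x)) \<in> borel_measurable lebesgue"
      by (rule borel_measurable_lim_metric) (rule f)
    ultimately show ?thesis using borel_measurable_AE[of "\<lambda>x. lim (\<lambda>n. f n x)" h] by blast
  qed
  have ab: "AE x in lebesgue. \<forall>n. norm (f n x) \<le> norm (g x)" using b by (simp add: AE_all_countable)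
  have hb: "AE x in lebesgue. norm (h x) \<le> norm (g x)"
    using ab lim
  proof (elim AE_mp, intro AE_I2 impI)
    fix x assume "(\<lambda>n. f n x) \<longlonglongrightarrow> h x" "\<forall>n. norm (f n x) \<le> norm (g x)"
    then show "norm (h x) \<le> norm (g x)" by (intro LIMSEQ_le_const2[OF tendsto_norm]) auto
  qed
  show sf: "square_int (f n)" for n
    by (rule square_int_bound[OF f, where g = "\<lambda>x. (norm (g x))\<^sup>2"])
       (use g b[of n] in \<open>auto simp: square_int_def power_mono elim: AE_mp\<close>)
  show sh: "square_int h"
    by (rule square_int_bound[OF hm, where g = "\<lambda>x. (norm (g x))\<^sup>2"])
       (use g hb in \<open>auto simp: square_int_def power_mono elim: AE_mp\<close>)
  have "(\<lambda>n. LINT x|lebesgue. (norm (f n x - h x))\<^sup>2) \<longlonglongrightarrow> (LINT x|(lebesgue::'a measure). 0)"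
  proof (rule integral_dominated_convergence[where w = "\<lambda>x. 4 * (norm (g x))\<^sup>2"])
    show "AE x in lebesgue. (\<lambda>n. (norm (f n x - h x))\<^sup>2) \<longlonglongrightarrow> 0"
      using lim
    proof (elim AE_mp, intro AE_I2 impI)
      fix x assume "(\<lambda>n. f n x) \<longlonglongrightarrow> h x"
      then have "(\<lambda>n. (norm (f n x - h x))\<^sup>2) \<longlonglongrightarrow> (norm (h x - h x))\<^sup>2" by (intro tendsto_intros)
      then show "(\<lambda>n. (norm (f n x - h x))\<^sup>2) \<longlonglongrightarrow> 0" by simp
    qed
    show "AE x in lebesgue. norm ((norm (f n x - h x))\<^sup>2) \<le> 4 * (norm (g x))\<^sup>2" for n
      using b[of n] hb
    proof (elim AE_mp, intro AE_I2 impI)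
      fix x assume "norm (h x) \<le> norm (g x)" "norm (f n x) \<le> norm (g x)"
      then have "norm (f n x - h x) \<le> 2 * norm (g x)" using norm_triangle_ineq4[of "f n x" "h x"] by linarith
      then have "(norm (f n x - h x))\<^sup>2 \<le> (2 * norm (g x))\<^sup>2" by (rule power_mono) simp
      then show "norm ((norm (f n x - h x))\<^sup>2) \<le> 4 * (norm (g x))\<^sup>2" by (simp add: power_mult_distrib)
    qed
  qed (use g f in \<open>auto simp: square_int_def\<close>)
  moreover have "(LINT x|lebesgue. (norm (f n x - h x))\<^sup>2) = (norm (el (f n) - el h))\<^sup>2" for n
    unfolding el_diff[OF sf[of n] sh, symmetric] by (rule norm_el[OF square_int_diff[OF sf[of n] sh], symmetric])
  ultimately have "(\<lambda>n. (norm (el (f n) - el h))\<^sup>2) \<longlonglongrightarrow> 0" by (simp only: Bochner_Integration.integral_zero)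
  then have "(\<lambda>n. sqrt ((norm (el (f n) - el h))\<^sup>2)) \<longlonglongrightarrow> sqrt 0" by (rule tendsto_real_sqrt)
  then have "(\<lambda>n. norm (el (f n) - el h)) \<longlonglongrightarrow> 0" by simp
  then show "(\<lambda>n. el (f n)) \<longlonglongrightarrow> el h" unfolding tendsto_norm_zero_iff by (rule LIM_zero_cancel)
qed

section \<open>Smooth functions and test functions\<close>

abbreviation dir_deriv :: "'a \<Rightarrow> ('a::euclidean_space \<Rightarrow> 'b::real_normed_vector) \<Rightarrow> 'a \<Rightarrow> 'b" where
  "dir_deriv b f \<equiv> \<lambda>x. frechet_derivative f (at x) b"

lemma frechet_derivative_eq: "(f has_derivative f') (at x) \<Longrightarrow> frechet_derivative f (at x) = f'"
  using frechet_derivative_at by metis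

lemma Ck_SucI:
  assumes "\<And>x. (f has_derivative f' x) (at x)" "\<And>b. b \<in> Basis \<Longrightarrow> Ck k (\<lambda>x. f' x b)"
  shows "Ck (Suc k) f"
proof -
  have "frechet_derivative f (at x) = f' x" for x using assms(1) by (rule frechet_derivative_eq)
  moreover have "f differentiable_on UNIV"
    using assms(1) by (auto simp: differentiable_on_def differentiable_def)
  ultimately show ?thesis using assms(2) by simp
qed

lemma Ck_SucD:
  assumes "Ck (Suc k) f"
  shows "(f has_derivative frechet_derivative f (at x)) (at x)" "b \<in> Basis \<Longrightarrow> Ck k (dir_deriv b f)"
  using assms by (auto simp: differentiable_on_def frechet_derivative_works)

lemma Ck_Suc: "Ck (Suc k) f \<Longrightarrow> Ck k f"
proof (induction k arbitrary: f)
  case 0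
  then show ?case by (auto intro: differentiable_imp_continuous_on)
next
  case (Suc k)
  then have "f differentiable_on UNIV" "\<And>b. b \<in> Basis \<Longrightarrow> Ck k (dir_deriv b f)" by auto
  then show ?case by simp
qed

lemma Ck_const: "Ck k (\<lambda>x. c)"
proof (induction k arbitrary: c)
  case (Suc k)
  show ?case by (rule Ck_SucI[OF has_derivative_const]) (rule Suc)
qed simp

lemma Ck_add: "Ck k f \<Longrightarrow> Ck k g \<Longrightarrow> Ck k (\<lambda>x. f x + g x)"
proof (induction k arbitrary: f g)
  case 0 then show ?case by (auto intro: continuous_on_add)
next
  case (Suc k)
  show ?case
    by (rule Ck_SucI[OF has_derivative_add[OF Ck_SucD(1)[OF Suc.prems(1)] Ck_SucD(1)[OF Suc.prems(2)]]])
       (intro Suc.IH Ck_SucD(2)[OF Suc.prems(1)] Ck_SucD(2)[OF Suc.prems(2)])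
qed

lemma Ck_linear: "bounded_linear D \<Longrightarrow> Ck k f \<Longrightarrow> Ck k (\<lambda>x. D (f x))"
proof (induction k arbitrary: f)
  case 0 then show ?case using bounded_linear.continuous_on by auto
next
  case (Suc k)
  show ?case
    by (rule Ck_SucI[OF bounded_linear.has_derivative[OF Suc.prems(1) Ck_SucD(1)[OF Suc.prems(2)]]])
       (intro Suc.IH Suc.prems(1) Ck_SucD(2)[OF Suc.prems(2)])
qed

lemma Ck_scaleR: "Ck k f \<Longrightarrow> Ck k g \<Longrightarrow> Ck k (\<lambda>x. f x *\<^sub>R g x)"
proof (induction k arbitrary: f g)
  case 0 then show ?case by (auto intro: continuous_on_scaleR)
next
  case (Suc k)
  show ?case
  proof (rule Ck_SucI[OF has_derivative_scaleR[OF Ck_SucD(1)[OF Suc.prems(1)] Ck_SucD(1)[OF Suc.prems(2)]]])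
    fix b :: 'a assume b: "b \<in> Basis"
    show "Ck k (\<lambda>x. f x *\<^sub>R frechet_derivative g (at x) b + frechet_derivative f (at x) b *\<^sub>R g x)"
      by (intro Ck_add Suc.IH Ck_SucD(2)[OF Suc.prems(1)] Ck_SucD(2)[OF Suc.prems(2)] b Ck_Suc[OF Suc.prems(1)] Ck_Suc[OF Suc.prems(2)])
  qed
qed

text \<open>The form in which the change of variables for Lebesgue measure is available; it covers
  translations (all factors 1) as well as the stretchings about a point.\<close>

definition diag_affine :: "('a \<Rightarrow> real) \<Rightarrow> 'a \<Rightarrow> 'a \<Rightarrow> 'a::euclidean_space" where
  "diag_affine c t x = t + (\<Sum>j\<in>Basis. (c j * (x \<bullet> j)) *\<^sub>R j)"

lemma diag_affine_inner: "j \<in> Basis \<Longrightarrow> diag_affine c t x \<bullet> j = t \<bullet> j + c j * (x \<bullet> j)"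
  by (simp add: diag_affine_def inner_add_left inner_sum_left inner_Basis if_distrib cong: if_cong)

lemma has_derivative_diag_affine:
  "(diag_affine c t has_derivative (\<lambda>h. \<Sum>j\<in>Basis. (c j * (h \<bullet> j)) *\<^sub>R j)) (at x)"
  unfolding diag_affine_def[abs_def] by (auto intro!: derivative_eq_intros)

lemma sum_Basis_pick: "b \<in> Basis \<Longrightarrow> (\<Sum>j\<in>Basis. (c j * (b \<bullet> j)) *\<^sub>R j) = c b *\<^sub>R (b::'a::euclidean_space)"
proof -
  assume b: "b \<in> Basis"
  have "(\<Sum>j\<in>Basis. (c j * (b \<bullet> j)) *\<^sub>R j) = (\<Sum>j\<in>Basis. if j = b then c b *\<^sub>R b else 0)"
    by (rule sum.cong) (use b in \<open>auto simp: inner_Basis\<close>)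
  then show ?thesis using b by simp
qed

lemma has_derivative_compose_diag_affine:
  assumes "\<And>y. (f has_derivative f' y) (at y)"
  shows "((\<lambda>x. f (diag_affine c t x)) has_derivative (\<lambda>h. f' (diag_affine c t x) (\<Sum>j\<in>Basis. (c j * (h \<bullet> j)) *\<^sub>R j))) (at x)"
  using has_derivative_compose[OF has_derivative_diag_affine assms] .

lemma Ck_diag_affine: "Ck k f \<Longrightarrow> Ck k (\<lambda>x. f (diag_affine c t x))"
proof (induction k arbitrary: f)
  case 0
  have "continuous_on UNIV (diag_affine c t)"
    using has_derivative_continuous[OF has_derivative_diag_affine] continuous_at_imp_continuous_on by blast
  then show ?case using 0 continuous_on_compose2[of UNIV f UNIV "diag_affine c t"] by simp
next
  case (Suc k)
  show ?case
  proof (rule Ck_SucI[OF has_derivative_compose_diag_affine[OF Ck_SucD(1)[OF Suc.prems]]])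
    fix b :: 'a assume b: "b \<in> Basis"
    have "frechet_derivative f (at y) (c b *\<^sub>R b) = c b *\<^sub>R frechet_derivative f (at y) b" for y
      using Ck_SucD(1)[OF Suc.prems] by (intro linear_scale has_derivative_linear)
    then show "Ck k (\<lambda>x. frechet_derivative f (at (diag_affine c t x)) (\<Sum>j\<in>Basis. (c j * (b \<bullet> j)) *\<^sub>R j))"
      unfolding sum_Basis_pick[OF b] by (simp add: Ck_scaleR Ck_const Suc.IH[OF Ck_SucD(2)[OF Suc.prems b]])
  qed
qed

text \<open>Builds smooth functions of several variables from one of a single variable, as needed
  for bumps adapted to the faces of a box.\<close>

lemma Ck_real_affine:
  fixes h :: "real \<Rightarrow> real" and u :: "'a::euclidean_space"
  shows "Ck k h \<Longrightarrow> Ck k (\<lambda>x. h (x \<bullet> u + d))"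
proof (induction k arbitrary: h)
  case 0
  have "continuous_on UNIV (\<lambda>x. x \<bullet> u + d)" by (intro continuous_intros)
  then show ?case using continuous_on_compose2[of UNIV h UNIV "\<lambda>x. x \<bullet> u + d"] 0 by auto
next
  case (Suc k)
  have "((\<lambda>x. h (x \<bullet> u + d)) has_derivative (\<lambda>y. frechet_derivative h (at (x \<bullet> u + d)) (y \<bullet> u))) (at x)" for x
    by (rule has_derivative_compose[OF _ Ck_SucD(1)[OF Suc.prems], of "\<lambda>x. x \<bullet> u + d" "\<lambda>y. y \<bullet> u"])
       (auto intro!: derivative_eq_intros)
  then show ?case
  proof (rule Ck_SucI)
    fix b :: 'a
    have "frechet_derivative h (at y) (b \<bullet> u) = (b \<bullet> u) *\<^sub>R frechet_derivative h (at y) 1" for y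
      using linear_scale[OF has_derivative_linear[OF Ck_SucD(1)[OF Suc.prems]], of y "b \<bullet> u" 1] by simp
    then show "Ck k (\<lambda>x. frechet_derivative h (at (x \<bullet> u + d)) (b \<bullet> u))"
      using Ck_scaleR[OF Ck_const Suc.IH[OF Ck_SucD(2)[OF Suc.prems]], of 1] by simp
  qed
qed

subsection \<open>A smooth function supported on the positive half line\<close>

text \<open>The functions exp(-1/x) times a polynomial in 1/x, extended by 0, are closed under
  differentiation. Smoothness of all of them follows by induction on the order with the polynomial
  left free.\<close>

definition flat :: "real poly \<Rightarrow> real \<Rightarrow> real" where
  "flat p x = (if x > 0 then poly p (1 / x) * exp (- (1 / x)) else 0)"

text \<open>The polynomial \<open>pCons a p\<close> is a + y p(y), so the induction hands one factor
  y over to the power in front; for this the exponent \<open>k\<close> is carried along.\<close>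

lemma poly_exp_tendsto: "((\<lambda>y::real. y ^ k * (poly p y * exp (- y))) \<longlongrightarrow> 0) at_top"
proof (induction p arbitrary: k)
  case (pCons a p)
  have "((\<lambda>y. a * (y ^ k / exp y) + y ^ Suc k * (poly p y * exp (- y))) \<longlongrightarrow> a * 0 + 0) at_top"
    by (intro tendsto_intros tendsto_power_div_exp_0 pCons.IH)
  moreover have "a * (y ^ k / exp y) + y ^ Suc k * (poly p y * exp (- y)) 
      = y ^ k * (poly (pCons a p) y * exp (- y))" for y
    by (simp add: exp_minus field_simps)
  ultimately show ?case by simp
qed simp

text \<open>With y = 1/x the chain rule produces the polynomial y^2 (p(y) - p'(y)).\<close>

lemma flat_deriv: "(flat p has_field_derivative flat (monom 1 2 * (p - pderiv p)) x) (at x)"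
proof -
  consider "x > 0" | "x < 0" | "x = 0" by linarith
  then show ?thesis
  proof cases
    case 1
    have "((\<lambda>x. poly p (1 / x) * exp (- (1 / x))) has_field_derivative flat (monom 1 2 * (p - pderiv p)) x) (at x)"
      using 1 by (auto intro!: derivative_eq_intros simp: flat_def poly_monom field_simps power2_eq_square)
    then show ?thesis
      by (rule has_field_derivative_transform_within_open[where S = "{0<..}"]) (use 1 in \<open>auto simp: flat_def\<close>)
  next
    case 2
    have "((\<lambda>x. 0) has_field_derivative flat (monom 1 2 * (p - pderiv p)) x) (at x)"
      using 2 by (simp add: flat_def)
    then show ?thesis
      by (rule has_field_derivative_transform_within_open[where S = "{..<0}"]) (use 2 in \<open>auto simp: flat_def\<close>)
  next
    case 3
    \<comment> \<open>At 0 the right difference quotient is y p(y) exp(-y) with y = 1/h, and the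
      exponential wins.\<close>
    have "((\<lambda>h. h * (poly p h * exp (- h))) \<longlongrightarrow> 0) at_top"
      using poly_exp_tendsto[of 1 p] by simp
    then have "((\<lambda>h. 1 / h * (poly p (1 / h) * exp (- (1 / h)))) \<longlongrightarrow> 0) (at_right 0)"
      by (rule filterlim_compose) (simp add: divide_inverse filterlim_inverse_at_top_right)
    then have r: "((\<lambda>h. (flat p (0 + h) - flat p 0) / h) \<longlongrightarrow> 0) (at_right 0)"
      by (rule Lim_transform_eventually)
         (auto simp: flat_def eventually_at_right_field intro!: exI[of _ 1])
    have "((\<lambda>h. 0) \<longlongrightarrow> (0::real)) (at_left (0::real))" by simp
    then have l: "((\<lambda>h. (flat p (0 + h) - flat p 0) / h) \<longlongrightarrow> 0) (at_left 0)"
      by (rule Lim_transform_eventually)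
         (auto simp: flat_def eventually_at_left_field intro!: exI[of _ "-1"])
    have "((\<lambda>h. (flat p (0 + h) - flat p 0) / h) \<longlongrightarrow> 0) (at 0)"
      using l r by (simp add: filterlim_split_at)
    then show ?thesis using 3 by (simp add: DERIV_def flat_def)
  qed
qed

lemma Ck_flat: "Ck k (flat p)"
proof (induction k arbitrary: p)
  case 0
  show ?case using DERIV_continuous[OF flat_deriv] continuous_at_imp_continuous_on by (metis Ck.simps(1))
next
  case (Suc k)
  show ?case
    by (rule Ck_SucI[OF flat_deriv[unfolded has_field_derivative_def]]) (simp add: Suc)
qed

subsection \<open>Test functions\<close>

text \<open>Any compact set outside of which the function vanishes will do; this spares computing
  closures of supports.\<close>

lemma test_functionsI:
  assumes "\<And>k. Ck k f" "compact K" "K \<subseteq> \<Omega>" "\<And>x. x \<notin> K \<Longrightarrow> f x = 0"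
  shows "f \<in> test_functions \<Omega>"
proof -
  have "closure {x. f x \<noteq> 0} \<subseteq> K"
    using assms by (intro closure_minimal compact_imp_closed) auto
  moreover have "bounded {x. f x \<noteq> 0}"
    by (rule bounded_subset[OF compact_imp_bounded[OF assms(2)]]) (use assms in auto)
  ultimately show ?thesis using assms(1,3) by (auto simp: test_functions_def)
qed

lemma test_functionsE:
  assumes "f \<in> test_functions \<Omega>"
  obtains K where "compact K" "K \<subseteq> \<Omega>" "\<And>x. x \<notin> K \<Longrightarrow> f x = 0" "\<And>k. Ck k f"
proof
  show "compact (closure {x. f x \<noteq> 0})" "closure {x. f x \<noteq> 0} \<subseteq> \<Omega>" "\<And>k. Ck k f"
    using assms unfolding test_functions_def by blast+
  show "f x = 0" if "x \<notin> closure {x. f x \<noteq> 0}" for x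
    using that closure_subset[of "{x. f x \<noteq> 0}"] by auto
qed

lemma test_functions_mono: "\<Omega> \<subseteq> \<Omega>' \<Longrightarrow> test_functions \<Omega> \<subseteq> test_functions \<Omega>'"
  by (auto simp: test_functions_def)

lemma test_functions_zero: "(\<lambda>x. 0) \<in> test_functions \<Omega>"
  by (rule test_functionsI[where K = "{}"]) (auto simp: Ck_const)

lemma test_functions_add:
  assumes "f \<in> test_functions \<Omega>" "g \<in> test_functions \<Omega>"
  shows "(\<lambda>x. f x + g x) \<in> test_functions \<Omega>"
proof -
  obtain K where K: "compact K" "K \<subseteq> \<Omega>" "\<And>x. x \<notin> K \<Longrightarrow> f x = 0" "\<And>k. Ck k f" using test_functionsE[OF assms(1)] by blast
  obtain K' where K': "compact K'" "K' \<subseteq> \<Omega>" "\<And>x. x \<notin> K' \<Longrightarrow> g x = 0" "\<And>k. Ck k g" using test_functionsE[OF assms(2)] by blast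
  show ?thesis by (rule test_functionsI[where K = "K \<union> K'"]) (use K K' in \<open>auto intro: Ck_add\<close>)
qed

lemma test_functions_linear:
  assumes "bounded_linear D" "f \<in> test_functions \<Omega>"
  shows "(\<lambda>x. D (f x)) \<in> test_functions \<Omega>"
proof -
  obtain K where K: "compact K" "K \<subseteq> \<Omega>" "\<And>x. x \<notin> K \<Longrightarrow> f x = 0" "\<And>k. Ck k f" using test_functionsE[OF assms(2)] by blast
  show ?thesis
    by (rule test_functionsI[where K = K]) (use K linear_0[OF bounded_linear.linear[OF assms(1)]] in \<open>auto intro: Ck_linear assms\<close>)
qed

lemma test_functions_scaleR: "f \<in> test_functions \<Omega> \<Longrightarrow> (\<lambda>x. c *\<^sub>R f x) \<in> test_functions \<Omega>"
  by (rule test_functions_linear[OF bounded_linear_scaleR_right])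

lemma test_functions_mult:
  assumes "f \<in> test_functions \<Omega>" "g \<in> test_functions \<Omega>'"
  shows "(\<lambda>x. f x *\<^sub>R g x) \<in> test_functions \<Omega>"
proof -
  obtain K where K: "compact K" "K \<subseteq> \<Omega>" "\<And>x. x \<notin> K \<Longrightarrow> f x = 0" "\<And>k. Ck k f" using test_functionsE[OF assms(1)] by blast
  obtain K' where K': "compact K'" "K' \<subseteq> \<Omega>'" "\<And>x. x \<notin> K' \<Longrightarrow> g x = 0" "\<And>k. Ck k g" using test_functionsE[OF assms(2)] by blast
  show ?thesis by (rule test_functionsI[where K = K]) (use K K' in \<open>auto intro: Ck_scaleR\<close>)
qed

lemma test_functions_Ck: "f \<in> test_functions \<Omega> \<Longrightarrow> Ck k f"
  by (simp add: test_functions_def)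

lemma test_functions_has_derivative:
  "f \<in> test_functions \<Omega> \<Longrightarrow> (f has_derivative frechet_derivative f (at x)) (at x)"
  using test_functions_Ck[of f \<Omega> 1] by (intro Ck_SucD[of 0]) simp

lemma test_functions_outside: "f \<in> test_functions \<Omega> \<Longrightarrow> x \<notin> \<Omega> \<Longrightarrow> f x = 0"
  using closure_subset[of "{x. f x \<noteq> 0}"] by (auto simp: test_functions_def)

lemma test_functions_dir_deriv:
  assumes f: "f \<in> test_functions \<Omega>" and b: "b \<in> Basis"
  shows "dir_deriv b f \<in> test_functions \<Omega>"
proof -
  obtain K where K: "compact K" "K \<subseteq> \<Omega>" "\<And>x. x \<notin> K \<Longrightarrow> f x = 0" "\<And>k. Ck k f" using test_functionsE[OF f] by blast
  show ?thesis
  proof (rule test_functionsI[where K = K])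
    show "Ck k (dir_deriv b f)" for k using Ck_SucD(2)[OF K(4)] b by blast
    fix x assume "x \<notin> K"
    then have "((\<lambda>x. 0) has_derivative frechet_derivative f (at x)) (at x)"
      by (intro has_derivative_transform_within_open[OF test_functions_has_derivative[OF f], where s = "- K"])
         (use K in \<open>auto intro: open_Compl compact_imp_closed\<close>)
    then have "frechet_derivative f (at x) = (\<lambda>h. 0)"
      using has_derivative_unique[OF _ has_derivative_const] by blast
    then show "frechet_derivative f (at x) b = 0" by simp
  qed (use K in auto)
qed

lemma frechet_derivative_Basis:
  assumes "f \<in> test_functions \<Omega>"
  shows "frechet_derivative f (at x) z = (\<Sum>b\<in>Basis. (z \<bullet> b) *\<^sub>R frechet_derivative f (at x) b)"
proof -
  have l: "linear (frechet_derivative f (at x))"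
    by (rule has_derivative_linear[OF test_functions_has_derivative[OF assms]])
  have "frechet_derivative f (at x) z = frechet_derivative f (at x) (\<Sum>b\<in>Basis. (z \<bullet> b) *\<^sub>R b)"
    by (simp add: euclidean_representation)
  then show ?thesis by (simp add: linear_sum[OF l] linear_scale[OF l])
qed

lemma test_functions_continuous: "f \<in> test_functions \<Omega> \<Longrightarrow> continuous_on S f"
  using test_functions_Ck[of f \<Omega> 0] by (auto intro: continuous_on_subset)

lemma test_functions_borel[measurable_dest]: "f \<in> test_functions \<Omega> \<Longrightarrow> f \<in> borel_measurable borel"
  using test_functions_continuous[of f \<Omega> UNIV] by (simp add: borel_measurable_continuous_onI)

lemma test_functions_measurable: "f \<in> test_functions \<Omega> \<Longrightarrow> f \<in> borel_measurable lebesgue"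
  by (simp add: test_functions_borel measurable_completion)

lemma test_functions_dominated:
  assumes "f \<in> test_functions \<Omega>"
  obtains B K where "compact K" "K \<subseteq> \<Omega>" "B \<ge> 0" "\<And>x. norm (f x) \<le> B * indicator K x"
proof -
  obtain K where K: "compact K" "K \<subseteq> \<Omega>" "\<And>x. x \<notin> K \<Longrightarrow> f x = 0" using test_functionsE[OF assms] by metis
  have "bounded (f ` K)" using compact_continuous_image[OF test_functions_continuous[OF assms] K(1)] compact_imp_bounded by blast
  then obtain B where B: "\<And>x. x \<in> K \<Longrightarrow> norm (f x) \<le> B" by (auto simp: bounded_iff)
  show ?thesis
  proof (rule that[of K "\<bar>B\<bar>"])
    show "norm (f x) \<le> \<bar>B\<bar> * indicator K x" for x
      using B[of x] K(3)[of x] by (cases "x \<in> K") auto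
  qed (use K in auto)
qed

lemma square_int_indicator:
  assumes "bounded K" "K \<in> sets lebesgue" shows "square_int (\<lambda>x. indicator K x *\<^sub>R c)"
proof -
  have "integrable lebesgue (\<lambda>x. indicator K x *\<^sub>R (norm c)\<^sup>2)"
    using assms bounded_set_imp_lmeasurable[OF assms] by (intro integrable_scaleR_left) (auto simp: fmeasurable_def)
  then show ?thesis
    by (rule square_int_bound[rotated]) (use assms(2) in \<open>auto simp: indicator_def intro!: borel_measurable_scaleR borel_measurable_indicator\<close>)
qed

lemma test_functions_square_int:
  assumes "f \<in> test_functions \<Omega>" shows "square_int f"
proof -
  obtain B K where K: "compact K" "\<And>x. norm (f x) \<le> B * indicator K x" "B \<ge> 0" using test_functions_dominated[OF assms] by metis
  have "integrable lebesgue (\<lambda>x. (norm (indicator K x *\<^sub>R B))\<^sup>2)"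
    using square_int_indicator[of K B] K(1) compact_imp_bounded[OF K(1)]
    by (simp add: square_int_def lmeasurable_compact fmeasurableD)
  then show ?thesis
  proof (rule square_int_bound[OF test_functions_measurable[OF assms]])
    show "AE x in lebesgue. (norm (f x))\<^sup>2 \<le> (norm (indicator K x *\<^sub>R B))\<^sup>2"
      using power_mono[OF K(2) norm_ge_zero, of _ 2] K(3) by (simp add: mult.commute abs_mult)
  qed
qed

text \<open>The partial derivatives are again test functions, hence bounded, and the mean value
  inequality holds on the whole space.\<close>

lemma test_functions_Lipschitz:
  fixes f :: "'a::euclidean_space \<Rightarrow> 'b::real_normed_vector"
  assumes "f \<in> test_functions \<Omega>"
  obtains B where "B \<ge> 0" "\<And>x y. norm (f x - f y) \<le> B * norm (x - y)"
proof -
  have "\<exists>B. B \<ge> 0 \<and> (\<forall>x. norm (frechet_derivative f (at x) b) \<le> B)" if b: "b \<in> Basis" for b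
  proof -
    obtain B K where "B \<ge> 0" "\<And>x. norm (frechet_derivative f (at x) b) \<le> B * indicator K x" 
      using test_functions_dominated[OF test_functions_dir_deriv[OF assms b]] by metis
    then have "\<And>x. norm (frechet_derivative f (at x) b) \<le> B"
      by (metis (no_types, opaque_lifting) indicator_le_1 mult.right_neutral mult_left_mono order_trans)
    then show ?thesis using \<open>B \<ge> 0\<close> by blast
  qed
  then obtain B where B: "\<And>b x. b \<in> Basis \<Longrightarrow> B b \<ge> 0 \<and> norm (frechet_derivative f (at x) b) \<le> B b" by metis
  show ?thesis
  proof (rule that[of "sum B Basis"])
    show "sum B Basis \<ge> 0" using B by (simp add: sum_nonneg)
    fix x y :: 'a
    have "onorm (frechet_derivative f (at z)) \<le> sum B Basis" for z
      by (rule order_trans[OF onorm_componentwise[OF has_derivative_bounded_linear[OF test_functions_has_derivative[OF assms]]]])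
         (use B in \<open>auto intro: sum_mono\<close>)
    then show "norm (f x - f y) \<le> sum B Basis * norm (x - y)"
      by (intro differentiable_bound[of UNIV f "\<lambda>x. frechet_derivative f (at x)"])
         (auto intro: test_functions_has_derivative[OF assms])
  qed
qed

section \<open>Difference quotients and integration by parts\<close>

lemma integrable_scaleR_pos_iff:
  fixes f :: "'a \<Rightarrow> 'b::euclidean_space"
  assumes "(p::real) > 0" shows "integrable M (\<lambda>x. p *\<^sub>R f x) \<longleftrightarrow> integrable M f"
  using integrable_scaleR_right[of p M f] integrable_scaleR_right[of "1/p" M "\<lambda>x. p *\<^sub>R f x"] assms by auto

lemma integral_lebesgue_diag_affine:
  fixes f :: "'a::euclidean_space \<Rightarrow> 'b::euclidean_space"
  assumes c: "\<And>j. j \<in> Basis \<Longrightarrow> c j \<noteq> 0" and f: "f \<in> borel_measurable lebesgue"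
  shows "(\<lambda>x. f (diag_affine c t x)) \<in> borel_measurable lebesgue"
    and "integrable lebesgue (\<lambda>x. f (diag_affine c t x)) \<longleftrightarrow> integrable lebesgue f"
    and "(LINT x|lebesgue. f x) = (\<Prod>j\<in>Basis. \<bar>c j\<bar>) *\<^sub>R (LINT x|lebesgue. f (diag_affine c t x))"
proof -
  let ?p = "\<Prod>j\<in>Basis. \<bar>c j\<bar>"
  have T: "diag_affine c t = (\<lambda>x. t + (\<Sum>j\<in>Basis. (c j * (x \<bullet> j)) *\<^sub>R j))"
    by (auto simp: diag_affine_def)
  have m: "diag_affine c t \<in> lebesgue \<rightarrow>\<^sub>M lebesgue"
    unfolding T by (rule lebesgue_affine_measurable[OF c])
  have eq: "lebesgue = density (distr lebesgue lebesgue (diag_affine c t)) (\<lambda>_. ennreal ?p)"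
    unfolding T using lebesgue_affine_euclidean[of c t, OF c] by (simp add: prod_ennreal)
  have p: "?p > 0" using c by (intro prod_pos) auto
  show fm: "(\<lambda>x. f (diag_affine c t x)) \<in> borel_measurable lebesgue"
    using measurable_compose[OF m f] .
  have "integrable lebesgue f \<longleftrightarrow> integrable (density (distr lebesgue lebesgue (diag_affine c t)) (\<lambda>_. ennreal ?p)) f"
    using eq by simp
  also have "\<dots> \<longleftrightarrow> integrable (distr lebesgue lebesgue (diag_affine c t)) (\<lambda>x. ?p *\<^sub>R f x)"
    using f p by (intro integrable_density) (auto intro: less_imp_le)
  also have "\<dots> \<longleftrightarrow> integrable lebesgue (\<lambda>x. ?p *\<^sub>R f (diag_affine c t x))"
    using f m by (intro integrable_distr_eq) auto
  also have "\<dots> \<longleftrightarrow> integrable lebesgue (\<lambda>x. f (diag_affine c t x))"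
    by (rule integrable_scaleR_pos_iff[OF p])
  finally show "integrable lebesgue (\<lambda>x. f (diag_affine c t x)) \<longleftrightarrow> integrable lebesgue f" by simp
  have "(LINT x|lebesgue. f x) = (LINT x|(density (distr lebesgue lebesgue (diag_affine c t)) (\<lambda>_. ennreal ?p)). f x)"
    using eq by simp
  also have "\<dots> = (LINT x|distr lebesgue lebesgue (diag_affine c t). ?p *\<^sub>R f x)"
    using f p by (intro integral_density) (auto intro: less_imp_le)
  also have "\<dots> = (LINT x|lebesgue. ?p *\<^sub>R f (diag_affine c t x))"
    using f m by (intro integral_distr) auto
  finally show "(LINT x|lebesgue. f x) = ?p *\<^sub>R (LINT x|lebesgue. f (diag_affine c t x))" by simp
qed

lemma square_int_diag_affine:
  fixes f :: "'a::euclidean_space \<Rightarrow> 'b::euclidean_space"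
  assumes c: "\<And>j. j \<in> Basis \<Longrightarrow> c j \<noteq> 0" and f: "square_int f"
  shows "square_int (\<lambda>x. f (diag_affine c t x))"
    and "(norm (el f))\<^sup>2 = (\<Prod>j\<in>Basis. \<bar>c j\<bar>) * (norm (el (\<lambda>x. f (diag_affine c t x))))\<^sup>2"
proof -
  have fm: "f \<in> borel_measurable lebesgue" "(\<lambda>x. (norm (f x))\<^sup>2) \<in> borel_measurable lebesgue"
    using f by auto
  show s: "square_int (\<lambda>x. f (diag_affine c t x))"
    using f integral_lebesgue_diag_affine(1)[OF c fm(1)] integral_lebesgue_diag_affine(2)[OF c fm(2)]
    by (auto simp: square_int_def)
  show "(norm (el f))\<^sup>2 = (\<Prod>j\<in>Basis. \<bar>c j\<bar>) * (norm (el (\<lambda>x. f (diag_affine c t x))))\<^sup>2"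
    using integral_lebesgue_diag_affine(3)[OF c fm(2)] norm_el[OF f] norm_el[OF s] by simp
qed

lemma diag_affine_translate: "diag_affine (\<lambda>_. 1) t x = x + t"
  by (simp add: diag_affine_def euclidean_representation)

lemma square_int_translate: "square_int f \<Longrightarrow> square_int (\<lambda>x. f (x + t))"
  using square_int_diag_affine(1)[of "\<lambda>_. 1" f t] by (simp add: diag_affine_translate)

lemma norm_el_translate: "square_int f \<Longrightarrow> norm (el (\<lambda>x. f (x + t))) = norm (el f)"
  using square_int_diag_affine(2)[of "\<lambda>_. 1" f t] by (simp add: diag_affine_translate)

lemma integral_lebesgue_translate:
  fixes f :: "'a::euclidean_space \<Rightarrow> 'b::euclidean_space"
  assumes "f \<in> borel_measurable lebesgue"
  shows "(LINT x|lebesgue. f (x + t)) = (LINT x|lebesgue. f x)"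
  using integral_lebesgue_diag_affine(3)[of "\<lambda>_. 1" f t] assms by (simp add: diag_affine_translate)

text \<open>Step sizes 1/(n+1) instead of a real parameter, since dominated convergence is used for
  sequences.\<close>

definition diffquot :: "nat \<Rightarrow> 'a \<Rightarrow> ('a::euclidean_space \<Rightarrow> 'b::euclidean_space) \<Rightarrow> 'a \<Rightarrow> 'b" where
  "diffquot n z f x = real (Suc n) *\<^sub>R (f (x + (1 / real (Suc n)) *\<^sub>R z) - f x)"

lemma diffquot_tendsto:
  assumes "f \<in> test_functions \<Omega>"
  shows "(\<lambda>n. diffquot n z f x) \<longlonglongrightarrow> frechet_derivative f (at x) z"
proof -
  have "((\<lambda>t. f (x + t *\<^sub>R z)) has_derivative (\<lambda>h. frechet_derivative f (at x) (h *\<^sub>R z))) (at 0)"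
  proof -
    have 1: "((\<lambda>t. x + t *\<^sub>R z) has_derivative (\<lambda>h. h *\<^sub>R z)) (at 0)" by (auto intro!: derivative_eq_intros)
    have 2: "(f has_derivative frechet_derivative f (at x)) (at (x + 0 *\<^sub>R z))"
      using test_functions_has_derivative[OF assms] by simp
    show ?thesis using has_derivative_compose[OF 1 2] .
  qed
  moreover have "frechet_derivative f (at x) (h *\<^sub>R z) = h *\<^sub>R frechet_derivative f (at x) z" for h
    by (rule linear_scale[OF has_derivative_linear[OF test_functions_has_derivative[OF assms]]])
  ultimately have d: "((\<lambda>t. f (x + t *\<^sub>R z)) has_derivative (\<lambda>h. h *\<^sub>R frechet_derivative f (at x) z)) (at 0)"
    by simp
  have "(\<lambda>n. 1 / real (Suc n)) \<longlonglongrightarrow> 0" by (intro LIMSEQ_Suc[OF lim_const_over_n])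
  then have fl: "filterlim (\<lambda>n. 1 / real (Suc n)) (at 0) sequentially"
    by (auto simp: filterlim_at)
  have "((\<lambda>t. norm (f (x + t *\<^sub>R z) - f x - t *\<^sub>R frechet_derivative f (at x) z) / norm t) \<longlongrightarrow> 0) (at 0)"
    using d by (simp add: has_derivative_at)
  from filterlim_compose[OF this fl]
  have "(\<lambda>n. norm (diffquot n z f x - frechet_derivative f (at x) z)) \<longlonglongrightarrow> 0"
  proof (rule Lim_transform_eventually, intro always_eventually allI)
    fix n
    let ?s = "1 / real (Suc n)" and ?a = "f (x + (1 / real (Suc n)) *\<^sub>R z) - f x" and ?d = "frechet_derivative f (at x) z"
    have "norm (?a - ?s *\<^sub>R ?d) / norm ?s = norm ((1 / ?s) *\<^sub>R (?a - ?s *\<^sub>R ?d))"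
      by simp
    also have "(1 / ?s) *\<^sub>R (?a - ?s *\<^sub>R ?d) = diffquot n z f x - ?d"
      by (simp add: diffquot_def scaleR_right_diff_distrib)
    finally show "norm (?a - ?s *\<^sub>R ?d) / norm ?s = norm (diffquot n z f x - ?d)" .
  qed
  then show ?thesis unfolding tendsto_norm_zero_iff by (rule LIM_zero_cancel)
qed

text \<open>The Lipschitz constant bounds the quotients, and steps no longer than
  \<open>norm z\<close> keep their supports in one ball.\<close>

lemma diffquot_dominated:
  fixes f :: "'a::euclidean_space \<Rightarrow> 'b::euclidean_space"
  assumes "f \<in> test_functions \<Omega>"
  obtains B R where "B \<ge> 0" "\<And>n x. norm (diffquot n z f x) \<le> B * indicator (cball 0 R) x"
proof -
  obtain K where K: "compact K" "\<And>x. x \<notin> K \<Longrightarrow> f x = 0" using test_functionsE[OF assms] by metis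
  obtain r where r: "\<And>x. x \<in> K \<Longrightarrow> norm x \<le> r" using compact_imp_bounded[OF K(1)] by (auto simp: bounded_iff)
  obtain B where B: "B \<ge> 0" "\<And>x y. norm (f x - f y) \<le> B * norm (x - y)" using test_functions_Lipschitz[OF assms] by blast
  show ?thesis
  proof (rule that[of "B * norm z" "r + norm z"])
    fix n x
    have sm: "norm ((1 / real (Suc n)) *\<^sub>R z) \<le> norm z"
      by (simp add: field_simps mult_le_cancel_left1)
    show "norm (diffquot n z f x) \<le> B * norm z * indicator (cball 0 (r + norm z)) x"
    proof (cases "x \<in> cball 0 (r + norm z)")
      case True
      have "norm (diffquot n z f x) = real (Suc n) * norm (f (x + (1 / real (Suc n)) *\<^sub>R z) - f x)"
        by (simp add: diffquot_def)
      also have "\<dots> \<le> real (Suc n) * (B * norm ((1 / real (Suc n)) *\<^sub>R z))"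
        using B(2)[of "x + (1 / real (Suc n)) *\<^sub>R z" x] by (intro mult_left_mono) auto
      also have "\<dots> = B * norm z" by simp
      finally show ?thesis using True by simp
    next
      case False
      then have "x \<notin> K" using r[of x] norm_ge_zero[of z] by (auto simp del: norm_ge_zero)
      moreover have "x + (1 / real (Suc n)) *\<^sub>R z \<notin> K"
        using r[of "x + (1 / real (Suc n)) *\<^sub>R z"] False sm norm_triangle_ineq4[of "x + (1 / real (Suc n)) *\<^sub>R z" "(1 / real (Suc n)) *\<^sub>R z"] by auto
      ultimately show ?thesis using K(2) B by (simp add: diffquot_def)
    qed
  qed (use B in auto)
qed

lemma diffquot_measurable: "f \<in> test_functions \<Omega> \<Longrightarrow> diffquot n z f \<in> borel_measurable lebesgue"
proof -
  assume "f \<in> test_functions \<Omega>"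
  then have [measurable]: "f \<in> borel_measurable borel" by (rule test_functions_borel)
  show ?thesis unfolding diffquot_def[abs_def] by (intro measurable_completion) measurable
qed

lemma frechet_test_square_int:
  assumes "f \<in> test_functions \<Omega>"
  shows "square_int (\<lambda>x. frechet_derivative f (at x) z)"
    "(\<lambda>n. el (diffquot n z f)) \<longlonglongrightarrow> el (\<lambda>x. frechet_derivative f (at x) z)"
    "square_int (diffquot n z f)"
proof -
  obtain B R where B: "B \<ge> 0" "\<And>n x. norm (diffquot n z f x) \<le> B * indicator (cball 0 R) x"
    using diffquot_dominated[OF assms] by metis
  have g: "square_int (\<lambda>x::'a. indicator (cball 0 R) x *\<^sub>R B)"
    by (rule square_int_indicator) auto
  have b: "AE x in lebesgue. norm (diffquot n z f x) \<le> norm (indicator (cball 0 R) x *\<^sub>R B)" for n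
    using B by (simp add: mult.commute)
  have l: "AE x in lebesgue. (\<lambda>n. diffquot n z f x) \<longlonglongrightarrow> frechet_derivative f (at x) z"
    using diffquot_tendsto[OF assms] by blast
  show "square_int (\<lambda>x. frechet_derivative f (at x) z)"
    "(\<lambda>n. el (diffquot n z f)) \<longlonglongrightarrow> el (\<lambda>x. frechet_derivative f (at x) z)"
    "square_int (diffquot n z f)"
    using el_dominated[OF diffquot_measurable[OF assms] g b l] by auto
qed

lemma test_functions_integrable:
  fixes f :: "'a::euclidean_space \<Rightarrow> 'b::euclidean_space"
  assumes "f \<in> test_functions \<Omega>" shows "integrable lebesgue f"
proof -
  obtain B K where K: "compact K" "\<And>x. norm (f x) \<le> B * indicator K x" "B \<ge> 0" using test_functions_dominated[OF assms] by metis
  have "integrable lebesgue (\<lambda>x. B * indicator K x)"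
    using lmeasurable_compact[OF K(1)] by (intro integrable_mult_right integrable_real_indicator) (auto simp: fmeasurable_def simp del: emeasure_completion)
  then show ?thesis
  proof (rule Bochner_Integration.integrable_bound)
    show "f \<in> borel_measurable lebesgue" by (rule test_functions_measurable[OF assms])
    show "AE x in lebesgue. norm (f x) \<le> norm (B * indicator K x)" using K by (simp add: abs_mult)
  qed
qed

text \<open>By translation invariance every difference quotient has integral zero, and the quotients
  converge dominatedly. Integration by parts rests on this.\<close>

lemma integral_dir_deriv_test:
  fixes f :: "'a::euclidean_space \<Rightarrow> 'b::euclidean_space"
  assumes "f \<in> test_functions \<Omega>"
  shows "(LINT x|lebesgue. frechet_derivative f (at x) z) = 0"
proof -
  obtain B R where B: "B \<ge> 0" "\<And>n x. norm (diffquot n z f x) \<le> B * indicator (cball 0 R) x"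
    using diffquot_dominated[OF assms] by metis
  have "(\<lambda>n. LINT x|lebesgue. diffquot n z f x) \<longlonglongrightarrow> (LINT x|lebesgue. frechet_derivative f (at x) z)"
  proof (rule integral_dominated_convergence[where w = "\<lambda>x. B * indicator (cball 0 R) x"])
    show "integrable lebesgue (\<lambda>x. B * indicator (cball 0 R) x)"
      using lmeasurable_cball[of 0 R] by (intro integrable_mult_right integrable_real_indicator) (auto simp: fmeasurable_def simp del: emeasure_completion)
  qed (use B diffquot_tendsto[OF assms] diffquot_measurable[OF assms] square_int_measurable[OF frechet_test_square_int(1)[OF assms]] in auto)
  moreover have "(LINT x|lebesgue. diffquot n z f x) = 0" for n
  proof -
    have i: "integrable lebesgue f" by (rule test_functions_integrable[OF assms])
    then have "integrable lebesgue (\<lambda>x. f (x + (1 / real (Suc n)) *\<^sub>R z))"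
      using integral_lebesgue_diag_affine(2)[of "\<lambda>_. 1" f "(1 / real (Suc n)) *\<^sub>R z"] by (auto simp: diag_affine_translate)
    then show ?thesis
      using i integral_lebesgue_translate[OF borel_measurable_integrable[OF i]] by (simp add: diffquot_def)
  qed
  ultimately show ?thesis using LIMSEQ_unique[OF _ tendsto_const] by auto
qed

lemma square_int_scaleR_integrable:
  fixes f :: "'a::euclidean_space \<Rightarrow> real" and g :: "'a \<Rightarrow> 'b::euclidean_space"
  assumes f: "square_int f" and g: "square_int g"
  shows "integrable lebesgue (\<lambda>x. f x *\<^sub>R g x)"
proof (rule Bochner_Integration.integrable_bound)
  have "square_int (\<lambda>x. norm (g x))" using g by (auto simp: square_int_def)
  then show "integrable lebesgue (\<lambda>x. f x \<bullet> norm (g x))" by (rule square_int_inner[OF f])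
qed (use f g in \<open>auto simp: abs_mult\<close>)

text \<open>The product is again a test function, so the integral of its derivative
  vanishes.\<close>

lemma test_functions_by_parts:
  fixes f :: "'a::euclidean_space \<Rightarrow> real" and g :: "'a \<Rightarrow> 'b::euclidean_space"
  assumes f: "f \<in> test_functions \<Omega>" and g: "g \<in> test_functions \<Omega>'"
  shows "(LINT x|lebesgue. frechet_derivative f (at x) z *\<^sub>R g x) = - (LINT x|lebesgue. f x *\<^sub>R frechet_derivative g (at x) z)"
proof -
  have "frechet_derivative (\<lambda>x. f x *\<^sub>R g x) (at x) z = f x *\<^sub>R frechet_derivative g (at x) z + frechet_derivative f (at x) z *\<^sub>R g x" for x
    using frechet_derivative_eq[OF has_derivative_scaleR[OF test_functions_has_derivative[OF f] test_functions_has_derivative[OF g]]] by simp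
  then have "(LINT x|lebesgue. f x *\<^sub>R frechet_derivative g (at x) z + frechet_derivative f (at x) z *\<^sub>R g x) = 0"
    using integral_dir_deriv_test[OF test_functions_mult[OF f g], of z] by simp
  moreover have "integrable lebesgue (\<lambda>x. f x *\<^sub>R frechet_derivative g (at x) z)"
    by (rule square_int_scaleR_integrable[OF test_functions_square_int[OF f] frechet_test_square_int(1)[OF g]])
  moreover have "integrable lebesgue (\<lambda>x. frechet_derivative f (at x) z *\<^sub>R g x)"
    by (rule square_int_scaleR_integrable[OF frechet_test_square_int(1)[OF f] test_functions_square_int[OF g]])
  ultimately show ?thesis by (simp add: eq_neg_iff_add_eq_0 add.commute)
qed

text \<open>The translation by z is split into n+1 equal steps. Translations are isometries, so all
  steps change the function by the same amount, and their number times this amount is the norm of a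
  difference quotient, which tends to that of the derivative.\<close>

lemma norm_translate_diff_le:
  fixes f :: "'a::euclidean_space \<Rightarrow> 'b::euclidean_space"
  assumes "f \<in> test_functions \<Omega>"
  shows "norm (el (\<lambda>x. f (x + z)) - el f) \<le> norm (el (\<lambda>x. frechet_derivative f (at x) z))"
proof (rule LIMSEQ_le_const[OF tendsto_norm[OF frechet_test_square_int(2)[OF assms]]])
  have sf: "square_int f" by (rule test_functions_square_int[OF assms])
  have "norm (el (\<lambda>x. f (x + z)) - el f) \<le> norm (el (diffquot n z f))" for n
  proof -
    define h where "h = (1 / real (Suc n)) *\<^sub>R z"
    have hz: "real (Suc n) *\<^sub>R h = z" by (simp add: h_def)
    have hadd: "x + real i *\<^sub>R h + h = x + real (Suc i) *\<^sub>R h" for x i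
      by (simp add: scaleR_left_distrib add.assoc add.commute)
    let ?t = "\<lambda>i::nat. el (\<lambda>x. f (x + real i *\<^sub>R h))"
    have s: "square_int (\<lambda>x. f (x + y))" for y by (rule square_int_translate[OF sf])
    have st: "norm (?t (Suc i) - ?t i) = norm (el (\<lambda>x. f (x + h) - f x))" for i
    proof -
      have eq: "?t (Suc i) - ?t i = el (\<lambda>x. f (x + real i *\<^sub>R h + h) - f (x + real i *\<^sub>R h))"
        using el_diff[OF s[of "real (Suc i) *\<^sub>R h"] s[of "real i *\<^sub>R h"]]
        unfolding hadd by (rule sym)
      show ?thesis unfolding eq by (rule norm_el_translate[OF square_int_diff[OF s[of h] sf]])
    qed
    have "el (\<lambda>x. f (x + z)) - el f = ?t (Suc n) - ?t 0" unfolding hz by simp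
    also have "\<dots> = (\<Sum>i<Suc n. ?t (Suc i) - ?t i)" by (rule sum_lessThan_telescope[symmetric])
    also have "norm \<dots> \<le> (\<Sum>i<Suc n. norm (?t (Suc i) - ?t i))" by (rule norm_sum)
    also have "\<dots> = real (Suc n) * norm (el (\<lambda>x. f (x + h) - f x))" unfolding st by simp
    also have "\<dots> = norm (el (diffquot n z f))"
      unfolding diffquot_def[abs_def] h_def[symmetric] using el_scaleR[OF square_int_diff[OF s[of h] sf], of "real (Suc n)"] by simp
    finally show ?thesis .
  qed
  then show "\<exists>N. \<forall>n\<ge>N. norm (el (\<lambda>x. f (x + z)) - el f) \<le> norm (el (diffquot n z f))" by blast
qed

section \<open>The fundamental lemma of the calculus of variations\<close>

lemma enn2real_inj: "enn2real a = enn2real b \<Longrightarrow> a \<noteq> \<infinity> \<Longrightarrow> b \<noteq> \<infinity> \<Longrightarrow> a = b"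
  by (cases a; cases b) auto

text \<open>The positive and the negative part of \<open>g\<close> are densities of two finite
  measures, \<open>ennreal\<close> cutting off negative values. These agree on boxes, an
  intersection-stable generator of the Borel sets, and so are equal.\<close>

lemma AE_zero_if_box_integrals_zero:
  fixes g :: "'a::euclidean_space \<Rightarrow> real"
  assumes g: "integrable lborel g" and z: "\<And>c d. (LINT x|lborel. indicator (box c d) x * g x) = 0"
  shows "AE x in lborel. g x = 0"
proof -
  have gm[measurable]: "g \<in> borel_measurable borel" using borel_measurable_integrable[OF g] by simp
  let ?M1 = "density lborel (\<lambda>x. ennreal (g x))" and ?M2 = "density lborel (\<lambda>x. ennreal (- g x))"
  have fin: "(\<integral>\<^sup>+x. ennreal (g x) \<partial>lborel) \<noteq> \<infinity>" "(\<integral>\<^sup>+x. ennreal (- g x) \<partial>lborel) \<noteq> \<infinity>"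
    using g by (auto simp: real_integrable_def)
  have eq: "emeasure ?M1 (box c d) = emeasure ?M2 (box c d)" for c d
  proof -
    let ?f = "\<lambda>x. indicator (box c d) x * g x"
    have i: "integrable lborel ?f" using integrable_mult_indicator[OF _ g, of "box c d"] by simp
    have "enn2real (\<integral>\<^sup>+x. ennreal (?f x) \<partial>lborel) = enn2real (\<integral>\<^sup>+x. ennreal (- ?f x) \<partial>lborel)"
      using real_lebesgue_integral_def[OF i] z[of c d] by simp
    moreover have "(\<integral>\<^sup>+x. ennreal (?f x) \<partial>lborel) \<noteq> \<infinity>" "(\<integral>\<^sup>+x. ennreal (- ?f x) \<partial>lborel) \<noteq> \<infinity>"
      using i by (auto simp: real_integrable_def)
    ultimately have "(\<integral>\<^sup>+x. ennreal (?f x) \<partial>lborel) = (\<integral>\<^sup>+x. ennreal (- ?f x) \<partial>lborel)"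
      by (rule enn2real_inj)
    moreover have "ennreal (?f x) = ennreal (g x) * indicator (box c d) x" "ennreal (- ?f x) = ennreal (- g x) * indicator (box c d) x" for x
      by (auto simp: indicator_def)
    ultimately show ?thesis by (simp add: emeasure_density)
  qed
  have "?M1 = ?M2"
  proof (rule measure_eqI_generator_eq[where E = "range (\<lambda>(a, b). box a b)" and \<Omega> = UNIV and A = "\<lambda>i::nat. box (- real i *\<^sub>R One) (real i *\<^sub>R One)"])
    show "Int_stable (range (\<lambda>(a, b). box a b :: 'a set))"
      by (auto simp: Int_stable_def box_Int_box)
    show "emeasure ?M1 X = emeasure ?M2 X" if "X \<in> range (\<lambda>(a, b). box a b)" for X
      using that eq by auto
    show "sets ?M1 = sigma_sets UNIV (range (\<lambda>(a, b). box a b))" "sets ?M2 = sigma_sets UNIV (range (\<lambda>(a, b). box a b))"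
      by (simp_all add: borel_eq_box)
    show "(\<Union>i::nat. box (- real i *\<^sub>R One) (real i *\<^sub>R One)) = (UNIV :: 'a set)"
      using UN_box_eq_UNIV by simp
    show "emeasure ?M1 (box (- real i *\<^sub>R One) (real i *\<^sub>R One)) \<noteq> \<infinity>" for i
    proof -
      have "emeasure ?M1 (box (- real i *\<^sub>R One) (real i *\<^sub>R One)) \<le> (\<integral>\<^sup>+x. ennreal (g x) \<partial>lborel)"
        by (subst emeasure_density) (auto intro!: nn_integral_mono simp: indicator_def)
      then show ?thesis using fin(1) by (metis infinity_ennreal_def top.extremum_unique)
    qed
  qed auto
  then have "AE x in lborel. ennreal (g x) = ennreal (- g x)"
    using finite_density_unique[of "\<lambda>x. ennreal (g x)" lborel "\<lambda>x. ennreal (- g x)"] fin by simp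
  then show ?thesis
  proof (rule AE_mp, intro AE_I2 impI)
    fix x assume "ennreal (g x) = ennreal (- g x)"
    then show "g x = 0" by (cases "g x \<ge> 0") (auto simp: ennreal_neg dest: ennreal_eq_0_iff[THEN iffD1, OF sym])
  qed
qed

text \<open>A product of one-dimensional cut-offs, one for each face of the box. As k grows the
  values inside tend to 1, so the bumps tend boundedly to the indicator of the open box.\<close>

definition box_bump :: "real \<Rightarrow> 'a \<Rightarrow> 'a \<Rightarrow> 'a::euclidean_space \<Rightarrow> real" where
  "box_bump k a b x = (\<Prod>i\<in>Basis. flat 1 (x \<bullet> (k *\<^sub>R i) + - k * (a \<bullet> i)) * flat 1 (x \<bullet> (- k *\<^sub>R i) + k * (b \<bullet> i)))"

lemma flat_nonneg: "0 \<le> flat 1 x" and flat_le_1: "flat 1 x \<le> 1"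
  by (auto simp: flat_def)

lemma Ck_prod:
  fixes f :: "'i \<Rightarrow> 'a::euclidean_space \<Rightarrow> real"
  assumes "finite I" "\<And>i. i \<in> I \<Longrightarrow> Ck k (f i)"
  shows "Ck k (\<lambda>x. \<Prod>i\<in>I. f i x)"
  using assms
proof (induction I rule: finite_induct)
  case empty show ?case using Ck_const[of k "1::real"] by simp
next
  case (insert i I)
  then show ?case using Ck_scaleR[of k "f i" "\<lambda>x. \<Prod>i\<in>I. f i x"] by simp
qed

lemma box_bump_test:
  assumes "k > 0" "cbox a b \<subseteq> \<Omega>" shows "box_bump k a b \<in> test_functions \<Omega>"
proof (rule test_functionsI[where K = "cbox a b"])
  have "Ck m (\<lambda>x. flat 1 (x \<bullet> (k *\<^sub>R i) + - k * (a \<bullet> i)) *\<^sub>R flat 1 (x \<bullet> (- k *\<^sub>R i) + k * (b \<bullet> i)))" for m i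
    by (intro Ck_scaleR Ck_real_affine Ck_flat)
  then show "Ck m (box_bump k a b)" for m
    unfolding box_bump_def[abs_def] by (intro Ck_prod) (auto simp del: inner_scaleR_right)
  fix x assume "x \<notin> cbox a b"
  then obtain i where i: "i \<in> Basis" "x \<bullet> i < a \<bullet> i \<or> b \<bullet> i < x \<bullet> i" by (auto simp: mem_box not_le)
  then have "flat 1 (x \<bullet> (k *\<^sub>R i) + - k * (a \<bullet> i)) * flat 1 (x \<bullet> (- k *\<^sub>R i) + k * (b \<bullet> i)) = 0"
    using \<open>k > 0\<close> by (auto simp: flat_def)
  then show "box_bump k a b x = 0" unfolding box_bump_def using i(1) by (intro prod_zero) auto
qed (use assms in auto)

lemma box_bump_bounds: "0 \<le> box_bump k a b x" "box_bump k a b x \<le> 1"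
  unfolding box_bump_def
  by (auto intro!: prod_nonneg prod_le_1 mult_nonneg_nonneg mult_le_one simp: flat_nonneg flat_le_1)

lemma flat_tendsto: "s > 0 \<Longrightarrow> (\<lambda>n. flat 1 (real (Suc n) * s)) \<longlonglongrightarrow> 1"
proof -
  assume s: "s > 0"
  have "(\<lambda>n. exp (- (1 / s) * (1 / real (Suc n)))) \<longlonglongrightarrow> exp (- (1 / s) * 0)"
    by (intro tendsto_intros LIMSEQ_Suc[OF lim_const_over_n])
  then show ?thesis using s by (simp add: flat_def mult.commute)
qed

lemma box_bump_tendsto: "(\<lambda>n. box_bump (real (Suc n)) a b x) \<longlonglongrightarrow> indicator (box a b) x"
proof (cases "x \<in> box a b")
  case True
  have "(\<lambda>n. box_bump (real (Suc n)) a b x) \<longlonglongrightarrow> (\<Prod>i\<in>(Basis::'a set). 1 * 1)"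
    unfolding box_bump_def
  proof (intro tendsto_prod tendsto_mult)
    fix i :: 'a assume "i \<in> Basis"
    then have "x \<bullet> i - a \<bullet> i > 0" "b \<bullet> i - x \<bullet> i > 0" using True by (auto simp: mem_box)
    then show "(\<lambda>n. flat 1 (x \<bullet> (real (Suc n) *\<^sub>R i) + - real (Suc n) * (a \<bullet> i))) \<longlonglongrightarrow> 1"
      "(\<lambda>n. flat 1 (x \<bullet> (- real (Suc n) *\<^sub>R i) + real (Suc n) * (b \<bullet> i))) \<longlonglongrightarrow> 1"
      using flat_tendsto[of "x \<bullet> i - a \<bullet> i"] flat_tendsto[of "b \<bullet> i - x \<bullet> i"]
      by (simp_all add: right_diff_distrib del: of_nat_Suc)
  qed
  then show ?thesis using True by simp
next
  case False
  then obtain i where i: "i \<in> Basis" "x \<bullet> i \<le> a \<bullet> i \<or> b \<bullet> i \<le> x \<bullet> i" by (auto simp: mem_box not_less)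
  have "box_bump (real (Suc n)) a b x = 0" for n
  proof -
    have "flat 1 (x \<bullet> (real (Suc n) *\<^sub>R i) + - real (Suc n) * (a \<bullet> i)) * flat 1 (x \<bullet> (- real (Suc n) *\<^sub>R i) + real (Suc n) * (b \<bullet> i)) = 0"
      using i(2) by (auto simp: flat_def simp del: of_nat_Suc)
    then show ?thesis unfolding box_bump_def using i(1) by (intro prod_zero) auto
  qed
  then show ?thesis using False by simp
qed

text \<open>Bumps turn the hypothesis into vanishing integrals over the boxes whose closure lies in
  the open set. Such boxes cover the set, and by Lindelof's theorem countably many suffice, so the
  exceptional null sets can be united.\<close>

lemma fundamental_lemma_real:
  fixes f :: "'a::euclidean_space \<Rightarrow> real"
  assumes \<Omega>: "open \<Omega>" and f: "square_int f"
    and z: "\<And>\<phi>. \<phi> \<in> test_functions \<Omega> \<Longrightarrow> (LINT x|lebesgue. \<phi> x * f x) = 0"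
  shows "AE x in lebesgue. x \<in> \<Omega> \<longrightarrow> f x = 0"
proof -
  have fm[measurable]: "f \<in> borel_measurable lebesgue" using f by blast
  have box0: "(LINT x|lebesgue. indicator (box a b) x * f x) = 0" if ab: "cbox a b \<subseteq> \<Omega>" for a b
  proof -
    have "(\<lambda>n. LINT x|lebesgue. box_bump (real (Suc n)) a b x * f x) \<longlonglongrightarrow> (LINT x|lebesgue. indicator (box a b) x * f x)"
    proof (rule integral_dominated_convergence[where w = "\<lambda>x. norm (indicator (cbox a b) x * f x)"])
      show "integrable lebesgue (\<lambda>x. norm (indicator (cbox a b) x * f x))"
        using square_int_inner[OF square_int_indicator[of "cbox a b" "1::real"] f] by (simp add: bounded_cbox)
      show "AE x in lebesgue. norm (box_bump (real (Suc n)) a b x * f x) \<le> norm (indicator (cbox a b) x * f x)" for n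
      proof (rule AE_I2)
        fix x
        show "norm (box_bump (real (Suc n)) a b x * f x) \<le> norm (indicator (cbox a b) x * f x)"
        proof (cases "x \<in> cbox a b")
          case True
          then show ?thesis using box_bump_bounds[of "real (Suc n)" a b x] by (simp add: abs_mult mult_left_le_one_le)
        next
          case False
          then have "box_bump (real (Suc n)) a b x = 0"
            using test_functions_outside[OF box_bump_test[of "real (Suc n)" a b "cbox a b"]] by simp
          then show ?thesis by simp
        qed
      qed
      show "AE x in lebesgue. (\<lambda>n. box_bump (real (Suc n)) a b x * f x) \<longlonglongrightarrow> indicator (box a b) x * f x"
        by (intro AE_I2 tendsto_mult box_bump_tendsto tendsto_const)
      show "(\<lambda>x. indicator (box a b) x * f x) \<in> borel_measurable lebesgue" by (intro borel_measurable_times fm borel_measurable_indicator) simp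
      show "(\<lambda>x. box_bump (real (Suc n)) a b x * f x) \<in> borel_measurable lebesgue" for n
        using test_functions_measurable[OF box_bump_test[OF _ ab, of "real (Suc n)"]] by simp
    qed
    moreover have "(LINT x|lebesgue. box_bump (real (Suc n)) a b x * f x) = 0" for n
      by (intro z box_bump_test ab) simp
    ultimately show ?thesis using LIMSEQ_unique[OF _ tendsto_const] by auto
  qed
  have AEbox: "AE x in lebesgue. x \<in> box a b \<longrightarrow> f x = 0" if ab: "cbox a b \<subseteq> \<Omega>" for a b
  proof -
    \<comment> \<open>The box criterion concerns Borel functions and \<open>lborel\<close>, hence
      the passage to a Borel representative.\<close>
    obtain g where g[measurable]: "g \<in> borel_measurable lborel" and fg: "AE x in lborel. f x = g x"
      using completion_ex_borel_measurable_real[OF fm] by auto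
    have fg': "AE x in lebesgue. f x = g x" using fg by (rule AE_completion)
    let ?h = "\<lambda>x. indicator (box a b) x * g x"
    have "integrable lebesgue (\<lambda>x. indicator (box a b) x * f x)"
      using square_int_inner[OF square_int_indicator[of "box a b" "1::real"] f] by (simp add: bounded_box)
    then have "integrable lebesgue ?h"
      by (rule Bochner_Integration.integrable_cong_AE_imp) (use fg' in \<open>auto elim: AE_mp intro!: measurable_completion\<close>)
    then have hi: "integrable lborel ?h" by (subst (asm) integrable_completion) auto
    have "AE x in lborel. ?h x = 0"
    proof (rule AE_zero_if_box_integrals_zero[OF hi])
      fix c d
      \<comment> \<open>Any box cut by \<open>box a b\<close> is again a box with closure in the
        open set, so the function restricted to \<open>box a b\<close> integrates to zero over all
        boxes.\<close>
      obtain p q where pq: "box a b \<inter> box c d = box p q" "cbox a b \<inter> cbox c d = cbox p q"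
        using box_Int_box[of a b c d] Int_interval[of a b c d] by blast
      have "(LINT x|lborel. indicator (box c d) x * ?h x) = (LINT x|lborel. indicator (box p q) x * g x)"
        using pq(1) by (intro Bochner_Integration.integral_cong) (auto simp: indicator_def)
      also have "\<dots> = (LINT x|lebesgue. indicator (box p q) x * g x)"
        by (rule integral_completion[symmetric]) measurable
      also have "\<dots> = (LINT x|lebesgue. indicator (box p q) x * f x)"
      proof (rule integral_cong_AE)
        show "(\<lambda>x. indicator (box p q) x * g x) \<in> borel_measurable lebesgue"
          by (rule measurable_completion) measurable
        show "(\<lambda>x. indicator (box p q) x * f x) \<in> borel_measurable lebesgue"
          by (intro borel_measurable_times fm borel_measurable_indicator) simp
      qed (use fg' in \<open>auto elim: AE_mp\<close>)
      also have "\<dots> = 0" using ab pq(2) by (intro box0) auto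
      finally show "(LINT x|lborel. indicator (box c d) x * ?h x) = 0" .
    qed
    then have "AE x in lebesgue. ?h x = 0" by (rule AE_completion)
    then show ?thesis using fg' by (auto elim!: AE_mp)
  qed
  define \<F> where "\<F> = {box a b |a b. cbox a b \<subseteq> \<Omega>}"
  obtain \<F>' where F: "\<F>' \<subseteq> \<F>" "countable \<F>'" "\<Union>\<F>' = \<Union>\<F>"
    using Lindelof[of \<F>] by (auto simp: \<F>_def)
  have "\<Omega> \<subseteq> \<Union>\<F>"
  proof
    fix x assume "x \<in> \<Omega>"
    then obtain a b where "cbox a b \<subseteq> \<Omega>" "x \<in> box a b" using open_contains_cbox[OF \<Omega>] by metis
    then show "x \<in> \<Union>\<F>" by (auto simp: \<F>_def)
  qed
  then have sub: "\<Omega> \<subseteq> \<Union>\<F>'" using F(3) by simp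
  have "AE x in lebesgue. \<forall>B\<in>\<F>'. x \<in> B \<longrightarrow> f x = 0"
    using F(1,2) AEbox by (subst AE_ball_countable) (auto simp: \<F>_def)
  then show ?thesis
    by (rule AE_mp) (use sub in \<open>auto intro!: AE_I2\<close>)
qed

lemma fundamental_lemma:
  fixes f :: "'a::euclidean_space \<Rightarrow> 'b::euclidean_space"
  assumes \<Omega>: "open \<Omega>" and f: "square_int f"
    and z: "\<And>\<phi>::'a \<Rightarrow> real. \<phi> \<in> test_functions \<Omega> \<Longrightarrow> (LINT x|lebesgue. \<phi> x *\<^sub>R f x) = 0"
  shows "AE x in lebesgue. x \<in> \<Omega> \<longrightarrow> f x = 0"
proof -
  have "AE x in lebesgue. x \<in> \<Omega> \<longrightarrow> f x \<bullet> e = 0" if e: "e \<in> Basis" for e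
  proof (rule fundamental_lemma_real[OF \<Omega>])
    have fm: "f \<in> borel_measurable lebesgue" using f by blast
    show "square_int (\<lambda>x. f x \<bullet> e)"
      by (rule square_int_bound[where g = "\<lambda>x. (norm (f x))\<^sup>2"])
         (use f fm e Basis_le_norm in \<open>auto simp: square_int_def power2_le_iff_abs_le\<close>)
    fix \<phi> :: "'a \<Rightarrow> real" assume t: "\<phi> \<in> test_functions \<Omega>"
    have "(LINT x|lebesgue. \<phi> x * (f x \<bullet> e)) = (LINT x|lebesgue. \<phi> x *\<^sub>R f x) \<bullet> e"
      by (subst integral_inner_left[symmetric]) (use square_int_scaleR_integrable[OF test_functions_square_int[OF t] f] in auto)
    then show "(LINT x|lebesgue. \<phi> x * (f x \<bullet> e)) = 0" using z[OF t] by simp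
  qed
  then have "AE x in lebesgue. \<forall>e\<in>Basis. x \<in> \<Omega> \<longrightarrow> f x \<bullet> e = 0"
    by (subst AE_ball_countable) (auto simp: countable_finite)
  then show ?thesis by (rule AE_mp) (auto intro!: AE_I2 euclidean_eqI[of _ 0])
qed

section \<open>Sobolev spaces as closed subspaces of a Hilbert space\<close>

definition zero_ext :: "'a set \<Rightarrow> ('a \<Rightarrow> 'b::real_vector) \<Rightarrow> 'a \<Rightarrow> 'b" where
  "zero_ext \<Omega> u x = indicator \<Omega> x *\<^sub>R u x"

lemma L2_iff:
  fixes u :: "'a::euclidean_space \<Rightarrow> 'b::euclidean_space"
  assumes "\<Omega> \<in> sets lebesgue"
  shows "u \<in> L2 \<Omega> \<longleftrightarrow> square_int (zero_ext \<Omega> u)"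
proof -
  have "u \<in> borel_measurable (lebesgue_on \<Omega>) \<longleftrightarrow> zero_ext \<Omega> u \<in> borel_measurable lebesgue"
    unfolding zero_ext_def[abs_def] by (subst borel_measurable_restrict_space_iff) (use assms in auto)
  moreover have "integrable (lebesgue_on \<Omega>) (\<lambda>x. (norm (u x))\<^sup>2) \<longleftrightarrow> integrable lebesgue (\<lambda>x. (norm (zero_ext \<Omega> u x))\<^sup>2)"
    by (subst integrable_restrict_space) (use assms in \<open>auto simp: zero_ext_def power_mult_distrib indicator_def intro!: arg_cong[where f = "integrable lebesgue"]\<close>)
  ultimately show ?thesis by (simp add: L2_def square_int_def)
qed

lemma integral_lebesgue_on:
  fixes f :: "'a::euclidean_space \<Rightarrow> 'b::euclidean_space"
  assumes "\<Omega> \<in> sets lebesgue"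
  shows "integral\<^sup>L (lebesgue_on \<Omega>) f = (LINT x|lebesgue. indicator \<Omega> x *\<^sub>R f x)"
  by (rule integral_restrict_space) (use assms in simp)

lemma AE_lebesgue_on:
  assumes "\<Omega> \<in> sets lebesgue"
  shows "(AE x in lebesgue_on \<Omega>. P x) \<longleftrightarrow> (AE x in lebesgue. x \<in> \<Omega> \<longrightarrow> P x)"
  by (rule AE_restrict_space_iff) (use assms in simp)

lemma integral_scaleR_inner:
  fixes f :: "'a::euclidean_space \<Rightarrow> real" and g :: "'a \<Rightarrow> 'b::euclidean_space"
  assumes f: "square_int f" and g: "square_int g"
  shows "(LINT x|lebesgue. f x *\<^sub>R g x) \<bullet> e = inner (el g) (el (\<lambda>x. f x *\<^sub>R e))"
    "square_int (\<lambda>x. f x *\<^sub>R e)"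
proof -
  show s: "square_int (\<lambda>x. f x *\<^sub>R e)"
    using f by (auto simp: square_int_def power_mult_distrib)
  have "(LINT x|lebesgue. f x *\<^sub>R g x) \<bullet> e = (LINT x|lebesgue. (f x *\<^sub>R g x) \<bullet> e)"
    by (rule integral_inner_left[symmetric]) (use square_int_scaleR_integrable[OF f g] in auto)
  also have "\<dots> = (LINT x|lebesgue. g x \<bullet> (f x *\<^sub>R e))" by simp
  also have "\<dots> = inner (el g) (el (\<lambda>x. f x *\<^sub>R e))" by (rule inner_el[symmetric, OF g s])
  finally show "(LINT x|lebesgue. f x *\<^sub>R g x) \<bullet> e = inner (el g) (el (\<lambda>x. f x *\<^sub>R e))" .
qed

text \<open>Expressed by inner products with fixed elements of L2, the condition is visibly
  preserved by linear combinations and by limits of \<open>u\<close> and \<open>w\<close>.\<close>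

lemma is_weak_deriv_iff:
  fixes u w :: "'a::euclidean_space \<Rightarrow> 'b::euclidean_space"
  assumes \<Omega>: "open \<Omega>" and u: "u \<in> L2 \<Omega>" and w: "w \<in> L2 \<Omega>"
  shows "is_weak_deriv \<Omega> b u w \<longleftrightarrow> (\<forall>\<psi>::'a \<Rightarrow> real. \<psi> \<in> test_functions \<Omega> \<longrightarrow> (\<forall>e\<in>Basis.
     inner (el (zero_ext \<Omega> u)) (el (\<lambda>x. frechet_derivative \<psi> (at x) b *\<^sub>R e)) = - inner (el (zero_ext \<Omega> w)) (el (\<lambda>x. \<psi> x *\<^sub>R e))))"
proof -
  have S: "\<Omega> \<in> sets lebesgue" using \<Omega> by simp
  note uw = u[unfolded L2_iff[OF S]] w[unfolded L2_iff[OF S]]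
  have "(LINT x|lebesgue_on \<Omega>. frechet_derivative \<psi> (at x) b *\<^sub>R u x) = - (LINT x|lebesgue_on \<Omega>. \<psi> x *\<^sub>R w x) \<longleftrightarrow>
     (\<forall>e\<in>Basis. inner (el (zero_ext \<Omega> u)) (el (\<lambda>x. frechet_derivative \<psi> (at x) b *\<^sub>R e)) = - inner (el (zero_ext \<Omega> w)) (el (\<lambda>x. \<psi> x *\<^sub>R e)))"
    if t: "\<psi> \<in> test_functions \<Omega>" for \<psi> :: "'a \<Rightarrow> real"
  proof -
    have 1: "(LINT x|lebesgue_on \<Omega>. frechet_derivative \<psi> (at x) b *\<^sub>R u x) = (LINT x|lebesgue. frechet_derivative \<psi> (at x) b *\<^sub>R zero_ext \<Omega> u x)"
      "(LINT x|lebesgue_on \<Omega>. \<psi> x *\<^sub>R w x) = (LINT x|lebesgue. \<psi> x *\<^sub>R zero_ext \<Omega> w x)"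
      by (simp_all add: integral_lebesgue_on[OF S] zero_ext_def mult.commute)
    show ?thesis
      unfolding 1 euclidean_eq_iff[where 'a = 'b] inner_minus_left
        integral_scaleR_inner(1)[OF frechet_test_square_int(1)[OF t] uw(1)]
        integral_scaleR_inner(1)[OF test_functions_square_int[OF t] uw(2)] ..
  qed
  then show ?thesis unfolding is_weak_deriv_def by blast
qed

lemma el_eq_0_iff: "square_int f \<Longrightarrow> el f = 0 \<longleftrightarrow> (AE x in lebesgue. f x = 0)"
  using el_eq_iff[of f "\<lambda>x. 0"] by (simp add: el_0)

lemma zero_ext_add: "zero_ext \<Omega> (\<lambda>x. u x + v x) = (\<lambda>x. zero_ext \<Omega> u x + zero_ext \<Omega> v x)"
  by (auto simp: zero_ext_def scaleR_right_distrib)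

lemma weak_deriv_unique:
  fixes u w w' :: "'a::euclidean_space \<Rightarrow> 'b::euclidean_space"
  assumes \<Omega>: "open \<Omega>" and w: "w \<in> L2 \<Omega>" "w' \<in> L2 \<Omega>"
    and d: "is_weak_deriv \<Omega> b u w" "is_weak_deriv \<Omega> b u w'"
  shows "el (zero_ext \<Omega> w) = el (zero_ext \<Omega> w')"
proof -
  have S: "\<Omega> \<in> sets lebesgue" using \<Omega> by simp
  note s = w[unfolded L2_iff[OF S]]
  let ?d = "\<lambda>x. zero_ext \<Omega> w x - zero_ext \<Omega> w' x"
  have sd: "square_int ?d" by (rule square_int_diff[OF s])
  have "AE x in lebesgue. x \<in> \<Omega> \<longrightarrow> ?d x = 0"
  proof (rule fundamental_lemma[OF \<Omega> sd])
    fix \<psi> :: "'a \<Rightarrow> real" assume t: "\<psi> \<in> test_functions \<Omega>"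
    have "(LINT x|lebesgue. \<psi> x *\<^sub>R zero_ext \<Omega> w x) = (LINT x|lebesgue. \<psi> x *\<^sub>R zero_ext \<Omega> w' x)"
      using d t unfolding is_weak_deriv_def integral_lebesgue_on[OF S] by (auto simp: zero_ext_def mult.commute)
    then show "(LINT x|lebesgue. \<psi> x *\<^sub>R ?d x) = 0"
      using square_int_scaleR_integrable[OF test_functions_square_int[OF t] s(1)]
        square_int_scaleR_integrable[OF test_functions_square_int[OF t] s(2)]
      by (simp add: scaleR_right_diff_distrib)
  qed
  then have "AE x in lebesgue. ?d x = 0" by (rule AE_mp) (auto intro!: AE_I2 simp: zero_ext_def)
  then show ?thesis by (intro el_eqI s) (auto elim: AE_mp)
qed

lemma weak_derivI:
  fixes u w :: "'a::euclidean_space \<Rightarrow> 'b::euclidean_space"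
  assumes "open \<Omega>" "w \<in> L2 \<Omega>" "is_weak_deriv \<Omega> b u w"
  shows "weak_deriv \<Omega> b u \<in> L2 \<Omega>" "is_weak_deriv \<Omega> b u (weak_deriv \<Omega> b u)"
    "el (zero_ext \<Omega> (weak_deriv \<Omega> b u)) = el (zero_ext \<Omega> w)"
proof -
  have "weak_deriv \<Omega> b u \<in> L2 \<Omega> \<and> is_weak_deriv \<Omega> b u (weak_deriv \<Omega> b u)"
    unfolding weak_deriv_def by (rule someI[of _ w]) (use assms in auto)
  then show "weak_deriv \<Omega> b u \<in> L2 \<Omega>" "is_weak_deriv \<Omega> b u (weak_deriv \<Omega> b u)"
    "el (zero_ext \<Omega> (weak_deriv \<Omega> b u)) = el (zero_ext \<Omega> w)"
    using weak_deriv_unique[OF assms(1) _ assms(2) _ assms(3)] by auto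
qed

lemma H1_weak_deriv:
  assumes "open \<Omega>" "u \<in> H1 \<Omega>" "b \<in> Basis"
  shows "weak_deriv \<Omega> b u \<in> L2 \<Omega>" "is_weak_deriv \<Omega> b u (weak_deriv \<Omega> b u)"
proof -
  obtain w where "w \<in> L2 \<Omega>" "is_weak_deriv \<Omega> b u w" using assms unfolding H1_def by blast
  then show "weak_deriv \<Omega> b u \<in> L2 \<Omega>" "is_weak_deriv \<Omega> b u (weak_deriv \<Omega> b u)"
    using weak_derivI(1,2)[OF assms(1)] by blast+
qed

text \<open>Sobolev functions, extended by zero, are pairs of the function and its tuple of partial derivatives; the
  components of the tuple are numbered by a bijection \<open>e\<close> of \<open>'n\<close> onto the basis. This turns \<open>H\<^sup>1\<close> on every domain
  into a subspace of one fixed Hilbert space, in which limits along varying domains can be taken.\<close>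

type_synonym ('a, 'b, 'n) hv = "('a, 'b) l2 \<times> (('a, 'b) l2 ^ 'n)"

definition hvec :: "('n \<Rightarrow> 'a) \<Rightarrow> 'a set \<Rightarrow> ('a::euclidean_space \<Rightarrow> 'b::euclidean_space) \<Rightarrow> ('a, 'b, 'n::finite) hv" where
  "hvec e \<Omega> u = (el (zero_ext \<Omega> u), \<chi> i. el (zero_ext \<Omega> (weak_deriv \<Omega> (e i) u)))"

lemma H1I:
  fixes u :: "'a::euclidean_space \<Rightarrow> 'b::euclidean_space" and w :: "'n::finite \<Rightarrow> 'a \<Rightarrow> 'b"
  assumes e: "bij_betw e UNIV Basis" and \<Omega>: "open \<Omega>" and u: "u \<in> L2 \<Omega>"
    and w: "\<And>i. w i \<in> L2 \<Omega>" "\<And>i. is_weak_deriv \<Omega> (e i) u (w i)"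
  shows "u \<in> H1 \<Omega>" "hvec e \<Omega> u = (el (zero_ext \<Omega> u), \<chi> i. el (zero_ext \<Omega> (w i)))"
proof -
  have "(Basis :: 'a set) = range e" using e by (simp add: bij_betw_def)
  show "u \<in> H1 \<Omega>" unfolding H1_def
  proof (intro CollectI conjI ballI u)
    fix b :: 'a assume "b \<in> Basis"
    then obtain i where "b = e i" using \<open>Basis = range e\<close> by auto
    then show "\<exists>w\<in>L2 \<Omega>. is_weak_deriv \<Omega> b u w" using w by blast
  qed
  show "hvec e \<Omega> u = (el (zero_ext \<Omega> u), \<chi> i. el (zero_ext \<Omega> (w i)))"
    unfolding hvec_def using weak_derivI(3)[OF \<Omega> w] by simp
qed

lemma zero_ext_scaleR: "zero_ext \<Omega> (\<lambda>x. c *\<^sub>R u x) = (\<lambda>x. c *\<^sub>R zero_ext \<Omega> u x)"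
  by (auto simp: zero_ext_def)

lemma hvec_add_scaleR:
  fixes u v :: "'a::euclidean_space \<Rightarrow> 'b::euclidean_space"
  assumes e: "bij_betw e UNIV Basis" and \<Omega>: "open \<Omega>" and u: "u \<in> H1 \<Omega>" and v: "v \<in> H1 \<Omega>"
  shows "(\<lambda>x. u x + c *\<^sub>R v x) \<in> H1 \<Omega>" "hvec e \<Omega> (\<lambda>x. u x + c *\<^sub>R v x) = hvec e \<Omega> u + c *\<^sub>R hvec e \<Omega> v"
proof -
  have S: "\<Omega> \<in> sets lebesgue" using \<Omega> by simp
  have eB: "e i \<in> Basis" for i using e by (auto simp: bij_betw_def)
  have L: "u \<in> L2 \<Omega>" "v \<in> L2 \<Omega>" using u v by (auto simp: H1_def)
  have sq: "square_int (zero_ext \<Omega> (\<lambda>x. u x + c *\<^sub>R v x))" if "u \<in> L2 \<Omega>" "v \<in> L2 \<Omega>" for u v :: "'a \<Rightarrow> 'b"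
    using that unfolding L2_iff[OF S] zero_ext_add zero_ext_scaleR by (intro square_int_add square_int_scaleR)
  have elq: "el (zero_ext \<Omega> (\<lambda>x. u x + c *\<^sub>R v x)) = el (zero_ext \<Omega> u) + c *\<^sub>R el (zero_ext \<Omega> v)" if "u \<in> L2 \<Omega>" "v \<in> L2 \<Omega>" for u v :: "'a \<Rightarrow> 'b"
    using that unfolding L2_iff[OF S] zero_ext_add zero_ext_scaleR by (simp add: el_add el_scaleR square_int_scaleR)
  let ?w = "\<lambda>i x. weak_deriv \<Omega> (e i) u x + c *\<^sub>R weak_deriv \<Omega> (e i) v x"
  note wu = H1_weak_deriv[OF \<Omega> u eB] and wv = H1_weak_deriv[OF \<Omega> v eB]
  have L2: "(\<lambda>x. u x + c *\<^sub>R v x) \<in> L2 \<Omega>" "?w i \<in> L2 \<Omega>" for i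
    using sq[OF L] sq[OF wu(1) wv(1)] by (auto simp: L2_iff[OF S])
  have d: "is_weak_deriv \<Omega> (e i) (\<lambda>x. u x + c *\<^sub>R v x) (?w i)" for i
    using wu(2)[of i] wv(2)[of i]
    unfolding is_weak_deriv_iff[OF \<Omega> L(1) wu(1)[of i]] is_weak_deriv_iff[OF \<Omega> L(2) wv(1)[of i]] is_weak_deriv_iff[OF \<Omega> L2(1) L2(2)[of i]]
      elq[OF L] elq[OF wu(1)[of i] wv(1)[of i]] by (simp add: inner_add_left)
  show "(\<lambda>x. u x + c *\<^sub>R v x) \<in> H1 \<Omega>" by (rule H1I(1)[OF e \<Omega> L2 d])
  show "hvec e \<Omega> (\<lambda>x. u x + c *\<^sub>R v x) = hvec e \<Omega> u + c *\<^sub>R hvec e \<Omega> v"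
    unfolding H1I(2)[OF e \<Omega> L2 d] elq[OF L] elq[OF wu(1) wv(1)] by (simp add: hvec_def vec_eq_iff)
qed

lemma hvec_diff:
  assumes "bij_betw e UNIV Basis" "open \<Omega>" "u \<in> H1 \<Omega>" "v \<in> H1 \<Omega>"
  shows "(\<lambda>x. u x - v x) \<in> H1 \<Omega>" "hvec e \<Omega> (\<lambda>x. u x - v x) = hvec e \<Omega> u - hvec e \<Omega> v"
  using hvec_add_scaleR[OF assms, of "-1"] by simp_all

lemma hvec_add:
  assumes "bij_betw e UNIV Basis" "open \<Omega>" "u \<in> H1 \<Omega>" "v \<in> H1 \<Omega>"
  shows "(\<lambda>x. u x + v x) \<in> H1 \<Omega>" "hvec e \<Omega> (\<lambda>x. u x + v x) = hvec e \<Omega> u + hvec e \<Omega> v"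
  using hvec_add_scaleR[OF assms, of "1"] by simp_all

text \<open>Test functions of the smaller set are test functions of the larger one, so the weak
  derivatives of the larger set serve on the smaller. Needed for the boundary data, which are given
  once, on the largest domain.\<close>

lemma hvec_restrict:
  fixes u :: "'a::euclidean_space \<Rightarrow> 'b::euclidean_space" and e :: "'n::finite \<Rightarrow> 'a"
  assumes e: "bij_betw e UNIV Basis" and \<Omega>: "open \<Omega>" "open \<Omega>'" "\<Omega> \<subseteq> \<Omega>'" and u: "u \<in> H1 \<Omega>'"
  shows "u \<in> H1 \<Omega>" "hvec e \<Omega> u = (el (zero_ext \<Omega> u), \<chi> i. el (zero_ext \<Omega> (weak_deriv \<Omega>' (e i) u)))"
proof -
  have S: "\<Omega> \<in> sets lebesgue" "\<Omega>' \<in> sets lebesgue" using \<Omega> by auto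
  have eB: "e i \<in> Basis" for i using e by (auto simp: bij_betw_def)
  have zz: "zero_ext \<Omega> f = (\<lambda>x. indicator \<Omega> x *\<^sub>R zero_ext \<Omega>' f x)" for f :: "'a \<Rightarrow> 'b"
    using \<Omega>(3) by (intro ext) (auto simp: zero_ext_def indicator_def)
  have L: "f \<in> L2 \<Omega>" if "f \<in> L2 \<Omega>'" for f :: "'a \<Rightarrow> 'b"
  proof -
    have s: "square_int (zero_ext \<Omega>' f)" using that by (simp add: L2_iff[OF S(2)])
    then have m: "zero_ext \<Omega>' f \<in> borel_measurable lebesgue" by blast
    have "square_int (zero_ext \<Omega> f)"
      by (rule square_int_bound[where g = "\<lambda>x. (norm (zero_ext \<Omega>' f x))\<^sup>2"])
         (use s S m in \<open>auto simp: zz square_int_def power_mult_distrib indicator_def intro!: borel_measurable_scaleR\<close>)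
    then show ?thesis by (simp add: L2_iff[OF S(1)])
  qed
  note wu = H1_weak_deriv[OF \<Omega>(2) u eB]
  have i: "(LINT x|lebesgue_on \<Omega>. h x *\<^sub>R f x) = (LINT x|lebesgue_on \<Omega>'. h x *\<^sub>R f x)"
    if "\<And>x. x \<notin> \<Omega> \<Longrightarrow> h x = 0" for h :: "'a \<Rightarrow> real" and f :: "'a \<Rightarrow> 'b"
    unfolding integral_lebesgue_on[OF S(1)] integral_lebesgue_on[OF S(2)]
    by (rule Bochner_Integration.integral_cong) (use that \<Omega>(3) in \<open>auto simp: indicator_def\<close>)
  have d: "is_weak_deriv \<Omega> (e k) u (weak_deriv \<Omega>' (e k) u)" for k
    unfolding is_weak_deriv_def
  proof (intro allI impI)
    fix \<psi> :: "'a \<Rightarrow> real" assume t: "\<psi> \<in> test_functions \<Omega>"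
    then have t': "\<psi> \<in> test_functions \<Omega>'" using test_functions_mono[OF \<Omega>(3)] by blast
    show "(LINT x|lebesgue_on \<Omega>. frechet_derivative \<psi> (at x) (e k) *\<^sub>R u x) = - (LINT x|lebesgue_on \<Omega>. \<psi> x *\<^sub>R weak_deriv \<Omega>' (e k) u x)"
      using wu(2)[of k] t' i[OF test_functions_outside[OF t]] i[OF test_functions_outside[OF test_functions_dir_deriv[OF t eB]]]
      unfolding is_weak_deriv_def by simp
  qed
  have uL: "u \<in> L2 \<Omega>" using u L by (auto simp: H1_def)
  show "u \<in> H1 \<Omega>" "hvec e \<Omega> u = (el (zero_ext \<Omega> u), \<chi> i. el (zero_ext \<Omega> (weak_deriv \<Omega>' (e i) u)))"
    using H1I[OF e \<Omega>(1) uL L[OF wu(1)] d] by auto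
qed

text \<open>Formed with classical derivatives and without a domain: a test function gives the same
  element for every domain that contains its support.\<close>

definition h_graph :: "('n \<Rightarrow> 'a) \<Rightarrow> ('a::euclidean_space \<Rightarrow> 'b::euclidean_space) \<Rightarrow> ('a, 'b, 'n::finite) hv" where
  "h_graph e \<phi> = (el \<phi>, \<chi> i. el (dir_deriv (e i) \<phi>))"

text \<open>The space \<open>H\<^sub>0\<^sup>1\<close>.\<close>

definition HS :: "('n \<Rightarrow> 'a) \<Rightarrow> 'a::euclidean_space set \<Rightarrow> ('a, 'b::euclidean_space, 'n::finite) hv set" where
  "HS e \<Omega> = closure (h_graph e ` test_functions \<Omega>)"

lemma zero_ext_test: "\<phi> \<in> test_functions \<Omega> \<Longrightarrow> zero_ext \<Omega> \<phi> = \<phi>"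
  by (rule ext) (auto simp: zero_ext_def indicator_def test_functions_outside)

lemma hvec_test:
  fixes \<phi> :: "'a::euclidean_space \<Rightarrow> 'b::euclidean_space"
  assumes e: "bij_betw e UNIV Basis" and \<Omega>: "open \<Omega>" and t: "\<phi> \<in> test_functions \<Omega>"
  shows "\<phi> \<in> H1 \<Omega>" "hvec e \<Omega> \<phi> = h_graph e \<phi>"
proof -
  have S: "\<Omega> \<in> sets lebesgue" using \<Omega> by simp
  have eB: "e i \<in> Basis" for i using e by (auto simp: bij_betw_def)
  have L: "\<phi> \<in> L2 \<Omega>" "dir_deriv (e i) \<phi> \<in> L2 \<Omega>" for i
    unfolding L2_iff[OF S] zero_ext_test[OF t] zero_ext_test[OF test_functions_dir_deriv[OF t eB]]
    by (rule test_functions_square_int[OF t], rule test_functions_square_int[OF test_functions_dir_deriv[OF t eB]])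
  have d: "is_weak_deriv \<Omega> (e i) \<phi> (dir_deriv (e i) \<phi>)" for i
    unfolding is_weak_deriv_def integral_lebesgue_on[OF S]
  proof (intro allI impI)
    fix \<psi> :: "'a \<Rightarrow> real" assume t': "\<psi> \<in> test_functions \<Omega>"
    have 1: "indicator \<Omega> x *\<^sub>R frechet_derivative \<psi> (at x) (e i) *\<^sub>R \<phi> x = frechet_derivative \<psi> (at x) (e i) *\<^sub>R \<phi> x"
      "indicator \<Omega> x *\<^sub>R \<psi> x *\<^sub>R frechet_derivative \<phi> (at x) (e i) = \<psi> x *\<^sub>R frechet_derivative \<phi> (at x) (e i)" for x
      using test_functions_outside[OF t] test_functions_outside[OF t'] by (auto simp: indicator_def)
    show "(LINT x|lebesgue. indicator \<Omega> x *\<^sub>R frechet_derivative \<psi> (at x) (e i) *\<^sub>R \<phi> x) =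
         - (LINT x|lebesgue. indicator \<Omega> x *\<^sub>R \<psi> x *\<^sub>R frechet_derivative \<phi> (at x) (e i))"
      unfolding 1 by (rule test_functions_by_parts[OF t' t])
  qed
  show "\<phi> \<in> H1 \<Omega>" by (rule H1I(1)[OF e \<Omega> L d])
  show "hvec e \<Omega> \<phi> = h_graph e \<phi>"
    unfolding H1I(2)[OF e \<Omega> L d] h_graph_def using t test_functions_dir_deriv[OF t eB] by (simp add: zero_ext_test)
qed

lemma h_graph_add_scaleR:
  assumes eB: "\<And>i. e i \<in> Basis" and t: "\<phi> \<in> test_functions \<Omega>" "\<psi> \<in> test_functions \<Omega>"
  shows "h_graph e \<phi> + c *\<^sub>R h_graph e \<psi> = h_graph e (\<lambda>x. \<phi> x + c *\<^sub>R \<psi> x)"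
proof -
  have "frechet_derivative (\<lambda>x. \<phi> x + c *\<^sub>R \<psi> x) (at x) = (\<lambda>h. frechet_derivative \<phi> (at x) h + c *\<^sub>R frechet_derivative \<psi> (at x) h)" for x
    by (intro frechet_derivative_eq has_derivative_add has_derivative_scaleR_right test_functions_has_derivative[OF t(1)] test_functions_has_derivative[OF t(2)])
  then show ?thesis
    using test_functions_square_int[OF t(1)] test_functions_square_int[OF t(2)]
      frechet_test_square_int(1)[OF t(1)] frechet_test_square_int(1)[OF t(2)]
    by (simp add: h_graph_def vec_eq_iff el_add el_scaleR square_int_scaleR)
qed

lemma h_graph_zero: "h_graph e (\<lambda>x. 0) = 0"
  by (simp add: h_graph_def el_0 zero_prod_def vec_eq_iff)

lemma HS_seq:
  assumes "x \<in> HS e \<Omega>"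
  obtains \<phi> where "\<And>n. \<phi> n \<in> test_functions \<Omega>" "(\<lambda>n. h_graph e (\<phi> n)) \<longlonglongrightarrow> x"
proof -
  obtain y where y: "\<forall>n. y n \<in> h_graph e ` test_functions \<Omega>" "y \<longlonglongrightarrow> x"
    using assms unfolding HS_def closure_sequential by blast
  then have "\<forall>n. \<exists>\<phi>. \<phi> \<in> test_functions \<Omega> \<and> y n = h_graph e \<phi>" by blast
  then obtain \<phi> where *: "\<forall>n. \<phi> n \<in> test_functions \<Omega> \<and> y n = h_graph e (\<phi> n)" using choice by metis
  then have eq: "y = (\<lambda>n. h_graph e (\<phi> n))" by auto
  show ?thesis
  proof (rule that)
    show "\<phi> n \<in> test_functions \<Omega>" for n using * by blast
    show "(\<lambda>n. h_graph e (\<phi> n)) \<longlonglongrightarrow> x" using y(2) unfolding eq .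
  qed
qed

lemma HS_closed: "closed (HS e \<Omega>)" by (simp add: HS_def)
lemma HS_test: "\<phi> \<in> test_functions \<Omega> \<Longrightarrow> h_graph e \<phi> \<in> HS e \<Omega>"
  unfolding HS_def by (rule subsetD[OF closure_subset]) (rule imageI)
lemma HS_mono: "\<Omega> \<subseteq> \<Omega>' \<Longrightarrow> HS e \<Omega> \<subseteq> HS e \<Omega>'"
  unfolding HS_def by (intro closure_mono image_mono test_functions_mono)

lemma HS_add_scaleR:
  assumes eB: "\<And>i. e i \<in> Basis" and x: "x \<in> HS e \<Omega>" and y: "y \<in> HS e \<Omega>"
  shows "x + c *\<^sub>R y \<in> HS e \<Omega>"
proof -
  obtain \<phi> where f: "\<And>n. \<phi> n \<in> test_functions \<Omega>" "(\<lambda>n. h_graph e (\<phi> n)) \<longlonglongrightarrow> x" using HS_seq[OF x] by blast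
  obtain \<psi> where g: "\<And>n. \<psi> n \<in> test_functions \<Omega>" "(\<lambda>n. h_graph e (\<psi> n)) \<longlonglongrightarrow> y" using HS_seq[OF y] by blast
  have "(\<lambda>n. h_graph e (\<phi> n) + c *\<^sub>R h_graph e (\<psi> n)) \<longlonglongrightarrow> x + c *\<^sub>R y" by (intro tendsto_intros f g)
  moreover have "h_graph e (\<phi> n) + c *\<^sub>R h_graph e (\<psi> n) \<in> HS e \<Omega>" for n
    unfolding h_graph_add_scaleR[OF eB f(1) g(1)] by (intro HS_test test_functions_add test_functions_scaleR f g)
  ultimately show ?thesis by (rule closed_sequentially[OF HS_closed, rotated])
qed

lemma HS_subspace:
  fixes e :: "'n::finite \<Rightarrow> 'a::euclidean_space"
  assumes eB: "\<And>i. e i \<in> Basis" shows "subspace (HS e \<Omega> :: ('a, 'b::euclidean_space, 'n) hv set)"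
proof -
  have 0: "(0 :: ('a, 'b, 'n) hv) \<in> HS e \<Omega>" using HS_test[OF test_functions_zero, of e \<Omega>] by (simp add: h_graph_zero)
  show ?thesis
    unfolding subspace_def
  proof (intro conjI ballI allI)
    fix x y :: "('a, 'b, 'n) hv" and c assume xy: "x \<in> HS e \<Omega>" "y \<in> HS e \<Omega>"
    show "x + y \<in> HS e \<Omega>" using HS_add_scaleR[OF eB xy, of 1] by simp
    show "c *\<^sub>R x \<in> HS e \<Omega>" using HS_add_scaleR[OF eB 0 xy(1), of c] by simp
  qed (rule 0)
qed

lemma l2_limit_AE_zero:
  assumes "(\<lambda>n. el (f n)) \<longlonglongrightarrow> u" "\<And>n. square_int (f n)" "\<And>n x. x \<notin> S \<Longrightarrow> f n x = 0"
  shows "AE x in lebesgue. x \<notin> S \<longrightarrow> fn u x = 0"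
proof -
  obtain r where r: "AE x in lebesgue. (\<lambda>k. fn (el (f (r k))) x) \<longlonglongrightarrow> fn u x"
    using l2_AE_subseq[OF assms(1)] by blast
  have "AE x in lebesgue. \<forall>k. fn (el (f (r k))) x = f (r k) x"
    using fn_el[OF assms(2)] by (simp add: AE_all_countable)
  with r show ?thesis
  proof (elim AE_mp, intro AE_I2 impI)
    fix x assume *: "\<forall>k. fn (el (f (r k))) x = f (r k) x" "(\<lambda>k. fn (el (f (r k))) x) \<longlonglongrightarrow> fn u x" "x \<notin> S"
    then have "(\<lambda>k. 0) \<longlonglongrightarrow> fn u x" using assms(3) by simp
    then show "fn u x = 0" using LIMSEQ_unique[OF _ tendsto_const] by blast
  qed
qed

text \<open>Test functions and their derivatives vanish outside the set, and an a.e. convergent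
  subsequence carries this to the limits. Inner products with such elements do not see the other
  factor outside the set.\<close>

lemma HS_outside:
  assumes eB: "\<And>i. e i \<in> Basis" and x: "x \<in> HS e \<Omega>"
  shows "AE y in lebesgue. y \<notin> \<Omega> \<longrightarrow> fn (fst x) y = 0" "AE y in lebesgue. y \<notin> \<Omega> \<longrightarrow> fn (snd x $ i) y = 0"
proof -
  obtain \<phi> where f: "\<And>n. \<phi> n \<in> test_functions \<Omega>" "(\<lambda>n. h_graph e (\<phi> n)) \<longlonglongrightarrow> x" using HS_seq[OF x] by blast
  show "AE y in lebesgue. y \<notin> \<Omega> \<longrightarrow> fn (fst x) y = 0"
  proof (rule l2_limit_AE_zero)
    show "(\<lambda>n. el (\<phi> n)) \<longlonglongrightarrow> fst x" using tendsto_fst[OF f(2)] by (simp add: h_graph_def)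
  qed (use f(1) in \<open>auto intro: test_functions_square_int test_functions_outside\<close>)
  show "AE y in lebesgue. y \<notin> \<Omega> \<longrightarrow> fn (snd x $ i) y = 0"
  proof (rule l2_limit_AE_zero)
    show "(\<lambda>n. el (dir_deriv (e i) (\<phi> n))) \<longlonglongrightarrow> snd x $ i"
      using tendsto_vec_nth[OF tendsto_snd[OF f(2)], of i] by (simp add: h_graph_def)
    show "square_int (dir_deriv (e i) (\<phi> n))" for n
      by (rule test_functions_square_int[OF test_functions_dir_deriv[OF f(1) eB]])
    show "dir_deriv (e i) (\<phi> n) y = 0" if "y \<notin> \<Omega>" for n y
      by (rule test_functions_outside[OF test_functions_dir_deriv[OF f(1) eB] that])
  qed
qed

lemma zero_ext_fn:
  assumes "AE y in lebesgue. y \<notin> \<Omega> \<longrightarrow> fn u y = 0"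
  shows "square_int (zero_ext \<Omega> (fn u))" "el (zero_ext \<Omega> (fn u)) = u"
proof -
  have *: "AE y in lebesgue. fn u y = zero_ext \<Omega> (fn u) y"
    using assms by (auto elim!: AE_mp intro!: AE_I2 simp: zero_ext_def indicator_def)
  show "square_int (zero_ext \<Omega> (fn u))" by (rule square_int_cong_AE[OF square_int_fn *])
  show "el (zero_ext \<Omega> (fn u)) = u" using el_eqI[OF square_int_fn *] by simp
qed

text \<open>The norms of pairs and of vectors are Euclidean, so the norms of the function spaces are
  reproduced exactly, not only up to equivalence.\<close>

lemma H1_norm_hvec:
  fixes u :: "'a::euclidean_space \<Rightarrow> 'b::euclidean_space"
  assumes e: "bij_betw e UNIV Basis" and \<Omega>: "open \<Omega>" and u: "u \<in> H1 \<Omega>"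
  shows "L2_norm \<Omega> u = norm (fst (hvec e \<Omega> u))" "grad_norm \<Omega> u = norm (snd (hvec e \<Omega> u))" "H1_norm \<Omega> u = norm (hvec e \<Omega> u)"
proof -
  have S: "\<Omega> \<in> sets lebesgue" using \<Omega> by simp
  have eB: "e i \<in> Basis" for i using e by (auto simp: bij_betw_def)
  have *: "(LINT x|lebesgue_on \<Omega>. (norm (f x))\<^sup>2) = (norm (el (zero_ext \<Omega> f)))\<^sup>2" "integrable (lebesgue_on \<Omega>) (\<lambda>x. (norm (f x))\<^sup>2)" if "f \<in> L2 \<Omega>" for f :: "'a \<Rightarrow> 'b"
  proof -
    have s: "square_int (zero_ext \<Omega> f)" using that by (simp add: L2_iff[OF S])
    show "(LINT x|lebesgue_on \<Omega>. (norm (f x))\<^sup>2) = (norm (el (zero_ext \<Omega> f)))\<^sup>2"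
      unfolding norm_el[OF s] integral_lebesgue_on[OF S] by (rule Bochner_Integration.integral_cong) (auto simp: zero_ext_def indicator_def)
    show "integrable (lebesgue_on \<Omega>) (\<lambda>x. (norm (f x))\<^sup>2)" using that by (simp add: L2_def)
  qed
  have uL: "u \<in> L2 \<Omega>" using u by (simp add: H1_def)
  show 1: "L2_norm \<Omega> u = norm (fst (hvec e \<Omega> u))" by (simp add: L2_norm_def *(1)[OF uL] hvec_def)
  have "(LINT x|lebesgue_on \<Omega>. grad_inner \<Omega> u u x) = (\<Sum>b\<in>Basis. (norm (el (zero_ext \<Omega> (weak_deriv \<Omega> b u))))\<^sup>2)"
    unfolding grad_inner_def power2_norm_eq_inner[symmetric]
    using *[OF H1_weak_deriv(1)[OF \<Omega> u]] by (subst Bochner_Integration.integral_sum) auto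
  also have "\<dots> = (\<Sum>i\<in>UNIV. (norm (el (zero_ext \<Omega> (weak_deriv \<Omega> (e i) u))))\<^sup>2)"
    by (rule sum.reindex_bij_betw[OF e, symmetric])
  also have "\<dots> = (norm (snd (hvec e \<Omega> u)))\<^sup>2"
    by (simp add: hvec_def norm_vec_def L2_set_def sum_nonneg)
  finally show 2: "grad_norm \<Omega> u = norm (snd (hvec e \<Omega> u))" by (simp add: grad_norm_def)
  show "H1_norm \<Omega> u = norm (hvec e \<Omega> u)" unfolding H1_norm_def 1 2 by (simp add: norm_prod_def)
qed

lemma H10_hvec:
  assumes e: "bij_betw e UNIV Basis" and \<Omega>: "open \<Omega>" and u: "u \<in> H10 \<Omega>"
  shows "hvec e \<Omega> u \<in> HS e \<Omega>"
proof -
  obtain \<phi> where f: "\<And>n. \<phi> n \<in> test_functions \<Omega>" "(\<lambda>n. H1_norm \<Omega> (\<lambda>x. u x - \<phi> n x)) \<longlonglongrightarrow> 0" and uH: "u \<in> H1 \<Omega>"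
    using u by (auto simp: H10_def)
  have "H1_norm \<Omega> (\<lambda>x. u x - \<phi> n x) = norm (h_graph e (\<phi> n) - hvec e \<Omega> u)" for n
    using H1_norm_hvec(3)[OF e \<Omega> hvec_diff(1)[OF e \<Omega> uH hvec_test(1)[OF e \<Omega> f(1)]]]
    unfolding hvec_diff(2)[OF e \<Omega> uH hvec_test(1)[OF e \<Omega> f(1)]] hvec_test(2)[OF e \<Omega> f(1)] by (simp add: norm_minus_commute)
  then have "(\<lambda>n. norm (h_graph e (\<phi> n) - hvec e \<Omega> u)) \<longlonglongrightarrow> 0" using f(2) by simp
  then have "(\<lambda>n. h_graph e (\<phi> n)) \<longlonglongrightarrow> hvec e \<Omega> u" unfolding tendsto_norm_zero_iff by (rule LIM_zero_cancel)
  then show ?thesis using closed_sequentially[OF HS_closed _, of "\<lambda>n. h_graph e (\<phi> n)"] HS_test[OF f(1)] by blast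
qed

lemma HS_H10:
  fixes x :: "('a::euclidean_space, 'b::euclidean_space, 'n::finite) hv"
  assumes e: "bij_betw e UNIV Basis" and \<Omega>: "open \<Omega>" and x: "x \<in> HS e \<Omega>"
    and u: "square_int (zero_ext \<Omega> u)" "el (zero_ext \<Omega> u) = fst x"
  shows "u \<in> H10 \<Omega>" "hvec e \<Omega> u = x"
proof -
  have S: "\<Omega> \<in> sets lebesgue" using \<Omega> by simp
  have eB: "e i \<in> Basis" for i using e by (auto simp: bij_betw_def)
  obtain \<phi> where f: "\<And>n. \<phi> n \<in> test_functions \<Omega>" "(\<lambda>n. h_graph e (\<phi> n)) \<longlonglongrightarrow> x" using HS_seq[OF x] by blast
  note zw = zero_ext_fn[OF HS_outside(2)[OF eB x]]
  have uL: "u \<in> L2 \<Omega>" using u by (simp add: L2_iff[OF S])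
  have wL: "fn (snd x $ i) \<in> L2 \<Omega>" for i using zw(1) by (simp add: L2_iff[OF S])
  have d: "is_weak_deriv \<Omega> (e i) u (fn (snd x $ i))" for i
    unfolding is_weak_deriv_iff[OF \<Omega> uL wL] zw(2) u(2)
  proof (intro allI impI ballI)
    fix \<psi> :: "'a \<Rightarrow> real" and c :: 'b assume t: "\<psi> \<in> test_functions \<Omega>" and c: "c \<in> Basis"
    have "inner (fst (h_graph e (\<phi> n))) (el (\<lambda>x. frechet_derivative \<psi> (at x) (e i) *\<^sub>R c)) = - inner (snd (h_graph e (\<phi> n)) $ i) (el (\<lambda>x. \<psi> x *\<^sub>R c))" for n
    proof -
      have "inner (el (\<phi> n)) (el (\<lambda>x. frechet_derivative \<psi> (at x) (e i) *\<^sub>R c)) = (LINT x|lebesgue. frechet_derivative \<psi> (at x) (e i) *\<^sub>R \<phi> n x) \<bullet> c"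
        by (rule integral_scaleR_inner(1)[symmetric, OF frechet_test_square_int(1)[OF t] test_functions_square_int[OF f(1)]])
      also have "\<dots> = - ((LINT x|lebesgue. \<psi> x *\<^sub>R frechet_derivative (\<phi> n) (at x) (e i)) \<bullet> c)"
        unfolding test_functions_by_parts[OF t f(1)] by simp
      also have "\<dots> = - inner (el (dir_deriv (e i) (\<phi> n))) (el (\<lambda>x. \<psi> x *\<^sub>R c))"
        by (simp only: integral_scaleR_inner(1)[OF test_functions_square_int[OF t] frechet_test_square_int(1)[OF f(1)]])
      finally show ?thesis by (simp add: h_graph_def)
    qed
    moreover have "(\<lambda>n. inner (fst (h_graph e (\<phi> n))) (el (\<lambda>x. frechet_derivative \<psi> (at x) (e i) *\<^sub>R c))) \<longlonglongrightarrow> inner (fst x) (el (\<lambda>x. frechet_derivative \<psi> (at x) (e i) *\<^sub>R c))"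
      by (intro tendsto_intros f)
    moreover have "(\<lambda>n. - inner (snd (h_graph e (\<phi> n)) $ i) (el (\<lambda>x. \<psi> x *\<^sub>R c))) \<longlonglongrightarrow> - inner (snd x $ i) (el (\<lambda>x. \<psi> x *\<^sub>R c))"
      by (intro tendsto_intros f)
    ultimately show "inner (fst x) (el (\<lambda>x. frechet_derivative \<psi> (at x) (e i) *\<^sub>R c)) = - inner (snd x $ i) (el (\<lambda>x. \<psi> x *\<^sub>R c))"
      using LIMSEQ_unique by auto
  qed
  have uH: "u \<in> H1 \<Omega>" by (rule H1I(1)[OF e \<Omega> uL wL d])
  show hv: "hvec e \<Omega> u = x"
    unfolding H1I(2)[OF e \<Omega> uL wL d] zw(2) u(2) by (simp add: prod_eq_iff)
  have "H1_norm \<Omega> (\<lambda>x. u x - \<phi> n x) = norm (h_graph e (\<phi> n) - x)" for n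
    using H1_norm_hvec(3)[OF e \<Omega> hvec_diff(1)[OF e \<Omega> uH hvec_test(1)[OF e \<Omega> f(1)]]]
    unfolding hvec_diff(2)[OF e \<Omega> uH hvec_test(1)[OF e \<Omega> f(1)]] hvec_test(2)[OF e \<Omega> f(1)] hv by (simp add: norm_minus_commute)
  then have "(\<lambda>n. H1_norm \<Omega> (\<lambda>x. u x - \<phi> n x)) \<longlonglongrightarrow> 0"
    using tendsto_norm_zero[OF LIM_zero[OF f(2)]] by simp
  then show "u \<in> H10 \<Omega>" using uH f(1) unfolding H10_def by auto
qed

section \<open>Translation, Poincare and compactness\<close>

lemma norm_translate_diff_h_graph:
  fixes \<phi> :: "'a::euclidean_space \<Rightarrow> 'b::euclidean_space" and e :: "'n::finite \<Rightarrow> 'a"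
  assumes e: "bij_betw e UNIV Basis" and t: "\<phi> \<in> test_functions \<Omega>"
  shows "norm (el (\<lambda>x. \<phi> (x + z)) - el \<phi>) \<le> norm z * (real CARD('n) * norm (h_graph e \<phi>))"
proof -
  have eB: "e i \<in> Basis" for i using e by (auto simp: bij_betw_def)
  have sq: "square_int (dir_deriv (e i) \<phi>)" for i by (rule frechet_test_square_int(1)[OF t])
  have comp: "norm (el (dir_deriv (e i) \<phi>)) \<le> norm (h_graph e \<phi>)" for i
    using norm_snd_le[of "snd (h_graph e \<phi>)" "fst (h_graph e \<phi>)"] Finite_Cartesian_Product.norm_nth_le[of "snd (h_graph e \<phi>)" i]
    by (simp add: h_graph_def)
  have sums: "el (\<lambda>x. \<Sum>i\<in>I. (z \<bullet> e i) *\<^sub>R frechet_derivative \<phi> (at x) (e i)) = (\<Sum>i\<in>I. (z \<bullet> e i) *\<^sub>R el (dir_deriv (e i) \<phi>))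
      \<and> square_int (\<lambda>x. \<Sum>i\<in>I. (z \<bullet> e i) *\<^sub>R frechet_derivative \<phi> (at x) (e i))" if "finite I" for I
    using that
    by (induction I rule: finite_induct) (auto simp: el_0 el_add el_scaleR square_int_add square_int_scaleR sq)
  have "norm (el (\<lambda>x. \<phi> (x + z)) - el \<phi>) \<le> norm (el (\<lambda>x. frechet_derivative \<phi> (at x) z))"
    by (rule norm_translate_diff_le[OF t])
  also have "(\<lambda>x. frechet_derivative \<phi> (at x) z) = (\<lambda>x. \<Sum>i\<in>UNIV. (z \<bullet> e i) *\<^sub>R frechet_derivative \<phi> (at x) (e i))"
    by (rule ext, subst frechet_derivative_Basis[OF t], rule sum.reindex_bij_betw[OF e, symmetric])
  also have "norm (el \<dots>) = norm (\<Sum>i\<in>UNIV. (z \<bullet> e i) *\<^sub>R el (dir_deriv (e i) \<phi>))" using sums[of UNIV] by simp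
  also have "\<dots> \<le> (\<Sum>i\<in>(UNIV::'n set). norm z * norm (h_graph e \<phi>))"
  proof (rule order_trans[OF norm_sum], rule sum_mono)
    fix i
    show "norm ((z \<bullet> e i) *\<^sub>R el (dir_deriv (e i) \<phi>)) \<le> norm z * norm (h_graph e \<phi>)"
      using Basis_le_norm[OF eB[of i], of z] comp[of i] by (auto intro: mult_mono)
  qed
  finally show ?thesis by (simp add: mult_ac)
qed

text \<open>A translation by the unit vector \<open>b\<close> moves the set off itself, so the
  function is orthogonal to its translate and their difference has squared norm 2 |phi|^2. The
  translation estimate bounds this by the derivative in the direction \<open>b\<close>.\<close>

lemma poincare_test:
  fixes \<phi> :: "'a::euclidean_space \<Rightarrow> 'b::euclidean_space"
  assumes t: "\<phi> \<in> test_functions \<Omega>" and b: "b \<in> Basis" and \<Omega>: "\<And>x. x \<in> \<Omega> \<Longrightarrow> 0 < x \<bullet> b \<and> x \<bullet> b < 1"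
  shows "norm (el \<phi>) \<le> norm (el (dir_deriv b \<phi>))"
proof -
  have s: "square_int \<phi>" "square_int (\<lambda>x. \<phi> (x + b))" using test_functions_square_int[OF t] square_int_translate by auto
  have "\<phi> (x + b) \<bullet> \<phi> x = 0" for x
  proof (cases "x \<in> \<Omega>")
    case True
    then have "x + b \<notin> \<Omega>" using \<Omega>[of x] \<Omega>[of "x + b"] b by (auto simp: inner_add_left)
    then show ?thesis using test_functions_outside[OF t] by simp
  qed (use test_functions_outside[OF t] in simp)
  then have "inner (el (\<lambda>x. \<phi> (x + b))) (el \<phi>) = 0" using inner_el[OF s(2,1)] by simp
  then have "(norm (el (\<lambda>x. \<phi> (x + b)) - el \<phi>))\<^sup>2 = (norm (el (\<lambda>x. \<phi> (x + b))))\<^sup>2 + (norm (el \<phi>))\<^sup>2"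
    by (simp add: power2_norm_eq_inner inner_diff inner_commute)
  also have "\<dots> = 2 * (norm (el \<phi>))\<^sup>2" using norm_el_translate[OF s(1), of b] by simp
  finally have "2 * (norm (el \<phi>))\<^sup>2 \<le> (norm (el (dir_deriv b \<phi>)))\<^sup>2"
    using power_mono[OF norm_translate_diff_le[OF t, of b] norm_ge_zero, of 2] by simp
  then have "(norm (el \<phi>))\<^sup>2 \<le> (norm (el (dir_deriv b \<phi>)))\<^sup>2" using zero_le_power2[of "norm (el \<phi>)"] by linarith
  then show ?thesis by (rule power2_le_imp_le) simp
qed

lemma poincare_HS:
  assumes eB: "\<And>i. e i \<in> Basis" and x: "x \<in> HS e \<Omega>" and \<Omega>: "\<And>x. x \<in> \<Omega> \<Longrightarrow> 0 < x \<bullet> e i \<and> x \<bullet> e i < 1"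
  shows "norm (fst x) \<le> norm (snd x)"
proof -
  obtain \<phi> where f: "\<And>n. \<phi> n \<in> test_functions \<Omega>" "(\<lambda>n. h_graph e (\<phi> n)) \<longlonglongrightarrow> x" using HS_seq[OF x] by blast
  have "norm (fst (h_graph e (\<phi> n))) \<le> norm (snd (h_graph e (\<phi> n)))" for n
    using poincare_test[OF f(1)[of n] eB[of i] \<Omega>] Finite_Cartesian_Product.norm_nth_le[of "snd (h_graph e (\<phi> n))" i]
    by (simp add: h_graph_def)
  then show ?thesis
    by (intro LIMSEQ_le[OF tendsto_norm[OF tendsto_fst[OF f(2)]] tendsto_norm[OF tendsto_snd[OF f(2)]]]) auto
qed

text \<open>Averages over small balls turn weak into pointwise convergence, and stay uniformly close to the functions
  in \<open>L\<^sup>2\<close> by the translation estimate.\<close>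

definition ball_avg :: "real \<Rightarrow> ('a::euclidean_space \<Rightarrow> 'b::euclidean_space) \<Rightarrow> 'a \<Rightarrow> 'b" where
  "ball_avg r f x = (1 / measure lborel (ball (0::'a) r)) *\<^sub>R (LINT z|lborel. indicator (ball 0 r) z *\<^sub>R f (x + z))"

lemma ball_measure_pos: "r > 0 \<Longrightarrow> measure lborel (ball (0::'a::euclidean_space) r) > 0"
  using content_ball_pos by blast

lemma open_snd_ball: "open {p::'a::euclidean_space \<times> 'a. snd p \<in> ball 0 r}"
  unfolding mem_ball dist_0_norm by (intro open_Collect_less continuous_intros)

lemma ball_avg_borel:
  assumes [measurable]: "f \<in> borel_measurable borel"
  shows "ball_avg r f \<in> borel_measurable borel"
proof -
  have 1: "(\<lambda>p::'a \<times> 'a. f (fst p + snd p)) \<in> borel_measurable borel"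
    by (rule measurable_compose[OF borel_measurable_continuous_onI assms]) (intro continuous_intros)
  have "(\<lambda>p::'a \<times> 'a. indicator {p. snd p \<in> ball 0 r} p *\<^sub>R f (fst p + snd p)) \<in> borel_measurable borel"
    by (intro borel_measurable_scaleR borel_measurable_indicator 1 borel_open open_snd_ball)
  then have "(\<lambda>(x, z). indicator (ball (0::'a) r) z *\<^sub>R f (x + z)) \<in> borel_measurable (borel \<Otimes>\<^sub>M borel)"
    by (simp add: borel_prod case_prod_unfold indicator_def)
  then have "(\<lambda>(x, z). indicator (ball (0::'a) r) z *\<^sub>R f (x + z)) \<in> borel_measurable (borel \<Otimes>\<^sub>M lborel)"
    by (simp cong: measurable_cong_sets sets_pair_measure_cong)
  then have "(\<lambda>x. LINT z|lborel. indicator (ball 0 r) z *\<^sub>R f (x + z)) \<in> borel_measurable borel"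
    by (rule lborel.borel_measurable_lebesgue_integral)
  then show ?thesis unfolding ball_avg_def[abs_def] by measurable
qed

lemma bounded_borel_integrable:
  fixes g :: "'a::euclidean_space \<Rightarrow> 'b::euclidean_space"
  assumes [measurable]: "g \<in> borel_measurable borel" and b: "\<And>x. norm (g x) \<le> B" 
  shows "integrable lborel (\<lambda>z. indicator (ball a r) z *\<^sub>R g z)"
proof (rule integrableI_bounded_set_indicator[where B = B])
  show "emeasure lborel (ball a r) < \<infinity>" using emeasure_lborel_ball_finite by blast
qed (use b in auto)

text \<open>The difference is an average of translation differences. Jensen's inequality bounds its
  square by the average of the squares, and Tonelli's theorem lets x be integrated first, where the
  hypothesis on translates applies.\<close>

lemma ball_avg_diff_le:
  fixes \<phi> :: "'a::euclidean_space \<Rightarrow> 'b::euclidean_space"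
  assumes t: "\<phi> \<in> test_functions \<Omega>" and r: "r > 0" and B: "\<And>z. norm z < r \<Longrightarrow> norm (el (\<lambda>x. \<phi> (x + z)) - el \<phi>) \<le> B"
  shows "square_int (\<lambda>x. \<phi> x - ball_avg r \<phi> x)" "norm (el (\<lambda>x. \<phi> x - ball_avg r \<phi> x)) \<le> B"
proof -
  note [measurable] = test_functions_borel[OF t]
  let ?V = "measure lborel (ball (0::'a) r)"
  have V: "?V > 0" by (rule ball_measure_pos[OF r])
  have eV: "emeasure lborel (ball (0::'a) r) = ennreal ?V"
    using emeasure_lborel_ball_finite[of 0 r] by (intro emeasure_eq_ennreal_measure) (auto simp: less_top)
  have B0: "B \<ge> 0" using order_trans[OF norm_ge_zero B[of 0]] r by simp
  obtain K where K: "\<And>x. norm (\<phi> x) \<le> K" using test_functions_dominated[OF t] 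
    by (metis (no_types, opaque_lifting) indicator_le_1 mult.right_neutral mult_left_mono order_trans)
  let ?d = "\<lambda>x. \<phi> x - ball_avg r \<phi> x"
  have dm[measurable]: "?d \<in> borel_measurable borel" using ball_avg_borel[of \<phi> r] by measurable
  have pt: "ennreal ((norm (?d x))\<^sup>2) \<le> (\<integral>\<^sup>+z. ennreal (indicator (ball 0 r) z / ?V * (norm (\<phi> (x + z) - \<phi> x))\<^sup>2) \<partial>lborel)" for x
  proof -
    let ?g = "\<lambda>z. indicator (ball 0 r) z *\<^sub>R (\<phi> (x + z) - \<phi> x)"
    have i1: "integrable lborel (\<lambda>z. indicator (ball 0 r) z *\<^sub>R \<phi> (x + z))" by (rule bounded_borel_integrable[where B = K]) (use K in auto)
    have i2: "integrable lborel (\<lambda>z. indicator (ball (0::'a) r) z *\<^sub>R \<phi> x)" by (rule bounded_borel_integrable[where B = K]) (use K in auto)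
    have bd: "norm (\<phi> (x + z) - \<phi> x) \<le> 2 * K" for z
      using norm_triangle_ineq4[of "\<phi> (x + z)" "\<phi> x"] K[of x] K[of "x + z"] by linarith
    have i3: "integrable lborel (\<lambda>z. indicator (ball 0 r) z * norm (\<phi> (x + z) - \<phi> x))"
      using bounded_borel_integrable[of "\<lambda>z. norm (\<phi> (x + z) - \<phi> x)" "2 * K" 0 r] bd by simp
    have i4: "integrable lborel (\<lambda>z. indicator (ball 0 r) z * (norm (\<phi> (x + z) - \<phi> x))\<^sup>2)"
      using bounded_borel_integrable[of "\<lambda>z. (norm (\<phi> (x + z) - \<phi> x))\<^sup>2" "(2 * K)\<^sup>2" 0 r] power_mono[OF bd norm_ge_zero, of _ 2] by simp
    let ?a = "LINT z|lborel. indicator (ball 0 r) z * norm (\<phi> (x + z) - \<phi> x)"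
    let ?s = "LINT z|lborel. indicator (ball 0 r) z * (norm (\<phi> (x + z) - \<phi> x))\<^sup>2"
    have "(LINT z|lborel. indicator (ball (0::'a) r) z *\<^sub>R \<phi> x) = ?V *\<^sub>R \<phi> x"
      by (subst integral_scaleR_left) (auto intro!: integrable_real_indicator emeasure_lborel_ball_finite)
    then have "?V *\<^sub>R ?d x = - (LINT z|lborel. ?g z)"
      using V i1 i2 by (simp add: ball_avg_def scaleR_right_diff_distrib)
    then have "norm (?V *\<^sub>R ?d x) = norm (LINT z|lborel. ?g z)" by (simp only: norm_minus_cancel)
    then have "?V * norm (?d x) = norm (LINT z|lborel. ?g z)" using V by (simp only: norm_scaleR abs_of_pos)
    also have "\<dots> \<le> (LINT z|lborel. norm (?g z))" by (rule integral_norm_bound)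
    also have "\<dots> = ?a" by (intro Bochner_Integration.integral_cong) auto
    finally have 1: "?V * norm (?d x) \<le> ?a" .
    \<comment> \<open>Jensen's inequality by hand: expanding a nonnegative square and inserting the
      bound on \<open>norm (?d x)\<close> gives (norm (?d x))^2 V \<le> s, where V is the volume of
      the ball.\<close>
    have "0 \<le> (LINT z|lborel. indicator (ball 0 r) z * (norm (\<phi> (x + z) - \<phi> x) - norm (?d x))\<^sup>2)"
      by (intro Bochner_Integration.integral_nonneg) auto
    also have "\<dots> = (LINT z|lborel. indicator (ball 0 r) z * (norm (\<phi> (x + z) - \<phi> x))\<^sup>2 - 2 * norm (?d x) * (indicator (ball 0 r) z * norm (\<phi> (x + z) - \<phi> x)) + (norm (?d x))\<^sup>2 * indicator (ball 0 r) z)"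
      by (intro Bochner_Integration.integral_cong) (auto simp: power2_diff algebra_simps)
    also have "\<dots> = ?s - 2 * norm (?d x) * ?a + (norm (?d x))\<^sup>2 * ?V"
      using i3 i4 bounded_borel_integrable[of "\<lambda>z::'a. 1::real" 1 0 r] by (simp add: emeasure_lborel_ball_finite)
    finally have "0 \<le> ?s - 2 * norm (?d x) * ?a + (norm (?d x))\<^sup>2 * ?V" .
    moreover have "norm (?d x) * (?V * norm (?d x)) \<le> norm (?d x) * ?a" using 1 by (rule mult_left_mono) simp
    ultimately have "(norm (?d x))\<^sup>2 * ?V \<le> ?s" by (simp add: power2_eq_square algebra_simps)
    then have "(norm (?d x))\<^sup>2 \<le> ?s / ?V" using V by (simp add: field_simps)
    also have "?s / ?V = (LINT z|lborel. indicator (ball 0 r) z / ?V * (norm (\<phi> (x + z) - \<phi> x))\<^sup>2)"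
      by (simp add: integral_divide_zero[symmetric] del: integral_divide_zero)
    finally have "ennreal ((norm (?d x))\<^sup>2) \<le> ennreal (LINT z|lborel. indicator (ball 0 r) z / ?V * (norm (\<phi> (x + z) - \<phi> x))\<^sup>2)"
      by (rule ennreal_leI)
    also have "\<dots> = (\<integral>\<^sup>+z. ennreal (indicator (ball 0 r) z / ?V * (norm (\<phi> (x + z) - \<phi> x))\<^sup>2) \<partial>lborel)"
    proof (rule nn_integral_eq_integral[symmetric])
      show "integrable lborel (\<lambda>z. indicator (ball 0 r) z / ?V * (norm (\<phi> (x + z) - \<phi> x))\<^sup>2)"
        using integrable_divide_zero[OF i4, of ?V] by simp
    qed (use V in auto)
    finally show ?thesis .
  qed
  have "(\<integral>\<^sup>+x. ennreal ((norm (?d x))\<^sup>2) \<partial>lborel) \<le> (\<integral>\<^sup>+x. (\<integral>\<^sup>+z. ennreal (indicator (ball 0 r) z / ?V * (norm (\<phi> (x + z) - \<phi> x))\<^sup>2) \<partial>lborel) \<partial>lborel)"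
    by (intro nn_integral_mono pt)
  also have "\<dots> = (\<integral>\<^sup>+z. (\<integral>\<^sup>+x. ennreal (indicator (ball 0 r) z / ?V * (norm (\<phi> (x + z) - \<phi> x))\<^sup>2) \<partial>lborel) \<partial>lborel)"
  proof (rule lborel_pair.Fubini'[symmetric])
    have "(\<lambda>p::'a \<times> 'a. \<phi> (fst p + snd p)) \<in> borel_measurable borel" "(\<lambda>p::'a \<times> 'a. \<phi> (fst p)) \<in> borel_measurable borel"
      by (rule measurable_compose[OF borel_measurable_continuous_onI test_functions_borel[OF t]], intro continuous_intros)+
    then have "(\<lambda>p::'a \<times> 'a. ennreal (indicator {p. snd p \<in> ball 0 r} p / ?V * (norm (\<phi> (fst p + snd p) - \<phi> (fst p)))\<^sup>2)) \<in> borel_measurable borel"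
      by (intro measurable_compose[OF _ measurable_ennreal] borel_measurable_times borel_measurable_divide borel_measurable_power
          borel_measurable_const borel_measurable_indicator borel_open open_snd_ball measurable_compose[OF _ borel_measurable_norm] borel_measurable_diff)
    then show "(\<lambda>(x, z). ennreal (indicator (ball 0 r) z / ?V * (norm (\<phi> (x + z) - \<phi> x))\<^sup>2)) \<in> borel_measurable (lborel \<Otimes>\<^sub>M lborel)"
      by (simp add: lborel_prod case_prod_unfold indicator_def)
  qed
  also have "\<dots> \<le> (\<integral>\<^sup>+z. ennreal (B\<^sup>2 / ?V) * indicator (ball (0::'a) r) z \<partial>lborel)"
  proof (rule nn_integral_mono)
    fix z :: 'a
    show "(\<integral>\<^sup>+x. ennreal (indicator (ball 0 r) z / ?V * (norm (\<phi> (x + z) - \<phi> x))\<^sup>2) \<partial>lborel) \<le> ennreal (B\<^sup>2 / ?V) * indicator (ball 0 r) z"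
    proof (cases "z \<in> ball 0 r")
      case True
      have s: "square_int \<phi>" "square_int (\<lambda>x. \<phi> (x + z))" using test_functions_square_int[OF t] square_int_translate by auto
      have "(\<integral>\<^sup>+x. ennreal ((norm (\<phi> (x + z) - \<phi> x))\<^sup>2) \<partial>lborel) = (\<integral>\<^sup>+x. ennreal ((norm (\<phi> (x + z) - \<phi> x))\<^sup>2) \<partial>lebesgue)"
        by (rule nn_integral_completion[symmetric])
      also have "\<dots> = ennreal ((norm (el (\<lambda>x. \<phi> (x + z)) - el \<phi>))\<^sup>2)"
        using nn_integral_norm_el[OF square_int_diff[OF s(2,1)]] by (simp add: el_diff[OF s(2,1)])
      also have "\<dots> \<le> ennreal (B\<^sup>2)" using B[of z] True by (intro ennreal_leI power_mono) auto
      finally have "ennreal (1 / ?V) * (\<integral>\<^sup>+x. ennreal ((norm (\<phi> (x + z) - \<phi> x))\<^sup>2) \<partial>lborel) \<le> ennreal (1 / ?V) * ennreal (B\<^sup>2)"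
        by (rule mult_left_mono) simp
      then show ?thesis using True V
        by (simp add: nn_integral_cmult[symmetric] ennreal_mult'[symmetric])
    qed simp
  qed
  also have "\<dots> = ennreal (B\<^sup>2 / ?V) * ennreal ?V" unfolding eV[symmetric] by (rule nn_integral_cmult_indicator) simp
  also have "\<dots> = ennreal (B\<^sup>2)" using V by (simp add: ennreal_mult'[symmetric])
  finally have main: "(\<integral>\<^sup>+x. ennreal ((norm (?d x))\<^sup>2) \<partial>lebesgue) \<le> ennreal (B\<^sup>2)" by (simp add: nn_integral_completion)
  show s: "square_int ?d"
    unfolding square_int_def
  proof (intro conjI integrableI_bounded)
    show "?d \<in> borel_measurable lebesgue" by (intro measurable_completion) measurable
    then show "(\<lambda>x. (norm (?d x))\<^sup>2) \<in> borel_measurable lebesgue" by measurable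
    show "(\<integral>\<^sup>+x. ennreal (norm ((norm (?d x))\<^sup>2)) \<partial>lebesgue) < \<infinity>" using main by (simp add: le_less_trans)
  qed
  have "ennreal ((norm (el ?d))\<^sup>2) \<le> ennreal (B\<^sup>2)" using main nn_integral_norm_el[OF s] by simp
  then have "(norm (el ?d))\<^sup>2 \<le> B\<^sup>2" by simp
  then show "norm (el ?d) \<le> B" using B0 by (rule power2_le_imp_le)
qed

text \<open>The average at a point is a bounded linear functional of the class of the function,
  which is how weak convergence becomes pointwise.\<close>

lemma ball_avg_inner:
  fixes \<phi> :: "'a::euclidean_space \<Rightarrow> 'b::euclidean_space"
  assumes t: "\<phi> \<in> test_functions \<Omega>"
  shows "ball_avg r \<phi> x \<bullet> c = inner (el \<phi>) (el (\<lambda>y. indicator (ball x r) y *\<^sub>R c)) / measure lborel (ball (0::'a) r)"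
proof -
  note [measurable] = test_functions_borel[OF t]
  let ?f = "\<lambda>y. indicator (ball x r) y *\<^sub>R \<phi> y"
  have fb[measurable]: "?f \<in> borel_measurable borel"
    by (intro borel_measurable_scaleR borel_measurable_indicator test_functions_borel[OF t]) simp
  then have fm: "?f \<in> borel_measurable lebesgue" by (intro measurable_completion) simp
  have s: "square_int (\<lambda>y. indicator (ball x r) y *\<^sub>R (1::real))" by (rule square_int_indicator) auto
  have "(LINT z|lborel. indicator (ball 0 r) z *\<^sub>R \<phi> (x + z)) = (LINT z|lborel. ?f (z + x))"
    by (intro Bochner_Integration.integral_cong) (auto simp: indicator_def dist_norm add.commute)
  also have "\<dots> = (LINT z|lebesgue. ?f (z + x))" by (rule integral_completion[symmetric]) measurable
  also have "\<dots> = (LINT z|lebesgue. ?f z)" by (rule integral_lebesgue_translate[OF fm])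
  finally have "(LINT z|lborel. indicator (ball 0 r) z *\<^sub>R \<phi> (x + z)) \<bullet> c = (LINT z|lebesgue. (indicator (ball x r) z *\<^sub>R 1) *\<^sub>R \<phi> z) \<bullet> c" by simp
  also have "\<dots> = inner (el \<phi>) (el (\<lambda>y. (indicator (ball x r) y *\<^sub>R 1) *\<^sub>R c))"
    by (rule integral_scaleR_inner(1)[OF s test_functions_square_int[OF t]])
  finally show ?thesis by (simp add: ball_avg_def)
qed

lemma ball_avg_bound:
  fixes \<phi> :: "'a::euclidean_space \<Rightarrow> 'b::euclidean_space"
  assumes t: "\<phi> \<in> test_functions \<Omega>" and r: "r > 0"
  shows "norm (ball_avg r \<phi> x) \<le> norm (el \<phi>) * (\<Sum>c\<in>(Basis::'b set). norm (el (\<lambda>y::'a. indicator (ball 0 r) y *\<^sub>R c))) / measure lborel (ball (0::'a) r)"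
proof -
  have V: "measure lborel (ball (0::'a) r) > 0" by (rule ball_measure_pos[OF r])
  have n: "norm (el (\<lambda>y. indicator (ball x r) y *\<^sub>R c)) = norm (el (\<lambda>y::'a. indicator (ball 0 r) y *\<^sub>R c))" for c :: 'b
  proof -
    have "(\<lambda>y::'a. indicator (ball x r) y *\<^sub>R c) = (\<lambda>y. (\<lambda>y. indicator (ball 0 r) y *\<^sub>R c) (y + - x))"
      by (auto simp: indicator_def dist_norm norm_minus_commute)
    then show ?thesis using norm_el_translate[of "\<lambda>y::'a. indicator (ball 0 r) y *\<^sub>R c" "- x"] square_int_indicator[of "ball (0::'a) r" c] by simp
  qed
  have "norm (ball_avg r \<phi> x) \<le> (\<Sum>c\<in>Basis. \<bar>ball_avg r \<phi> x \<bullet> c\<bar>)" by (rule norm_le_l1)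
  also have "\<dots> \<le> (\<Sum>c\<in>(Basis::'b set). norm (el \<phi>) * norm (el (\<lambda>y::'a. indicator (ball 0 r) y *\<^sub>R c)) / measure lborel (ball (0::'a) r))"
  proof (rule sum_mono)
    fix c :: 'b
    show "\<bar>ball_avg r \<phi> x \<bullet> c\<bar> \<le> norm (el \<phi>) * norm (el (\<lambda>y::'a. indicator (ball 0 r) y *\<^sub>R c)) / measure lborel (ball (0::'a) r)"
      unfolding ball_avg_inner[OF t] n[symmetric] abs_divide
      using V Cauchy_Schwarz_ineq2[of "el \<phi>" "el (\<lambda>y. indicator (ball x r) y *\<^sub>R c)"] by (simp add: divide_right_mono)
  qed
  finally show ?thesis by (simp add: sum_distrib_left sum_divide_distrib)
qed

lemma ball_avg_outside:
  assumes t: "\<phi> \<in> test_functions \<Omega>" and \<Omega>: "\<Omega> \<subseteq> cball 0 R" and x: "norm x > R + r"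
  shows "ball_avg r \<phi> x = 0"
proof -
  have "indicator (ball 0 r) z *\<^sub>R \<phi> (x + z) = 0" for z
  proof (cases "norm z < r")
    case True
    then have "norm (x + z) > R" using x norm_triangle_ineq4[of "x + z" z] by simp
    then have "x + z \<notin> \<Omega>" using \<Omega> by auto
    then show ?thesis using test_functions_outside[OF t] by simp
  qed (simp add: indicator_def)
  then have "(\<lambda>z. indicator (ball 0 r) z *\<^sub>R \<phi> (x + z)) = (\<lambda>z. 0)" by (rule ext)
  then show ?thesis by (simp add: ball_avg_def)
qed

lemma rellich_test:
  fixes \<phi> :: "nat \<Rightarrow> 'a::euclidean_space \<Rightarrow> 'b::euclidean_space" and e :: "'n::finite \<Rightarrow> 'a"
  assumes e: "bij_betw e UNIV Basis" and t: "\<And>n. \<phi> n \<in> test_functions \<Omega>" and \<Omega>: "bounded \<Omega>"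
    and B: "\<And>n. norm (h_graph e (\<phi> n)) \<le> B" and w: "weakly_to (\<lambda>n. el (\<phi> n)) 0"
  shows "(\<lambda>n. el (\<phi> n)) \<longlonglongrightarrow> 0"
proof -
  obtain R where R: "\<Omega> \<subseteq> cball 0 R" using bounded_subset_ballD[OF \<Omega>, of 0] ball_subset_cball by blast
  have B0: "B \<ge> 0" using order_trans[OF norm_ge_zero B[of 0]] .
  have avg0: "(\<lambda>n. el (ball_avg r (\<phi> n))) \<longlonglongrightarrow> 0 \<and> (\<forall>n. square_int (ball_avg r (\<phi> n)))" if r: "r > 0" for r
  proof -
    define D where "D = B * (\<Sum>c\<in>(Basis::'b set). norm (el (\<lambda>y::'a. indicator (ball 0 r) y *\<^sub>R c))) / measure lborel (ball (0::'a) r)"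
    have V: "measure lborel (ball (0::'a) r) > 0" by (rule ball_measure_pos[OF r])
    have D0: "D \<ge> 0" using B0 V by (simp add: D_def sum_nonneg)
    \<comment> \<open>Averaging enlarges the support by at most \<open>r\<close>, so a constant on
      one ball dominates all averages.\<close>
    have g: "square_int (\<lambda>x::'a. indicator (cball 0 (R + r)) x *\<^sub>R D)" by (rule square_int_indicator) auto
    have m: "ball_avg r (\<phi> n) \<in> borel_measurable lebesgue" for n
      using ball_avg_borel[OF test_functions_borel[OF t[of n]], of r] by (intro measurable_completion) simp
    have b: "AE x in lebesgue. norm (ball_avg r (\<phi> n) x) \<le> norm (indicator (cball 0 (R + r)) x *\<^sub>R D)" for n
    proof (rule AE_I2)
      fix x
      show "norm (ball_avg r (\<phi> n) x) \<le> norm (indicator (cball 0 (R + r)) x *\<^sub>R D)"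
      proof (cases "norm x > R + r")
        case True
        then show ?thesis using ball_avg_outside[OF t R True] by simp
      next
        case False
        have "norm (el (\<phi> n)) \<le> B"
          using norm_fst_le[of "fst (h_graph e (\<phi> n))" "snd (h_graph e (\<phi> n))"] B[of n] by (simp add: h_graph_def)
        then have "norm (ball_avg r (\<phi> n) x) \<le> D"
          unfolding D_def using V
          by (intro order_trans[OF ball_avg_bound[OF t r]] divide_right_mono mult_right_mono sum_nonneg) auto
        then show ?thesis using False D0 by simp
      qed
    qed
    have l: "AE x in lebesgue. (\<lambda>n. ball_avg r (\<phi> n) x) \<longlonglongrightarrow> 0"
    proof (rule AE_I2)
      fix x
      show "(\<lambda>n. ball_avg r (\<phi> n) x) \<longlonglongrightarrow> 0"
      proof (rule tendsto_componentwise_iff[THEN iffD2], rule ballI)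
        fix c :: 'b
        have "(\<lambda>n. inner (el (\<phi> n)) (el (\<lambda>y. indicator (ball x r) y *\<^sub>R c)) / measure lborel (ball (0::'a) r)) \<longlonglongrightarrow> inner 0 (el (\<lambda>y. indicator (ball x r) y *\<^sub>R c)) / measure lborel (ball (0::'a) r)"
          using w V by (intro tendsto_divide tendsto_const) (auto simp: weakly_to_def)
        then show "(\<lambda>n. ball_avg r (\<phi> n) x \<bullet> c) \<longlonglongrightarrow> 0 \<bullet> c" by (simp add: ball_avg_inner[OF t])
      qed
    qed
    show ?thesis using el_dominated(1,3)[OF m g b l] by (simp add: el_0)
  qed
  show ?thesis
  proof (rule LIMSEQ_I)
    fix \<epsilon> :: real assume \<epsilon>: "\<epsilon> > 0"
    \<comment> \<open>The summand 1 keeps \<open>c\<close> positive. The radius \<epsilon>/(2c) then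
      limits the error of averaging to \<epsilon>/2 for all n at once and leaves \<epsilon>/2 for
      the averages.\<close>
    define c where "c = real CARD('n) * B + 1"
    have c: "c > 0" using B0 by (simp add: c_def add_nonneg_pos)
    define r where "r = \<epsilon> / (2 * c)"
    have r: "r > 0" using \<epsilon> c by (simp add: r_def)
    obtain N where N: "\<And>n. n \<ge> N \<Longrightarrow> norm (el (ball_avg r (\<phi> n)) - 0) < \<epsilon> / 2"
      using LIMSEQ_D[OF conjunct1[OF avg0[OF r]], of "\<epsilon>/2"] \<epsilon> by auto
    have "norm (el (\<phi> n) - 0) < \<epsilon>" if n: "n \<ge> N" for n
    proof -
      have bound: "norm (el (\<lambda>x. \<phi> n (x + z)) - el (\<phi> n)) \<le> r * c" if z: "norm z < r" for z
      proof -
        have "norm (el (\<lambda>x. \<phi> n (x + z)) - el (\<phi> n)) \<le> norm z * (real CARD('n) * norm (h_graph e (\<phi> n)))"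
          by (rule norm_translate_diff_h_graph[OF e t])
        also have "\<dots> \<le> r * c"
        proof (rule mult_mono)
          have "real CARD('n) * norm (h_graph e (\<phi> n)) \<le> real CARD('n) * B" by (intro mult_left_mono B) simp
          then show "real CARD('n) * norm (h_graph e (\<phi> n)) \<le> c" unfolding c_def by linarith
        qed (use z r in auto)
        finally show ?thesis .
      qed
      have s: "square_int (ball_avg r (\<phi> n))" using avg0[OF r] by blast
      have "norm (el (\<phi> n) - el (ball_avg r (\<phi> n))) \<le> r * c"
        using ball_avg_diff_le(2)[OF t r bound] by (simp add: el_diff[OF test_functions_square_int[OF t] s])
      moreover have "r * c = \<epsilon> / 2" using c by (simp add: r_def)
      moreover have "norm (el (\<phi> n)) \<le> norm (el (\<phi> n) - el (ball_avg r (\<phi> n))) + norm (el (ball_avg r (\<phi> n)))"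
        using norm_triangle_ineq[of "el (\<phi> n) - el (ball_avg r (\<phi> n))" "el (ball_avg r (\<phi> n))"] by simp
      ultimately show ?thesis using N[OF n] by simp
    qed
    then show "\<exists>no. \<forall>n\<ge>no. norm (el (\<phi> n) - 0) < \<epsilon>" by blast
  qed
qed

section \<open>Weak convergence of pairs and the compact embedding\<close>

lemma tendsto_imp_weakly_to: "x \<longlonglongrightarrow> l \<Longrightarrow> weakly_to x l"
  unfolding weakly_to_def by (intro allI tendsto_intros)

lemma weakly_to_diff: "weakly_to x l \<Longrightarrow> weakly_to y m \<Longrightarrow> weakly_to (\<lambda>n. x n - y n) (l - m)"
  unfolding weakly_to_def inner_diff_left by (auto intro: tendsto_diff)

lemma weakly_to_fst: "weakly_to x l \<Longrightarrow> weakly_to (\<lambda>n. fst (x n)) (fst l)"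
  unfolding weakly_to_def
proof
  fix g assume *: "\<forall>g. (\<lambda>n. inner (x n) g) \<longlonglongrightarrow> inner l g"
  show "(\<lambda>n. inner (fst (x n)) g) \<longlonglongrightarrow> inner (fst l) g" using *[rule_format, of "(g, 0)"] by (simp add: inner_prod_def)
qed

lemma weakly_to_snd: "weakly_to x l \<Longrightarrow> weakly_to (\<lambda>n. snd (x n)) (snd l)"
  unfolding weakly_to_def
proof
  fix g assume *: "\<forall>g. (\<lambda>n. inner (x n) g) \<longlonglongrightarrow> inner l g"
  show "(\<lambda>n. inner (snd (x n)) g) \<longlonglongrightarrow> inner (snd l) g" using *[rule_format, of "(0, g)"] by (simp add: inner_prod_def)
qed

text \<open>The differences \<open>x n - l\<close> are replaced by test functions closer than
  1/(n+1); these inherit boundedness and weak convergence to 0, so the case of test functions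
  applies.\<close>

lemma rellich_HS:
  fixes x :: "nat \<Rightarrow> ('a::euclidean_space, 'b::euclidean_space, 'n::finite) hv"
  assumes e: "bij_betw e UNIV Basis" and \<Omega>: "bounded \<Omega>"
    and x: "\<And>n. x n \<in> HS e \<Omega>" and B: "\<And>n. norm (x n) \<le> B" and w: "weakly_to x l"
  shows "l \<in> HS e \<Omega>" "(\<lambda>n. fst (x n)) \<longlonglongrightarrow> fst l"
proof -
  have eB: "e i \<in> Basis" for i using e by (auto simp: bij_betw_def)
  have sub: "subspace (HS e \<Omega> :: ('a, 'b, 'n) hv set)" by (rule HS_subspace[OF eB])
  show l: "l \<in> HS e \<Omega>" by (rule weakly_closed[OF w B HS_closed subspace_imp_convex[OF sub] x])
  have "\<exists>\<phi>. \<phi> \<in> test_functions \<Omega> \<and> norm (h_graph e \<phi> - (x n - l)) < 1 / Suc n" for n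
  proof -
    have "x n - l \<in> HS e \<Omega>" by (rule subspace_diff[OF sub x l])
    then obtain \<psi> where p: "\<And>n. \<psi> n \<in> test_functions \<Omega>" "(\<lambda>n. h_graph e (\<psi> n)) \<longlonglongrightarrow> x n - l" by (rule HS_seq) blast
    then obtain k where "norm (h_graph e (\<psi> k) - (x n - l)) < 1 / Suc n" using LIMSEQ_D[OF p(2), of "1 / Suc n"] by auto
    then show ?thesis using p(1) by blast
  qed
  then obtain \<phi> where f: "\<And>n. \<phi> n \<in> test_functions \<Omega>" "\<And>n. norm (h_graph e (\<phi> n) - (x n - l)) < 1 / Suc n" by metis
  have d: "(\<lambda>n. h_graph e (\<phi> n) - (x n - l)) \<longlonglongrightarrow> 0"
    by (rule Lim_null_comparison[OF _ LIMSEQ_Suc[OF lim_const_over_n[of 1]]]) (use f(2) in \<open>auto intro!: always_eventually less_imp_le\<close>)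
  have "weakly_to (\<lambda>n. (h_graph e (\<phi> n) - (x n - l)) - (l - x n)) (0 - (l - l))"
    by (intro weakly_to_diff tendsto_imp_weakly_to[OF d] w tendsto_imp_weakly_to[OF tendsto_const])
  then have wh: "weakly_to (\<lambda>n. h_graph e (\<phi> n)) 0" by simp
  have wf: "weakly_to (\<lambda>n. el (\<phi> n)) 0" using weakly_to_fst[OF wh] by (simp add: h_graph_def)
  have bd: "norm (h_graph e (\<phi> n)) \<le> 1 + (B + norm l)" for n
  proof -
    have "norm (h_graph e (\<phi> n)) \<le> norm (h_graph e (\<phi> n) - (x n - l)) + norm (x n - l)"
      using norm_triangle_ineq[of "h_graph e (\<phi> n) - (x n - l)" "x n - l"] by simp
    moreover have "norm (x n - l) \<le> B + norm l" using norm_triangle_ineq4[of "x n" l] B[of n] by simp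
    moreover have "1 / real (Suc n) \<le> 1" by simp
    ultimately show ?thesis using f(2)[of n] by linarith
  qed
  have "(\<lambda>n. el (\<phi> n)) \<longlonglongrightarrow> 0" by (rule rellich_test[OF e f(1) \<Omega> bd wf])
  moreover have "(\<lambda>n. fst (h_graph e (\<phi> n) - (x n - l))) \<longlonglongrightarrow> 0" using tendsto_fst[OF d] by simp
  ultimately have "(\<lambda>n. el (\<phi> n) - fst (h_graph e (\<phi> n) - (x n - l)) + fst l) \<longlonglongrightarrow> 0 - 0 + fst l" by (intro tendsto_intros)
  then show "(\<lambda>n. fst (x n)) \<longlonglongrightarrow> fst l" by (simp add: h_graph_def)
qed

section \<open>Ladyzhenskaya's inequality in the plane\<close>

definition ax :: "2 \<Rightarrow> real ^ 2" where "ax i = axis i 1"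

lemma ax_bij: "bij_betw ax UNIV Basis"
  unfolding bij_betw_def ax_def by (auto simp: inj_on_def axis_eq_axis Basis_vec_def)

lemma ax_Basis[simp]: "ax i \<in> Basis" using ax_bij by (auto simp: bij_betw_def)

lemma inner_ax[simp]: "x \<bullet> ax i = x $ i" by (simp add: ax_def inner_axis)

lemma ax_nth: "ax i $ j = (if i = j then 1 else 0)" by (simp add: ax_def axis_def)

definition vec2 :: "real \<Rightarrow> real \<Rightarrow> real ^ 2" where "vec2 s t = s *\<^sub>R ax 1 + t *\<^sub>R ax 2"

lemma vec2_nth[simp]: "vec2 s t $ 1 = s" "vec2 s t $ 2 = t"
  by (simp_all add: vec2_def ax_nth)

lemma prod_Basis_2: "(\<Prod>b\<in>Basis. f (b::real^2)) = f (ax 1) * f (ax 2)"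
proof -
  have "(\<Prod>b\<in>Basis. f b) = (\<Prod>i\<in>UNIV. f (ax i))" by (rule prod.reindex_bij_betw[OF ax_bij, symmetric])
  then show ?thesis by (simp add: UNIV_2)
qed

text \<open>Lebesgue measure is determined by its values on boxes. Seen as a product, it admits
  Tonelli's theorem in either order of the coordinates.\<close>

lemma lborel_vec2: "lborel = distr (lborel \<Otimes>\<^sub>M lborel) borel (\<lambda>p. vec2 (fst p) (snd p))"
proof (rule lborel_eqI)
  have m: "(\<lambda>p. vec2 (fst p) (snd p)) \<in> borel_measurable (lborel \<Otimes>\<^sub>M lborel)"
    unfolding lborel_prod by (simp, rule borel_measurable_continuous_onI) (auto simp: vec2_def intro!: continuous_intros)
  fix l u :: "real ^ 2" assume le: "\<And>b. b \<in> Basis \<Longrightarrow> l \<bullet> b \<le> u \<bullet> b"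
  have le': "l $ i \<le> u $ i" for i using le[of "ax i"] by simp
  have "(\<lambda>p. vec2 (fst p) (snd p)) -` box l u \<inter> space (lborel \<Otimes>\<^sub>M lborel) = {l $ 1<..<u $ 1} \<times> {l $ 2<..<u $ 2}"
    by (auto simp: mem_box_cart forall_2 space_pair_measure)
  then have "emeasure (distr (lborel \<Otimes>\<^sub>M lborel) borel (\<lambda>p. vec2 (fst p) (snd p))) (box l u) = emeasure (lborel \<Otimes>\<^sub>M lborel) ({l $ 1<..<u $ 1} \<times> {l $ 2<..<u $ 2})"
    using m by (subst emeasure_distr) auto
  also have "\<dots> = ennreal ((u $ 1 - l $ 1) * (u $ 2 - l $ 2))"
    using le' by (subst lborel.emeasure_pair_measure_Times) (auto simp: ennreal_mult)
  finally show "emeasure (distr (lborel \<Otimes>\<^sub>M lborel) borel (\<lambda>p. vec2 (fst p) (snd p))) (box l u) = ennreal (\<Prod>b\<in>Basis. (u - l) \<bullet> b)"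
    by (simp add: prod_Basis_2)
qed simp

lemma continuous_vec2: "continuous_on UNIV (\<lambda>p. vec2 (fst p) (snd p))"
  by (auto simp: vec2_def intro!: continuous_intros)

lemma nn_integral_vec2:
  assumes f: "f \<in> borel_measurable borel"
  shows "(\<integral>\<^sup>+x. f x \<partial>lborel) = (\<integral>\<^sup>+s. (\<integral>\<^sup>+t. f (vec2 s t) \<partial>lborel) \<partial>lborel)"
    "(\<integral>\<^sup>+x. f x \<partial>lborel) = (\<integral>\<^sup>+t. (\<integral>\<^sup>+s. f (vec2 s t) \<partial>lborel) \<partial>lborel)"
proof -
  have m: "(\<lambda>p. vec2 (fst p) (snd p)) \<in> borel_measurable (lborel \<Otimes>\<^sub>M lborel)"
    unfolding lborel_prod using borel_measurable_continuous_onI[OF continuous_vec2] by simp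
  have fm: "(\<lambda>(s, t). f (vec2 s t)) \<in> borel_measurable (lborel \<Otimes>\<^sub>M lborel)"
    using measurable_compose[OF m f] by (simp add: case_prod_unfold)
  have "(\<integral>\<^sup>+x. f x \<partial>lborel) = (\<integral>\<^sup>+p. f (vec2 (fst p) (snd p)) \<partial>(lborel \<Otimes>\<^sub>M lborel))"
    by (subst lborel_vec2, subst nn_integral_distr[OF m]) (use f in auto)
  also have "\<dots> = (\<integral>\<^sup>+s. (\<integral>\<^sup>+t. f (vec2 s t) \<partial>lborel) \<partial>lborel)"
    using lborel.nn_integral_fst[OF fm] by (simp add: case_prod_unfold)
  finally show 1: "(\<integral>\<^sup>+x. f x \<partial>lborel) = (\<integral>\<^sup>+s. (\<integral>\<^sup>+t. f (vec2 s t) \<partial>lborel) \<partial>lborel)" .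
  show "(\<integral>\<^sup>+x. f x \<partial>lborel) = (\<integral>\<^sup>+t. (\<integral>\<^sup>+s. f (vec2 s t) \<partial>lborel) \<partial>lborel)"
    unfolding 1 by (rule lborel_pair.Fubini'[OF fm, symmetric])
qed

lemma nn_integral_vec2_measurable:
  fixes f :: "real ^ 2 \<Rightarrow> ennreal"
  assumes f: "f \<in> borel_measurable borel"
  shows "(\<lambda>s. \<integral>\<^sup>+t. f (vec2 s t) \<partial>lborel) \<in> borel_measurable lborel"
    "(\<lambda>t. \<integral>\<^sup>+s. f (vec2 s t) \<partial>lborel) \<in> borel_measurable lborel"
proof -
  have "(\<lambda>p. vec2 (fst p) (snd p)) \<in> borel_measurable (lborel \<Otimes>\<^sub>M lborel)" "(\<lambda>p. vec2 (snd p) (fst p)) \<in> borel_measurable (lborel \<Otimes>\<^sub>M lborel)"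
    unfolding lborel_prod by (auto simp: vec2_def intro!: borel_measurable_continuous_onI continuous_intros)
  then have "(\<lambda>p. f (vec2 (fst p) (snd p))) \<in> borel_measurable (lborel \<Otimes>\<^sub>M lborel)" "(\<lambda>p. f (vec2 (snd p) (fst p))) \<in> borel_measurable (lborel \<Otimes>\<^sub>M lborel)"
    using measurable_compose[OF _ f] by blast+
  then show "(\<lambda>s. \<integral>\<^sup>+t. f (vec2 s t) \<partial>lborel) \<in> borel_measurable lborel"
    "(\<lambda>t. \<integral>\<^sup>+s. f (vec2 s t) \<partial>lborel) \<in> borel_measurable lborel"
    by (auto intro!: lborel.borel_measurable_nn_integral simp: case_prod_unfold)
qed

text \<open>The squared norm is the integral of its derivative 2 f . f' from a point to the left
  where f vanishes.\<close>

lemma sq_norm_le_integral: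
  fixes f f' :: "real \<Rightarrow> 'b::euclidean_space"
  assumes d: "\<And>s. (f has_vector_derivative f' s) (at s)" and c: "continuous_on UNIV f'"
    and z: "\<And>s. s \<le> R \<Longrightarrow> f s = 0"
  shows "ennreal ((norm (f s))\<^sup>2) \<le> (\<integral>\<^sup>+y. ennreal (2 * (norm (f y) * norm (f' y))) \<partial>lborel)"
proof -
  \<comment> \<open>Taking the minimum makes \<open>a\<close> a zero of f with a \<le> s also when s
    itself lies left of \<open>R\<close>.\<close>
  define a where "a = min s R"
  have fa: "f a = 0" and as: "a \<le> s" using z by (auto simp: a_def)
  let ?g = "\<lambda>y. 2 * (f y \<bullet> f' y)"
  have fc: "continuous_on UNIV f"
    by (intro continuous_at_imp_continuous_on ballI has_vector_derivative_continuous[OF d])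
  have "(LINT y|lborel. indicator {a..s} y *\<^sub>R ?g y) = f s \<bullet> f s - f a \<bullet> f a"
  proof (rule integral_FTC_atLeastAtMost[OF as])
    show "((\<lambda>y. f y \<bullet> f y) has_vector_derivative ?g x) (at x within {a..s})" for x
      using has_vector_derivative_at_within[OF d[of x], of "{a..s}"]
      by (auto intro!: derivative_eq_intros simp: has_vector_derivative_def inner_commute algebra_simps)
    show "continuous_on {a..s} ?g"
      by (intro continuous_intros continuous_on_subset[OF fc] continuous_on_subset[OF c]) auto
  qed
  then have eq: "(norm (f s))\<^sup>2 = (LINT y|lborel. indicator {a..s} y *\<^sub>R ?g y)" using fa by (simp add: power2_norm_eq_inner)
  have i: "integrable lborel (\<lambda>y. indicator {a..s} y *\<^sub>R ?g y)"
    by (intro borel_integrable_atLeastAtMost'[unfolded set_integrable_def] continuous_intros continuous_on_subset[OF fc] continuous_on_subset[OF c]) auto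
  have "ennreal ((norm (f s))\<^sup>2) = ennreal (norm (LINT y|lborel. indicator {a..s} y *\<^sub>R ?g y))" using eq by (metis abs_of_nonneg real_norm_def zero_le_power2)
  also have "\<dots> \<le> (\<integral>\<^sup>+y. ennreal (norm (indicator {a..s} y *\<^sub>R ?g y)) \<partial>lborel)" by (rule integral_norm_bound_ennreal[OF i])
  also have "\<dots> \<le> (\<integral>\<^sup>+y. ennreal (2 * (norm (f y) * norm (f' y))) \<partial>lborel)"
  proof (intro nn_integral_mono ennreal_leI)
    fix y
    have "\<bar>f y \<bullet> f' y\<bar> \<le> norm (f y) * norm (f' y)" by (rule Cauchy_Schwarz_ineq2)
    then show "norm (indicator {a..s} y *\<^sub>R ?g y) \<le> 2 * (norm (f y) * norm (f' y))" by (simp add: indicator_def abs_mult)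
  qed
  finally show ?thesis .
qed

lemma nn_integral_norm_mult_le:
  fixes f :: "'a::euclidean_space \<Rightarrow> 'b::euclidean_space" and g :: "'a \<Rightarrow> 'c::euclidean_space"
  assumes f: "square_int f" and g: "square_int g"
  shows "(\<integral>\<^sup>+x. ennreal (norm (f x) * norm (g x)) \<partial>lebesgue) \<le> ennreal (norm (el f) * norm (el g))"
proof -
  have s: "square_int (\<lambda>x. norm (f x))" "square_int (\<lambda>x. norm (g x))" using f g by (auto simp: square_int_def)
  have n: "norm (el (\<lambda>x. norm (f x))) = norm (el f)" "norm (el (\<lambda>x. norm (g x))) = norm (el g)"
    by (rule power2_eq_imp_eq; use norm_el[OF s(1)] norm_el[OF f] norm_el[OF s(2)] norm_el[OF g] in simp)+
  have "(\<integral>\<^sup>+x. ennreal (norm (f x) * norm (g x)) \<partial>lebesgue) = ennreal (LINT x|lebesgue. norm (f x) \<bullet> norm (g x))"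
    using square_int_inner[OF s] by (subst nn_integral_eq_integral[symmetric]) auto
  also have "\<dots> = ennreal (inner (el (\<lambda>x. norm (f x))) (el (\<lambda>x. norm (g x))))" by (simp only: inner_el[OF s])
  also have "\<dots> \<le> ennreal (norm (el f) * norm (el g))" using norm_cauchy_schwarz[of "el (\<lambda>x. norm (f x))" "el (\<lambda>x. norm (g x))"] n by (intro ennreal_leI) simp
  finally show ?thesis .
qed

text \<open>Integrating along a horizontal line bounds the squared norm by a function of the second
  coordinate alone, integrating along a vertical line by a function of the first alone. The fourth
  power is at most the product of the two, whose integral factors; each factor is an integral of 2
  |phi| |d_i phi|, estimated by Cauchy-Schwarz.\<close>

lemma ladyzhenskaya_test:
  fixes \<phi> :: "real ^ 2 \<Rightarrow> 'b::euclidean_space"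
  assumes t: "\<phi> \<in> test_functions \<Omega>"
  shows "(\<integral>\<^sup>+x. ennreal ((norm (\<phi> x)) ^ 4) \<partial>lebesgue) \<le> ennreal (4 * (norm (el \<phi>))\<^sup>2 * (norm (snd (h_graph ax \<phi>)))\<^sup>2)"
proof -
  note [measurable] = test_functions_borel[OF t]
  have tb: "dir_deriv (ax i) \<phi> \<in> test_functions \<Omega>" for i by (rule test_functions_dir_deriv[OF t]) simp
  note [measurable] = test_functions_borel[OF tb]
  obtain K where K: "compact K" "\<And>x. x \<notin> K \<Longrightarrow> \<phi> x = 0" using test_functionsE[OF t] by metis
  obtain r where r: "\<And>x. x \<in> K \<Longrightarrow> norm x \<le> r" using compact_imp_bounded[OF K(1)] by (auto simp: bounded_iff)
  have zero: "\<phi> x = 0" if "x $ i < - r" for x i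
    using K(2)[of x] r[of x] that component_le_norm_cart[of x i] by (cases "x \<in> K") auto
  let ?p = "\<lambda>i x. ennreal (2 * (norm (\<phi> x) * norm (frechet_derivative \<phi> (at x) (ax i))))"
  have pm: "?p i \<in> borel_measurable borel" for i by measurable
  have vm[measurable]: "(\<lambda>s. vec2 s t) \<in> borel_measurable borel" "(\<lambda>t. vec2 s t) \<in> borel_measurable borel" for s t
    by (auto simp: vec2_def)
  have dir: "((\<lambda>s. \<phi> (x0 + s *\<^sub>R ax i)) has_vector_derivative frechet_derivative \<phi> (at (x0 + s *\<^sub>R ax i)) (ax i)) (at s)" for x0 s i
  proof -
    have 1: "((\<lambda>s. x0 + s *\<^sub>R ax i) has_derivative (\<lambda>h. h *\<^sub>R ax i)) (at s)" by (auto intro!: derivative_eq_intros)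
    have 2: "((\<lambda>s. \<phi> (x0 + s *\<^sub>R ax i)) has_derivative (\<lambda>h. frechet_derivative \<phi> (at (x0 + s *\<^sub>R ax i)) (h *\<^sub>R ax i))) (at s)"
      by (rule has_derivative_compose[OF 1 test_functions_has_derivative[OF t]])
    show ?thesis unfolding has_vector_derivative_def
      using 2 linear_scale[OF has_derivative_linear[OF test_functions_has_derivative[OF t]]] by simp
  qed
  have cont: "continuous_on UNIV (\<lambda>s. frechet_derivative \<phi> (at (x0 + s *\<^sub>R ax i)) (ax i))" for x0 i
    by (rule continuous_on_compose2[OF test_functions_continuous[OF tb, of UNIV]]) (auto intro!: continuous_intros)
  have b1: "ennreal ((norm (\<phi> (vec2 s t)))\<^sup>2) \<le> (\<integral>\<^sup>+y. ?p 1 (vec2 y t) \<partial>lborel)" for s t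
  proof -
    have e: "vec2 y t = t *\<^sub>R ax 2 + y *\<^sub>R ax 1" for y by (simp add: vec2_def)
    show ?thesis unfolding e
      by (rule sq_norm_le_integral[where R = "- r - 1", OF dir cont]) (rule zero[of _ 1], simp add: ax_nth)
  qed
  have b2: "ennreal ((norm (\<phi> (vec2 s t)))\<^sup>2) \<le> (\<integral>\<^sup>+y. ?p 2 (vec2 s y) \<partial>lborel)" for s t
  proof -
    have e: "vec2 s y = s *\<^sub>R ax 1 + y *\<^sub>R ax 2" for y by (simp add: vec2_def)
    show ?thesis unfolding e
      by (rule sq_norm_le_integral[where R = "- r - 1", OF dir cont]) (rule zero[of _ 2], simp add: ax_nth)
  qed
  have pi: "(\<integral>\<^sup>+x. ?p i x \<partial>lborel) \<le> ennreal (2 * (norm (el \<phi>) * norm (snd (h_graph ax \<phi>))))" for i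
  proof -
    have "(\<integral>\<^sup>+x. ?p i x \<partial>lborel) = (\<integral>\<^sup>+x. ennreal 2 * ennreal (norm (\<phi> x) * norm (frechet_derivative \<phi> (at x) (ax i))) \<partial>lebesgue)"
      unfolding nn_integral_completion by (intro nn_integral_cong) (simp add: ennreal_mult)
    also have "\<dots> = ennreal 2 * (\<integral>\<^sup>+x. ennreal (norm (\<phi> x) * norm (frechet_derivative \<phi> (at x) (ax i))) \<partial>lebesgue)"
      using square_int_measurable[OF test_functions_square_int[OF t]] square_int_measurable[OF test_functions_square_int[OF tb]]
      by (intro nn_integral_cmult measurable_compose[OF _ measurable_ennreal] borel_measurable_times measurable_compose[OF _ borel_measurable_norm]) auto
    also have "\<dots> \<le> ennreal 2 * ennreal (norm (el \<phi>) * norm (el (dir_deriv (ax i) \<phi>)))"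
      by (intro mult_left_mono nn_integral_norm_mult_le test_functions_square_int[OF t] test_functions_square_int[OF tb]) simp
    also have "\<dots> \<le> ennreal 2 * ennreal (norm (el \<phi>) * norm (snd (h_graph ax \<phi>)))"
      using Finite_Cartesian_Product.norm_nth_le[of "snd (h_graph ax \<phi>)" i]
      by (intro mult_left_mono ennreal_leI) (auto simp: h_graph_def)
    finally show ?thesis by (simp add: ennreal_mult)
  qed
  have "(\<integral>\<^sup>+x. ennreal ((norm (\<phi> x)) ^ 4) \<partial>lebesgue) = (\<integral>\<^sup>+x. ennreal ((norm (\<phi> x)) ^ 4) \<partial>lborel)" by (rule nn_integral_completion)
  also have "\<dots> = (\<integral>\<^sup>+s. (\<integral>\<^sup>+t. ennreal ((norm (\<phi> (vec2 s t))) ^ 4) \<partial>lborel) \<partial>lborel)" by (rule nn_integral_vec2(1)) measurable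
  also have "\<dots> \<le> (\<integral>\<^sup>+s. (\<integral>\<^sup>+t. (\<integral>\<^sup>+y. ?p 2 (vec2 s y) \<partial>lborel) * (\<integral>\<^sup>+y. ?p 1 (vec2 y t) \<partial>lborel) \<partial>lborel) \<partial>lborel)"
  proof (intro nn_integral_mono)
    fix s t
    have "ennreal ((norm (\<phi> (vec2 s t))) ^ 4) = ennreal ((norm (\<phi> (vec2 s t)))\<^sup>2) * ennreal ((norm (\<phi> (vec2 s t)))\<^sup>2)"
      by (simp add: ennreal_mult[symmetric] power_add[symmetric])
    also have "\<dots> \<le> (\<integral>\<^sup>+y. ?p 2 (vec2 s y) \<partial>lborel) * (\<integral>\<^sup>+y. ?p 1 (vec2 y t) \<partial>lborel)" by (intro mult_mono b1 b2) auto
    finally show "ennreal ((norm (\<phi> (vec2 s t))) ^ 4) \<le> (\<integral>\<^sup>+y. ?p 2 (vec2 s y) \<partial>lborel) * (\<integral>\<^sup>+y. ?p 1 (vec2 y t) \<partial>lborel)" .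
  qed
  also have "\<dots> = (\<integral>\<^sup>+s. (\<integral>\<^sup>+y. ?p 2 (vec2 s y) \<partial>lborel) * (\<integral>\<^sup>+t. (\<integral>\<^sup>+y. ?p 1 (vec2 y t) \<partial>lborel) \<partial>lborel) \<partial>lborel)"
    by (intro nn_integral_cong nn_integral_cmult nn_integral_vec2_measurable(2) pm)
  also have "\<dots> = (\<integral>\<^sup>+s. (\<integral>\<^sup>+y. ?p 2 (vec2 s y) \<partial>lborel) \<partial>lborel) * (\<integral>\<^sup>+t. (\<integral>\<^sup>+y. ?p 1 (vec2 y t) \<partial>lborel) \<partial>lborel)"
    by (intro nn_integral_multc nn_integral_vec2_measurable(1) pm)
  also have "\<dots> = (\<integral>\<^sup>+x. ?p 2 x \<partial>lborel) * (\<integral>\<^sup>+x. ?p 1 x \<partial>lborel)"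
    unfolding nn_integral_vec2(1)[OF pm[of 2]] nn_integral_vec2(2)[OF pm[of 1]] ..
  also have "\<dots> \<le> ennreal (2 * (norm (el \<phi>) * norm (snd (h_graph ax \<phi>)))) * ennreal (2 * (norm (el \<phi>) * norm (snd (h_graph ax \<phi>))))"
    by (intro mult_mono pi) auto
  also have "\<dots> = ennreal (4 * (norm (el \<phi>))\<^sup>2 * (norm (snd (h_graph ax \<phi>)))\<^sup>2)"
    by (simp add: ennreal_mult[symmetric] power2_eq_square mult_ac)
  finally show ?thesis .
qed

text \<open>The space L4 is not introduced separately: membership in it is square integrability of
  this function, and the squared L4 norm is the L2 norm of it.\<close>

definition sqn :: "('a::euclidean_space, 'b::euclidean_space) l2 \<Rightarrow> 'a \<Rightarrow> real" where "sqn u x = (norm (fn u x))\<^sup>2"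

text \<open>Along an a.e. convergent subsequence of approximating test functions Fatou's lemma keeps
  the inequality, the right-hand sides being convergent.\<close>

lemma ladyzhenskaya:
  fixes x :: "(real ^ 2, 'b::euclidean_space, 2) hv"
  assumes x: "x \<in> HS ax \<Omega>"
  shows "square_int (sqn (fst x))" "norm (el (sqn (fst x))) \<le> 2 * norm (fst x) * norm (snd x)"
proof -
  obtain \<phi> where f: "\<And>n. \<phi> n \<in> test_functions \<Omega>" "(\<lambda>n. h_graph ax (\<phi> n)) \<longlonglongrightarrow> x" using HS_seq[OF x] by blast
  have "(\<lambda>n. el (\<phi> n)) \<longlonglongrightarrow> fst x" using tendsto_fst[OF f(2)] by (simp add: h_graph_def)
  then obtain r where r: "strict_mono (r :: nat \<Rightarrow> nat)" "AE y in lebesgue. (\<lambda>k. fn (el (\<phi> (r k))) y) \<longlonglongrightarrow> fn (fst x) y"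
    by (rule l2_AE_subseq)
  have ae: "AE y in lebesgue. \<forall>k. fn (el (\<phi> (r k))) y = \<phi> (r k) y"
    using fn_el[OF test_functions_square_int[OF f(1)]] by (simp add: AE_all_countable)
  let ?b = "\<lambda>k. 4 * (norm (el (\<phi> (r k))))\<^sup>2 * (norm (snd (h_graph ax (\<phi> (r k)))))\<^sup>2"
  have fr: "(\<lambda>k. h_graph ax (\<phi> (r k))) \<longlonglongrightarrow> x" using LIMSEQ_subseq_LIMSEQ[OF f(2) r(1)] by (simp add: o_def)
  have "(\<lambda>k. el (\<phi> (r k))) \<longlonglongrightarrow> fst x" using tendsto_fst[OF fr] by (simp add: h_graph_def)
  then have bl: "?b \<longlonglongrightarrow> 4 * (norm (fst x))\<^sup>2 * (norm (snd x))\<^sup>2" by (intro tendsto_intros tendsto_snd[OF fr])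
  have "(\<integral>\<^sup>+y. ennreal ((norm (fn (fst x) y)) ^ 4) \<partial>lebesgue) = (\<integral>\<^sup>+y. liminf (\<lambda>k. ennreal ((norm (\<phi> (r k) y)) ^ 4)) \<partial>lebesgue)"
  proof (rule nn_integral_cong_AE)
    show "AE y in lebesgue. ennreal ((norm (fn (fst x) y)) ^ 4) = liminf (\<lambda>k. ennreal ((norm (\<phi> (r k) y)) ^ 4))"
      using r(2) ae
    proof (elim AE_mp, intro AE_I2 impI)
      fix y assume 1: "\<forall>k. fn (el (\<phi> (r k))) y = \<phi> (r k) y" and 2: "(\<lambda>k. fn (el (\<phi> (r k))) y) \<longlonglongrightarrow> fn (fst x) y"
      have "(\<lambda>k. \<phi> (r k) y) \<longlonglongrightarrow> fn (fst x) y" using 1 2 by simp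
      then have "(\<lambda>k. ennreal ((norm (\<phi> (r k) y)) ^ 4)) \<longlonglongrightarrow> ennreal ((norm (fn (fst x) y)) ^ 4)" by (intro tendsto_intros)
      then show "ennreal ((norm (fn (fst x) y)) ^ 4) = liminf (\<lambda>k. ennreal ((norm (\<phi> (r k) y)) ^ 4))"
        using lim_imp_Liminf[OF sequentially_bot] by metis
    qed
  qed
  also have "\<dots> \<le> liminf (\<lambda>k. \<integral>\<^sup>+y. ennreal ((norm (\<phi> (r k) y)) ^ 4) \<partial>lebesgue)"
    using square_int_measurable[OF test_functions_square_int[OF f(1)]] by (intro nn_integral_liminf) measurable
  also have "\<dots> \<le> liminf (\<lambda>k. ennreal (?b k))"
    by (intro Liminf_mono always_eventually allI ladyzhenskaya_test[OF f(1)])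
  also have "\<dots> = ennreal (4 * (norm (fst x))\<^sup>2 * (norm (snd x))\<^sup>2)"
    by (rule lim_imp_Liminf[OF sequentially_bot tendsto_ennrealI[OF bl]])
  finally have main: "(\<integral>\<^sup>+y. ennreal ((norm (sqn (fst x) y))\<^sup>2) \<partial>lebesgue) \<le> ennreal ((2 * norm (fst x) * norm (snd x))\<^sup>2)"
    by (simp add: sqn_def power_mult_distrib power_mult[symmetric])
  have m[measurable]: "sqn (fst x) \<in> borel_measurable lebesgue" unfolding sqn_def[abs_def] by measurable
  show s: "square_int (sqn (fst x))"
    unfolding square_int_def
  proof (intro conjI integrableI_bounded m)
    show "(\<integral>\<^sup>+y. ennreal (norm ((norm (sqn (fst x) y))\<^sup>2)) \<partial>lebesgue) < \<infinity>" using main by (simp add: le_less_trans)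
  qed measurable
  have "ennreal ((norm (el (sqn (fst x))))\<^sup>2) \<le> ennreal ((2 * norm (fst x) * norm (snd x))\<^sup>2)" using main unfolding nn_integral_norm_el[OF s] .
  then have "(norm (el (sqn (fst x))))\<^sup>2 \<le> (2 * norm (fst x) * norm (snd x))\<^sup>2" by simp
  then show "norm (el (sqn (fst x))) \<le> 2 * norm (fst x) * norm (snd x)" by (rule power2_le_imp_le) simp
qed

text \<open>The entries of the tensor product \<open>v \<otimes> p\<close>, against which the gradient is tested in the convective term.\<close>

definition mul :: "(real ^ 2, real ^ 2) l2 \<Rightarrow> (real ^ 2, 'b::euclidean_space) l2 \<Rightarrow> (real ^ 2, 'b) l2 ^ 2" where
  "mul v p = (\<chi> i. el (\<lambda>x. (fn v x $ i) *\<^sub>R fn p x))"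

text \<open>Summed over the components, the squared products give exactly |v|^2 |p|^2, so the
  squared norm is an inner product of two functions \<open>sqn\<close>, to which Ladyzhenskaya's
  inequality applies.\<close>

lemma mul_square_int:
  fixes v :: "(real ^ 2, real ^ 2, 2) hv" and p :: "(real ^ 2, 'b::euclidean_space, 2) hv"
  assumes v: "v \<in> HS ax \<Omega>" and p: "p \<in> HS ax \<Omega>'"
  shows "square_int (\<lambda>x. (fn (fst v) x $ i) *\<^sub>R fn (fst p) x)"
    "(norm (mul (fst v) (fst p)))\<^sup>2 \<le> 4 * norm (fst v) * norm (snd v) * norm (fst p) * norm (snd p)"
proof -
  note lv = ladyzhenskaya[OF v] and lp = ladyzhenskaya[OF p]
  have int: "integrable lebesgue (\<lambda>x. sqn (fst v) x * sqn (fst p) x)" using square_int_inner[OF lv(1) lp(1)] by simp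
  have sqm: "(norm ((fn (fst v) x $ i) *\<^sub>R fn (fst p) x))\<^sup>2 \<le> sqn (fst v) x * sqn (fst p) x" for x i
    using power_mono[OF component_le_norm_cart[of "fn (fst v) x" i] abs_ge_zero, of 2]
    by (auto simp: sqn_def power_mult_distrib intro!: mult_right_mono)
  have nm: "(\<lambda>x. fn (fst v) x $ i) \<in> borel_measurable lebesgue" for i by (rule measurable_compose[OF fn_measurable borel_measurable_continuous_onI]) (intro continuous_intros)
  show s: "square_int (\<lambda>x. (fn (fst v) x $ i) *\<^sub>R fn (fst p) x)" for i
    by (rule square_int_bound[OF _ int]) (use sqm nm in auto)
  have "(norm (mul (fst v) (fst p)))\<^sup>2 = (\<Sum>i\<in>UNIV. (norm (el (\<lambda>x. (fn (fst v) x $ i) *\<^sub>R fn (fst p) x)))\<^sup>2)"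
    by (simp add: mul_def norm_vec_def L2_set_def sum_nonneg)
  also have "\<dots> = (\<Sum>i\<in>UNIV. LINT x|lebesgue. (norm ((fn (fst v) x $ i) *\<^sub>R fn (fst p) x))\<^sup>2)"
    by (simp only: norm_el[OF s])
  also have "\<dots> = (LINT x|lebesgue. (\<Sum>i\<in>UNIV. (norm ((fn (fst v) x $ i) *\<^sub>R fn (fst p) x))\<^sup>2))"
    by (rule Bochner_Integration.integral_sum[symmetric]) (use s in \<open>auto simp: square_int_def\<close>)
  also have "\<dots> = (LINT x|lebesgue. sqn (fst v) x \<bullet> sqn (fst p) x)"
    by (intro Bochner_Integration.integral_cong refl) (simp add: sqn_def power_mult_distrib norm_vec_def L2_set_def sum_nonneg sum_distrib_right)
  also have "\<dots> = inner (el (sqn (fst v))) (el (sqn (fst p)))" by (rule inner_el[OF lv(1) lp(1), symmetric])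
  also have "\<dots> \<le> norm (el (sqn (fst v))) * norm (el (sqn (fst p)))" by (rule norm_cauchy_schwarz)
  also have "\<dots> \<le> (2 * norm (fst v) * norm (snd v)) * (2 * norm (fst p) * norm (snd p))"
    by (intro mult_mono lv lp) auto
  finally show "(norm (mul (fst v) (fst p)))\<^sup>2 \<le> 4 * norm (fst v) * norm (snd v) * norm (fst p) * norm (snd p)" by (simp add: mult_ac)
qed

text \<open>The product is bilinear. The chosen representatives are additive only a.e., which the
  classes do not notice.\<close>

lemma mul_diff:
  fixes v w :: "(real ^ 2, real ^ 2, 2) hv" and p q :: "(real ^ 2, 'b::euclidean_space, 2) hv"
  assumes v: "v \<in> HS ax \<Omega>" and w: "w \<in> HS ax \<Omega>" and p: "p \<in> HS ax \<Omega>'" and q: "q \<in> HS ax \<Omega>'"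
  shows "mul (fst v) (fst p) - mul (fst w) (fst p) = mul (fst (v - w)) (fst p)"
    "mul (fst v) (fst p) - mul (fst v) (fst q) = mul (fst v) (fst (p - q))"
proof -
  show "mul (fst v) (fst p) - mul (fst w) (fst p) = mul (fst (v - w)) (fst p)"
    unfolding mul_def vec_eq_iff
  proof (intro allI)
    fix i
    have "el (\<lambda>x. (fn (fst v) x $ i) *\<^sub>R fn (fst p) x - (fn (fst w) x $ i) *\<^sub>R fn (fst p) x) = el (\<lambda>x. (fn (fst (v - w)) x $ i) *\<^sub>R fn (fst p) x)"
      by (rule el_eqI[OF square_int_diff[OF mul_square_int(1)[OF v p] mul_square_int(1)[OF w p]]])
         (rule AE_mp[OF fn_diff[of "fst v" "fst w"]], auto intro!: AE_I2 simp: scaleR_left_diff_distrib)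
    then show "((\<chi> i. el (\<lambda>x. (fn (fst v) x $ i) *\<^sub>R fn (fst p) x)) - (\<chi> i. el (\<lambda>x. (fn (fst w) x $ i) *\<^sub>R fn (fst p) x))) $ i =
         (\<chi> i. el (\<lambda>x. (fn (fst (v - w)) x $ i) *\<^sub>R fn (fst p) x)) $ i"
      by (simp add: el_diff[OF mul_square_int(1)[OF v p] mul_square_int(1)[OF w p]])
  qed
  show "mul (fst v) (fst p) - mul (fst v) (fst q) = mul (fst v) (fst (p - q))"
    unfolding mul_def vec_eq_iff
  proof (intro allI)
    fix i
    have "el (\<lambda>x. (fn (fst v) x $ i) *\<^sub>R fn (fst p) x - (fn (fst v) x $ i) *\<^sub>R fn (fst q) x) = el (\<lambda>x. (fn (fst v) x $ i) *\<^sub>R fn (fst (p - q)) x)"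
      by (rule el_eqI[OF square_int_diff[OF mul_square_int(1)[OF v p] mul_square_int(1)[OF v q]]])
         (rule AE_mp[OF fn_diff[of "fst p" "fst q"]], auto intro!: AE_I2 simp: scaleR_right_diff_distrib)
    then show "((\<chi> i. el (\<lambda>x. (fn (fst v) x $ i) *\<^sub>R fn (fst p) x)) - (\<chi> i. el (\<lambda>x. (fn (fst v) x $ i) *\<^sub>R fn (fst q) x))) $ i =
         (\<chi> i. el (\<lambda>x. (fn (fst v) x $ i) *\<^sub>R fn (fst (p - q)) x)) $ i"
      by (simp add: el_diff[OF mul_square_int(1)[OF v p] mul_square_int(1)[OF v q]])
  qed
qed

section \<open>Stretching of domains\<close>

text \<open>A linear map acting on the values: it takes components, forms the buoyancy vector from
  the temperature, and rescales the values of pulled-back fields.\<close>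

definition lmap :: "('b::euclidean_space \<Rightarrow> 'c::euclidean_space) \<Rightarrow> ('a::euclidean_space, 'b) l2 \<Rightarrow> ('a, 'c) l2" where
  "lmap D u = el (\<lambda>x. D (fn u x))"

lemma square_int_linear:
  assumes D: "bounded_linear D" and f: "square_int f"
  shows "square_int (\<lambda>x. D (f x))"
proof -
  obtain K where K: "\<And>x. norm (D x) \<le> norm x * K" using bounded_linear.bounded[OF D] by blast
  have m: "(\<lambda>x. D (f x)) \<in> borel_measurable lebesgue"
    using f by (intro measurable_compose[OF square_int_measurable[OF f] borel_measurable_continuous_onI] linear_continuous_on D)
  have "(norm (D (f x)))\<^sup>2 \<le> K\<^sup>2 * (norm (f x))\<^sup>2" for x
    using power_mono[OF K[of "f x"] norm_ge_zero, of 2] by (simp add: power_mult_distrib mult.commute)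
  then show ?thesis
    by (intro square_int_bound[OF m, where g = "\<lambda>x. K\<^sup>2 * (norm (f x))\<^sup>2"]) (use f in \<open>auto simp: square_int_def\<close>)
qed

lemma lmap_el:
  assumes "bounded_linear D" "square_int f" shows "lmap D (el f) = el (\<lambda>x. D (f x))"
  unfolding lmap_def
  by (rule el_eqI[OF square_int_linear[OF assms(1) square_int_fn]]) (rule AE_mp[OF fn_el[OF assms(2)]], simp)

lemma norm_lmap_le:
  assumes D: "bounded_linear D" and K: "\<And>y. norm (D y) \<le> K * norm y" "K \<ge> 0"
  shows "norm (lmap D u) \<le> K * norm u"
proof (rule power2_le_imp_le)
  have s: "square_int (\<lambda>x. D (fn u x))" by (rule square_int_linear[OF D square_int_fn])
  have "(norm (lmap D u))\<^sup>2 = (LINT x|lebesgue. (norm (D (fn u x)))\<^sup>2)" unfolding lmap_def by (rule norm_el[OF s])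
  also have "\<dots> \<le> (LINT x|lebesgue. K\<^sup>2 * (norm (fn u x))\<^sup>2)"
  proof (rule integral_mono)
    fix x show "(norm (D (fn u x)))\<^sup>2 \<le> K\<^sup>2 * (norm (fn u x))\<^sup>2"
      using power_mono[OF K(1)[of "fn u x"] norm_ge_zero, of 2] by (simp add: power_mult_distrib)
  qed (use s square_int_fn[of u] in \<open>auto simp: square_int_def\<close>)
  also have "\<dots> = (K * norm u)\<^sup>2" by (simp add: norm_fn power_mult_distrib)
  finally show "(norm (lmap D u))\<^sup>2 \<le> (K * norm u)\<^sup>2" .
qed (use K in simp)

lemma bounded_linear_lmap:
  assumes D: "bounded_linear D"
  shows "bounded_linear (lmap D)"
proof -
  obtain K where K: "K \<ge> 0" "\<And>x. norm (D x) \<le> norm x * K" using bounded_linear.nonneg_bounded[OF D] by blast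
  note l = square_int_linear[OF D square_int_fn]
  show ?thesis
  proof (rule bounded_linear_intro[where K = K])
    fix u v :: "('c, 'a) l2" and r :: real
    have "lmap D (el (\<lambda>x. fn u x + fn v x)) = lmap D u + lmap D v"
      unfolding lmap_el[OF D square_int_add[OF square_int_fn square_int_fn]]
      by (simp add: linear_add[OF bounded_linear.linear[OF D]] el_add l lmap_def)
    then show "lmap D (u + v) = lmap D u + lmap D v" by (simp add: el_add)
    have "lmap D (el (\<lambda>x. r *\<^sub>R fn u x)) = r *\<^sub>R lmap D u"
      unfolding lmap_el[OF D square_int_scaleR[OF square_int_fn]]
      by (simp add: linear_scale[OF bounded_linear.linear[OF D]] el_scaleR l lmap_def)
    then show "lmap D (r *\<^sub>R u) = r *\<^sub>R lmap D u" by (simp add: el_scaleR)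
    show "norm (lmap D u) \<le> norm u * K" using norm_lmap_le[OF D, of K u] K by (simp add: mult.commute)
  qed
qed

text \<open>The point \<open>c\<close> is fixed, and the coordinate \<open>j\<close> is scaled by \<open>1 + s w\<^sub>j\<close>.\<close>

definition stretch :: "'a \<Rightarrow> 'a \<Rightarrow> real \<Rightarrow> 'a \<Rightarrow> 'a::euclidean_space" where
  "stretch w c s = diag_affine (\<lambda>b. 1 + s * (w \<bullet> b)) (- s *\<^sub>R (\<Sum>j\<in>Basis. ((w \<bullet> j) * (c \<bullet> j)) *\<^sub>R j))"

lemma stretch_inner:
  assumes "j \<in> Basis" shows "stretch w c s x \<bullet> j = x \<bullet> j + s * (w \<bullet> j) * (x \<bullet> j - c \<bullet> j)"
  using assms by (simp add: stretch_def diag_affine_inner inner_sum_left inner_Basis if_distrib algebra_simps cong: if_cong)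

definition cmp :: "'a \<Rightarrow> 'a \<Rightarrow> real \<Rightarrow> ('a::euclidean_space, 'b::euclidean_space) l2 \<Rightarrow> ('a, 'b) l2" where
  "cmp w c s u = el (\<lambda>x. fn u (stretch w c s x))"

lemma stretch_coeff_pos:
  assumes w: "\<forall>b\<in>Basis. w \<bullet> b \<ge> 0" and s: "s \<ge> 0" and b: "b \<in> Basis"
  shows "1 + s * (w \<bullet> b) \<ge> (1::real)" "1 + s * (w \<bullet> b) \<noteq> 0"
  using mult_nonneg_nonneg[OF s bspec[OF w b]] by auto

text \<open>No coordinate is contracted, so the Jacobian is at least 1 and composition does not
  increase the norm.\<close>

lemma square_int_stretch:
  fixes f :: "'a::euclidean_space \<Rightarrow> 'b::euclidean_space"
  assumes w: "\<forall>b\<in>Basis. w \<bullet> b \<ge> 0" and s: "s \<ge> 0" and f: "square_int f"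
  shows "square_int (\<lambda>x. f (stretch w c s x))" "norm (el (\<lambda>x. f (stretch w c s x))) \<le> norm (el f)"
proof -
  note p = stretch_coeff_pos[OF w s]
  show "square_int (\<lambda>x. f (stretch w c s x))"
    unfolding stretch_def by (rule square_int_diag_affine(1)) (use p f in auto)
  have "1 \<le> (\<Prod>j\<in>(Basis::'a set). \<bar>1 + s * (w \<bullet> j)\<bar>)"
    by (rule prod_ge_1) (use p(1) in force)
  then have "(norm (el (\<lambda>x. f (stretch w c s x))))\<^sup>2 \<le> (\<Prod>j\<in>(Basis::'a set). \<bar>1 + s * (w \<bullet> j)\<bar>) * (norm (el (\<lambda>x. f (stretch w c s x))))\<^sup>2"
    by (simp add: mult_le_cancel_right1)
  also have "\<dots> = (norm (el f))\<^sup>2"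
    unfolding stretch_def by (rule square_int_diag_affine(2)[symmetric]) (use p f in auto)
  finally show "norm (el (\<lambda>x. f (stretch w c s x))) \<le> norm (el f)" by (rule power2_le_imp_le) simp
qed

text \<open>Composition is defined through a chosen representative. The norm estimate, applied to
  the difference of two representatives, shows that the choice is immaterial.\<close>

lemma cmp_el:
  assumes w: "\<forall>b\<in>Basis. w \<bullet> b \<ge> 0" and s: "s \<ge> 0" and f: "square_int f"
  shows "cmp w c s (el f) = el (\<lambda>x. f (stretch w c s x))"
proof -
  let ?d = "\<lambda>x. fn (el f) x - f x"
  have sd: "square_int ?d" using f by (simp add: square_int_diff)
  have "el ?d = 0" using el_diff[OF square_int_fn f, of "el f"] by simp
  then have "el (\<lambda>x. ?d (stretch w c s x)) = 0" using square_int_stretch(2)[OF w s sd, of c] by simp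
  then show ?thesis unfolding cmp_def
    using el_diff[OF square_int_stretch(1)[OF w s square_int_fn[of "el f"], of c] square_int_stretch(1)[OF w s f, of c]] by simp
qed

text \<open>The chain rule on the level of pairs: the derivative in the i-th direction acquires the
  factor of the i-th coordinate, and \<open>D\<close> acts on the values.\<close>

definition pull :: "('b \<Rightarrow> 'b) \<Rightarrow> 'a \<Rightarrow> 'a \<Rightarrow> real \<Rightarrow> ('n \<Rightarrow> 'a) \<Rightarrow> ('a::euclidean_space, 'b::euclidean_space, 'n::finite) hv \<Rightarrow> ('a, 'b, 'n) hv" where
  "pull D w c s e x = (lmap D (cmp w c s (fst x)), \<chi> i. (1 + s * (w \<bullet> e i)) *\<^sub>R lmap D (cmp w c s (snd x $ i)))"

lemma bounded_linear_cmp: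
  fixes w :: "'a::euclidean_space"
  assumes w: "\<forall>b\<in>Basis. w \<bullet> b \<ge> 0" and s: "s \<ge> 0"
  shows "bounded_linear (cmp w c s :: ('a, 'b::euclidean_space) l2 \<Rightarrow> ('a, 'b) l2)" "norm (cmp w c s u) \<le> norm (u :: ('a, 'b) l2)"
proof -
  note l = square_int_stretch(1)[where c = c, OF w s square_int_fn]
  show n: "norm (cmp w c s u) \<le> norm u" for u :: "('a, 'b) l2"
    unfolding cmp_def using square_int_stretch(2)[OF w s square_int_fn[of u], of c] by simp
  show "bounded_linear (cmp w c s :: ('a, 'b::euclidean_space) l2 \<Rightarrow> ('a, 'b) l2)"
  proof (rule bounded_linear_intro[where K = 1])
    fix u v :: "('a, 'b) l2" and r :: real
    have "cmp w c s (el (\<lambda>x. fn u x + fn v x)) = cmp w c s u + cmp w c s v"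
      using cmp_el[OF w s square_int_add[OF square_int_fn[of u] square_int_fn[of v]], of c] el_add[OF l[of u] l[of v]]
      by (simp only: cmp_def[symmetric])
    then show "cmp w c s (u + v) = cmp w c s u + cmp w c s v" unfolding el_add[OF square_int_fn square_int_fn] by simp
    have "cmp w c s (el (\<lambda>x. r *\<^sub>R fn u x)) = r *\<^sub>R cmp w c s u"
      using cmp_el[OF w s square_int_scaleR[OF square_int_fn[of u], of r], of c] el_scaleR[OF l[of u], of r]
      by (simp only: cmp_def[symmetric])
    then show "cmp w c s (r *\<^sub>R u) = r *\<^sub>R cmp w c s u" unfolding el_scaleR[OF square_int_fn] by simp
    show "norm (cmp w c s u) \<le> norm u * 1" using n by simp
  qed
qed

lemma norm_vec_le:
  fixes x y :: "'b::real_normed_vector ^ 'n::finite"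
  assumes "\<And>i. norm (x $ i) \<le> K * norm (y $ i)" "K \<ge> 0"
  shows "norm x \<le> K * norm y"
proof -
  have "norm x \<le> L2_set (\<lambda>i. K * norm (y $ i)) UNIV"
    unfolding norm_vec_def by (rule L2_set_mono) (use assms in auto)
  also have "\<dots> = K * norm y" unfolding norm_vec_def by (rule L2_set_right_distrib[symmetric, OF assms(2)])
  finally show ?thesis .
qed

text \<open>The factors 1 + s w are at most 2, so the bound does not depend on s. This uniformity is
  what extends convergence from test functions to their closure.\<close>

lemma bounded_linear_pull:
  fixes w :: "'a::euclidean_space" and e :: "'n::finite \<Rightarrow> 'a"
  assumes w: "\<forall>b\<in>Basis. w \<bullet> b \<ge> 0" "\<forall>b\<in>Basis. w \<bullet> b \<le> 1" and s: "s \<ge> 0" "s \<le> 1"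
    and D: "bounded_linear D" "\<And>y. norm (D y) \<le> norm y" and eB: "\<And>i. e i \<in> Basis"
  shows "bounded_linear (pull D w c s e :: ('a, 'b::euclidean_space, 'n) hv \<Rightarrow> ('a, 'b, 'n) hv)"
    "norm (pull D w c s e x) \<le> 2 * norm (x :: ('a, 'b, 'n) hv)"
proof -
  note L = bounded_linear.linear[OF bounded_linear_lmap[OF D(1)]] and C = bounded_linear.linear[OF bounded_linear_cmp(1)[OF w(1) s(1)]]
  have n: "norm (lmap D (cmp w c s u)) \<le> norm u" for u :: "('a, 'b) l2"
    using norm_lmap_le[OF D(1), of 1 "cmp w c s u"] D(2) bounded_linear_cmp(2)[OF w(1) s(1), of c u] by simp
  have cc: "0 \<le> 1 + s * (w \<bullet> e i)" "1 + s * (w \<bullet> e i) \<le> 2" for i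
    using stretch_coeff_pos(1)[OF w(1) s(1) eB[of i]] mult_mono[OF s(2) bspec[OF w(2) eB[of i]] _ bspec[OF w(1) eB[of i]]] by auto
  show b: "norm (pull D w c s e x) \<le> 2 * norm x" for x :: "('a, 'b, 'n) hv"
  proof -
    have 1: "norm (fst (pull D w c s e x)) \<le> 2 * norm (fst x)" by (simp add: pull_def order_trans[OF n])
    have 2: "norm (snd (pull D w c s e x)) \<le> 2 * norm (snd x)"
    proof (rule norm_vec_le)
      fix i
      have "norm (snd (pull D w c s e x) $ i) = (1 + s * (w \<bullet> e i)) * norm (lmap D (cmp w c s (snd x $ i)))" using cc(1)[of i] by (simp add: pull_def)
      also have "\<dots> \<le> 2 * norm (snd x $ i)" by (intro mult_mono cc n) auto
      finally show "norm (snd (pull D w c s e x) $ i) \<le> 2 * norm (snd x $ i)" .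
    qed simp
    have "(norm (pull D w c s e x))\<^sup>2 = (norm (fst (pull D w c s e x)))\<^sup>2 + (norm (snd (pull D w c s e x)))\<^sup>2" by (simp add: norm_prod_def)
    also have "\<dots> \<le> (2 * norm (fst x))\<^sup>2 + (2 * norm (snd x))\<^sup>2" using 1 2 by (intro add_mono power_mono) auto
    also have "\<dots> = (2 * norm x)\<^sup>2" by (simp add: norm_prod_def power_mult_distrib)
    finally show ?thesis by (rule power2_le_imp_le) simp
  qed
  show "bounded_linear (pull D w c s e :: ('a, 'b, 'n) hv \<Rightarrow> ('a, 'b, 'n) hv)"
  proof (rule bounded_linear_intro[where K = 2])
    fix x y :: "('a, 'b, 'n) hv" and r :: real
    show "pull D w c s e (x + y) = pull D w c s e x + pull D w c s e y"
      by (simp add: pull_def vec_eq_iff linear_add[OF L] linear_add[OF C] scaleR_right_distrib)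
    show "pull D w c s e (r *\<^sub>R x) = r *\<^sub>R pull D w c s e x"
      by (simp add: pull_def vec_eq_iff linear_scale[OF L] linear_scale[OF C])
    show "norm (pull D w c s e x) \<le> norm x * 2" using b[of x] by simp
  qed
qed

text \<open>A stretching does not decrease distances to its centre, so the preimage of a compact
  support is bounded, hence compact.\<close>

lemma test_functions_pull:
  fixes f :: "'a::euclidean_space \<Rightarrow> 'b::euclidean_space" and w :: 'a
  assumes f: "f \<in> test_functions \<Omega>" and w: "\<forall>b\<in>Basis. w \<bullet> b \<ge> 0" and s: "s \<ge> 0" and D: "bounded_linear D"
    and sub: "\<And>x. stretch w c s x \<in> \<Omega> \<Longrightarrow> x \<in> \<Omega>'"
  shows "(\<lambda>x. D (f (stretch w c s x))) \<in> test_functions \<Omega>'"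
    "b \<in> Basis \<Longrightarrow> frechet_derivative (\<lambda>x. D (f (stretch w c s x))) (at x) b = (1 + s * (w \<bullet> b)) *\<^sub>R D (frechet_derivative f (at (stretch w c s x)) b)"
proof -
  obtain K where K: "compact K" "K \<subseteq> \<Omega>" "\<And>x. x \<notin> K \<Longrightarrow> f x = 0" "\<And>k. Ck k f" using test_functionsE[OF f] by blast
  define K' where "K' = stretch w c s -` K"
  have cont: "continuous_on UNIV (stretch w c s)" unfolding stretch_def
    using has_derivative_continuous[OF has_derivative_diag_affine] continuous_at_imp_continuous_on by blast
  have bd: "norm (x - c) \<le> norm (stretch w c s x - c)" for x
  proof (rule norm_le_componentwise)
    fix b :: 'a assume b: "b \<in> Basis"
    have "(stretch w c s x - c) \<bullet> b = (1 + s * (w \<bullet> b)) * ((x - c) \<bullet> b)" using b by (simp add: inner_diff_left stretch_inner algebra_simps)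
    then show "\<bar>(x - c) \<bullet> b\<bar> \<le> \<bar>(stretch w c s x - c) \<bullet> b\<bar>"
      using stretch_coeff_pos(1)[OF w s b] by (simp add: abs_mult mult_le_cancel_right1)
  qed
  obtain R where R: "\<And>x. x \<in> K \<Longrightarrow> norm x \<le> R" using compact_imp_bounded[OF K(1)] by (auto simp: bounded_iff)
  have "norm x \<le> R + norm c + norm c" if "x \<in> K'" for x
    using R[of "stretch w c s x"] bd[of x] that norm_triangle_ineq4[of "stretch w c s x" c] norm_triangle_ineq[of "x - c" c] by (auto simp: K'_def)
  then have "bounded K'" by (auto simp: bounded_iff)
  moreover have "closed K'" unfolding K'_def using closed_vimage[OF compact_imp_closed[OF K(1)] cont] .
  ultimately have cK: "compact K'" by (simp add: compact_eq_bounded_closed)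
  have D0: "D 0 = 0" using linear_0[OF bounded_linear.linear[OF D]] .
  show "(\<lambda>x. D (f (stretch w c s x))) \<in> test_functions \<Omega>'"
  proof (rule test_functionsI[OF _ cK])
    show "Ck k (\<lambda>x. D (f (stretch w c s x)))" for k unfolding stretch_def by (rule Ck_linear[OF D Ck_diag_affine[OF K(4)]])
    show "K' \<subseteq> \<Omega>'" using K(2) sub by (auto simp: K'_def)
    show "D (f (stretch w c s x)) = 0" if "x \<notin> K'" for x using that K(3) D0 by (simp add: K'_def)
  qed
  assume b: "b \<in> Basis"
  note l = has_derivative_linear[OF test_functions_has_derivative[OF f]]
  have fd: "frechet_derivative (\<lambda>x. D (f (stretch w c s x))) (at x) = (\<lambda>h. D (frechet_derivative f (at (stretch w c s x)) (\<Sum>j\<in>Basis. ((1 + s * (w \<bullet> j)) * (h \<bullet> j)) *\<^sub>R j)))"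
    unfolding stretch_def
    by (rule frechet_derivative_eq, rule bounded_linear.has_derivative[OF D has_derivative_compose_diag_affine[OF test_functions_has_derivative[OF f]]])
  show "frechet_derivative (\<lambda>x. D (f (stretch w c s x))) (at x) b = (1 + s * (w \<bullet> b)) *\<^sub>R D (frechet_derivative f (at (stretch w c s x)) b)"
    unfolding fd sum_Basis_pick[OF b] linear_scale[OF l] linear_scale[OF bounded_linear.linear[OF D]] ..
qed

lemma pull_h_graph:
  fixes f :: "'a::euclidean_space \<Rightarrow> 'b::euclidean_space" and w :: 'a and e :: "'n::finite \<Rightarrow> 'a"
  assumes f: "f \<in> test_functions \<Omega>" and w: "\<forall>b\<in>Basis. w \<bullet> b \<ge> 0" and s: "s \<ge> 0" and D: "bounded_linear D"
    and eB: "\<And>i. e i \<in> Basis"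
  shows "pull D w c s e (h_graph e f) = h_graph e (\<lambda>x. D (f (stretch w c s x)))"
proof -
  have sf: "square_int f" "square_int (dir_deriv (e i) f)" for i
    by (rule test_functions_square_int[OF f], rule frechet_test_square_int(1)[OF f])
  have "lmap D (cmp w c s (el g)) = el (\<lambda>x. D (g (stretch w c s x)))" if "square_int g" for g :: "'a \<Rightarrow> 'b"
    using that by (simp add: cmp_el[OF w s] lmap_el[OF D] square_int_stretch(1)[OF w s])
  moreover have "el (\<lambda>x. (1 + s * (w \<bullet> e i)) *\<^sub>R D (dir_deriv (e i) f (stretch w c s x))) = (1 + s * (w \<bullet> e i)) *\<^sub>R el (\<lambda>x. D (dir_deriv (e i) f (stretch w c s x)))" for i
    by (rule el_scaleR[OF square_int_linear[OF D square_int_stretch(1)[OF w s sf(2)]]])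
  ultimately show ?thesis
    unfolding pull_def h_graph_def
    using sf by (simp add: vec_eq_iff test_functions_pull(2)[OF f w s D UNIV_I eB])
qed

lemma pull_HS:
  fixes x :: "('a::euclidean_space, 'b::euclidean_space, 'n::finite) hv" and w :: 'a
  assumes w: "\<forall>b\<in>Basis. w \<bullet> b \<ge> 0" "\<forall>b\<in>Basis. w \<bullet> b \<le> 1" and s: "s \<ge> 0" "s \<le> 1"
    and D: "bounded_linear D" "\<And>y. norm (D y) \<le> norm y" and eB: "\<And>i. e i \<in> Basis"
    and sub: "\<And>x. stretch w c s x \<in> \<Omega> \<Longrightarrow> x \<in> \<Omega>'" and x: "x \<in> HS e \<Omega>"
  shows "pull D w c s e x \<in> HS e \<Omega>'"
proof -
  obtain \<phi> where f: "\<And>n. \<phi> n \<in> test_functions \<Omega>" "(\<lambda>n. h_graph e (\<phi> n)) \<longlonglongrightarrow> x" using HS_seq[OF x] by blast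
  have "(\<lambda>n. pull D w c s e (h_graph e (\<phi> n))) \<longlonglongrightarrow> pull D w c s e x"
    by (rule bounded_linear.tendsto[OF bounded_linear_pull(1)[OF w s D eB] f(2)])
  moreover have "pull D w c s e (h_graph e (\<phi> n)) \<in> HS e \<Omega>'" for n
    unfolding pull_h_graph[OF f(1) w(1) s(1) D(1) eB] by (rule HS_test[OF test_functions_pull(1)[OF f(1) w(1) s(1) D(1) sub]])
  ultimately show ?thesis by (rule closed_sequentially[OF HS_closed, rotated])
qed

text \<open>What is asked of a transformation of the values for pulled-back functions to converge: a
  uniform bound and pointwise convergence to the identity. It is used for the identity itself and
  for the scaling that preserves solenoidal fields.\<close>

definition contraction_family :: "(real \<Rightarrow> 'b \<Rightarrow> 'b::euclidean_space) \<Rightarrow> bool" where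
  "contraction_family D \<longleftrightarrow> (\<forall>s\<ge>0. bounded_linear (D s) \<and> (\<forall>y. norm (D s y) \<le> norm y)) \<and>
     (\<forall>y. (\<lambda>n. D (1 / Suc n) y) \<longlonglongrightarrow> y)"

lemma pull_tendsto_test:
  fixes f :: "'a::euclidean_space \<Rightarrow> 'b::euclidean_space" and w :: 'a
  assumes f: "f \<in> test_functions \<Omega>" and w: "\<forall>b\<in>Basis. w \<bullet> b \<ge> 0" and D: "contraction_family D"
  shows "(\<lambda>n. lmap (D (1 / Suc n)) (cmp w c (1 / Suc n) (el f))) \<longlonglongrightarrow> el f"
proof -
  have Ds: "bounded_linear (D (1 / Suc n))" "norm (D (1 / Suc n) y) \<le> norm y" for n y
    using D by (auto simp: contraction_family_def)
  have sf: "square_int f" by (rule test_functions_square_int[OF f])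
  have eq: "lmap (D (1 / Suc n)) (cmp w c (1 / Suc n) (el f)) = el (\<lambda>x. D (1 / Suc n) (f (stretch w c (1 / Suc n) x)))" for n
    using cmp_el[OF w _ sf, of "1 / Suc n" c] lmap_el[OF Ds(1) square_int_stretch(1)[OF w _ sf], of "1 / Suc n" n c] by simp
  obtain B K where K: "compact K" "B \<ge> 0" "\<And>x. norm (f x) \<le> B * indicator K x" using test_functions_dominated[OF f] by metis
  obtain R where R: "\<And>x. x \<in> K \<Longrightarrow> norm x \<le> R" using compact_imp_bounded[OF K(1)] by (auto simp: bounded_iff)
  have bd: "norm (x - c) \<le> norm (stretch w c (1 / Suc n) x - c)" for x n
  proof (rule norm_le_componentwise)
    fix b :: 'a assume b: "b \<in> Basis"
    have "(stretch w c (1 / Suc n) x - c) \<bullet> b = (1 + 1 / Suc n * (w \<bullet> b)) * ((x - c) \<bullet> b)"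
      using b by (simp only: inner_diff_left stretch_inner) (simp add: algebra_simps)
    then show "\<bar>(x - c) \<bullet> b\<bar> \<le> \<bar>(stretch w c (1 / Suc n) x - c) \<bullet> b\<bar>"
      using stretch_coeff_pos(1)[OF w, of "1 / Suc n" b] b by (simp add: abs_mult mult_le_cancel_right1)
  qed
  \<comment> \<open>If the stretched point lies in \<open>K\<close>, the original one is no farther
    from the centre and so lies in this ball; the ball serves for all n.\<close>
  let ?R = "R + norm c + norm c"
  have g: "square_int (\<lambda>x::'a. indicator (cball 0 ?R) x *\<^sub>R B)" by (rule square_int_indicator) auto
  have l: "(\<lambda>n. D (1 / Suc n) (f (stretch w c (1 / Suc n) x))) \<longlonglongrightarrow> f x" for x
  proof -
    have st: "(\<lambda>n. stretch w c (1 / Suc n) x) \<longlonglongrightarrow> x"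
    proof (rule tendsto_componentwise_iff[THEN iffD2], rule ballI)
      fix b :: 'a assume b: "b \<in> Basis"
      have "(\<lambda>n. x \<bullet> b + 1 / Suc n * (w \<bullet> b) * (x \<bullet> b - c \<bullet> b)) \<longlonglongrightarrow> x \<bullet> b + 0 * (w \<bullet> b) * (x \<bullet> b - c \<bullet> b)"
        by (intro tendsto_intros LIMSEQ_Suc[OF lim_const_over_n])
      then show "(\<lambda>n. stretch w c (1 / Suc n) x \<bullet> b) \<longlonglongrightarrow> x \<bullet> b" by (simp add: stretch_inner[OF b])
    qed
    have fl: "(\<lambda>n. f (stretch w c (1 / Suc n) x)) \<longlonglongrightarrow> f x"
      using continuous_on_tendsto_compose[OF test_functions_continuous[OF f, of UNIV] st] by simp
    have "(\<lambda>n. D (1 / Suc n) (f (stretch w c (1 / Suc n) x) - f x)) \<longlonglongrightarrow> 0"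
      by (rule Lim_null_comparison[OF always_eventually tendsto_norm_zero[OF LIM_zero[OF fl]]]) (use Ds in auto)
    then have "(\<lambda>n. D (1 / Suc n) (f (stretch w c (1 / Suc n) x) - f x) + D (1 / Suc n) (f x)) \<longlonglongrightarrow> 0 + f x"
      using D by (intro tendsto_add) (auto simp: contraction_family_def)
    then show ?thesis by (simp only: linear_diff[OF bounded_linear.linear[OF Ds(1)]] diff_add_cancel add_0)
  qed
  show ?thesis unfolding eq
  proof (rule el_dominated(1)[OF _ g])
    show "(\<lambda>x. D (1 / Suc n) (f (stretch w c (1 / Suc n) x))) \<in> borel_measurable lebesgue" for n
      by (rule square_int_measurable[OF square_int_linear[OF Ds(1) square_int_stretch(1)[OF w _ sf]]]) simp
    show "AE x in lebesgue. norm (D (1 / Suc n) (f (stretch w c (1 / Suc n) x))) \<le> norm (indicator (cball 0 ?R) x *\<^sub>R B)" for n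
    proof (rule AE_I2)
      fix x
      let ?y = "stretch w c (1 / Suc n) x"
      have 1: "norm (D (1 / Suc n) (f ?y)) \<le> B * indicator K ?y" using Ds(2) K(3) order_trans by blast
      show "norm (D (1 / Suc n) (f ?y)) \<le> norm (indicator (cball 0 ?R) x *\<^sub>R B)"
      proof (cases "?y \<in> K")
        case True
        then have "norm x \<le> ?R"
          using R[of ?y] bd[of x n] norm_triangle_ineq4[of ?y c] norm_triangle_ineq[of "x - c" c] by auto
        then show ?thesis using 1 True K(2) by simp
      qed (use 1 in simp)
    qed
    show "AE x in lebesgue. (\<lambda>n. D (1 / Suc n) (f (stretch w c (1 / Suc n) x))) \<longlonglongrightarrow> f x" using l by blast
  qed
qed

lemma pull_tendsto:
  fixes x :: "('a::euclidean_space, 'b::euclidean_space, 'n::finite) hv" and w :: 'a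
  assumes w: "\<forall>b\<in>Basis. w \<bullet> b \<ge> 0" "\<forall>b\<in>Basis. w \<bullet> b \<le> 1" and D: "contraction_family D"
    and eB: "\<And>i. e i \<in> Basis" and x: "x \<in> HS e \<Omega>"
  shows "(\<lambda>n. pull (D (1 / Suc n)) w c (1 / Suc n) e x) \<longlonglongrightarrow> x"
proof -
  let ?P = "\<lambda>n. pull (D (1 / Suc n)) w c (1 / Suc n) e"
  have Ds: "bounded_linear (D (1 / Suc n))" "norm (D (1 / Suc n) y) \<le> norm y" for n y
    using D by (auto simp: contraction_family_def)
  have Pb: "bounded_linear (?P n)" "norm (?P n y) \<le> 2 * norm y" for n and y :: "('a, 'b, 'n) hv"
    by (rule bounded_linear_pull[OF w _ _ Ds eB]; simp)+
  have test: "(\<lambda>n. ?P n (h_graph e f)) \<longlonglongrightarrow> h_graph e f" if f: "f \<in> test_functions \<Omega>" for f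
  proof -
    have "(\<lambda>n. (1 + 1 / Suc n * (w \<bullet> e i)) *\<^sub>R lmap (D (1 / Suc n)) (cmp w c (1 / Suc n) (el (dir_deriv (e i) f)))) \<longlonglongrightarrow> (1 + 0 * (w \<bullet> e i)) *\<^sub>R el (dir_deriv (e i) f)" for i
      by (intro tendsto_intros LIMSEQ_Suc[OF lim_const_over_n] pull_tendsto_test[OF test_functions_dir_deriv[OF f eB] w(1) D])
    then show ?thesis
      unfolding pull_def h_graph_def
      by (intro tendsto_Pair vec_tendstoI) (use pull_tendsto_test[OF f w(1) D] in simp_all)
  qed
  show ?thesis
  proof (rule LIMSEQ_I)
    fix \<epsilon> :: real assume \<epsilon>: "\<epsilon> > 0"
    obtain \<phi> where f: "\<And>n. \<phi> n \<in> test_functions \<Omega>" "(\<lambda>n. h_graph e (\<phi> n)) \<longlonglongrightarrow> x" using HS_seq[OF x] by blast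
    \<comment> \<open>One quarter of \<epsilon>, because the operators have norm at most 2 and the
      approximation error enters twice: 2 * \<epsilon>/4 + \<epsilon>/4 + \<epsilon>/4.\<close>
    obtain k where k: "norm (h_graph e (\<phi> k) - x) < \<epsilon> / 4" using LIMSEQ_D[OF f(2), of "\<epsilon> / 4"] \<epsilon> by auto
    let ?h = "h_graph e (\<phi> k)"
    obtain N where N: "\<And>n. n \<ge> N \<Longrightarrow> norm (?P n ?h - ?h) < \<epsilon> / 4" using LIMSEQ_D[OF test[OF f(1)[of k]], of "\<epsilon> / 4"] \<epsilon> by auto
    have telescope: "a - d = a - b + (b - h) + (h - d)" for a b h d :: "('a, 'b, 'n) hv" by simp
    have "norm (?P n x - x) < \<epsilon>" if "n \<ge> N" for n
    proof -
      have eq: "?P n x - x = ?P n (x - ?h) + (?P n ?h - ?h) + (?h - x)"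
        unfolding linear_diff[OF bounded_linear.linear[OF Pb(1)[of n]], of x ?h] by (rule telescope)
      have "norm (?P n x - x) \<le> norm (?P n (x - ?h)) + norm (?P n ?h - ?h) + norm (?h - x)"
        unfolding eq using norm_triangle_ineq[of "?P n (x - ?h) + (?P n ?h - ?h)" "?h - x"] norm_triangle_ineq[of "?P n (x - ?h)" "?P n ?h - ?h"] by linarith
      then show ?thesis using Pb(2)[of n "x - ?h"] k N[OF that] unfolding norm_minus_commute[of x ?h] by linarith
    qed
    then show "\<exists>no. \<forall>n\<ge>no. norm (?P n x - x) < \<epsilon>" by blast
  qed
qed

text \<open>For fixed k the stretching carries a whole tail of the sequence, and so its convex hull,
  into the space over the limit domain. Mazur's lemma gives strongly convergent convex combinations,
  so the stretched limit lies there too; finally k tends to infinity. Values are left alone because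
  the divergence is treated separately.\<close>

lemma mosco_weak_limit:
  fixes x :: "nat \<Rightarrow> ('a::euclidean_space, 'b::euclidean_space, 'n::finite) hv" and w :: 'a
  assumes w: "\<forall>b\<in>Basis. w \<bullet> b \<ge> 0" "\<forall>b\<in>Basis. w \<bullet> b \<le> 1" and e: "bij_betw e UNIV Basis"
    and sub: "\<And>k. eventually (\<lambda>n. \<forall>y. stretch w c (1 / Suc k) y \<in> \<Omega> n \<longrightarrow> y \<in> \<Omega>') sequentially"
    and bdd: "\<And>n. \<Omega> n \<subseteq> \<Omega>M" and x: "\<And>n. x n \<in> HS e (\<Omega> n)" and B: "\<And>n. norm (x n) \<le> B" and wl: "weakly_to x l"
  shows "l \<in> HS e \<Omega>'"
proof -
  have eB: "e i \<in> Basis" for i using e by (auto simp: bij_betw_def)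
  let ?D = "\<lambda>s y. y"
  have D: "contraction_family ?D" by (simp add: contraction_family_def)
  obtain W where W: "\<And>n. W n \<in> convex hull (x ` {n..})" "W \<longlonglongrightarrow> l" using weakly_to_mazur[OF wl B] by blast
  have Ds: "bounded_linear (\<lambda>y::'b. y)" by simp
  have "x n \<in> HS e \<Omega>M" for n using HS_mono[OF bdd] x by blast
  then have "convex hull (x ` {n..}) \<subseteq> HS e \<Omega>M" for n
    by (intro hull_minimal subspace_imp_convex[OF HS_subspace[OF eB]]) auto
  then have lM: "l \<in> HS e \<Omega>M" using closed_sequentially[OF HS_closed _ W(2)] W(1) by blast
  have "pull (\<lambda>y::'b. y) w c (1 / Suc k) e l \<in> HS e \<Omega>'" for k
  proof -
    obtain N where N: "\<And>n y. n \<ge> N \<Longrightarrow> stretch w c (1 / Suc k) y \<in> \<Omega> n \<Longrightarrow> y \<in> \<Omega>'"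
      using sub[of k] unfolding eventually_sequentially by blast
    let ?P = "pull (\<lambda>y::'b. y) w c (1 / Suc k) e :: ('a, 'b, 'n) hv \<Rightarrow> _"
    have bl: "bounded_linear ?P" by (rule bounded_linear_pull(1)[OF w _ _ Ds _ eB]) auto
    have sb: "subspace {y. ?P y \<in> HS e \<Omega>'}"
      using linear_subspace_vimage[OF bounded_linear.linear[OF bl] HS_subspace[OF eB]] by (simp add: vimage_def)
    have hs: "convex hull (x ` {n..}) \<subseteq> {y. ?P y \<in> HS e \<Omega>'}" if "n \<ge> N" for n
    proof (rule hull_minimal, rule image_subsetI, rule CollectI)
      show "convex {y. ?P y \<in> HS e \<Omega>'}" by (rule subspace_imp_convex[OF sb])
      fix m assume "m \<in> {n..}"
      then have "m \<ge> N" using that by simp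
      show "?P (x m) \<in> HS e \<Omega>'"
        by (rule pull_HS[OF w _ _ Ds _ eB N[OF \<open>m \<ge> N\<close>] x[of m]]) auto
    qed
    have ev: "?P (W (n + N)) \<in> HS e \<Omega>'" for n using subsetD[OF hs[of "n + N", OF le_add2] W(1)[of "n + N"]] by (rule CollectD)
    have "(\<lambda>n. ?P (W (n + N))) \<longlonglongrightarrow> ?P l" by (rule bounded_linear.tendsto[OF bl LIMSEQ_ignore_initial_segment[OF W(2)]])
    then show ?thesis by (rule closed_sequentially[OF HS_closed ev])
  qed
  moreover have "(\<lambda>n. pull (\<lambda>y::'b. y) w c (1 / Suc n) e l) \<longlonglongrightarrow> l" by (rule pull_tendsto[OF w D eB lM])
  ultimately show ?thesis by (rule closed_sequentially[OF HS_closed])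
qed

section \<open>Stability of the Boussinesq system under convergence of domains\<close>

text \<open>The divergence as a bounded operator on the pairs, so that the solenoidal ones form a
  closed subspace without reference to a domain.\<close>

definition hdiv :: "(real ^ 2, real ^ 2, 2) hv \<Rightarrow> (real ^ 2, real) l2" where
  "hdiv x = (\<Sum>i\<in>UNIV. lmap (\<lambda>y. y $ i) (snd x $ i))"

lemma bounded_linear_hdiv: "bounded_linear hdiv"
  unfolding hdiv_def[abs_def]
  by (intro bounded_linear_sum bounded_linear_compose[OF bounded_linear_lmap[OF bounded_linear_vec_nth]]
      bounded_linear_compose[OF bounded_linear_vec_nth bounded_linear_snd])

text \<open>Up to the determinant, which is constant for an affine map, this is the inverse of the
  linear part of the stretching. Without that factor the map is a contraction.\<close>

definition shrink :: "real ^ 2 \<Rightarrow> real \<Rightarrow> real ^ 2 \<Rightarrow> real ^ 2" where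
  "shrink w s y = (\<chi> i. y $ i / (1 + s * w $ i))"

lemma ax_coeff:
  assumes "\<forall>b\<in>Basis. (w::real^2) \<bullet> b \<ge> 0" "s \<ge> 0" shows "1 + s * w $ i \<ge> 1"
  using stretch_coeff_pos(1)[OF assms, of "ax i"] by simp

lemma bounded_linear_shrink:
  assumes w: "\<forall>b\<in>Basis. w \<bullet> b \<ge> 0" and s: "s \<ge> 0"
  shows "bounded_linear (shrink w s)" "norm (shrink w s y) \<le> norm y"
proof -
  have n: "norm (shrink w s y) \<le> norm y" for y
  proof (rule norm_le_componentwise_cart)
    fix i
    show "norm (shrink w s y $ i) \<le> norm (y $ i)"
      using ax_coeff[OF w s, of i] by (simp add: shrink_def abs_divide divide_le_eq mult_le_cancel_left1)
  qed
  show "bounded_linear (shrink w s)"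
    by (rule bounded_linear_intro[where K = 1]) (use n in \<open>auto simp: shrink_def vec_eq_iff add_divide_distrib\<close>)
  show "norm (shrink w s y) \<le> norm y" by (rule n)
qed

lemma contraction_family_shrink:
  assumes w: "\<forall>b\<in>Basis. w \<bullet> b \<ge> 0" shows "contraction_family (shrink w)"
  unfolding contraction_family_def
proof (intro conjI allI impI)
  fix y
  show "(\<lambda>n. shrink w (1 / Suc n) y) \<longlonglongrightarrow> y"
  proof (rule vec_tendstoI)
    fix i
    have "(\<lambda>n. y $ i / (1 + 1 / Suc n * w $ i)) \<longlonglongrightarrow> y $ i / (1 + 0 * w $ i)"
      by (intro tendsto_intros LIMSEQ_Suc[OF lim_const_over_n]) simp
    then show "(\<lambda>n. shrink w (1 / Suc n) y $ i) \<longlonglongrightarrow> y $ i" by (simp add: shrink_def)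
  qed
qed (use bounded_linear_shrink[OF w] in auto)

text \<open>The vector field is scaled by the inverse of the scaling of the coordinates (a Piola transform), which keeps
  it solenoidal.\<close>

lemma hdiv_pull:
  assumes w: "\<forall>b\<in>Basis. w \<bullet> b \<ge> 0" and s: "s \<ge> 0" and x: "hdiv x = 0"
  shows "hdiv (pull (shrink w s) w c s ax x) = 0"
proof -
  have "(1 + s * (w \<bullet> ax i)) *\<^sub>R lmap (\<lambda>y. y $ i) (lmap (shrink w s) (cmp w c s u)) = cmp w c s (lmap (\<lambda>y. y $ i) u)" for i u
  proof -
    note l = square_int_stretch(1)[where c = c, OF w s square_int_fn[of u]]
    note lS = square_int_linear[OF bounded_linear_shrink(1)[OF w s] l]
    note bn = bounded_linear_vec_nth[of i]
    have "cmp w c s (lmap (\<lambda>y. y $ i) u) = el (\<lambda>x. fn u (stretch w c s x) $ i)"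
      unfolding lmap_def by (rule cmp_el[OF w s square_int_linear[OF bn square_int_fn]])
    moreover have "lmap (\<lambda>y. y $ i) (lmap (shrink w s) (cmp w c s u)) = el (\<lambda>x. shrink w s (fn u (stretch w c s x)) $ i)"
      unfolding cmp_def lmap_el[OF bounded_linear_shrink(1)[OF w s] l] by (rule lmap_el[OF bn lS])
    moreover have "(1 + s * w $ i) *\<^sub>R el (\<lambda>x. shrink w s (fn u (stretch w c s x)) $ i) = el (\<lambda>x. (1 + s * w $ i) *\<^sub>R (shrink w s (fn u (stretch w c s x)) $ i))"
      by (rule el_scaleR[symmetric, OF square_int_linear[OF bn lS]])
    ultimately show ?thesis using ax_coeff[OF w s, of i] by (simp add: shrink_def)
  qed
  then have "hdiv (pull (shrink w s) w c s ax x) = (\<Sum>i\<in>UNIV. cmp w c s (lmap (\<lambda>y. y $ i) (snd x $ i)))"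
    unfolding hdiv_def pull_def
    by (simp only: snd_conv vec_lambda_beta linear_scale[OF bounded_linear.linear[OF bounded_linear_lmap[OF bounded_linear_vec_nth]]])
  also have "\<dots> = cmp w c s (hdiv x)"
    unfolding hdiv_def by (rule linear_sum[OF bounded_linear.linear[OF bounded_linear_cmp(1)[OF w s]], symmetric])
  finally show ?thesis using x linear_0[OF bounded_linear.linear[OF bounded_linear_cmp(1)[OF w s]]] by simp
qed

text \<open>\<open>\<theta>\<close> is the difference of the temperature and its boundary data \<open>D\<close>; in contrast to the temperature, it extends by
  zero to a Sobolev function on the plane.\<close>

definition hsol :: "real \<Rightarrow> real \<Rightarrow> real \<Rightarrow> (real ^ 2, real ^ 2) l2 \<Rightarrow> (real ^ 2, real) l2 \<Rightarrow> (real ^ 2, real, 2) hv \<Rightarrow>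
    (real ^ 2) set \<Rightarrow> (real ^ 2, real ^ 2, 2) hv \<Rightarrow> (real ^ 2, real, 2) hv \<Rightarrow> bool" where
  "hsol Rey Pra Gra G1 G2 D \<Omega> v \<theta> \<longleftrightarrow> v \<in> HS ax \<Omega> \<and> hdiv v = 0 \<and> \<theta> \<in> HS ax \<Omega> \<and>
    (\<forall>\<phi>\<in>HS ax \<Omega>. hdiv \<phi> = 0 \<longrightarrow>
       inner (snd v) (mul (fst v) (fst \<phi>)) + 1 / Rey * inner (snd v) (snd \<phi>)
       - Gra / Rey\<^sup>2 * inner (lmap (\<lambda>t. t *\<^sub>R axis 2 1) (fst D + fst \<theta>)) (fst \<phi>) = inner G1 (fst \<phi>)) \<and>
    (\<forall>\<phi>\<in>HS ax \<Omega>.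
       inner (snd D + snd \<theta>) (mul (fst v) (fst \<phi>)) + 1 / (Rey * Pra) * inner (snd D + snd \<theta>) (snd \<phi>) = inner G2 (fst \<phi>))"

section \<open>Passing to the limit in products and in the system\<close>

lemma norm_snd_le_norm: "norm (snd z) \<le> norm z"
  using norm_snd_le[of "snd z" "fst z"] by simp

lemma LIMSEQ_sq_norm_bound:
  fixes x :: "nat \<Rightarrow> 'a::real_normed_vector"
  assumes "\<And>n. (norm (x n - l))\<^sup>2 \<le> b n" "b \<longlonglongrightarrow> 0"
  shows "x \<longlonglongrightarrow> l"
proof -
  have "(\<lambda>n. sqrt (b n)) \<longlonglongrightarrow> 0" using tendsto_real_sqrt[OF assms(2)] by simp
  then have "(\<lambda>n. x n - l) \<longlonglongrightarrow> 0"
    by (rule Lim_null_comparison[rotated]) (use assms(1) real_le_rsqrt in \<open>auto intro!: always_eventually\<close>)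
  then show ?thesis by (rule LIM_zero_cancel)
qed

text \<open>Ladyzhenskaya's inequality bounds the squared norm of the difference by the L2 norm of
  the moving difference times quantities that stay bounded. Thus L2 convergence suffices, although
  the gradients are only bounded.\<close>

lemma mul_tendsto_left:
  fixes v :: "nat \<Rightarrow> (real ^ 2, real ^ 2, 2) hv" and p :: "(real ^ 2, 'b::euclidean_space, 2) hv"
  assumes v: "\<And>n. v n \<in> HS ax \<Omega>" "l \<in> HS ax \<Omega>" and p: "p \<in> HS ax \<Omega>'" and B: "\<And>n. norm (v n) \<le> B"
    and lim: "(\<lambda>n. fst (v n)) \<longlonglongrightarrow> fst l"
  shows "(\<lambda>n. mul (fst (v n)) (fst p)) \<longlonglongrightarrow> mul (fst l) (fst p)"
proof (rule LIMSEQ_sq_norm_bound)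
  let ?c = "4 * (B + norm l) * norm (fst p) * norm (snd p)"
  have d: "v n - l \<in> HS ax \<Omega>" for n by (rule subspace_diff[OF HS_subspace[OF ax_Basis] v])
  have b: "norm (snd (v n - l)) \<le> B + norm l" for n
    using norm_snd_le_norm[of "v n - l"] norm_triangle_ineq4[of "v n" l] B[of n] by linarith
  show "(norm (mul (fst (v n)) (fst p) - mul (fst l) (fst p)))\<^sup>2 \<le> ?c * norm (fst (v n) - fst l)" for n
  proof -
    have "(norm (mul (fst (v n)) (fst p) - mul (fst l) (fst p)))\<^sup>2 \<le> 4 * norm (fst (v n - l)) * norm (snd (v n - l)) * norm (fst p) * norm (snd p)"
      using mul_square_int(2)[OF d[of n] p] mul_diff(1)[OF v(1)[of n] v(2) p p] by simp
    also have "\<dots> \<le> 4 * norm (fst (v n - l)) * (B + norm l) * norm (fst p) * norm (snd p)"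
      by (rule mult_right_mono, rule mult_right_mono, rule mult_left_mono[OF b]) simp_all
    finally show ?thesis by (simp only: fst_diff mult_ac)
  qed
  show "(\<lambda>n. ?c * norm (fst (v n) - fst l)) \<longlonglongrightarrow> 0"
    by (rule tendsto_mult_right_zero[OF tendsto_norm_zero[OF LIM_zero[OF lim]]])
qed

lemma mul_tendsto_right:
  fixes v :: "(real ^ 2, real ^ 2, 2) hv" and p :: "nat \<Rightarrow> (real ^ 2, 'b::euclidean_space, 2) hv"
  assumes v: "v \<in> HS ax \<Omega>" and p: "\<And>n. p n \<in> HS ax \<Omega>'" "q \<in> HS ax \<Omega>'" and lim: "p \<longlonglongrightarrow> q"
  shows "(\<lambda>n. mul (fst v) (fst (p n))) \<longlonglongrightarrow> mul (fst v) (fst q)"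
proof (rule LIMSEQ_sq_norm_bound)
  have d: "p n - q \<in> HS ax \<Omega>'" for n by (rule subspace_diff[OF HS_subspace[OF ax_Basis] p])
  show "(norm (mul (fst v) (fst (p n)) - mul (fst v) (fst q)))\<^sup>2 \<le> 4 * norm (fst v) * norm (snd v) * norm (fst (p n - q)) * norm (snd (p n - q))" for n
    using mul_square_int(2)[OF v d[of n]] mul_diff(2)[OF v v p(1)[of n] p(2)] by simp
  show "(\<lambda>n. 4 * norm (fst v) * norm (snd v) * norm (fst (p n - q)) * norm (snd (p n - q))) \<longlonglongrightarrow> 0"
    using tendsto_mult[OF tendsto_mult[OF tendsto_const tendsto_norm[OF tendsto_fst[OF LIM_zero[OF lim]]]] tendsto_norm[OF tendsto_snd[OF LIM_zero[OF lim]]],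
      of "4 * norm (fst v) * norm (snd v)"] by simp
qed

lemma weakly_to_add_const: "weakly_to x l \<Longrightarrow> weakly_to (\<lambda>n. c + x n) (c + l)"
  unfolding weakly_to_def inner_add_left by (auto intro: tendsto_add)

text \<open>Two successive limits: in n with a test function common to almost all domains, then in
  the stretching parameter. The two inclusion hypotheses have different roles: \<open>s1\<close>
  puts the weak limits into the space over the limit domain, \<open>s2\<close> provides the common
  test functions.\<close>

lemma hsol_limit:
  fixes v :: "nat \<Rightarrow> (real ^ 2, real ^ 2, 2) hv" and \<theta> :: "nat \<Rightarrow> (real ^ 2, real, 2) hv"
  assumes sol: "\<And>n. hsol Rey Pra Gra G1 G2 D (\<Omega> n) (v n) (\<theta> n)" and B: "\<And>n. norm (v n) \<le> B" "\<And>n. norm (\<theta> n) \<le> B"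
    and \<Omega>M: "bounded \<Omega>M" "\<And>n. \<Omega> n \<subseteq> \<Omega>M" "\<Omega>' \<subseteq> \<Omega>M"
    and w: "\<forall>b\<in>Basis. w \<bullet> b \<ge> 0" "\<forall>b\<in>Basis. w \<bullet> b \<le> 1"
    and s1: "\<And>k. eventually (\<lambda>n. \<forall>y. stretch w c (1 / Suc k) y \<in> \<Omega> n \<longrightarrow> y \<in> \<Omega>') sequentially"
    and s2: "\<And>k. eventually (\<lambda>n. \<forall>y. stretch w c (1 / Suc k) y \<in> \<Omega>' \<longrightarrow> y \<in> \<Omega> n) sequentially"
  obtains r vl \<theta>l where "strict_mono (r :: nat \<Rightarrow> nat)" "hsol Rey Pra Gra G1 G2 D \<Omega>' vl \<theta>l"
    "(\<lambda>n. fst (\<theta> (r n))) \<longlonglongrightarrow> fst \<theta>l"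
proof -
  obtain r1 vl where r1: "strict_mono r1" "weakly_to (v \<circ> r1) vl" using bounded_weak_subseq[of v B] B(1) by blast
  obtain r2 \<theta>l where r2: "strict_mono r2" "weakly_to ((\<theta> \<circ> r1) \<circ> r2) \<theta>l" using bounded_weak_subseq[of "\<theta> \<circ> r1" B] B(2) by auto
  define r where "r = r1 \<circ> r2"
  have r: "strict_mono r" unfolding r_def by (rule strict_mono_o[OF r1(1) r2(1)])
  define V where "V n = v (r n)" for n
  define T where "T n = \<theta> (r n)" for n
  have wV: "weakly_to V vl" using weakly_to_subseq[OF r1(2) r2(1)] by (simp add: V_def[abs_def] r_def o_def)
  have wT: "weakly_to T \<theta>l" using r2(2) by (simp add: T_def[abs_def] r_def o_def)
  have BV: "norm (V n) \<le> B" and BT: "norm (T n) \<le> B" for n by (simp_all add: V_def T_def B)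
  have solr: "hsol Rey Pra Gra G1 G2 D (\<Omega> (r n)) (V n) (T n)" for n unfolding V_def T_def by (rule sol)
  have ev: "eventually (\<lambda>n. P (r n)) sequentially" if "eventually P sequentially" for P
    by (rule eventually_subseq[OF r that])
  have VH: "V n \<in> HS ax (\<Omega> (r n))" and TH: "T n \<in> HS ax (\<Omega> (r n))" and dV: "hdiv (V n) = 0" for n
    using solr[of n] by (auto simp: hsol_def)
  have VM: "V n \<in> HS ax \<Omega>M" and TM: "T n \<in> HS ax \<Omega>M" for n using HS_mono[OF \<Omega>M(2)] VH TH by blast+
  have vl': "vl \<in> HS ax \<Omega>'" by (rule mosco_weak_limit[OF w ax_bij ev[OF s1] \<Omega>M(2) VH BV wV])
  have tl': "\<theta>l \<in> HS ax \<Omega>'" by (rule mosco_weak_limit[OF w ax_bij ev[OF s1] \<Omega>M(2) TH BT wT])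
  note RV = rellich_HS[OF ax_bij \<Omega>M(1) VM BV wV] and RT = rellich_HS[OF ax_bij \<Omega>M(1) TM BT wT]
  have dvl: "hdiv vl = 0"
  proof -
    have sub: "subspace {x. hdiv x = 0}" 
      using bounded_linear.linear[OF bounded_linear_hdiv] by (simp add: subspace_def linear_0 linear_add linear_scale)
    have "closed {x. hdiv x = 0}"
      using continuous_closed_vimage[OF closed_singleton[of 0], of hdiv] linear_continuous_at[OF bounded_linear_hdiv] by (simp add: vimage_def)
    then show ?thesis using weakly_closed[OF wV BV _ subspace_imp_convex[OF sub]] dV by auto
  qed
  have wsV: "weakly_to (\<lambda>n. snd (V n)) (snd vl)" and wsT: "weakly_to (\<lambda>n. snd D + snd (T n)) (snd D + snd \<theta>l)"
    by (rule weakly_to_snd[OF wV], rule weakly_to_add_const[OF weakly_to_snd[OF wT]])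
  have bsV: "norm (snd (V n)) \<le> B" for n using norm_snd_le_norm[of "V n"] BV[of n] by linarith
  have bsT: "norm (snd D + snd (T n)) \<le> norm (snd D) + B" for n
    using norm_snd_le_norm[of "T n"] BT[of n] norm_triangle_ineq[of "snd D" "snd (T n)"] by linarith
  let ?L = "lmap (\<lambda>t. t *\<^sub>R axis 2 1) :: (real ^ 2, real) l2 \<Rightarrow> (real ^ 2, real ^ 2) l2"
  have bL: "bounded_linear ?L" by (intro bounded_linear_lmap bounded_linear_scaleR_left)
  have mV: "(\<lambda>n. mul (fst (V n)) (fst \<phi>)) \<longlonglongrightarrow> mul (fst vl) (fst \<phi>)" if "\<phi> \<in> HS ax \<Omega>'" for \<phi> :: "(real ^ 2, 'c::euclidean_space, 2) hv"
    by (rule mul_tendsto_left[OF VM RV(1) that BV RV(2)])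
  let ?P = "\<lambda>k. pull (shrink w (1 / Suc k)) w c (1 / Suc k) ax"
  let ?Q = "\<lambda>k. pull (\<lambda>y. y) w c (1 / Suc k) ax"
  \<comment> \<open>First limit: the test function stays fixed, and the gradients, converging
    weakly, are paired with the products, converging strongly.\<close>
  have eq1': "inner (snd vl) (mul (fst vl) (fst \<phi>)) + 1 / Rey * inner (snd vl) (snd \<phi>)
       - Gra / Rey\<^sup>2 * inner (?L (fst D + fst \<theta>l)) (fst \<phi>) = inner G1 (fst \<phi>)"
    if p: "\<phi> \<in> HS ax \<Omega>M" and ep: "eventually (\<lambda>n. \<phi> \<in> HS ax (\<Omega> (r n)) \<and> hdiv \<phi> = 0) sequentially" for \<phi>
  proof (rule LIMSEQ_unique)
    show "(\<lambda>n. inner (snd (V n)) (mul (fst (V n)) (fst \<phi>)) + 1 / Rey * inner (snd (V n)) (snd \<phi>)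
       - Gra / Rey\<^sup>2 * inner (?L (fst D + fst (T n))) (fst \<phi>)) \<longlonglongrightarrow> inner (snd vl) (mul (fst vl) (fst \<phi>)) + 1 / Rey * inner (snd vl) (snd \<phi>)
       - Gra / Rey\<^sup>2 * inner (?L (fst D + fst \<theta>l)) (fst \<phi>)"
      by (intro tendsto_diff tendsto_add tendsto_mult tendsto_const weakly_to_strong_inner[OF wsV bsV] mul_tendsto_left[OF VM RV(1) p BV RV(2)]
          tendsto_inner[OF bounded_linear.tendsto[OF bL tendsto_add[OF tendsto_const RT(2)]] tendsto_const])
    show "(\<lambda>n. inner (snd (V n)) (mul (fst (V n)) (fst \<phi>)) + 1 / Rey * inner (snd (V n)) (snd \<phi>)
       - Gra / Rey\<^sup>2 * inner (?L (fst D + fst (T n))) (fst \<phi>)) \<longlonglongrightarrow> inner G1 (fst \<phi>)"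
      by (rule tendsto_eventually, use ep in eventually_elim) (use solr in \<open>auto simp: hsol_def\<close>)
  qed
  \<comment> \<open>Second limit: the stretched copies qualify for the first limit, remain
    solenoidal by the rescaling of their values, and converge strongly.\<close>
  have eq1: "inner (snd vl) (mul (fst vl) (fst \<phi>)) + 1 / Rey * inner (snd vl) (snd \<phi>)
       - Gra / Rey\<^sup>2 * inner (?L (fst D + fst \<theta>l)) (fst \<phi>) = inner G1 (fst \<phi>)"
    if p: "\<phi> \<in> HS ax \<Omega>'" and d: "hdiv \<phi> = 0" for \<phi>
  proof -
    have lim: "(\<lambda>k. ?P k \<phi>) \<longlonglongrightarrow> \<phi>" by (rule pull_tendsto[OF w contraction_family_shrink[OF w(1)] ax_Basis p])
    have pH: "eventually (\<lambda>n. ?P k \<phi> \<in> HS ax (\<Omega> (r n))) sequentially" for k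
      using ev[OF s2[of k]]
    proof eventually_elim
      case (elim n)
      then show ?case by (intro pull_HS[OF w _ _ _ _ ax_Basis _ p] bounded_linear_shrink[OF w(1)]) auto
    qed
    have pM: "?P k \<phi> \<in> HS ax \<Omega>M" for k
      using eventually_happens[OF pH[of k]] HS_mono[OF \<Omega>M(2)] by auto
    have pd: "hdiv (?P k \<phi>) = 0" for k by (rule hdiv_pull[OF w(1) _ d]) simp
    have "inner (snd vl) (mul (fst vl) (fst (?P k \<phi>))) + 1 / Rey * inner (snd vl) (snd (?P k \<phi>))
       - Gra / Rey\<^sup>2 * inner (?L (fst D + fst \<theta>l)) (fst (?P k \<phi>)) = inner G1 (fst (?P k \<phi>))" for k
      using pH[of k] pd[of k] by (intro eq1' pM) simp
    moreover have "(\<lambda>k. inner (snd vl) (mul (fst vl) (fst (?P k \<phi>))) + 1 / Rey * inner (snd vl) (snd (?P k \<phi>))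
       - Gra / Rey\<^sup>2 * inner (?L (fst D + fst \<theta>l)) (fst (?P k \<phi>))) \<longlonglongrightarrow> inner (snd vl) (mul (fst vl) (fst \<phi>)) + 1 / Rey * inner (snd vl) (snd \<phi>)
       - Gra / Rey\<^sup>2 * inner (?L (fst D + fst \<theta>l)) (fst \<phi>)"
      by (intro tendsto_diff tendsto_add tendsto_mult tendsto_const tendsto_inner mul_tendsto_right[OF vl' pM subsetD[OF HS_mono[OF \<Omega>M(3)] p] lim]
          tendsto_fst[OF lim] tendsto_snd[OF lim])
    moreover have "(\<lambda>k. inner G1 (fst (?P k \<phi>))) \<longlonglongrightarrow> inner G1 (fst \<phi>)" by (intro tendsto_inner tendsto_const tendsto_fst[OF lim])
    ultimately show ?thesis using LIMSEQ_unique by simp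
  qed
  have eq2': "inner (snd D + snd \<theta>l) (mul (fst vl) (fst \<phi>)) + 1 / (Rey * Pra) * inner (snd D + snd \<theta>l) (snd \<phi>) = inner G2 (fst \<phi>)"
    if p: "\<phi> \<in> HS ax \<Omega>M" and ep: "eventually (\<lambda>n. \<phi> \<in> HS ax (\<Omega> (r n))) sequentially" for \<phi>
  proof (rule LIMSEQ_unique)
    show "(\<lambda>n. inner (snd D + snd (T n)) (mul (fst (V n)) (fst \<phi>)) + 1 / (Rey * Pra) * inner (snd D + snd (T n)) (snd \<phi>))
      \<longlonglongrightarrow> inner (snd D + snd \<theta>l) (mul (fst vl) (fst \<phi>)) + 1 / (Rey * Pra) * inner (snd D + snd \<theta>l) (snd \<phi>)"
      by (intro tendsto_add tendsto_mult tendsto_const weakly_to_strong_inner[OF wsT bsT] mul_tendsto_left[OF VM RV(1) p BV RV(2)])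
    show "(\<lambda>n. inner (snd D + snd (T n)) (mul (fst (V n)) (fst \<phi>)) + 1 / (Rey * Pra) * inner (snd D + snd (T n)) (snd \<phi>)) \<longlonglongrightarrow> inner G2 (fst \<phi>)"
      by (rule tendsto_eventually, use ep in eventually_elim) (use solr in \<open>auto simp: hsol_def\<close>)
  qed
  have eq2: "inner (snd D + snd \<theta>l) (mul (fst vl) (fst \<phi>)) + 1 / (Rey * Pra) * inner (snd D + snd \<theta>l) (snd \<phi>) = inner G2 (fst \<phi>)"
    if p: "\<phi> \<in> HS ax \<Omega>'" for \<phi>
  proof -
    \<comment> \<open>Scalar test functions carry no divergence constraint, so their values are not
      transformed.\<close>
    have idf: "contraction_family (\<lambda>s y::real. y)" by (simp add: contraction_family_def)
    have lim: "(\<lambda>k. ?Q k \<phi>) \<longlonglongrightarrow> \<phi>" by (rule pull_tendsto[OF w idf ax_Basis p])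
    have pH: "eventually (\<lambda>n. ?Q k \<phi> \<in> HS ax (\<Omega> (r n))) sequentially" for k
      using ev[OF s2[of k]]
    proof eventually_elim
      case (elim n)
      then show ?case by (intro pull_HS[OF w _ _ _ _ ax_Basis _ p]) auto
    qed
    have pM: "?Q k \<phi> \<in> HS ax \<Omega>M" for k
      using eventually_happens[OF pH[of k]] HS_mono[OF \<Omega>M(2)] by auto
    have "inner (snd D + snd \<theta>l) (mul (fst vl) (fst (?Q k \<phi>))) + 1 / (Rey * Pra) * inner (snd D + snd \<theta>l) (snd (?Q k \<phi>)) = inner G2 (fst (?Q k \<phi>))" for k
      by (intro eq2' pM pH)
    moreover have "(\<lambda>k. inner (snd D + snd \<theta>l) (mul (fst vl) (fst (?Q k \<phi>))) + 1 / (Rey * Pra) * inner (snd D + snd \<theta>l) (snd (?Q k \<phi>)))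
      \<longlonglongrightarrow> inner (snd D + snd \<theta>l) (mul (fst vl) (fst \<phi>)) + 1 / (Rey * Pra) * inner (snd D + snd \<theta>l) (snd \<phi>)"
      by (intro tendsto_add tendsto_mult tendsto_const tendsto_inner mul_tendsto_right[OF vl' pM subsetD[OF HS_mono[OF \<Omega>M(3)] p] lim] tendsto_snd[OF lim])
    moreover have "(\<lambda>k. inner G2 (fst (?Q k \<phi>))) \<longlonglongrightarrow> inner G2 (fst \<phi>)" by (intro tendsto_inner tendsto_const tendsto_fst[OF lim])
    ultimately show ?thesis using LIMSEQ_unique by simp
  qed
  have "hsol Rey Pra Gra G1 G2 D \<Omega>' vl \<theta>l" unfolding hsol_def using vl' dvl tl' eq1 eq2 by blast
  moreover have "(\<lambda>n. fst (\<theta> (r n))) \<longlonglongrightarrow> fst \<theta>l" using RT(2) by (simp add: T_def[abs_def])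
  ultimately show ?thesis using that r by blast
qed

section \<open>Admissible boundaries\<close>

definition e1 :: "1 \<Rightarrow> real" where "e1 i = 1"

lemma e1_bij: "bij_betw e1 UNIV Basis"
  by (auto simp: bij_betw_def e1_def inj_on_def)

lemma e1_Basis[simp]: "e1 i \<in> Basis" by (simp add: e1_def)

text \<open>A set of full measure meets every interval, so it is dense up to the end points.
  Combined with continuity this turns a.e. statements on the open interval into statements at every
  point of the closed one.\<close>

lemma AE_dense_unit:
  assumes "AE s in lebesgue. s \<in> {0<..<1} \<longrightarrow> P s" and t: "(t::real) \<in> {0..1}"
  obtains s where "\<And>n::nat. s n \<in> {0<..<1} \<and> P (s n)" "s \<longlonglongrightarrow> t"
proof -
  have "\<exists>s. s \<in> {0<..<1} \<and> P s \<and> \<bar>s - t\<bar> < 1 / Suc n" for n :: nat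
  proof (rule ccontr)
    assume no: "\<not> ?thesis"
    define a where "a = max 0 (t - 1 / Suc n)"
    define b where "b = min 1 (t + 1 / Suc n)"
    have "1 / real (Suc n) > 0" by simp
    then have ab: "a < b" using t unfolding a_def b_def by (simp only: max_less_iff_conj min_less_iff_conj atLeastAtMost_iff) linarith
    have "AE s in lebesgue. s \<notin> {a<..<b}"
    proof (rule AE_mp[OF assms(1)], intro AE_I2 impI notI)
      fix s assume s: "s \<in> {0<..<1} \<longrightarrow> P s" "s \<in> {a<..<b}"
      then have "s \<in> {0<..<1}" "\<bar>s - t\<bar> < 1 / Suc n" by (auto simp: a_def b_def abs_less_iff)
      then show False using no s(1) by blast
    qed
    then have "{a<..<b} \<in> null_sets lebesgue" by (subst AE_iff_null_sets) auto
    then have "emeasure lebesgue {a<..<b} = 0" by (rule null_setsD1)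
    then show False using ab by simp
  qed
  then obtain s where s: "\<And>n::nat. s n \<in> {0<..<1} \<and> P (s n) \<and> \<bar>s n - t\<bar> < 1 / Suc n" by metis
  have "(\<lambda>n. s n - t) \<longlonglongrightarrow> 0"
    by (rule Lim_null_comparison[OF _ LIMSEQ_Suc[OF lim_const_over_n[of 1]]])
       (use s in \<open>auto intro!: always_eventually less_imp_le\<close>)
  then show ?thesis using that s LIM_zero_cancel by blast
qed

text \<open>As an inner product with the derivative, the increment passes to L2 limits of
  derivatives.\<close>

lemma test_increment:
  fixes \<phi> :: "real \<Rightarrow> real"
  assumes t: "\<phi> \<in> test_functions \<Omega>" and st: "s \<le> u"
  shows "\<phi> u - \<phi> s = inner (el (dir_deriv 1 \<phi>)) (el (\<lambda>x. indicator {s..u} x *\<^sub>R (1::real)))"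
proof -
  have tb: "dir_deriv 1 \<phi> \<in> test_functions \<Omega>" by (rule test_functions_dir_deriv[OF t]) simp
  have sq: "square_int (\<lambda>x. indicator {s..u} x *\<^sub>R (1::real))" by (rule square_int_indicator) auto
  have "(LINT y|lborel. indicator {s..u} y *\<^sub>R dir_deriv 1 \<phi> y) = \<phi> u - \<phi> s"
  proof (rule integral_FTC_atLeastAtMost[OF st])
    fix x
    have fd: "frechet_derivative \<phi> (at x) = (\<lambda>h. h *\<^sub>R frechet_derivative \<phi> (at x) 1)"
    proof
      fix h show "frechet_derivative \<phi> (at x) h = h *\<^sub>R frechet_derivative \<phi> (at x) 1"
        using linear_scale[OF has_derivative_linear[OF test_functions_has_derivative[OF t, of x]], of h 1] by simp
    qed
    have "(\<phi> has_vector_derivative dir_deriv 1 \<phi> x) (at x)"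
      unfolding has_vector_derivative_def by (rule has_derivative_eq_rhs[OF test_functions_has_derivative[OF t] fd])
    then show "(\<phi> has_vector_derivative dir_deriv 1 \<phi> x) (at x within {s..u})" by (rule has_vector_derivative_at_within)
  qed (rule test_functions_continuous[OF tb])
  moreover have "(LINT y|lborel. indicator {s..u} y *\<^sub>R dir_deriv 1 \<phi> y) = (LINT y|lebesgue. indicator {s..u} y *\<^sub>R dir_deriv 1 \<phi> y)"
    using test_functions_borel[OF tb] by (intro integral_completion[symmetric]) simp
  moreover have "\<dots> = inner (el (dir_deriv 1 \<phi>)) (el (\<lambda>x. indicator {s..u} x *\<^sub>R (1::real)))"
    by (subst inner_el[OF test_functions_square_int[OF tb] sq]) (simp add: mult.commute)
  ultimately show ?thesis by simp
qed

lemma open_unit: "open {0<..<1::real}" by simp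

text \<open>The derivative is extended by zero, and the bound is wanted a.e. on the whole line; with
  the absolute value of \<open>L\<close> it holds there whatever the sign of
  \<open>L\<close>.\<close>

lemma admissible_hvec:
  assumes "\<gamma> \<in> admissible L \<nu>"
  shows "hvec e1 {0<..<1} \<gamma> \<in> HS e1 {0<..<1}" "\<gamma> \<in> H1 {0<..<1}"
    "AE s in lebesgue. \<bar>fn (snd (hvec e1 {0<..<1} \<gamma>) $ i) s\<bar> \<le> \<bar>L\<bar>"
proof -
  have g: "\<gamma> \<in> H10 {0<..<1}" "AE s in lebesgue_on {0<..<1}. \<bar>weak_deriv {0<..<1} 1 \<gamma> s\<bar> \<le> L" using assms by (auto simp: admissible_def)
  show "hvec e1 {0<..<1} \<gamma> \<in> HS e1 {0<..<1}" by (rule H10_hvec[OF e1_bij open_unit g(1)])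
  show H: "\<gamma> \<in> H1 {0<..<1}" using g by (simp add: H10_def)
  have wL: "square_int (zero_ext {0<..<1} (weak_deriv {0<..<1} 1 \<gamma>))"
    using H1_weak_deriv(1)[OF open_unit H, of 1] by (simp add: L2_iff)
  have "AE s in lebesgue. s \<in> {0<..<1} \<longrightarrow> \<bar>weak_deriv {0<..<1} 1 \<gamma> s\<bar> \<le> L" using g(2) by (subst (asm) AE_lebesgue_on) auto
  then have "AE s in lebesgue. \<bar>zero_ext {0<..<1} (weak_deriv {0<..<1} 1 \<gamma>) s\<bar> \<le> \<bar>L\<bar>"
    by (rule AE_mp) (auto intro!: AE_I2 simp: zero_ext_def indicator_def)
  then show "AE s in lebesgue. \<bar>fn (snd (hvec e1 {0<..<1} \<gamma>) $ i) s\<bar> \<le> \<bar>L\<bar>"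
    using fn_el[OF wL] by (auto simp: hvec_def e1_def elim!: AE_mp)
qed

lemma inner_indicator_le:
  fixes u :: "(real, real) l2"
  assumes "AE s in lebesgue. \<bar>fn u s\<bar> \<le> B" and st: "s \<le> t" and B: "B \<ge> 0"
  shows "\<bar>inner u (el (\<lambda>x. indicator {s..t} x *\<^sub>R (1::real)))\<bar> \<le> B * (t - s)"
proof -
  have sq: "square_int (\<lambda>x. indicator {s..t} x *\<^sub>R (1::real))" by (rule square_int_indicator) auto
  have "inner u (el (\<lambda>x. indicator {s..t} x *\<^sub>R (1::real))) = (LINT x|lebesgue. fn u x \<bullet> (indicator {s..t} x *\<^sub>R (1::real)))"
    using inner_el[OF square_int_fn[of u] sq] by simp
  also have "\<bar>\<dots>\<bar> \<le> (LINT x|lebesgue. B * indicator {s..t} x)"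
  proof (rule order_trans[OF integral_abs_bound], rule integral_mono_AE)
    show "integrable lebesgue (\<lambda>x. \<bar>fn u x \<bullet> (indicator {s..t} x *\<^sub>R (1::real))\<bar>)"
      using square_int_inner[OF square_int_fn[of u] sq] by (rule integrable_abs)
    show "integrable lebesgue (\<lambda>x. B * indicator {s..t} x)"
      by (intro integrable_mult_right integrable_real_indicator) (use st in auto)
    show "AE x in lebesgue. \<bar>fn u x \<bullet> (indicator {s..t} x *\<^sub>R (1::real))\<bar> \<le> B * indicator {s..t} x"
      using assms(1) by (rule AE_mp) (auto intro!: AE_I2 simp: indicator_def B)
  qed
  also have "\<dots> = B * (t - s)" using st by simp
  finally show ?thesis .
qed

text \<open>Approximating test functions converge a.e. along a subsequence, and their increments
  converge to integrals of the weak derivative. This proves the estimate on a set of full measure,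
  and continuity of the chosen representative extends it to the closed interval.\<close>

lemma admissible_Lipschitz:
  assumes a: "\<gamma> \<in> admissible L \<nu>" and s: "s \<in> {0..1}" and t: "t \<in> {0..1}"
  shows "\<bar>\<gamma> s - \<gamma> t\<bar> \<le> \<bar>L\<bar> * \<bar>s - t\<bar>" "\<gamma> s \<le> 1 - \<nu>"
proof -
  let ?I = "{0<..<1::real}"
  have g: "continuous_on {0..1} \<gamma>" "AE s in lebesgue_on ?I. \<gamma> s \<le> 1 - \<nu>" using a by (auto simp: admissible_def)
  let ?x = "hvec e1 ?I \<gamma>"
  note x = admissible_hvec[OF a]
  obtain \<phi> where f: "\<And>n. \<phi> n \<in> test_functions ?I" "(\<lambda>n. h_graph e1 (\<phi> n)) \<longlonglongrightarrow> ?x" using HS_seq[OF x(1)] by blast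
  have "(\<lambda>n. el (\<phi> n)) \<longlonglongrightarrow> fst ?x" using tendsto_fst[OF f(2)] by (simp add: h_graph_def)
  then obtain r where r: "strict_mono (r :: nat \<Rightarrow> nat)" "AE y in lebesgue. (\<lambda>k. fn (el (\<phi> (r k))) y) \<longlonglongrightarrow> fn (fst ?x) y"
    by (rule l2_AE_subseq)
  have ae: "AE y in lebesgue. \<forall>k. fn (el (\<phi> (r k))) y = \<phi> (r k) y"
    using fn_el[OF test_functions_square_int[OF f(1)]] by (simp add: AE_all_countable)
  have "square_int (zero_ext ?I \<gamma>)" using x(2) by (simp add: H1_def L2_iff)
  then have "AE y in lebesgue. fn (fst ?x) y = zero_ext ?I \<gamma> y" unfolding hvec_def using fn_el by auto
  then have lim: "AE y in lebesgue. y \<in> ?I \<longrightarrow> (\<lambda>k. \<phi> (r k) y) \<longlonglongrightarrow> \<gamma> y"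
    using r(2) ae by (elim AE_mp) (auto intro!: AE_I2 simp: zero_ext_def)
  have fr: "(\<lambda>k. snd (h_graph e1 (\<phi> (r k))) $ 1) \<longlonglongrightarrow> snd ?x $ 1"
    using LIMSEQ_subseq_LIMSEQ[OF tendsto_vec_nth[OF tendsto_snd[OF f(2)], of 1] r(1)] by (simp add: o_def)
  have good: "\<bar>\<gamma> q - \<gamma> p\<bar> \<le> \<bar>L\<bar> * (q - p)" if p: "(\<lambda>k. \<phi> (r k) p) \<longlonglongrightarrow> \<gamma> p" and q: "(\<lambda>k. \<phi> (r k) q) \<longlonglongrightarrow> \<gamma> q" and pq: "p \<le> q" for p q
  proof -
    let ?i = "el (\<lambda>x. indicator {p..q} x *\<^sub>R (1::real))"
    have "\<phi> (r k) q - \<phi> (r k) p = inner (snd (h_graph e1 (\<phi> (r k))) $ 1) ?i" for k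
      using test_increment[OF f(1) pq] by (simp add: h_graph_def e1_def)
    then have "(\<lambda>k. \<phi> (r k) q - \<phi> (r k) p) \<longlonglongrightarrow> inner (snd ?x $ 1) ?i"
      using tendsto_inner[OF fr tendsto_const[of ?i]] by simp
    then have "\<gamma> q - \<gamma> p = inner (snd ?x $ 1) ?i" using LIMSEQ_unique[OF tendsto_diff[OF q p]] by blast
    then show ?thesis using inner_indicator_le[OF x(3) pq] by simp
  qed
  obtain s' where s': "\<And>n::nat. s' n \<in> ?I \<and> (\<lambda>k. \<phi> (r k) (s' n)) \<longlonglongrightarrow> \<gamma> (s' n)" "s' \<longlonglongrightarrow> s" using AE_dense_unit[OF lim s] by blast
  obtain t' where t': "\<And>n::nat. t' n \<in> ?I \<and> (\<lambda>k. \<phi> (r k) (t' n)) \<longlonglongrightarrow> \<gamma> (t' n)" "t' \<longlonglongrightarrow> t" using AE_dense_unit[OF lim t] by blast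
  have cs: "(\<lambda>n. \<gamma> (s' n)) \<longlonglongrightarrow> \<gamma> s" by (rule continuous_on_tendsto_compose[OF g(1) s'(2) s]) (use s'(1) in \<open>auto intro!: always_eventually less_imp_le\<close>)
  have ct: "(\<lambda>n. \<gamma> (t' n)) \<longlonglongrightarrow> \<gamma> t" by (rule continuous_on_tendsto_compose[OF g(1) t'(2) t]) (use t'(1) in \<open>auto intro!: always_eventually less_imp_le\<close>)
  have "\<bar>\<gamma> (s' n) - \<gamma> (t' n)\<bar> \<le> \<bar>L\<bar> * \<bar>s' n - t' n\<bar>" for n
    using good[of "s' n" "t' n"] good[of "t' n" "s' n"] s'(1)[of n] t'(1)[of n] by (cases "s' n \<le> t' n") (auto simp: abs_minus_commute)
  then show "\<bar>\<gamma> s - \<gamma> t\<bar> \<le> \<bar>L\<bar> * \<bar>s - t\<bar>"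
    by (intro LIMSEQ_le[OF tendsto_rabs[OF tendsto_diff[OF cs ct]] tendsto_mult[OF tendsto_const tendsto_rabs[OF tendsto_diff[OF s'(2) t'(2)]]]]) auto
  have "AE s in lebesgue. s \<in> ?I \<longrightarrow> \<gamma> s \<le> 1 - \<nu>" using g(2) by (subst (asm) AE_lebesgue_on) auto
  from AE_dense_unit[OF this s] obtain u where u: "\<And>n::nat. u n \<in> ?I \<and> \<gamma> (u n) \<le> 1 - \<nu>" "u \<longlonglongrightarrow> s" by blast
  have "(\<lambda>n. \<gamma> (u n)) \<longlonglongrightarrow> \<gamma> s" by (rule continuous_on_tendsto_compose[OF g(1) u(2) s]) (use u(1) in \<open>auto intro!: always_eventually less_imp_le\<close>)
  then show "\<gamma> s \<le> 1 - \<nu>" by (rule LIMSEQ_le_const2) (use u(1) in auto)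
qed

text \<open>Closed and convex sets are weakly closed; in this way the slope bound survives weak
  convergence.\<close>

lemma closed_convex_AE_bound:
  "closed {u :: (real, real) l2. AE s in lebesgue. \<bar>fn u s\<bar> \<le> B}" "convex {u :: (real, real) l2. AE s in lebesgue. \<bar>fn u s\<bar> \<le> B}"
proof -
  show "closed {u :: (real, real) l2. AE s in lebesgue. \<bar>fn u s\<bar> \<le> B}"
    unfolding closed_sequential_limits
  proof (intro allI impI CollectI, elim conjE)
    fix x and l :: "(real, real) l2" assume x: "\<forall>n. x n \<in> {u. AE s in lebesgue. \<bar>fn u s\<bar> \<le> B}" and "x \<longlonglongrightarrow> l"
    then obtain r where r: "AE s in lebesgue. (\<lambda>k. fn (x (r k)) s) \<longlonglongrightarrow> fn l s" using l2_AE_subseq by blast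
    have "AE s in lebesgue. \<forall>k. \<bar>fn (x (r k)) s\<bar> \<le> B" using x by (simp add: AE_all_countable)
    with r show "AE s in lebesgue. \<bar>fn l s\<bar> \<le> B"
      by (elim AE_mp, intro AE_I2 impI) (rule LIMSEQ_le_const2[OF tendsto_rabs], auto)
  qed
  show "convex {u :: (real, real) l2. AE s in lebesgue. \<bar>fn u s\<bar> \<le> B}"
  proof (rule convexI, rule CollectI)
    fix x y :: "(real, real) l2" and u v :: real
    assume xy: "x \<in> {u. AE s in lebesgue. \<bar>fn u s\<bar> \<le> B}" "y \<in> {u. AE s in lebesgue. \<bar>fn u s\<bar> \<le> B}" and uv: "0 \<le> u" "0 \<le> v" "u + v = 1"
    have 1: "AE s in lebesgue. \<bar>fn x s\<bar> \<le> B" "AE s in lebesgue. \<bar>fn y s\<bar> \<le> B" using xy by auto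
    show "AE s in lebesgue. \<bar>fn (u *\<^sub>R x + v *\<^sub>R y) s\<bar> \<le> B"
      using 1 fn_add[of "u *\<^sub>R x" "v *\<^sub>R y"] fn_scaleR[of u x] fn_scaleR[of v y]
    proof (elim AE_mp, intro AE_I2 impI)
      fix s assume h: "fn (v *\<^sub>R y) s = v *\<^sub>R fn y s" "fn (u *\<^sub>R x) s = u *\<^sub>R fn x s" "fn (u *\<^sub>R x + v *\<^sub>R y) s = fn (u *\<^sub>R x) s + fn (v *\<^sub>R y) s" "\<bar>fn y s\<bar> \<le> B" "\<bar>fn x s\<bar> \<le> B"
      have "\<bar>u * fn x s + v * fn y s\<bar> \<le> u * \<bar>fn x s\<bar> + v * \<bar>fn y s\<bar>"
        using abs_triangle_ineq[of "u * fn x s" "v * fn y s"] uv by (simp add: abs_mult)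
      also have "\<dots> \<le> B" by (rule convex_bound_le[OF h(5,4) uv])
      finally show "\<bar>fn (u *\<^sub>R x + v *\<^sub>R y) s\<bar> \<le> B" by (simp add: h)
    qed
  qed
qed

text \<open>The interval has length 1, so the pointwise bound on the derivative bounds its norm, and
  Poincare's inequality with constant 1 passes the bound on to the function.\<close>

lemma norm_hvec_admissible:
  assumes "\<gamma> \<in> admissible L \<nu>"
  shows "norm (snd (hvec e1 {0<..<1} \<gamma>)) \<le> \<bar>L\<bar>" "norm (fst (hvec e1 {0<..<1} \<gamma>)) \<le> \<bar>L\<bar>"
proof -
  let ?x = "hvec e1 {0<..<1} \<gamma>"
  note x = admissible_hvec[OF assms]
  have out: "AE s in lebesgue. s \<notin> {0<..<1} \<longrightarrow> fn (snd ?x $ 1) s = 0" by (rule HS_outside(2)[OF e1_Basis x(1)])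
  have "(norm (snd ?x $ 1))\<^sup>2 = (LINT s|lebesgue. (norm (fn (snd ?x $ 1) s))\<^sup>2)" by (rule norm_fn)
  also have "\<dots> \<le> (LINT s|lebesgue. L\<^sup>2 * indicator {0<..<1::real} s)"
  proof (rule integral_mono_AE)
    show "integrable lebesgue (\<lambda>s. (norm (fn (snd ?x $ 1) s))\<^sup>2)" using square_int_fn[of "snd ?x $ 1"] by (simp add: square_int_def)
    show "integrable lebesgue (\<lambda>s. L\<^sup>2 * indicator {0<..<1::real} s)" by (intro integrable_mult_right integrable_real_indicator) auto
    show "AE s in lebesgue. (norm (fn (snd ?x $ 1) s))\<^sup>2 \<le> L\<^sup>2 * indicator {0<..<1::real} s"
      using x(3)[of 1] out by (elim AE_mp) (auto intro!: AE_I2 simp: indicator_def abs_le_square_iff)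
  qed
  also have "\<dots> = \<bar>L\<bar>\<^sup>2" by simp
  finally have 1: "norm (snd ?x $ 1) \<le> \<bar>L\<bar>" by (rule power2_le_imp_le) simp
  have "norm (snd ?x) = norm (snd ?x $ 1)" by (simp add: norm_vec_def L2_set_def)
  then show 2: "norm (snd ?x) \<le> \<bar>L\<bar>" using 1 by simp
  have "norm (fst ?x) \<le> norm (snd ?x)" by (rule poincare_HS[OF e1_Basis x(1), where i = 1]) (auto simp: e1_def)
  then show "norm (fst ?x) \<le> \<bar>L\<bar>" using 2 by simp
qed

lemma admissible_uniform_limit:
  assumes a: "\<And>n. \<gamma> n \<in> admissible L \<nu>" and c: "continuous_on {0..1} \<gamma>'" and B: "\<And>n s. s \<in> {0..1} \<Longrightarrow> \<bar>\<gamma> n s\<bar> \<le> B"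
    and lim: "\<And>s. s \<in> {0..1} \<Longrightarrow> (\<lambda>n. \<gamma> n s) \<longlonglongrightarrow> \<gamma>' s"
  obtains r where "strict_mono (r :: nat \<Rightarrow> nat)" "\<gamma>' \<in> admissible L \<nu>" 
    "weakly_to (\<lambda>n. snd (hvec e1 {0<..<1} (\<gamma> (r n)))) (snd (hvec e1 {0<..<1} \<gamma>'))"
    "(\<lambda>n. fst (hvec e1 {0<..<1} (\<gamma> n))) \<longlonglongrightarrow> fst (hvec e1 {0<..<1} \<gamma>')"
proof -
  let ?I = "{0<..<1::real}"
  have sL: "square_int (zero_ext ?I (\<gamma> n))" for n using admissible_hvec(2)[OF a] by (simp add: H1_def L2_iff)
  have g: "square_int (\<lambda>s. indicator ?I s *\<^sub>R B)" by (rule square_int_indicator) auto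
  have b: "AE s in lebesgue. norm (zero_ext ?I (\<gamma> n) s) \<le> norm (indicator ?I s *\<^sub>R B)" for n
    using B by (intro AE_I2) (auto simp: zero_ext_def indicator_def intro: order_trans[OF _ abs_ge_self])
  have l: "AE s in lebesgue. (\<lambda>n. zero_ext ?I (\<gamma> n) s) \<longlonglongrightarrow> zero_ext ?I \<gamma>' s"
    using lim by (intro AE_I2) (auto simp: zero_ext_def indicator_def)
  have D: "(\<lambda>n. el (zero_ext ?I (\<gamma> n))) \<longlonglongrightarrow> el (zero_ext ?I \<gamma>')" "square_int (zero_ext ?I \<gamma>')"
    using el_dominated(1,2)[OF square_int_measurable[OF sL] g b l] .
  define x where "x n = hvec e1 ?I (\<gamma> n)" for n
  have xB: "norm (x n) \<le> 2 * \<bar>L\<bar>" for n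
    using norm_hvec_admissible[OF a, of n] norm_Pair_le[of "fst (x n)" "snd (x n)"] by (simp add: x_def)
  have xH: "x n \<in> HS e1 ?I" for n using admissible_hvec(1)[OF a] by (simp add: x_def)
  obtain r l where r: "strict_mono r" "weakly_to (x \<circ> r) l" using bounded_weak_subseq[of x "2 * \<bar>L\<bar>"] xB by blast
  have lH: "l \<in> HS e1 ?I"
    by (rule weakly_closed[OF r(2) _ HS_closed subspace_imp_convex[OF HS_subspace[OF e1_Basis]]]) (use xB xH in auto)
  \<comment> \<open>The first components converge in norm as well, and both limits coincide. This
    ties the weak limit of the derivatives to the pointwise limit of the functions.\<close>
  have "fst l = el (zero_ext ?I \<gamma>')"
  proof -
    have 1: "weakly_to (\<lambda>n. fst ((x \<circ> r) n)) (fst l)" by (rule weakly_to_fst[OF r(2)])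
    have "(\<lambda>n. fst ((x \<circ> r) n)) \<longlonglongrightarrow> el (zero_ext ?I \<gamma>')"
      using LIMSEQ_subseq_LIMSEQ[OF D(1) r(1)] by (simp add: x_def hvec_def o_def)
    then have 2: "weakly_to (\<lambda>n. fst ((x \<circ> r) n)) (el (zero_ext ?I \<gamma>'))" by (rule tendsto_imp_weakly_to)
    have "inner (fst l) g = inner (el (zero_ext ?I \<gamma>')) g" for g using 1 2 LIMSEQ_unique unfolding weakly_to_def by blast
    then have "inner (fst l - el (zero_ext ?I \<gamma>')) (fst l - el (zero_ext ?I \<gamma>')) = 0" by (simp add: inner_diff_left)
    then show ?thesis by simp
  qed
  note HL = HS_H10[OF e1_bij open_unit lH D(2) this[symmetric]]
  have ws: "weakly_to (\<lambda>n. snd ((x \<circ> r) n)) (snd l)" by (rule weakly_to_snd[OF r(2)])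
  have "weakly_to (\<lambda>n. snd ((x \<circ> r) n) $ 1) (snd l $ 1)"
    unfolding weakly_to_def
  proof
    fix g :: "(real, real) l2"
    have "(\<lambda>n. inner (snd ((x \<circ> r) n)) (\<chi> i. g)) \<longlonglongrightarrow> inner (snd l) (\<chi> i. g)" using ws unfolding weakly_to_def by blast
    then show "(\<lambda>n. inner (snd ((x \<circ> r) n) $ 1) g) \<longlonglongrightarrow> inner (snd l $ 1) g" by (simp add: inner_vec_def)
  qed
  then have "snd l $ 1 \<in> {u. AE s in lebesgue. \<bar>fn u s\<bar> \<le> \<bar>L\<bar>}"
  proof (rule weakly_closed[OF _ _ closed_convex_AE_bound])
    show "snd ((x \<circ> r) n) $ 1 \<in> {u. AE s in lebesgue. \<bar>fn u s\<bar> \<le> \<bar>L\<bar>}" for n using admissible_hvec(3)[OF a] by (simp add: x_def)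
    show "norm (snd ((x \<circ> r) n) $ 1) \<le> 2 * \<bar>L\<bar>" for n
      using Finite_Cartesian_Product.norm_nth_le[of "snd (x (r n))" 1] norm_snd_le_norm[of "x (r n)"] xB[of "r n"] by simp
  qed
  then have ab: "AE s in lebesgue. \<bar>fn (el (zero_ext ?I (weak_deriv ?I 1 \<gamma>'))) s\<bar> \<le> \<bar>L\<bar>"
    unfolding HL(2)[symmetric] by (simp add: hvec_def e1_def)
  have wL: "square_int (zero_ext ?I (weak_deriv ?I 1 \<gamma>'))"
    using H1_weak_deriv(1)[OF open_unit, of \<gamma>' 1] HL(1) by (simp add: L2_iff H10_def)
  have L0: "L \<ge> 0"
  proof (rule ccontr)
    assume "\<not> L \<ge> 0"
    have "AE s in lebesgue. s \<in> ?I \<longrightarrow> \<bar>weak_deriv ?I 1 (\<gamma> 0) s\<bar> \<le> L" using a[of 0] by (simp add: admissible_def AE_lebesgue_on)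
    then have "AE s in lebesgue. s \<in> ?I \<longrightarrow> False" by (rule AE_mp) (use \<open>\<not> L \<ge> 0\<close> in \<open>auto intro!: AE_I2\<close>)
    then show False using AE_dense_unit[of "\<lambda>s. False" "0"] by auto
  qed
  have "AE s in lebesgue. s \<in> ?I \<longrightarrow> \<bar>weak_deriv ?I 1 \<gamma>' s\<bar> \<le> L"
    using ab fn_el[OF wL] by (elim AE_mp) (use L0 in \<open>auto intro!: AE_I2 simp: zero_ext_def\<close>)
  moreover have "AE s in lebesgue. s \<in> ?I \<longrightarrow> \<gamma>' s \<le> 1 - \<nu>"
  proof (intro AE_I2 impI)
    fix s assume "s \<in> ?I"
    then show "\<gamma>' s \<le> 1 - \<nu>"
      by (intro LIMSEQ_le_const2[OF lim[of s]]) (use admissible_Lipschitz(2)[OF a, of s s] in auto)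
  qed
  ultimately have "\<gamma>' \<in> admissible L \<nu>" unfolding admissible_def using HL(1) c by (simp add: AE_lebesgue_on)
  moreover have "weakly_to (\<lambda>n. snd (hvec e1 ?I (\<gamma> (r n)))) (snd (hvec e1 ?I \<gamma>'))" using ws by (simp add: x_def HL(2))
  moreover have "(\<lambda>n. fst (hvec e1 ?I (\<gamma> n))) \<longlonglongrightarrow> fst (hvec e1 ?I \<gamma>')" using D(1) by (simp add: hvec_def)
  ultimately show ?thesis using that r(1) by blast
qed

text \<open>The fixed point lies \<nu>/2 below the top and at least \<nu>/2 above the graphs.
  Coordinates measured from it are multiplied by 1 + s * a and 1 + s, so the sides and the top cause
  no trouble and only the lower boundary has to be compared.\<close>

lemma Dom_stretch:
  assumes L: "L > 0" and \<nu>: "\<nu> > 0" and s: "0 < s" "s \<le> 1"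
    and a: "0 \<le> a" "a * L \<le> \<nu> / 4"
    and g1: "\<And>t. t \<in> {0<..<1} \<Longrightarrow> \<gamma>1 t \<le> 1 - \<nu>"
    and g2: "\<And>t u. t \<in> {0<..<1} \<Longrightarrow> u \<in> {0<..<1} \<Longrightarrow> \<bar>\<gamma>2 t - \<gamma>2 u\<bar> \<le> L * \<bar>t - u\<bar>"
    and close: "\<And>t. t \<in> {0<..<1} \<Longrightarrow> \<bar>\<gamma>1 t - \<gamma>2 t\<bar> \<le> \<nu> * s / 8"
    and x: "stretch (vec2 a 1) (vec2 (1/2) (1 - \<nu>/2)) s x \<in> Dom \<gamma>1"
  shows "x \<in> Dom \<gamma>2"
proof -
  define y where "y = stretch (vec2 a 1) (vec2 (1/2) (1 - \<nu>/2)) s x"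
  have y1: "y $ 1 = x $ 1 + s * a * (x $ 1 - 1/2)" and y2: "y $ 2 = x $ 2 + s * (x $ 2 - (1 - \<nu>/2))"
    using stretch_inner[of "ax 1"] stretch_inner[of "ax 2"] by (simp_all add: y_def)
  have D: "0 < y $ 1" "y $ 1 < 1" "\<gamma>1 (y $ 1) < y $ 2" "y $ 2 < 1" using x by (auto simp: Dom_def y_def)
  define d where "d = x $ 1 - 1/2"
  have sa: "0 \<le> s * a" using s a by simp
  have yd: "y $ 1 - 1/2 = (1 + s * a) * d" by (simp add: y1 d_def algebra_simps)
  have "\<bar>d\<bar> \<le> \<bar>y $ 1 - 1/2\<bar>" unfolding yd using sa by (simp add: abs_mult mult_le_cancel_right1)
  then have d2: "\<bar>d\<bar> < 1/2" using D by linarith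
  then have "0 < x $ 1" "x $ 1 < 1" unfolding d_def by linarith+
  then have x1: "x $ 1 \<in> {0<..<1}" by simp
  define q where "q = x $ 2 - (1 - \<nu>/2)"
  have yq: "y $ 2 - (1 - \<nu>/2) = (1 + s) * q" by (simp add: y2 q_def algebra_simps)
  have xt: "x $ 2 < 1"
  proof (rule ccontr)
    assume "\<not> x $ 2 < 1"
    then have "q \<ge> \<nu> / 2" by (simp add: q_def)
    then have "(1 + s) * (\<nu> / 2) \<le> (1 + s) * q" using s by (intro mult_left_mono) auto
    moreover have "(1 + s) * (\<nu> / 2) \<ge> \<nu> / 2" using s \<nu> by (simp add: field_simps)
    ultimately show False using D(4) yq by linarith
  qed
  have yI: "y $ 1 \<in> {0<..<1}" using D by simp
  have "\<bar>x $ 1 - y $ 1\<bar> = \<bar>(s * a) * d\<bar>" by (simp add: y1 d_def)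
  also have "\<dots> = s * a * \<bar>d\<bar>" using sa by (simp only: abs_mult[of "s * a"] abs_of_nonneg)
  also have "\<dots> \<le> s * a * (1/2)" using d2 sa by (intro mult_left_mono) auto
  finally have "L * \<bar>x $ 1 - y $ 1\<bar> \<le> L * (s * a * (1/2))" using L by (intro mult_left_mono) auto
  also have "\<dots> = s / 2 * (a * L)" by simp
  also have "\<dots> \<le> s / 2 * (\<nu> / 4)" using s a by (intro mult_left_mono) auto
  finally have Ld: "L * \<bar>x $ 1 - y $ 1\<bar> \<le> \<nu> * s / 8" by (simp add: mult.commute)
  \<comment> \<open>Two losses of \<nu> s / 8 each: one from the slope over the horizontal
    displacement, which is at most s * a / 2, the other from the distance of the two graphs.\<close>
  have up: "\<gamma>2 (x $ 1) \<le> \<gamma>1 (y $ 1) + \<nu> * s / 4"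
    using abs_le_D1[OF g2[OF x1 yI]] abs_le_D2[OF close[OF yI]] Ld by linarith
  define g where "g = \<gamma>1 (y $ 1) - (1 - \<nu>/2)"
  have g: "g \<le> - (\<nu> / 2)" using g1[OF yI] by (simp add: g_def)
  have gq: "g < (1 + s) * q" using D(3) yq by (simp add: g_def)
  \<comment> \<open>Otherwise g < (1 + s) (g + \<nu> s / 4). Here s g \<le> - \<nu> s / 2, and 1 + s
    \<le> 2 makes the remaining gain at most \<nu> s / 2, so the right-hand side would be at most
    g.\<close>
  have "g + \<nu> * s / 4 < q"
  proof (rule ccontr)
    assume "\<not> ?thesis"
    then have "(1 + s) * q \<le> (1 + s) * (g + \<nu> * s / 4)" using s by (intro mult_left_mono) auto
    then have "g < (1 + s) * (g + \<nu> * s / 4)" using gq by linarith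
    moreover have "(1 + s) * (g + \<nu> * s / 4) = g + s * g + (1 + s) * (\<nu> * s / 4)" by (simp add: algebra_simps)
    moreover have "s * g \<le> s * (- (\<nu> / 2))" using g s by (intro mult_left_mono) auto
    moreover have "(1 + s) * (\<nu> * s / 4) \<le> 2 * (\<nu> * s / 4)" using s \<nu> by (intro mult_right_mono) auto
    ultimately show False by (simp add: mult.commute)
  qed
  then have "\<gamma>2 (x $ 1) < x $ 2" using up by (simp add: g_def q_def)
  then show ?thesis using x1 xt by (simp add: Dom_def)
qed

section \<open>Weak solutions in Hilbert space form\<close>

lemma integral_lebesgue_on_inner:
  assumes S: "\<Omega> \<in> sets lebesgue" and f: "square_int (zero_ext \<Omega> f)" and g: "square_int (zero_ext \<Omega> g)"
  shows "(LINT x|lebesgue_on \<Omega>. f x \<bullet> g x) = inner (el (zero_ext \<Omega> f)) (el (zero_ext \<Omega> g))"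
    "integrable (lebesgue_on \<Omega>) (\<lambda>x. f x \<bullet> g x)"
proof -
  have eq: "indicator \<Omega> x *\<^sub>R (f x \<bullet> g x) = zero_ext \<Omega> f x \<bullet> zero_ext \<Omega> g x" for x by (simp add: zero_ext_def indicator_def)
  show "(LINT x|lebesgue_on \<Omega>. f x \<bullet> g x) = inner (el (zero_ext \<Omega> f)) (el (zero_ext \<Omega> g))"
    unfolding integral_lebesgue_on[OF S] eq by (rule inner_el[OF f g, symmetric])
  have "integrable lebesgue (\<lambda>x. indicator \<Omega> x *\<^sub>R (f x \<bullet> g x))" unfolding eq by (rule square_int_inner[OF f g])
  then show "integrable (lebesgue_on \<Omega>) (\<lambda>x. f x \<bullet> g x)" using S by (subst integrable_restrict_space) auto
qed

lemma H1_square_int: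
  assumes "open \<Omega>" "u \<in> H1 \<Omega>"
  shows "square_int (zero_ext \<Omega> u)" "b \<in> Basis \<Longrightarrow> square_int (zero_ext \<Omega> (weak_deriv \<Omega> b u))"
proof -
  have S: "\<Omega> \<in> sets lebesgue" using assms(1) by simp
  show "square_int (zero_ext \<Omega> u)" using assms(2) by (simp add: H1_def L2_iff[OF S])
  show "square_int (zero_ext \<Omega> (weak_deriv \<Omega> b u))" if "b \<in> Basis" using H1_weak_deriv(1)[OF assms that] by (simp add: L2_iff[OF S])
qed

lemma H10_H1: "u \<in> H10 \<Omega> \<Longrightarrow> u \<in> H1 \<Omega>" by (simp add: H10_def)

lemma grad_inner_inner:
  fixes u \<phi> :: "real ^ 2 \<Rightarrow> 'b::euclidean_space"
  assumes \<Omega>: "open \<Omega>" and u: "u \<in> H1 \<Omega>" and p: "\<phi> \<in> H1 \<Omega>"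
  shows "(LINT x|lebesgue_on \<Omega>. grad_inner \<Omega> u \<phi> x) = inner (snd (hvec ax \<Omega> u)) (snd (hvec ax \<Omega> \<phi>))"
proof -
  have S: "\<Omega> \<in> sets lebesgue" using \<Omega> by simp
  note i = integral_lebesgue_on_inner[OF S H1_square_int(2)[OF \<Omega> u] H1_square_int(2)[OF \<Omega> p]]
  have "(LINT x|lebesgue_on \<Omega>. grad_inner \<Omega> u \<phi> x) = (LINT x|lebesgue_on \<Omega>. (\<Sum>j\<in>UNIV. weak_deriv \<Omega> (ax j) u x \<bullet> weak_deriv \<Omega> (ax j) \<phi> x))"
    unfolding grad_inner_def by (intro Bochner_Integration.integral_cong refl sum.reindex_bij_betw[OF ax_bij, symmetric])
  also have "\<dots> = (\<Sum>j\<in>UNIV. LINT x|lebesgue_on \<Omega>. weak_deriv \<Omega> (ax j) u x \<bullet> weak_deriv \<Omega> (ax j) \<phi> x)"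
    by (rule Bochner_Integration.integral_sum) (rule i(2)[OF ax_Basis ax_Basis])
  also have "\<dots> = inner (snd (hvec ax \<Omega> u)) (snd (hvec ax \<Omega> \<phi>))"
    by (simp add: hvec_def inner_vec_def i(1))
  finally show ?thesis .
qed

text \<open>The convective integral pairs the gradient of \<open>u\<close> with the products of
  \<open>v\<close> and \<phi>. Both of these vanish on the boundary, so Ladyzhenskaya's inequality
  makes the products square integrable.\<close>

lemma convect_inner:
  fixes u \<phi> :: "real ^ 2 \<Rightarrow> 'b::euclidean_space"
  assumes \<Omega>: "open \<Omega>" and u: "u \<in> H1 \<Omega>" and v: "v \<in> H10 \<Omega>" and p: "\<phi> \<in> H10 \<Omega>"
  shows "(LINT x|lebesgue_on \<Omega>. convect \<Omega> v u x \<bullet> \<phi> x) = inner (snd (hvec ax \<Omega> u)) (mul (fst (hvec ax \<Omega> v)) (fst (hvec ax \<Omega> \<phi>)))"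
proof -
  have S: "\<Omega> \<in> sets lebesgue" using \<Omega> by simp
  note sv = H1_square_int(1)[OF \<Omega> H10_H1[OF v]] and sp = H1_square_int(1)[OF \<Omega> H10_H1[OF p]]
  note m = mul_square_int(1)[OF H10_hvec[OF ax_bij \<Omega> v] H10_hvec[OF ax_bij \<Omega> p]]
  have ae: "AE x in lebesgue. (fn (fst (hvec ax \<Omega> v)) x $ i) *\<^sub>R fn (fst (hvec ax \<Omega> \<phi>)) x = zero_ext \<Omega> (\<lambda>x. (v x $ i) *\<^sub>R \<phi> x) x" for i
    using fn_el[OF sv] fn_el[OF sp] by (elim AE_mp) (auto intro!: AE_I2 simp: hvec_def zero_ext_def indicator_def)
  have sq: "square_int (zero_ext \<Omega> (\<lambda>x. (v x $ i) *\<^sub>R \<phi> x))" for i by (rule square_int_cong_AE[OF m ae])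
  have me: "mul (fst (hvec ax \<Omega> v)) (fst (hvec ax \<Omega> \<phi>)) $ i = el (zero_ext \<Omega> (\<lambda>x. (v x $ i) *\<^sub>R \<phi> x))" for i
    unfolding mul_def using el_eqI[OF m ae] by simp
  note i = integral_lebesgue_on_inner[OF S H1_square_int(2)[OF \<Omega> u ax_Basis] sq]
  have "(LINT x|lebesgue_on \<Omega>. convect \<Omega> v u x \<bullet> \<phi> x) = (LINT x|lebesgue_on \<Omega>. (\<Sum>j\<in>UNIV. weak_deriv \<Omega> (ax j) u x \<bullet> ((v x $ j) *\<^sub>R \<phi> x)))"
  proof (intro Bochner_Integration.integral_cong refl)
    fix x
    have "convect \<Omega> v u x = (\<Sum>j\<in>UNIV. (v x \<bullet> ax j) *\<^sub>R weak_deriv \<Omega> (ax j) u x)"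
      unfolding convect_def by (rule sum.reindex_bij_betw[OF ax_bij, symmetric])
    then show "convect \<Omega> v u x \<bullet> \<phi> x = (\<Sum>j\<in>UNIV. weak_deriv \<Omega> (ax j) u x \<bullet> ((v x $ j) *\<^sub>R \<phi> x))"
      by (simp add: inner_sum_left)
  qed
  also have "\<dots> = (\<Sum>j\<in>UNIV. LINT x|lebesgue_on \<Omega>. weak_deriv \<Omega> (ax j) u x \<bullet> ((v x $ j) *\<^sub>R \<phi> x))"
    by (rule Bochner_Integration.integral_sum) (rule i(2))
  also have "\<dots> = inner (snd (hvec ax \<Omega> u)) (mul (fst (hvec ax \<Omega> v)) (fst (hvec ax \<Omega> \<phi>)))"
    unfolding i(1) inner_vec_def me by (simp add: hvec_def)
  finally show ?thesis .
qed

lemma divergence_hdiv: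
  assumes \<Omega>: "open \<Omega>" and v: "v \<in> H1 \<Omega>"
  shows "(AE x in lebesgue_on \<Omega>. divergence \<Omega> v x = 0) \<longleftrightarrow> hdiv (hvec ax \<Omega> v) = 0"
proof -
  have S: "\<Omega> \<in> sets lebesgue" using \<Omega> by simp
  note w = H1_square_int(2)[OF \<Omega> v ax_Basis] and bn = bounded_linear_vec_nth
  note wi = square_int_linear[OF bn w]
  have "hdiv (hvec ax \<Omega> v) = el (\<lambda>x. zero_ext \<Omega> (weak_deriv \<Omega> (ax 1) v) x $ 1) + el (\<lambda>x. zero_ext \<Omega> (weak_deriv \<Omega> (ax 2) v) x $ 2)"
    by (simp add: hdiv_def sum_2 hvec_def lmap_el[OF bn w])
  also have "\<dots> = el (\<lambda>x. zero_ext \<Omega> (weak_deriv \<Omega> (ax 1) v) x $ 1 + zero_ext \<Omega> (weak_deriv \<Omega> (ax 2) v) x $ 2)"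
    by (rule el_add[symmetric, OF wi wi])
  also have "(\<lambda>x. zero_ext \<Omega> (weak_deriv \<Omega> (ax 1) v) x $ 1 + zero_ext \<Omega> (weak_deriv \<Omega> (ax 2) v) x $ 2) = zero_ext \<Omega> (divergence \<Omega> v)"
  proof
    fix x
    have "divergence \<Omega> v x = (\<Sum>j\<in>UNIV. weak_deriv \<Omega> (ax j) v x \<bullet> ax j)"
      unfolding divergence_def by (rule sum.reindex_bij_betw[OF ax_bij, symmetric])
    then show "zero_ext \<Omega> (weak_deriv \<Omega> (ax 1) v) x $ 1 + zero_ext \<Omega> (weak_deriv \<Omega> (ax 2) v) x $ 2 = zero_ext \<Omega> (divergence \<Omega> v) x"
      by (simp add: zero_ext_def sum_2 distrib_left)
  qed
  finally have dve: "hdiv (hvec ax \<Omega> v) = el (zero_ext \<Omega> (divergence \<Omega> v))" .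
  have "square_int (\<lambda>x. zero_ext \<Omega> (weak_deriv \<Omega> (ax 1) v) x $ 1 + zero_ext \<Omega> (weak_deriv \<Omega> (ax 2) v) x $ 2)" by (rule square_int_add[OF wi wi])
  moreover have "(\<lambda>x. zero_ext \<Omega> (weak_deriv \<Omega> (ax 1) v) x $ 1 + zero_ext \<Omega> (weak_deriv \<Omega> (ax 2) v) x $ 2) = zero_ext \<Omega> (divergence \<Omega> v)" by fact
  ultimately have "square_int (zero_ext \<Omega> (divergence \<Omega> v))" by simp
  then have "hdiv (hvec ax \<Omega> v) = 0 \<longleftrightarrow> (AE x in lebesgue. zero_ext \<Omega> (divergence \<Omega> v) x = 0)" unfolding dve by (rule el_eq_0_iff)
  also have "\<dots> \<longleftrightarrow> (AE x in lebesgue. x \<in> \<Omega> \<longrightarrow> divergence \<Omega> v x = 0)"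
    by (rule AE_cong) (auto simp: zero_ext_def indicator_def)
  finally show ?thesis by (simp add: AE_lebesgue_on[OF S])
qed

text \<open>Data are paired only with elements that vanish outside the domain, so one extension of
  the data to the largest domain serves for all domains.\<close>

lemma inner_restrict:
  assumes f: "square_int (zero_ext \<Omega> f)" "square_int (zero_ext \<Omega>M f)" and sub: "\<Omega> \<subseteq> \<Omega>M"
    and p: "AE y in lebesgue. y \<notin> \<Omega> \<longrightarrow> fn p y = 0"
  shows "inner (el (zero_ext \<Omega>M f)) p = inner (el (zero_ext \<Omega> f)) p"
proof -
  have "inner (el (zero_ext \<Omega>M f)) (el (fn p)) = inner (el (zero_ext \<Omega> f)) (el (fn p))"
    unfolding inner_el[OF f(1) square_int_fn] inner_el[OF f(2) square_int_fn]
  proof (rule integral_cong_AE)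
    have m: "zero_ext \<Omega> f \<in> borel_measurable lebesgue" "zero_ext \<Omega>M f \<in> borel_measurable lebesgue" using f by auto
    show "(\<lambda>x. zero_ext \<Omega>M f x \<bullet> fn p x) \<in> borel_measurable lebesgue" "(\<lambda>x. zero_ext \<Omega> f x \<bullet> fn p x) \<in> borel_measurable lebesgue"
      using m by (intro borel_measurable_inner fn_measurable; simp)+
    show "AE x in lebesgue. zero_ext \<Omega>M f x \<bullet> fn p x = zero_ext \<Omega> f x \<bullet> fn p x"
      using p by (rule AE_mp) (use sub in \<open>auto intro!: AE_I2 simp: zero_ext_def indicator_def\<close>)
  qed
  then show ?thesis by simp
qed

lemma zero_ext_square_int_subset:
  assumes "square_int (zero_ext \<Omega>M f)" "\<Omega> \<in> sets lebesgue" "\<Omega> \<subseteq> \<Omega>M"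
  shows "square_int (zero_ext \<Omega> f)"
proof -
  have m: "zero_ext \<Omega>M f \<in> borel_measurable lebesgue" using assms(1) by blast
  have zz: "zero_ext \<Omega> f = (\<lambda>x. indicator \<Omega> x *\<^sub>R zero_ext \<Omega>M f x)"
    using assms(3) by (intro ext) (auto simp: zero_ext_def indicator_def)
  show ?thesis
    by (rule square_int_bound[where g = "\<lambda>x. (norm (zero_ext \<Omega>M f x))\<^sup>2"])
       (use assms(1,2) m in \<open>auto simp: zz square_int_def power_mult_distrib indicator_def intro!: borel_measurable_scaleR\<close>)
qed

text \<open>Everything that stays fixed while the domain varies.\<close>

locale boussinesq_data =
  fixes \<Omega>M :: "(real ^ 2) set" and g1 :: "real ^ 2 \<Rightarrow> real ^ 2" and g2 Td :: "real ^ 2 \<Rightarrow> real" and Rey Pra Gra :: real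
  assumes \<Omega>M: "open \<Omega>M" and g1: "g1 \<in> L2 \<Omega>M" and g2: "g2 \<in> L2 \<Omega>M" and Td: "Td \<in> H1 \<Omega>M"
begin

abbreviation "hs \<equiv> hsol Rey Pra Gra (el (zero_ext \<Omega>M g1)) (el (zero_ext \<Omega>M g2)) (hvec ax \<Omega>M Td)"

lemma SM: "\<Omega>M \<in> sets lebesgue" using \<Omega>M by simp

lemma rhs_eq:
  fixes \<phi> :: "real ^ 2 \<Rightarrow> 'b::euclidean_space"
  assumes \<Omega>: "open \<Omega>" "\<Omega> \<subseteq> \<Omega>M" and g: "g \<in> L2 \<Omega>M" and p: "\<phi> \<in> H10 \<Omega>"
  shows "(LINT x|lebesgue_on \<Omega>. g x \<bullet> \<phi> x) = inner (el (zero_ext \<Omega>M g)) (fst (hvec ax \<Omega> \<phi>))"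
proof -
  have S: "\<Omega> \<in> sets lebesgue" using \<Omega> by simp
  have gM: "square_int (zero_ext \<Omega>M g)" using g by (simp add: L2_iff[OF SM])
  note gs = zero_ext_square_int_subset[OF gM S \<Omega>(2)]
  have "(LINT x|lebesgue_on \<Omega>. g x \<bullet> \<phi> x) = inner (el (zero_ext \<Omega> g)) (fst (hvec ax \<Omega> \<phi>))"
    using integral_lebesgue_on_inner(1)[OF S gs H1_square_int(1)[OF \<Omega>(1) H10_H1[OF p]]] by (simp add: hvec_def)
  also have "\<dots> = inner (el (zero_ext \<Omega>M g)) (fst (hvec ax \<Omega> \<phi>))"
    by (rule inner_restrict[OF gs gM \<Omega>(2) HS_outside(1)[OF ax_Basis H10_hvec[OF ax_bij \<Omega>(1) p]], symmetric])
  finally show ?thesis .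
qed

lemma mul_outside:
  fixes p :: "(real ^ 2, 'b::euclidean_space, 2) hv"
  assumes v: "v \<in> HS ax \<Omega>" and p: "p \<in> HS ax \<Omega>"
  shows "AE y in lebesgue. y \<notin> \<Omega> \<longrightarrow> fn (mul (fst v) (fst p) $ i) y = 0"
  using fn_el[OF mul_square_int(1)[OF v p, of i]] HS_outside(1)[OF ax_Basis p]
  by (elim AE_mp) (auto intro!: AE_I2 simp: mul_def)

text \<open>In the paired integrals the restriction of the boundary data may be replaced by the data
  on the largest domain, because the other factor vanishes outside. Thus only the homogeneous part
  of the temperature depends on the domain.\<close>

lemma T_split:
  fixes p :: "(real ^ 2, real ^ 2) l2"
  assumes \<Omega>: "open \<Omega>" "\<Omega> \<subseteq> \<Omega>M" and T: "T \<in> H1 \<Omega>"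
  shows "fst (hvec ax \<Omega> T) = el (zero_ext \<Omega> Td) + fst (hvec ax \<Omega> (\<lambda>x. T x - Td x))"
    and "(\<And>i. AE y in lebesgue. y \<notin> \<Omega> \<longrightarrow> fn (m $ i) y = 0) \<Longrightarrow> inner (snd (hvec ax \<Omega> T)) m = inner (snd (hvec ax \<Omega>M Td) + snd (hvec ax \<Omega> (\<lambda>x. T x - Td x))) m"
    and "AE y in lebesgue. y \<notin> \<Omega> \<longrightarrow> fn p y = 0 \<Longrightarrow> inner (lmap (\<lambda>t. t *\<^sub>R axis 2 1) (fst (hvec ax \<Omega> T))) p = inner (lmap (\<lambda>t. t *\<^sub>R axis 2 1) (fst (hvec ax \<Omega>M Td) + fst (hvec ax \<Omega> (\<lambda>x. T x - Td x)))) p"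
proof -
  let ?\<theta> = "\<lambda>x. T x - Td x"
  have S: "\<Omega> \<in> sets lebesgue" using \<Omega> by simp
  note R = hvec_restrict[OF ax_bij \<Omega>(1) \<Omega>M \<Omega>(2) Td]
  have eq: "hvec ax \<Omega> T = hvec ax \<Omega> Td + hvec ax \<Omega> ?\<theta>" using hvec_diff(2)[OF ax_bij \<Omega>(1) T R(1)] by simp
  show 1: "fst (hvec ax \<Omega> T) = el (zero_ext \<Omega> Td) + fst (hvec ax \<Omega> ?\<theta>)" unfolding eq R(2) by simp
  have sT: "square_int (zero_ext \<Omega>M Td)" by (rule H1_square_int(1)[OF \<Omega>M Td])
  show "inner (snd (hvec ax \<Omega> T)) m = inner (snd (hvec ax \<Omega>M Td) + snd (hvec ax \<Omega> ?\<theta>)) m"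
    if m: "\<And>i. AE y in lebesgue. y \<notin> \<Omega> \<longrightarrow> fn (m $ i) y = 0"
  proof -
    have sw: "square_int (zero_ext \<Omega>M (weak_deriv \<Omega>M (ax i) Td))" for i by (rule H1_square_int(2)[OF \<Omega>M Td]) simp
    have "inner (el (zero_ext \<Omega>M (weak_deriv \<Omega>M (ax i) Td))) (m $ i) = inner (el (zero_ext \<Omega> (weak_deriv \<Omega>M (ax i) Td))) (m $ i)" for i
      by (rule inner_restrict[OF zero_ext_square_int_subset[OF sw S \<Omega>(2)] sw \<Omega>(2) m])
    then have "inner (snd (hvec ax \<Omega> Td)) m = inner (snd (hvec ax \<Omega>M Td)) m"
      unfolding R(2) by (simp add: hvec_def inner_vec_def)
    then show ?thesis unfolding eq by (simp add: inner_add_left)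
  qed
  show "inner (lmap (\<lambda>t. t *\<^sub>R axis 2 1) (fst (hvec ax \<Omega> T))) p = inner (lmap (\<lambda>t. t *\<^sub>R axis 2 1) (fst (hvec ax \<Omega>M Td) + fst (hvec ax \<Omega> ?\<theta>))) p"
    if p: "AE y in lebesgue. y \<notin> \<Omega> \<longrightarrow> fn p y = 0"
  proof -
    have bl: "bounded_linear (\<lambda>t::real. t *\<^sub>R (axis 2 1 :: real ^ 2))" by (rule bounded_linear_scaleR_left)
    note lin = linear_add[OF bounded_linear.linear[OF bounded_linear_lmap[OF bl]]]
    have zs: "(\<lambda>x. zero_ext A Td x *\<^sub>R axis 2 1) = zero_ext A (\<lambda>x. Td x *\<^sub>R axis 2 (1::real) :: real ^ 2)" for A by (rule ext) (simp add: zero_ext_def)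
    have sM: "square_int (zero_ext \<Omega>M (\<lambda>x. Td x *\<^sub>R axis 2 (1::real) :: real ^ 2))" using square_int_linear[OF bl sT] unfolding zs .
    have lm: "lmap (\<lambda>t. t *\<^sub>R axis 2 1) (el (zero_ext A Td)) = el (zero_ext A (\<lambda>x. Td x *\<^sub>R axis 2 (1::real) :: real ^ 2))" if "square_int (zero_ext A Td)" for A
      unfolding lmap_el[OF bl that] zs ..
    have "inner (lmap (\<lambda>t. t *\<^sub>R axis 2 1) (el (zero_ext \<Omega>M Td))) p = inner (lmap (\<lambda>t. t *\<^sub>R axis 2 1) (el (zero_ext \<Omega> Td))) p"
      unfolding lm[OF sT] lm[OF zero_ext_square_int_subset[OF sT S \<Omega>(2)]]
      by (rule inner_restrict[OF zero_ext_square_int_subset[OF sM S \<Omega>(2)] sM \<Omega>(2) p])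
    then show ?thesis unfolding 1 lin inner_add_left by (simp add: hvec_def)
  qed
qed

lemma weak_forms:
  assumes \<Omega>: "open \<Omega>" "\<Omega> \<subseteq> \<Omega>M" and v: "v \<in> H10 \<Omega>" and T: "T \<in> H1 \<Omega>" and \<theta>: "(\<lambda>x. T x - Td x) \<in> H10 \<Omega>"
  defines "hv \<equiv> hvec ax \<Omega> v" and "h\<theta> \<equiv> hvec ax \<Omega> (\<lambda>x. T x - Td x)" and "D \<equiv> hvec ax \<Omega>M Td"
  shows "\<phi> \<in> H10 \<Omega> \<Longrightarrow>
    (LINT x|lebesgue_on \<Omega>. convect \<Omega> v v x \<bullet> \<phi> x) + 1 / Rey * (LINT x|lebesgue_on \<Omega>. grad_inner \<Omega> v \<phi> x)
        - Gra / Rey\<^sup>2 * (LINT x|lebesgue_on \<Omega>. (T x *\<^sub>R axis 2 1) \<bullet> \<phi> x)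
    = inner (snd hv) (mul (fst hv) (fst (hvec ax \<Omega> \<phi>))) + 1 / Rey * inner (snd hv) (snd (hvec ax \<Omega> \<phi>))
       - Gra / Rey\<^sup>2 * inner (lmap (\<lambda>t. t *\<^sub>R axis 2 1) (fst D + fst h\<theta>)) (fst (hvec ax \<Omega> \<phi>))"
    and "\<psi> \<in> H10 \<Omega> \<Longrightarrow>
    (LINT x|lebesgue_on \<Omega>. convect \<Omega> v T x * \<psi> x) + 1 / (Rey * Pra) * (LINT x|lebesgue_on \<Omega>. grad_inner \<Omega> T \<psi> x)
    = inner (snd D + snd h\<theta>) (mul (fst hv) (fst (hvec ax \<Omega> \<psi>))) + 1 / (Rey * Pra) * inner (snd D + snd h\<theta>) (snd (hvec ax \<Omega> \<psi>))"
proof -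
  have S: "\<Omega> \<in> sets lebesgue" using \<Omega> by simp
  have hvH: "hv \<in> HS ax \<Omega>" unfolding hv_def by (rule H10_hvec[OF ax_bij \<Omega>(1) v])
  show "(LINT x|lebesgue_on \<Omega>. convect \<Omega> v v x \<bullet> \<phi> x) + 1 / Rey * (LINT x|lebesgue_on \<Omega>. grad_inner \<Omega> v \<phi> x)
        - Gra / Rey\<^sup>2 * (LINT x|lebesgue_on \<Omega>. (T x *\<^sub>R axis 2 1) \<bullet> \<phi> x)
    = inner (snd hv) (mul (fst hv) (fst (hvec ax \<Omega> \<phi>))) + 1 / Rey * inner (snd hv) (snd (hvec ax \<Omega> \<phi>))
       - Gra / Rey\<^sup>2 * inner (lmap (\<lambda>t. t *\<^sub>R axis 2 1) (fst D + fst h\<theta>)) (fst (hvec ax \<Omega> \<phi>))" if p: "\<phi> \<in> H10 \<Omega>"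
  proof -
    have bl: "bounded_linear (\<lambda>t::real. t *\<^sub>R (axis 2 1 :: real ^ 2))" by (rule bounded_linear_scaleR_left)
    have zs: "(\<lambda>x. zero_ext \<Omega> T x *\<^sub>R axis 2 1) = zero_ext \<Omega> (\<lambda>x. T x *\<^sub>R axis 2 (1::real) :: real ^ 2)" by (auto simp: zero_ext_def)
    note sT = H1_square_int(1)[OF \<Omega>(1) T]
    have "(LINT x|lebesgue_on \<Omega>. (T x *\<^sub>R axis 2 1) \<bullet> \<phi> x) = inner (el (zero_ext \<Omega> (\<lambda>x. T x *\<^sub>R axis 2 1))) (el (zero_ext \<Omega> \<phi>))"
      by (rule integral_lebesgue_on_inner(1)[OF S square_int_linear[OF bl sT, unfolded zs] H1_square_int(1)[OF \<Omega>(1) H10_H1[OF p]]])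
    also have "\<dots> = inner (lmap (\<lambda>t. t *\<^sub>R axis 2 1) (fst (hvec ax \<Omega> T))) (fst (hvec ax \<Omega> \<phi>))"
      unfolding hvec_def fst_conv lmap_el[OF bl sT] zs ..
    also have "\<dots> = inner (lmap (\<lambda>t. t *\<^sub>R axis 2 1) (fst D + fst h\<theta>)) (fst (hvec ax \<Omega> \<phi>))"
      unfolding D_def h\<theta>_def by (rule T_split(3)[OF \<Omega> T HS_outside(1)[OF ax_Basis H10_hvec[OF ax_bij \<Omega>(1) p]]])
    finally show ?thesis
      unfolding convect_inner[OF \<Omega>(1) H10_H1[OF v] v p] grad_inner_inner[OF \<Omega>(1) H10_H1[OF v] H10_H1[OF p]] hv_def by simp
  qed
  show "(LINT x|lebesgue_on \<Omega>. convect \<Omega> v T x * \<psi> x) + 1 / (Rey * Pra) * (LINT x|lebesgue_on \<Omega>. grad_inner \<Omega> T \<psi> x)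
    = inner (snd D + snd h\<theta>) (mul (fst hv) (fst (hvec ax \<Omega> \<psi>))) + 1 / (Rey * Pra) * inner (snd D + snd h\<theta>) (snd (hvec ax \<Omega> \<psi>))" if p: "\<psi> \<in> H10 \<Omega>"
  proof -
    note pH = H10_hvec[OF ax_bij \<Omega>(1) p]
    have "(LINT x|lebesgue_on \<Omega>. convect \<Omega> v T x * \<psi> x) = (LINT x|lebesgue_on \<Omega>. convect \<Omega> v T x \<bullet> \<psi> x)" by simp
    also have "\<dots> = inner (snd (hvec ax \<Omega> T)) (mul (fst hv) (fst (hvec ax \<Omega> \<psi>)))"
      unfolding hv_def by (rule convect_inner[OF \<Omega>(1) T v p])
    also have "\<dots> = inner (snd D + snd h\<theta>) (mul (fst hv) (fst (hvec ax \<Omega> \<psi>)))"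
      unfolding D_def h\<theta>_def by (rule T_split(2)[OF \<Omega> T mul_outside[OF hvH pH]])
    finally have 1: "(LINT x|lebesgue_on \<Omega>. convect \<Omega> v T x * \<psi> x) = inner (snd D + snd h\<theta>) (mul (fst hv) (fst (hvec ax \<Omega> \<psi>)))" .
    have "(LINT x|lebesgue_on \<Omega>. grad_inner \<Omega> T \<psi> x) = inner (snd D + snd h\<theta>) (snd (hvec ax \<Omega> \<psi>))"
      unfolding grad_inner_inner[OF \<Omega>(1) T H10_H1[OF p]] D_def h\<theta>_def by (rule T_split(2)[OF \<Omega> T HS_outside(2)[OF ax_Basis pH]])
    then show ?thesis unfolding 1 by simp
  qed
qed

lemma V_iff:
  assumes "open \<Omega>" shows "\<phi> \<in> V \<Omega> \<longleftrightarrow> \<phi> \<in> H10 \<Omega> \<and> hdiv (hvec ax \<Omega> \<phi>) = 0"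
  using divergence_hdiv[OF assms, of \<phi>] by (auto simp: V_def H10_H1)

lemma HS_rep:
  fixes x :: "(real ^ 2, 'b::euclidean_space, 2) hv"
  assumes \<Omega>: "open \<Omega>" and x: "x \<in> HS ax \<Omega>"
  shows "fn (fst x) \<in> H10 \<Omega>" "hvec ax \<Omega> (fn (fst x)) = x"
  using HS_H10[OF ax_bij \<Omega> x zero_ext_fn[OF HS_outside(1)[OF ax_Basis x]]] by auto

text \<open>Every element of \<open>HS\<close> is represented by a function in \<open>H10\<close>,
  so testing with elements and testing with functions are equivalent.\<close>

lemma weak_hsol:
  assumes \<Omega>: "open \<Omega>" "\<Omega> \<subseteq> \<Omega>M" and w: "weak_solution Rey Pra Gra g1 g2 Td \<Omega> v T"
  shows "hs \<Omega> (hvec ax \<Omega> v) (hvec ax \<Omega> (\<lambda>x. T x - Td x))"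
proof -
  have v: "v \<in> H10 \<Omega>" "hdiv (hvec ax \<Omega> v) = 0" and T: "T \<in> H1 \<Omega>" "(\<lambda>x. T x - Td x) \<in> H10 \<Omega>"
    using w by (auto simp: weak_solution_def V_iff[OF \<Omega>(1)])
  note W = weak_forms[OF \<Omega> v(1) T]
  show ?thesis
    unfolding hsol_def
  proof (intro conjI ballI impI)
    show "hvec ax \<Omega> v \<in> HS ax \<Omega>" "hvec ax \<Omega> (\<lambda>x. T x - Td x) \<in> HS ax \<Omega>" by (rule H10_hvec[OF ax_bij \<Omega>(1)], fact)+
    show "hdiv (hvec ax \<Omega> v) = 0" by (rule v)
  next
    fix p assume p: "p \<in> HS ax \<Omega>" "hdiv p = 0"
    note r = HS_rep[OF \<Omega>(1) p(1)]
    have "fn (fst p) \<in> V \<Omega>" using r p(2) by (simp add: V_iff[OF \<Omega>(1)])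
    then have "inner (snd (hvec ax \<Omega> v)) (mul (fst (hvec ax \<Omega> v)) (fst (hvec ax \<Omega> (fn (fst p))))) + 1 / Rey * inner (snd (hvec ax \<Omega> v)) (snd (hvec ax \<Omega> (fn (fst p))))
       - Gra / Rey\<^sup>2 * inner (lmap (\<lambda>t. t *\<^sub>R axis 2 1) (fst (hvec ax \<Omega>M Td) + fst (hvec ax \<Omega> (\<lambda>x. T x - Td x)))) (fst (hvec ax \<Omega> (fn (fst p))))
       = inner (el (zero_ext \<Omega>M g1)) (fst (hvec ax \<Omega> (fn (fst p))))"
      unfolding W(1)[OF r(1), symmetric] rhs_eq[OF \<Omega> g1 r(1), symmetric] using w unfolding weak_solution_def by blast
    then show "inner (snd (hvec ax \<Omega> v)) (mul (fst (hvec ax \<Omega> v)) (fst p)) + 1 / Rey * inner (snd (hvec ax \<Omega> v)) (snd p)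
       - Gra / Rey\<^sup>2 * inner (lmap (\<lambda>t. t *\<^sub>R axis 2 1) (fst (hvec ax \<Omega>M Td) + fst (hvec ax \<Omega> (\<lambda>x. T x - Td x)))) (fst p) = inner (el (zero_ext \<Omega>M g1)) (fst p)"
      unfolding r(2) .
  next
    fix p :: "(real ^ 2, real, 2) hv" assume p: "p \<in> HS ax \<Omega>"
    note r = HS_rep[OF \<Omega>(1) p]
    have "inner (snd (hvec ax \<Omega>M Td) + snd (hvec ax \<Omega> (\<lambda>x. T x - Td x))) (mul (fst (hvec ax \<Omega> v)) (fst (hvec ax \<Omega> (fn (fst p)))))
       + 1 / (Rey * Pra) * inner (snd (hvec ax \<Omega>M Td) + snd (hvec ax \<Omega> (\<lambda>x. T x - Td x))) (snd (hvec ax \<Omega> (fn (fst p))))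
       = inner (el (zero_ext \<Omega>M g2)) (fst (hvec ax \<Omega> (fn (fst p))))"
      unfolding W(2)[OF r(1), symmetric] rhs_eq[OF \<Omega> g2 r(1), symmetric] inner_real_def using w r(1) unfolding weak_solution_def by blast
    then show "inner (snd (hvec ax \<Omega>M Td) + snd (hvec ax \<Omega> (\<lambda>x. T x - Td x))) (mul (fst (hvec ax \<Omega> v)) (fst p))
       + 1 / (Rey * Pra) * inner (snd (hvec ax \<Omega>M Td) + snd (hvec ax \<Omega> (\<lambda>x. T x - Td x))) (snd p) = inner (el (zero_ext \<Omega>M g2)) (fst p)"
      unfolding r(2) .
  qed
qed

text \<open>The temperature is recovered by adding the boundary data to a representative; the second
  conclusion records that its homogeneous part is still the given element.\<close>

lemma hsol_weak:
  assumes \<Omega>: "open \<Omega>" "\<Omega> \<subseteq> \<Omega>M" and h: "hs \<Omega> x y"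
  shows "weak_solution Rey Pra Gra g1 g2 Td \<Omega> (fn (fst x)) (\<lambda>z. Td z + fn (fst y) z)"
    "hvec ax \<Omega> (\<lambda>z. Td z + fn (fst y) z - Td z) = y"
proof -
  have x: "x \<in> HS ax \<Omega>" "hdiv x = 0" and y: "y \<in> HS ax \<Omega>" using h by (auto simp: hsol_def)
  note rx = HS_rep[OF \<Omega>(1) x(1)] and ry = HS_rep[OF \<Omega>(1) y]
  let ?T = "\<lambda>z. Td z + fn (fst y) z"
  have Tt: "(\<lambda>z. ?T z - Td z) = fn (fst y)" by simp
  have T: "?T \<in> H1 \<Omega>" by (rule hvec_add(1)[OF ax_bij \<Omega>(1) hvec_restrict(1)[OF ax_bij \<Omega>(1) \<Omega>M \<Omega>(2) Td] H10_H1[OF ry(1)]])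
  have th: "(\<lambda>z. ?T z - Td z) \<in> H10 \<Omega>" unfolding Tt by (rule ry(1))
  show yy: "hvec ax \<Omega> (\<lambda>z. ?T z - Td z) = y" unfolding Tt by (rule ry(2))
  note W = weak_forms[OF \<Omega> rx(1) T th, unfolded rx(2) yy]
  show "weak_solution Rey Pra Gra g1 g2 Td \<Omega> (fn (fst x)) ?T"
    unfolding weak_solution_def
  proof (intro conjI ballI T th)
    show "fn (fst x) \<in> V \<Omega>" using rx x(2) by (simp add: V_iff[OF \<Omega>(1)])
    fix \<phi> assume "\<phi> \<in> V \<Omega>"
    then have p: "\<phi> \<in> H10 \<Omega>" "hdiv (hvec ax \<Omega> \<phi>) = 0" by (auto simp: V_iff[OF \<Omega>(1)])
    show "(LINT x'|lebesgue_on \<Omega>. convect \<Omega> (fn (fst x)) (fn (fst x)) x' \<bullet> \<phi> x') + 1 / Rey * (LINT x'|lebesgue_on \<Omega>. grad_inner \<Omega> (fn (fst x)) \<phi> x')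
        - Gra / Rey\<^sup>2 * (LINT x'|lebesgue_on \<Omega>. (?T x' *\<^sub>R axis 2 1) \<bullet> \<phi> x') = (LINT x'|lebesgue_on \<Omega>. g1 x' \<bullet> \<phi> x')"
      unfolding W(1)[OF p(1)] rhs_eq[OF \<Omega> g1 p(1)] using h p(2) H10_hvec[OF ax_bij \<Omega>(1) p(1)] unfolding hsol_def by blast
  next
    fix \<phi> :: "real ^ 2 \<Rightarrow> real" assume p: "\<phi> \<in> H10 \<Omega>"
    show "(LINT x'|lebesgue_on \<Omega>. convect \<Omega> (fn (fst x)) ?T x' * \<phi> x') + 1 / (Rey * Pra) * (LINT x'|lebesgue_on \<Omega>. grad_inner \<Omega> ?T \<phi> x')
        = (LINT x'|lebesgue_on \<Omega>. g2 x' * \<phi> x')"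
      unfolding W(2)[OF p(1)] rhs_eq[OF \<Omega> g2 p(1), unfolded inner_real_def] using h H10_hvec[OF ax_bij \<Omega>(1) p(1)] unfolding hsol_def by blast
  qed
qed

end

section \<open>The cost functional\<close>

definition one_on :: "(real ^ 2) set \<Rightarrow> (real ^ 2, real) l2" where
  "one_on \<Omega> = el (zero_ext \<Omega> (\<lambda>x. 1))"

lemma square_int_one: "\<Omega> \<in> sets lebesgue \<Longrightarrow> bounded \<Omega> \<Longrightarrow> square_int (zero_ext \<Omega> (\<lambda>x. 1::real))"
  unfolding zero_ext_def[abs_def] by (rule square_int_indicator)

text \<open>The squared distance of \<open>u\<close> to the multiples of \<open>o1\<close>. For the
  indicator of a domain, whose squared norm is the area, the projection coefficient is the mean
  value. In this form continuity in both arguments is plain.\<close>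

definition spread :: "(real ^ 2, real) l2 \<Rightarrow> (real ^ 2, real) l2 \<Rightarrow> real" where
  "spread u o1 = (norm (u - (inner u o1 / (norm o1)\<^sup>2) *\<^sub>R o1))\<^sup>2"

lemma L2_norm_spread:
  assumes S: "\<Omega> \<in> sets lebesgue" "bounded \<Omega>" and T: "square_int (zero_ext \<Omega> T)"
  shows "(L2_norm \<Omega> (\<lambda>x. T x - mean \<Omega> T))\<^sup>2 = spread (el (zero_ext \<Omega> T)) (one_on \<Omega>)"
proof -
  note s1 = square_int_one[OF S]
  have fm: "\<Omega> \<in> lmeasurable" by (rule bounded_set_imp_lmeasurable[OF S(2,1)])
  have "(norm (one_on \<Omega>))\<^sup>2 = (LINT x|lebesgue. (norm (zero_ext \<Omega> (\<lambda>x. 1::real) x))\<^sup>2)" unfolding one_on_def by (rule norm_el[OF s1])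
  also have "\<dots> = (LINT x|lebesgue. indicator \<Omega> x)" by (intro Bochner_Integration.integral_cong) (auto simp: zero_ext_def indicator_def)
  also have "\<dots> = measure lebesgue \<Omega>" by simp
  finally have n1: "(norm (one_on \<Omega>))\<^sup>2 = measure lebesgue \<Omega>" .
  have "(LINT x|lebesgue_on \<Omega>. T x) = (LINT x|lebesgue_on \<Omega>. T x \<bullet> 1)" by simp
  also have "\<dots> = inner (el (zero_ext \<Omega> T)) (one_on \<Omega>)" unfolding one_on_def by (rule integral_lebesgue_on_inner(1)[OF S(1) T s1])
  finally have m: "mean \<Omega> T = inner (el (zero_ext \<Omega> T)) (one_on \<Omega>) / (norm (one_on \<Omega>))\<^sup>2" unfolding mean_def n1 by simp
  let ?c = "mean \<Omega> T"
  have zz: "zero_ext \<Omega> (\<lambda>x. T x - ?c) = (\<lambda>x. zero_ext \<Omega> T x - ?c *\<^sub>R zero_ext \<Omega> (\<lambda>x. 1) x)" by (auto simp: zero_ext_def right_diff_distrib)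
  have sd: "square_int (zero_ext \<Omega> (\<lambda>x. T x - ?c))" unfolding zz by (intro square_int_diff square_int_scaleR T s1)
  have "(L2_norm \<Omega> (\<lambda>x. T x - ?c))\<^sup>2 = (LINT x|lebesgue_on \<Omega>. (T x - ?c) \<bullet> (T x - ?c))"
    by (simp add: L2_norm_def power2_eq_square)
  also have "\<dots> = (norm (el (zero_ext \<Omega> (\<lambda>x. T x - ?c))))\<^sup>2"
    unfolding power2_norm_eq_inner by (rule integral_lebesgue_on_inner(1)[OF S(1) sd sd])
  also have "el (zero_ext \<Omega> (\<lambda>x. T x - ?c)) = el (zero_ext \<Omega> T) - ?c *\<^sub>R one_on \<Omega>"
    unfolding zz one_on_def el_diff[OF T square_int_scaleR[OF s1]] el_scaleR[OF s1] ..
  finally show ?thesis unfolding spread_def m .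
qed

lemma spread_tendsto:
  assumes "u \<longlonglongrightarrow> u'" "o1 \<longlonglongrightarrow> o'" "o' \<noteq> 0"
  shows "(\<lambda>n. spread (u n) (o1 n)) \<longlonglongrightarrow> spread u' o'"
  unfolding spread_def by (intro tendsto_intros assms) (use assms(3) in simp)

text \<open>Each vertical line meets the graph in one point, so Tonelli's theorem gives measure
  zero.\<close>

lemma graph_null:
  fixes \<gamma> :: "real \<Rightarrow> real"
  assumes c: "continuous_on {0..1} \<gamma>"
  shows "AE x :: real ^ 2 in lebesgue. \<not> (x $ 1 \<in> {0<..<1} \<and> x $ 2 = \<gamma> (x $ 1))"
proof -
  \<comment> \<open>Clamping the argument to [0,1] yields a function continuous on the whole line,
    so that its graph is closed and hence Borel.\<close>
  define g where "g s = \<gamma> (max 0 (min 1 s))" for s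
  have gc: "continuous_on UNIV g" unfolding g_def
    by (rule continuous_on_compose2[OF c]) (auto intro!: continuous_intros)
  define G where "G = {x :: real ^ 2. x $ 2 = g (x $ 1)}"
  have "closed G" unfolding G_def
    by (intro closed_Collect_eq continuous_intros continuous_on_compose2[OF gc]) auto
  then have Gb: "G \<in> sets borel" by simp
  have "emeasure lborel G = (\<integral>\<^sup>+x. indicator G x \<partial>lborel)" using Gb by simp
  also have "\<dots> = (\<integral>\<^sup>+s. (\<integral>\<^sup>+t. indicator G (vec2 s t) \<partial>lborel) \<partial>lborel)" by (rule nn_integral_vec2(1)) (use Gb in simp)
  also have "\<dots> = (\<integral>\<^sup>+s. (\<integral>\<^sup>+t. indicator {g s} t \<partial>lborel) \<partial>(lborel::real measure))"
    by (intro nn_integral_cong) (auto simp: G_def indicator_def)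
  also have "\<dots> = 0" by simp
  finally have "G \<in> null_sets lborel" using Gb by (auto simp: null_sets_def)
  then have "AE x in lborel. x \<notin> G" by (rule AE_not_in)
  then have "AE x in lebesgue. x \<notin> G" by (rule AE_completion)
  then show ?thesis by (rule AE_mp) (auto intro!: AE_I2 simp: G_def g_def)
qed

text \<open>Off the limit graph every point eventually belongs to all or to none of the domains, in
  accordance with the limit domain. The graph is a null set, and the extension of f from the largest
  domain dominates.\<close>

lemma el_zero_ext_Dom_tendsto:
  assumes c: "continuous_on {0..1} \<gamma>" and lim: "\<And>s. s \<in> {0..1} \<Longrightarrow> (\<lambda>n. \<gamma>n n s) \<longlonglongrightarrow> \<gamma> s"
    and f: "square_int (zero_ext \<Omega>M f)" and sub: "\<And>n. Dom (\<gamma>n n) \<subseteq> \<Omega>M" "Dom \<gamma> \<subseteq> \<Omega>M" and S: "\<And>n. Dom (\<gamma>n n) \<in> sets lebesgue"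
  shows "(\<lambda>n. el (zero_ext (Dom (\<gamma>n n)) f)) \<longlonglongrightarrow> el (zero_ext (Dom \<gamma>) f)"
proof (rule el_dominated(1)[OF _ f])
  show "zero_ext (Dom (\<gamma>n n)) f \<in> borel_measurable lebesgue" for n
    by (rule square_int_measurable[OF zero_ext_square_int_subset[OF f S sub(1)]])
  show "AE x in lebesgue. norm (zero_ext (Dom (\<gamma>n n)) f x) \<le> norm (zero_ext \<Omega>M f x)" for n
    using sub(1)[of n] by (intro AE_I2) (auto simp: zero_ext_def indicator_def)
  show "AE x in lebesgue. (\<lambda>n. zero_ext (Dom (\<gamma>n n)) f x) \<longlonglongrightarrow> zero_ext (Dom \<gamma>) f x"
    using graph_null[OF c]
  proof (rule AE_mp, intro AE_I2 impI)
    fix x :: "real ^ 2" assume x: "\<not> (x $ 1 \<in> {0<..<1} \<and> x $ 2 = \<gamma> (x $ 1))"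
    have "eventually (\<lambda>n. x \<in> Dom (\<gamma>n n) \<longleftrightarrow> x \<in> Dom \<gamma>) sequentially"
    proof (cases "x $ 1 \<in> {0<..<1}")
      case True
      then have l: "(\<lambda>n. \<gamma>n n (x $ 1)) \<longlonglongrightarrow> \<gamma> (x $ 1)" by (intro lim) auto
      consider "\<gamma> (x $ 1) < x $ 2" | "x $ 2 < \<gamma> (x $ 1)" using x True by linarith
      then show ?thesis
      proof cases
        case 1
        show ?thesis using order_tendstoD(2)[OF l 1] by eventually_elim (use 1 in \<open>auto simp: Dom_def\<close>)
      next
        case 2
        show ?thesis using order_tendstoD(1)[OF l 2] by eventually_elim (use 2 in \<open>auto simp: Dom_def\<close>)
      qed
    qed (auto simp: Dom_def)
    then have "eventually (\<lambda>n. zero_ext (Dom (\<gamma>n n)) f x = zero_ext (Dom \<gamma>) f x) sequentially"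
      by eventually_elim (auto simp: zero_ext_def indicator_def)
    then show "(\<lambda>n. zero_ext (Dom (\<gamma>n n)) f x) \<longlonglongrightarrow> zero_ext (Dom \<gamma>) f x" by (rule tendsto_eventually)
  qed
qed

section \<open>Topology of the domains and the cost in Hilbert space form\<close>

lemma Dom_open:
  assumes "continuous_on {0..1} \<gamma>" shows "open (Dom \<gamma>)"
proof -
  define g where "g s = \<gamma> (max 0 (min 1 s))" for s
  have gc: "continuous_on UNIV g" unfolding g_def
    by (rule continuous_on_compose2[OF assms]) (auto intro!: continuous_intros)
  have "Dom \<gamma> = {x. 0 < x $ 1} \<inter> {x. x $ 1 < 1} \<inter> {x. g (x $ 1) < x $ 2} \<inter> {x. x $ 2 < 1}"
    by (auto simp: Dom_def g_def)
  also have "open \<dots>" by (intro open_Int open_Collect_less continuous_intros continuous_on_compose2[OF gc]) auto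
  finally show ?thesis .
qed

lemma Dom_max_open: "open (Dom_max M)" and Dom_max_bounded: "bounded (Dom_max M)"
proof -
  have "Dom_max M = {x. 0 < x $ 1} \<inter> {x. x $ 1 < 1} \<inter> {x. - M < x $ 2} \<inter> {x. x $ 2 < 1}" by (auto simp: Dom_max_def)
  also have "open \<dots>" by (intro open_Int open_Collect_less continuous_intros)
  finally show "open (Dom_max M)" .
  have "Dom_max M \<subseteq> cbox (vec2 0 (- M)) (vec2 1 1)" by (auto simp: Dom_max_def mem_box_cart forall_2)
  then show "bounded (Dom_max M)" using bounded_cbox bounded_subset by blast
qed

lemma one_on_nonzero:
  assumes "open \<Omega>" "bounded \<Omega>" "\<Omega> \<noteq> {}" shows "one_on \<Omega> \<noteq> 0"
proof
  assume "one_on \<Omega> = 0"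
  then have "AE x in lebesgue. zero_ext \<Omega> (\<lambda>x. 1::real) x = 0"
    using el_eq_0_iff[OF square_int_one[of \<Omega>]] assms by (simp add: one_on_def)
  then have "AE x in lebesgue. x \<notin> \<Omega>" by (rule AE_mp) (auto intro!: AE_I2 simp: zero_ext_def)
  then have "\<Omega> \<in> null_sets lebesgue" using assms(1) by (subst AE_iff_null_sets) auto
  then have "negligible \<Omega>" by (simp add: negligible_iff_null_sets)
  then show False using open_not_negligible[OF assms(1,3)] by simp
qed

text \<open>The cost as a function of Hilbert space elements alone, so that each term can be
  followed along the minimizing sequence in a fixed space.\<close>

definition hcost :: "real \<Rightarrow> real \<Rightarrow> (real ^ 2, real) l2 \<Rightarrow> (real ^ 2, real) l2 \<Rightarrow> (real, real, 1) hv \<Rightarrow> real" where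
  "hcost lam1 lam2 u o1 g = spread u o1 + lam1 / 2 * (norm (snd g))\<^sup>2 + lam2 / 2 * (inner (fst g) (el (zero_ext {0<..<1} (\<lambda>s. 1))))\<^sup>2"

lemma J_hcost:
  assumes a: "\<gamma> \<in> admissible L \<nu>" and b: "bounded (Dom \<gamma>)" and T: "square_int (zero_ext (Dom \<gamma>) T)"
  shows "J lam1 lam2 T \<gamma> = hcost lam1 lam2 (el (zero_ext (Dom \<gamma>) T)) (one_on (Dom \<gamma>)) (hvec e1 {0<..<1} \<gamma>)"
proof -
  have S: "Dom \<gamma> \<in> sets lebesgue" using Dom_open[of \<gamma>] a by (simp add: admissible_def)
  let ?I = "{0<..<1::real}"
  have SI: "?I \<in> sets lebesgue" by simp
  have H: "\<gamma> \<in> H1 ?I" by (rule admissible_hvec(2)[OF a])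
  note sg = H1_square_int(1)[OF open_unit H]
  have one: "square_int (zero_ext ?I (\<lambda>s. 1::real))" unfolding zero_ext_def[abs_def] by (rule square_int_indicator) auto
  have "L2_norm ?I (weak_deriv ?I 1 \<gamma>) = norm (snd (hvec e1 ?I \<gamma>))"
  proof -
    have "L2_norm ?I (weak_deriv ?I 1 \<gamma>) = grad_norm ?I \<gamma>"
      by (simp add: L2_norm_def grad_norm_def grad_inner_def power2_eq_square)
    then show ?thesis using H1_norm_hvec(2)[OF e1_bij open_unit H] by simp
  qed
  moreover have "(LINT s|lebesgue_on ?I. \<gamma> s) = inner (fst (hvec e1 ?I \<gamma>)) (el (zero_ext ?I (\<lambda>s. 1)))"
    using integral_lebesgue_on_inner(1)[OF SI sg one] by (simp add: hvec_def)
  ultimately show ?thesis unfolding J_def hcost_def L2_norm_spread[OF S b T] by simp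
qed

text \<open>Provides a competitor, so that the infimum is taken over a nonempty set.\<close>

lemma zero_admissible: 
  assumes "L \<ge> 0" "\<nu> \<le> 1" shows "(\<lambda>s. 0) \<in> admissible L \<nu>"
proof -
  let ?I = "{0<..<1::real}"
  have t: "(\<lambda>s::real. 0::real) \<in> test_functions ?I" by (rule test_functions_zero)
  note h = hvec_test[OF e1_bij open_unit t]
  have x: "hvec e1 ?I (\<lambda>s. 0::real) \<in> HS e1 ?I" unfolding h(2) by (rule HS_test[OF t])
  have H: "(\<lambda>s. 0 :: real) \<in> H10 ?I" by (rule HS_H10(1)[OF e1_bij open_unit x H1_square_int(1)[OF open_unit h(1)]]) (simp add: hvec_def)
  have "el (zero_ext ?I (weak_deriv ?I 1 (\<lambda>s. 0::real))) = 0" using h(2) by (simp add: hvec_def h_graph_zero zero_prod_def vec_eq_iff e1_def)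
  moreover have "square_int (zero_ext ?I (weak_deriv ?I 1 (\<lambda>s. 0::real)))"
    using H1_weak_deriv(1)[OF open_unit h(1), of 1] by (simp add: L2_iff)
  ultimately have "AE s in lebesgue. zero_ext ?I (weak_deriv ?I 1 (\<lambda>s. 0::real)) s = 0" using el_eq_0_iff by blast
  then have "AE s in lebesgue. s \<in> ?I \<longrightarrow> \<bar>weak_deriv ?I 1 (\<lambda>s. 0::real) s\<bar> \<le> L"
    by (rule AE_mp) (use assms in \<open>auto intro!: AE_I2 simp: zero_ext_def\<close>)
  then show ?thesis using H assms unfolding admissible_def by (simp add: AE_lebesgue_on)
qed

section \<open>Existence of an optimal domain\<close>

text \<open>Containment in the largest domain bounds the graph from below at the midpoint, and the
  Lipschitz estimate carries this bound to the whole interval.\<close>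

lemma admissible_bounded:
  assumes \<gamma>: "\<gamma> \<in> admissible L \<nu>" and D: "Dom \<gamma> \<subseteq> Dom_max M" and \<nu>: "\<nu> > 0" and M: "M > 0" and s: "s \<in> {0..1}"
  shows "\<bar>\<gamma> s\<bar> \<le> 1 + \<bar>\<nu>\<bar> + M + \<bar>L\<bar>"
proof -
  have "- M \<le> \<gamma> (1/2)"
  proof (rule ccontr)
    assume "\<not> - M \<le> \<gamma> (1/2)"
    then have "vec2 (1/2) (- M) \<in> Dom \<gamma>" using M by (simp add: Dom_def)
    then have "vec2 (1/2) (- M) \<in> Dom_max M" using D by blast
    then show False by (simp add: Dom_max_def)
  qed
  moreover have "\<bar>\<gamma> s - \<gamma> (1/2)\<bar> \<le> \<bar>L\<bar> * \<bar>s - 1/2\<bar>" by (rule admissible_Lipschitz(1)[OF \<gamma> s]) auto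
  moreover have "\<bar>L\<bar> * \<bar>s - 1/2\<bar> \<le> \<bar>L\<bar> * 1" using s by (intro mult_left_mono) auto
  moreover have "\<gamma> s \<le> 1 - \<nu>" by (rule admissible_Lipschitz(2)[OF \<gamma> s s])
  ultimately show ?thesis using \<nu> M by linarith
qed

text \<open>Uniform convergence by Arzela-Ascoli comes first; a second selection adds weak
  convergence of the derivatives and identifies their limit.\<close>

lemma admissible_subseq:
  assumes a: "\<And>n. \<gamma> n \<in> admissible L \<nu>" and B: "\<And>n s. s \<in> {0..1} \<Longrightarrow> \<bar>\<gamma> n s\<bar> \<le> B"
  obtains r g where "strict_mono (r :: nat \<Rightarrow> nat)" "g \<in> admissible L \<nu>"
    "\<And>e. e > 0 \<Longrightarrow> eventually (\<lambda>n. \<forall>s\<in>{0..1}. \<bar>\<gamma> (r n) s - g s\<bar> < e) sequentially"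
    "weakly_to (\<lambda>n. snd (hvec e1 {0<..<1} (\<gamma> (r n)))) (snd (hvec e1 {0<..<1} g))"
    "(\<lambda>n. fst (hvec e1 {0<..<1} (\<gamma> (r n)))) \<longlonglongrightarrow> fst (hvec e1 {0<..<1} g)"
proof -
  have eq: "\<exists>d. 0 < d \<and> (\<forall>n y. y \<in> {0..1} \<and> norm (x - y) < d \<longrightarrow> norm (\<gamma> n x - \<gamma> n y) < e)" if x: "x \<in> {0..1}" and e: "0 < e" for x e :: real
  proof (intro exI conjI allI impI)
    \<comment> \<open>The summand 1 avoids division by zero.\<close>
    show d: "0 < e / (\<bar>L\<bar> + 1)" using e by simp
    fix n y assume y: "y \<in> {0..1} \<and> norm (x - y) < e / (\<bar>L\<bar> + 1)"
    have "\<bar>\<gamma> n x - \<gamma> n y\<bar> \<le> \<bar>L\<bar> * \<bar>x - y\<bar>" using y by (intro admissible_Lipschitz(1)[OF a x]) auto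
    also have "\<dots> \<le> (\<bar>L\<bar> + 1) * \<bar>x - y\<bar>" by (intro mult_right_mono) auto
    also have "\<dots> < (\<bar>L\<bar> + 1) * (e / (\<bar>L\<bar> + 1))" using y by (intro mult_strict_left_mono) auto
    also have "\<dots> = e" by (simp add: add_nonneg_eq_0_iff)
    finally show "norm (\<gamma> n x - \<gamma> n y) < e" by simp
  qed
  obtain g k where g: "continuous_on {0..1} g" "strict_mono (k :: nat \<Rightarrow> nat)" 
    and u: "\<And>e. 0 < e \<Longrightarrow> \<exists>N. \<forall>n x. n \<ge> N \<and> x \<in> {0..1} \<longrightarrow> norm (\<gamma> (k n) x - g x) < e"
    by (rule Arzela_Ascoli[of "{0..1}" \<gamma> B]) (use B eq in auto)
  have ev: "eventually (\<lambda>n. \<forall>s\<in>{0..1}. \<bar>\<gamma> (k n) s - g s\<bar> < e) sequentially" if e: "e > 0" for e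
  proof -
    obtain N where "\<forall>n x. n \<ge> N \<and> x \<in> {0..1} \<longrightarrow> norm (\<gamma> (k n) x - g x) < e" using u[OF e] by blast
    then show ?thesis by (auto simp: eventually_sequentially intro!: exI[of _ N])
  qed
  have "(\<lambda>n. \<gamma> (k n) s) \<longlonglongrightarrow> g s" if "s \<in> {0..1}" for s
  proof (rule tendstoI)
    fix e :: real assume "e > 0"
    show "eventually (\<lambda>n. dist (\<gamma> (k n) s) (g s) < e) sequentially"
      using ev[OF \<open>e > 0\<close>] by eventually_elim (use that in \<open>auto simp: dist_real_def\<close>)
  qed
  then obtain r where r: "strict_mono (r :: nat \<Rightarrow> nat)" "g \<in> admissible L \<nu>" 
    "weakly_to (\<lambda>n. snd (hvec e1 {0<..<1} (\<gamma> (k (r n))))) (snd (hvec e1 {0<..<1} g))"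
    "(\<lambda>n. fst (hvec e1 {0<..<1} (\<gamma> (k n)))) \<longlonglongrightarrow> fst (hvec e1 {0<..<1} g)"
    using admissible_uniform_limit[of "\<lambda>n. \<gamma> (k n)" L \<nu> g B] a g(1) B by blast
  show ?thesis
  proof (rule that[of "k \<circ> r" g])
    show "strict_mono (k \<circ> r)" by (rule strict_mono_o[OF g(2) r(1)])
    show "eventually (\<lambda>n. \<forall>s\<in>{0..1}. \<bar>\<gamma> ((k \<circ> r) n) s - g s\<bar> < e) sequentially" if "e > 0" for e
      unfolding o_def by (rule eventually_subseq[OF r(1) ev[OF that]])
    show "(\<lambda>n. fst (hvec e1 {0<..<1} (\<gamma> ((k \<circ> r) n)))) \<longlonglongrightarrow> fst (hvec e1 {0<..<1} g)"
      using LIMSEQ_subseq_LIMSEQ[OF r(4,1)] by (simp add: o_def)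
  qed (use r in \<open>auto simp: o_def\<close>)
qed

text \<open>Uniform convergence provides the distance \<nu> s / 8, with s = 1/(k+1), that comparing
  two domains requires. Both directions are wanted, one for weak limits and one for test
  functions.\<close>

lemma Dom_stretch_eventually:
  assumes L: "L > 0" and \<nu>: "\<nu> > 0" and a: "0 \<le> a" "a * L \<le> \<nu> / 4"
    and adm: "\<And>n. \<gamma> n \<in> admissible L \<nu>" "g \<in> admissible L \<nu>"
    and u: "\<And>e. e > 0 \<Longrightarrow> eventually (\<lambda>n. \<forall>s\<in>{0..1}. \<bar>\<gamma> n s - g s\<bar> < e) sequentially"
  shows "eventually (\<lambda>n. \<forall>y. stretch (vec2 a 1) (vec2 (1/2) (1 - \<nu>/2)) (1 / Suc k) y \<in> Dom (\<gamma> n) \<longrightarrow> y \<in> Dom g) sequentially"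
    and "eventually (\<lambda>n. \<forall>y. stretch (vec2 a 1) (vec2 (1/2) (1 - \<nu>/2)) (1 / Suc k) y \<in> Dom g \<longrightarrow> y \<in> Dom (\<gamma> n)) sequentially"
proof -
  have k: "0 < 1 / real (Suc k)" "1 / real (Suc k) \<le> 1" by simp_all
  have lip: "\<bar>f t - f u\<bar> \<le> L * \<bar>t - u\<bar>" if "f \<in> admissible L \<nu>" "t \<in> {0<..<1}" "u \<in> {0<..<1}" for f t u
    using admissible_Lipschitz(1)[OF that(1), of t u] that(2,3) L by auto
  have top: "f t \<le> 1 - \<nu>" if "f \<in> admissible L \<nu>" "t \<in> {0<..<1}" for f t
    using admissible_Lipschitz(2)[OF that(1), of t t] that(2) by auto
  have e: "eventually (\<lambda>n. \<forall>s\<in>{0..1}. \<bar>\<gamma> n s - g s\<bar> < \<nu> * (1 / real (Suc k)) / 8) sequentially" by (rule u) (use \<nu> in simp)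
  show "eventually (\<lambda>n. \<forall>y. stretch (vec2 a 1) (vec2 (1/2) (1 - \<nu>/2)) (1 / Suc k) y \<in> Dom (\<gamma> n) \<longrightarrow> y \<in> Dom g) sequentially"
    using e
  proof (eventually_elim, intro allI impI)
    fix n and y :: "real ^ 2" assume c: "\<forall>s\<in>{0..1}. \<bar>\<gamma> n s - g s\<bar> < \<nu> * (1 / real (Suc k)) / 8"
      and y: "stretch (vec2 a 1) (vec2 (1/2) (1 - \<nu>/2)) (1 / Suc k) y \<in> Dom (\<gamma> n)"
    show "y \<in> Dom g"
      by (rule Dom_stretch[OF L \<nu> k a top[OF adm(1)] lip[OF adm(2)] _ y]; (assumption | rule less_imp_le[OF bspec[OF c]], simp))
  qed
  show "eventually (\<lambda>n. \<forall>y. stretch (vec2 a 1) (vec2 (1/2) (1 - \<nu>/2)) (1 / Suc k) y \<in> Dom g \<longrightarrow> y \<in> Dom (\<gamma> n)) sequentially"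
    using e
  proof (eventually_elim, intro allI impI)
    fix n and y :: "real ^ 2" assume c: "\<forall>s\<in>{0..1}. \<bar>\<gamma> n s - g s\<bar> < \<nu> * (1 / real (Suc k)) / 8"
      and y: "stretch (vec2 a 1) (vec2 (1/2) (1 - \<nu>/2)) (1 / Suc k) y \<in> Dom g"
    show "y \<in> Dom (\<gamma> n)"
      by (rule Dom_stretch[OF L \<nu> k a top[OF adm(2)] lip[OF adm(1)] _ y]; (assumption | subst abs_minus_commute, rule less_imp_le[OF bspec[OF c]], simp))
  qed
qed

text \<open>The domains have width 1 in the first coordinate, so Poincare's inequality with constant
  1 bounds both components of the pair by \<tau>.\<close>

lemma norm_hvec_le_grad_norm:
  assumes \<Omega>: "open \<Omega>" "\<Omega> \<subseteq> Dom_max M" and u: "u \<in> H10 \<Omega>" and g: "grad_norm \<Omega> u \<le> \<tau>"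
  shows "norm (hvec ax \<Omega> u) \<le> 2 * \<tau>"
proof -
  let ?x = "hvec ax \<Omega> u"
  have n: "norm (snd ?x) \<le> \<tau>" using g H1_norm_hvec(2)[OF ax_bij \<Omega>(1) H10_H1[OF u]] by simp
  have "norm (fst ?x) \<le> norm (snd ?x)"
    by (rule poincare_HS[of ax _ _ 1, OF ax_Basis H10_hvec[OF ax_bij \<Omega>(1) u]]) (use \<Omega>(2) in \<open>auto simp: Dom_max_def inner_ax\<close>)
  moreover have "norm ?x \<le> norm (fst ?x) + norm (snd ?x)" by (metis norm_Pair_le prod.collapse)
  ultimately show ?thesis using n by linarith
qed

lemma el_zero_ext_cong_AE:
  assumes "open \<Omega>" "T \<in> H1 \<Omega>" "T' \<in> H1 \<Omega>" "AE x in lebesgue_on \<Omega>. T' x = T x"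
  shows "el (zero_ext \<Omega> T) = el (zero_ext \<Omega> T')"
proof (rule el_eqI[OF H1_square_int(1)[OF assms(1,2)]])
  have "AE x in lebesgue. x \<in> \<Omega> \<longrightarrow> T' x = T x" using assms(1,4) by (simp add: AE_lebesgue_on)
  then show "AE x in lebesgue. zero_ext \<Omega> T x = zero_ext \<Omega> T' x" by (rule AE_mp) (auto intro!: AE_I2 simp: zero_ext_def indicator_def)
qed

theorem theorem3p3:
  fixes L \<nu> M lam1 lam2 C \<tau> \<epsilon>1 \<epsilon>2 \<epsilon>3 Rey Pra Gra :: real
    and g1 :: "real^2 \<Rightarrow> real^2"
    and g2 Td :: "real^2 \<Rightarrow> real"
  assumes "L > 0" and "0 < \<nu>" "\<nu> < 1" and "lam1 > 0" "lam2 > 0"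
    and "M > 0" and "\<forall>\<gamma>\<in>admissible L \<nu>. Dom \<gamma> \<subseteq> Dom_max M"
    and "wellposedness_constants L \<nu> M C \<tau> \<epsilon>1 \<epsilon>2 \<epsilon>3"
    and "g1 \<in> L2 (Dom_max M)"
    and "g2 \<in> L2 (Dom_max M)"
    and "Td \<in> H1 (Dom_max M) \<inter> Cc (Dom_max M)"
    and "Rey \<in> {0<..<\<epsilon>1}" and "Pra \<in> {0<..<\<epsilon>2 / Rey}" and "Gra \<in> {0<..<\<epsilon>3 * Rey}"
    and "K1 M C \<tau> Rey Pra Gra Td < 1" and "K2 M C \<tau> Rey Pra Gra g1 g2 Td \<le> \<tau>"
  shows "\<exists>\<gamma>s\<in>admissible L \<nu>. \<exists>vs Ts.
    weak_solution Rey Pra Gra g1 g2 Td (Dom \<gamma>s) vs Ts \<and>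
    J lam1 lam2 Ts \<gamma>s =
      Inf {J lam1 lam2 T \<gamma> | v T \<gamma>. \<gamma> \<in> admissible L \<nu> \<and>
        weak_solution Rey Pra Gra g1 g2 Td (Dom \<gamma>) v T}"
proof -
  let ?A = "admissible L \<nu>" and ?I = "{0<..<1::real}"
  let ?w = "\<lambda>\<gamma> v T. weak_solution Rey Pra Gra g1 g2 Td (Dom \<gamma>) v T"
  let ?b = "\<lambda>\<gamma> v T. grad_norm (Dom \<gamma>) v + grad_norm (Dom \<gamma>) (\<lambda>x. T x - Td x) \<le> \<tau>"
  let ?o = "\<lambda>\<gamma>. one_on (Dom \<gamma>)" and ?g = "\<lambda>\<gamma>. hvec e1 ?I \<gamma>" and ?T = "\<lambda>\<gamma> T. el (zero_ext (Dom \<gamma>) T)"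
  define S where "S = {J lam1 lam2 T \<gamma> | v T \<gamma>. \<gamma> \<in> ?A \<and> ?w \<gamma> v T}"
  note sub = assms(7)[rule_format]
  interpret boussinesq_data "Dom_max M" g1 g2 Td Rey Pra Gra
    by unfold_locales (use assms Dom_max_open in auto)
  have op: "open (Dom \<gamma>)" and bd: "bounded (Dom \<gamma>)" if "\<gamma> \<in> ?A" for \<gamma>
    using that Dom_open bounded_subset[OF Dom_max_bounded sub] by (auto simp: admissible_def)
  have wp: "\<exists>v T. ?w \<gamma> v T \<and> ?b \<gamma> v T \<and> (\<forall>v' T'. ?w \<gamma> v' T' \<longrightarrow> (AE x in lebesgue_on (Dom \<gamma>). v' x = v x \<and> T' x = T x))"
    if "\<gamma> \<in> ?A" for \<gamma>
    using assms(8)[unfolded wellposedness_constants_def] assms(9-16) that unfolding smallness_regime_def by blast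
  have cost: "J lam1 lam2 T \<gamma> = hcost lam1 lam2 (?T \<gamma> T) (?o \<gamma>) (?g \<gamma>)" if "\<gamma> \<in> ?A" "?w \<gamma> v T" for \<gamma> v T
    using that by (intro J_hcost[OF _ bd] H1_square_int(1)[OF op]) (auto simp: weak_solution_def)
  \<comment> \<open>A competitor for the infimum comes without the bound \<tau>. By uniqueness it
    agrees a.e. with the bounded solution, and the cost depends only on the a.e. class.\<close>
  have good: "\<exists>\<gamma> v T. \<gamma> \<in> ?A \<and> ?w \<gamma> v T \<and> ?b \<gamma> v T \<and> J lam1 lam2 T \<gamma> = j" if jS: "j \<in> S" for j
  proof -
    obtain \<gamma> v T where a: "\<gamma> \<in> ?A" "?w \<gamma> v T" "j = J lam1 lam2 T \<gamma>" using jS by (auto simp: S_def)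
    obtain v' T' where b: "?w \<gamma> v' T'" "?b \<gamma> v' T'" "AE x in lebesgue_on (Dom \<gamma>). v x = v' x \<and> T x = T' x"
      using wp[OF a(1)] a(2) by blast
    have "AE x in lebesgue_on (Dom \<gamma>). T x = T' x" using b(3) by (rule AE_mp) auto
    then have "?T \<gamma> T' = ?T \<gamma> T" by (intro el_zero_ext_cong_AE op a) (use a b in \<open>auto simp: weak_solution_def\<close>)
    then have "J lam1 lam2 T' \<gamma> = j" unfolding a(3) cost[OF a(1,2)] cost[OF a(1) b(1)] by simp
    then show ?thesis using a(1) b(1,2) by blast
  qed
  have nonneg: "0 \<le> j" if "j \<in> S" for j
    using that assms(4,5) by (auto simp: S_def J_def)
  \<comment> \<open>The flat boundary shows that the set of costs is nonempty.\<close>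
  have z: "(\<lambda>s. 0) \<in> ?A" using assms by (intro zero_admissible) auto
  obtain v0 T0 where "?w (\<lambda>s. 0) v0 T0" using wp[OF z] by blast
  then have ne: "S \<noteq> {}" using z by (auto simp: S_def)
  have bdd: "bdd_below S" using nonneg by (rule bdd_belowI)
  have "\<exists>j\<in>S. j < Inf S + 1 / Suc n" for n using cInf_lessD[OF ne, of "Inf S + 1 / Suc n"] by auto
  then have "\<forall>n. \<exists>\<gamma> v T. \<gamma> \<in> ?A \<and> ?w \<gamma> v T \<and> ?b \<gamma> v T \<and> J lam1 lam2 T \<gamma> < Inf S + 1 / Suc n" using good by blast
  from choice[OF this] obtain \<gamma> where "\<forall>n. \<exists>v T. \<gamma> n \<in> ?A \<and> ?w (\<gamma> n) v T \<and> ?b (\<gamma> n) v T \<and> J lam1 lam2 T (\<gamma> n) < Inf S + 1 / Suc n" ..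
  from choice[OF this] obtain v where "\<forall>n. \<exists>T. \<gamma> n \<in> ?A \<and> ?w (\<gamma> n) (v n) T \<and> ?b (\<gamma> n) (v n) T \<and> J lam1 lam2 T (\<gamma> n) < Inf S + 1 / Suc n" ..
  from choice[OF this] obtain T where "\<forall>n. \<gamma> n \<in> ?A \<and> ?w (\<gamma> n) (v n) (T n) \<and> ?b (\<gamma> n) (v n) (T n) \<and> J lam1 lam2 (T n) (\<gamma> n) < Inf S + 1 / Suc n" ..
  then have a: "\<And>n. \<gamma> n \<in> ?A" and w: "\<And>n. ?w (\<gamma> n) (v n) (T n)" and b: "\<And>n. ?b (\<gamma> n) (v n) (T n)"
    and j: "\<And>n. J lam1 lam2 (T n) (\<gamma> n) < Inf S + 1 / Suc n" by blast+
  define U where "U n = hvec ax (Dom (\<gamma> n)) (v n)" for n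
  define \<theta> where "\<theta> n = hvec ax (Dom (\<gamma> n)) (\<lambda>x. T n x - Td x)" for n
  have gn: "0 \<le> grad_norm \<Omega> u" for \<Omega> and u :: "real ^ 2 \<Rightarrow> 'z::euclidean_space"
    by (auto simp: grad_norm_def grad_inner_def intro!: real_sqrt_ge_zero Bochner_Integration.integral_nonneg sum_nonneg)
  have gl: "grad_norm (Dom (\<gamma> n)) (v n) \<le> \<tau>" "grad_norm (Dom (\<gamma> n)) (\<lambda>x. T n x - Td x) \<le> \<tau>" for n
    using b[of n] gn[of "Dom (\<gamma> n)" "v n"] gn[of "Dom (\<gamma> n)" "\<lambda>x. T n x - Td x"] by linarith+
  have H: "v n \<in> H10 (Dom (\<gamma> n))" "(\<lambda>x. T n x - Td x) \<in> H10 (Dom (\<gamma> n))" "T n \<in> H1 (Dom (\<gamma> n))" for n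
    using w[of n] by (auto simp: weak_solution_def V_iff[OF op[OF a]])
  have VB: "norm (U n) \<le> 2 * \<tau>" and TB: "norm (\<theta> n) \<le> 2 * \<tau>" for n
    unfolding U_def \<theta>_def using norm_hvec_le_grad_norm[OF op[OF a] sub[OF a]] H gl by blast+
  have hs: "hs (Dom (\<gamma> n)) (U n) (\<theta> n)" for n unfolding U_def \<theta>_def by (rule weak_hsol[OF op sub w]; rule a)
  obtain r g where r: "strict_mono (r :: nat \<Rightarrow> nat)" and g: "g \<in> ?A"
    and u: "\<And>e. e > 0 \<Longrightarrow> eventually (\<lambda>n. \<forall>s\<in>{0..1}. \<bar>\<gamma> (r n) s - g s\<bar> < e) sequentially"
    and gw: "weakly_to (\<lambda>n. snd (?g (\<gamma> (r n)))) (snd (?g g))" and gs: "(\<lambda>n. fst (?g (\<gamma> (r n)))) \<longlonglongrightarrow> fst (?g g)"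
    by (rule admissible_subseq[of \<gamma>, OF a admissible_bounded[OF a sub[OF a] assms(2,6)]]; (assumption | rule that, blast+))
  \<comment> \<open>The horizontal stretching rate: at most 1, as the uniform operator bound
    requires, and small enough against the slope \<open>L\<close> for the comparison of
    domains.\<close>
  define \<alpha> where "\<alpha> = min 1 (\<nu> / (4 * L))"
  have al: "0 \<le> \<alpha>" "\<alpha> \<le> 1" using assms(1,2) by (auto simp: \<alpha>_def)
  have "\<alpha> * L \<le> \<nu> / (4 * L) * L" using assms(1) by (intro mult_right_mono) (auto simp: \<alpha>_def)
  then have al': "\<alpha> * L \<le> \<nu> / 4" using assms(1) by simp
  note ds = Dom_stretch_eventually[of L \<nu> \<alpha> "\<lambda>n. \<gamma> (r n)" g, OF assms(1,2) al(1) al' a g u]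
  have wb: "\<forall>b\<in>Basis. vec2 \<alpha> 1 \<bullet> b \<ge> 0" "\<forall>b\<in>Basis. vec2 \<alpha> 1 \<bullet> b \<le> 1"
    using al by (auto simp: Basis_vec_def inner_axis forall_2 exhaust_2)
  obtain q vl \<theta>l where q: "strict_mono (q :: nat \<Rightarrow> nat)" and hl: "hs (Dom g) vl \<theta>l"
    and fl: "(\<lambda>n. fst (\<theta> (r (q n)))) \<longlonglongrightarrow> fst \<theta>l"
    by (rule hsol_limit[where \<Omega> = "\<lambda>n. Dom (\<gamma> (r n))" and v = "\<lambda>n. U (r n)" and \<theta> = "\<lambda>n. \<theta> (r n)", OF hs VB TB Dom_max_bounded sub[OF a] sub[OF g] wb ds])
  define \<sigma> where "\<sigma> n = r (q n)" for n
  let ?Ts = "\<lambda>z. Td z + fn (fst \<theta>l) z"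
  have ws: "?w g (fn (fst vl)) ?Ts" by (rule hsol_weak(1)[OF op[OF g] sub[OF g] hl])
  have cont: "continuous_on {0..1} g" using g by (simp add: admissible_def)
  have pt: "(\<lambda>n. \<gamma> (\<sigma> n) s) \<longlonglongrightarrow> g s" if "s \<in> {0..1}" for s
  proof (rule tendstoI)
    fix e :: real assume "e > 0"
    show "eventually (\<lambda>n. dist (\<gamma> (\<sigma> n) s) (g s) < e) sequentially"
      using eventually_subseq[OF q u[OF \<open>e > 0\<close>]] by eventually_elim (use that in \<open>auto simp: dist_real_def \<sigma>_def\<close>)
  qed
  have SD: "Dom (\<gamma> (\<sigma> n)) \<in> sets lebesgue" for n using op[OF a] by simp
  have "square_int (zero_ext (Dom_max M) Td)" using H1_square_int(1)[OF Dom_max_open] Td by blast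
  note limD = el_zero_ext_Dom_tendsto[OF cont pt this sub[OF a] sub[OF g] SD]
  have "square_int (zero_ext (Dom_max M) (\<lambda>x. 1::real))" by (rule square_int_one) (use Dom_max_open Dom_max_bounded in auto)
  note lim1 = el_zero_ext_Dom_tendsto[OF cont pt this sub[OF a] sub[OF g] SD, folded one_on_def]
  \<comment> \<open>The boundary data on the moving domains converge by dominated convergence, the
    homogeneous parts by Rellich's theorem; their sums are the temperatures.\<close>
  have Tn: "?T (\<gamma> n) (T n) = ?T (\<gamma> n) Td + fst (\<theta> n)" for n
    using T_split(1)[OF op[OF a] sub[OF a] H(3)] unfolding \<theta>_def by (simp add: hvec_def)
  have Ts: "?T g ?Ts = ?T g Td + fst \<theta>l"
    using T_split(1)[OF op[OF g] sub[OF g], of ?Ts] ws unfolding hsol_weak(2)[OF op[OF g] sub[OF g] hl]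
    by (simp add: weak_solution_def) (simp add: hvec_def)
  have limT: "(\<lambda>n. ?T (\<gamma> (\<sigma> n)) (T (\<sigma> n))) \<longlonglongrightarrow> ?T g ?Ts"
    unfolding Tn Ts by (rule tendsto_add[OF limD fl[folded \<sigma>_def]])
  \<comment> \<open>The stretching centre lies in the limit domain, which is therefore of positive
    measure; the mean value divides by it.\<close>
  have "vec2 (1/2) (1 - \<nu>/2) \<in> Dom g" using admissible_Lipschitz(2)[OF g, of "1/2" "1/2"] assms(2) by (simp add: Dom_def)
  then have "?o g \<noteq> 0" by (intro one_on_nonzero op bd g) auto
  note sp = spread_tendsto[OF limT lim1 this]
  have \<sigma>: "strict_mono \<sigma>" unfolding \<sigma>_def[abs_def] using strict_mono_o[OF r q] by (simp add: o_def)
  have Jlim: "(\<lambda>n. J lam1 lam2 (T (\<sigma> n)) (\<gamma> (\<sigma> n))) \<longlonglongrightarrow> Inf S"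
  proof (rule tendsto_sandwich)
    show "eventually (\<lambda>n. Inf S \<le> J lam1 lam2 (T (\<sigma> n)) (\<gamma> (\<sigma> n))) sequentially"
      by (intro always_eventually allI cInf_lower bdd) (use a w in \<open>unfold S_def, blast\<close>)
    show "eventually (\<lambda>n. J lam1 lam2 (T (\<sigma> n)) (\<gamma> (\<sigma> n)) \<le> Inf S + 1 / Suc (\<sigma> n)) sequentially"
      using j by (intro always_eventually allI less_imp_le)
    show "(\<lambda>n. Inf S + 1 / Suc (\<sigma> n)) \<longlonglongrightarrow> Inf S"
      using LIMSEQ_subseq_LIMSEQ[OF LIMSEQ_inverse_real_of_nat_add[of "Inf S"] \<sigma>] by (simp add: o_def inverse_eq_divide)
  qed simp
  let ?o1 = "el (zero_ext ?I (\<lambda>s. 1))"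
  \<comment> \<open>What is left of the limit of the costs after the two convergent terms are
    subtracted. As lam1 > 0, it determines the limit of the norms of the derivatives, so no lower
    limits are needed.\<close>
  define c where "c = Inf S - spread (?T g ?Ts) (?o g) - lam2 / 2 * (inner (fst (?g g)) ?o1)\<^sup>2"
  have "(\<lambda>n. J lam1 lam2 (T (\<sigma> n)) (\<gamma> (\<sigma> n)) - spread (?T (\<gamma> (\<sigma> n)) (T (\<sigma> n))) (?o (\<gamma> (\<sigma> n)))
      - lam2 / 2 * (inner (fst (?g (\<gamma> (\<sigma> n)))) ?o1)\<^sup>2) \<longlonglongrightarrow> c"
    unfolding c_def
    by (intro tendsto_diff Jlim sp tendsto_mult[OF tendsto_const] tendsto_power tendsto_inner[OF _ tendsto_const]
        LIMSEQ_subseq_LIMSEQ[OF gs q, unfolded o_def, folded \<sigma>_def])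
  then have "(\<lambda>n. lam1 / 2 * (norm (snd (?g (\<gamma> (\<sigma> n)))))\<^sup>2) \<longlonglongrightarrow> c"
    unfolding cost[OF a w] hcost_def by (simp add: algebra_simps)
  from tendsto_mult_left[OF this, of "2 / lam1"] have "(\<lambda>n. (norm (snd (?g (\<gamma> (\<sigma> n)))))\<^sup>2) \<longlonglongrightarrow> 2 / lam1 * c"
    using assms(4) by simp
  from tendsto_real_sqrt[OF this] have "(\<lambda>n. norm (snd (?g (\<gamma> (\<sigma> n))))) \<longlonglongrightarrow> sqrt (2 / lam1 * c)" by simp
  \<comment> \<open>Weak lower semicontinuity: the derivative of the limit boundary costs at most as
    much as the limit, which makes the limit a minimizer.\<close>
  then have le: "norm (snd (?g g)) \<le> sqrt (2 / lam1 * c)"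
    by (rule weakly_to_norm_le[OF weakly_to_subseq[OF gw q, unfolded o_def, folded \<sigma>_def]])
  then have "0 \<le> sqrt (2 / lam1 * c)" using norm_ge_zero order_trans by blast
  then have "0 \<le> 2 / lam1 * c" by simp
  then have "(norm (snd (?g g)))\<^sup>2 \<le> 2 / lam1 * c" using power_mono[OF le norm_ge_zero, of 2] by simp
  then have "lam1 / 2 * (norm (snd (?g g)))\<^sup>2 \<le> lam1 / 2 * (2 / lam1 * c)" using assms(4) by (intro mult_left_mono) auto
  then have "J lam1 lam2 ?Ts g \<le> Inf S" unfolding cost[OF g ws] hcost_def c_def using assms(4) by simp
  moreover have "Inf S \<le> J lam1 lam2 ?Ts g" by (intro cInf_lower bdd) (use g ws in \<open>unfold S_def, blast\<close>)
  ultimately have "J lam1 lam2 ?Ts g = Inf S" by simp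
  then show ?thesis using g ws unfolding S_def by blast
qed

end
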